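(* Let $X$ be a quasi-Banach space and suppose $0<\alpha<1$. Then $X^*$ has weak cotype $2$ if and only if there is a constant $C$ such that whenever $F$ is a finite-dimensional quotient of $X$, there exists a quotient $E$ of $F$ with $\dim E\ge\alpha\dim F$ and $d_E\le C$.
   Context: A quasi-Banach space is a complete quasi-normed space, not necessarily locally convex; by the Aoki–Rolewicz theorem its quasi-norm may be taken, up to equivalence, to be an $r$-norm for some $0<r\le1$, i.e. $\|x+y\|^r\le\|x\|^r+\|y\|^r$. The dual $X^*$ is the Banach space of all bounded linear functionals on $X$. Quotients (by closed subspaces) carry the quotient quasi-norm. $d_E$ denotes the Euclidean distance of $E$: the infimum of $\|v\|\|w\|$ over all factorizations $I_E=vw$ of the identity of $E$ with $w:E\to H$, $v:H\to E$ bounded linear and $H$ a Hilbert space. A Banach space $Z$ is of weak cotype $2$ if there is a constant $C$ such that whenever $H$ is a finite-dimensional Hilbert space with orthonormal basis $(e_1,\dots,e_n)$ and $u:H\to Z$ is linear, then $a_k(u)\le Ck^{-1/2}\ell(u)$ for $1\le k\le n$. Here $\ell(u)=\left(\mathbb E\|\sum_{k=1}^n g_k u(e_k)\|^2\right)^{1/2}$, where $g_1,\dots,g_n$ are independent normalized Gaussian random variables, and $a_k(u)=\inf\{\|u-v\|: v:H\to Z \text{ linear},\ \mathrm{rank}\,v<k\}$. *)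

theory Defs
  imports "HOL-Probability.Probability" "HOL-Algebra.AbelCoset" "Jordan_Normal_Form.VS_Connect"
begin

text \<open>
  Spaces are real and carrier-based, so that quotients and duals are again objects of the same kind.
  The multiplicative fields inherited from the record of modules play no role.
\<close>

record 'a qspace = "(real, 'a) module" +
  qnorm :: "'a \<Rightarrow> real"

abbreviation real_vs :: "'a qspace \<Rightarrow> bool" where
  "real_vs X \<equiv> vectorspace (class_ring :: real ring) X"

abbreviation fin_dim :: "'a qspace \<Rightarrow> bool" where
  "fin_dim X \<equiv> vectorspace.fin_dim (class_ring :: real ring) X"

abbreviation vdim :: "'a qspace \<Rightarrow> nat" where
  "vdim X \<equiv> vectorspace.dim (class_ring :: real ring) X"

abbreviation lin_maps :: "'a qspace \<Rightarrow> 'b qspace \<Rightarrow> ('a \<Rightarrow> 'b) set" where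
  "lin_maps X Y \<equiv> module_hom (class_ring :: real ring) X Y"

definition quasi_normed_space :: "'a qspace \<Rightarrow> bool" where
  "quasi_normed_space X \<longleftrightarrow>
     real_vs X \<and>
     (\<forall>x\<in>carrier X. 0 \<le> qnorm X x \<and> (qnorm X x = 0 \<longleftrightarrow> x = \<zero>\<^bsub>X\<^esub>)) \<and>
     (\<forall>c. \<forall>x\<in>carrier X. qnorm X (c \<odot>\<^bsub>X\<^esub> x) = \<bar>c\<bar> * qnorm X x) \<and>
     (\<exists>K. \<forall>x\<in>carrier X. \<forall>y\<in>carrier X. qnorm X (x \<oplus>\<^bsub>X\<^esub> y) \<le> K * (qnorm X x + qnorm X y))"

definition q_tendsto :: "'a qspace \<Rightarrow> (nat \<Rightarrow> 'a) \<Rightarrow> 'a \<Rightarrow> bool" where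
  "q_tendsto X s x \<longleftrightarrow> (\<lambda>n. qnorm X (s n \<ominus>\<^bsub>X\<^esub> x)) \<longlonglongrightarrow> 0"

definition q_Cauchy :: "'a qspace \<Rightarrow> (nat \<Rightarrow> 'a) \<Rightarrow> bool" where
  "q_Cauchy X s \<longleftrightarrow> (\<forall>\<epsilon>>0. \<exists>N. \<forall>m\<ge>N. \<forall>n\<ge>N. qnorm X (s m \<ominus>\<^bsub>X\<^esub> s n) < \<epsilon>)"

definition q_complete :: "'a qspace \<Rightarrow> bool" where
  "q_complete X \<longleftrightarrow>
     (\<forall>s. (\<forall>n. s n \<in> carrier X) \<and> q_Cauchy X s \<longrightarrow> (\<exists>x\<in>carrier X. q_tendsto X s x))"

definition quasi_banach_space :: "'a qspace \<Rightarrow> bool" where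
  "quasi_banach_space X \<longleftrightarrow> quasi_normed_space X \<and> q_complete X"

definition closed_subspace :: "'a set \<Rightarrow> 'a qspace \<Rightarrow> bool" where
  "closed_subspace M X \<longleftrightarrow>
     VectorSpace.subspace (class_ring :: real ring) M X \<and>
     (\<forall>s x. (\<forall>n. s n \<in> M) \<and> x \<in> carrier X \<and> q_tendsto X s x \<longrightarrow> x \<in> M)"

text \<open>
  Scaling a coset elementwise would collapse it for the scalar 0, hence the union of cosets in
  the \<open>smult\<close> field.
\<close>

definition quotient_space :: "'a qspace \<Rightarrow> 'a set \<Rightarrow> 'a set qspace" where
  "quotient_space X M =
     \<lparr> carrier = a_rcosets\<^bsub>X\<^esub> M,
       mult = (\<lambda>A B. M),
       one = M,
       zero = M,
       add = (\<lambda>A B. A <+>\<^bsub>X\<^esub> B),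
       smult = (\<lambda>c A. \<Union>x\<in>A. M +>\<^bsub>X\<^esub> (c \<odot>\<^bsub>X\<^esub> x)),
       qnorm = (\<lambda>A. INF x\<in>A. qnorm X x) \<rparr>"

definition is_quotient_of :: "'a set qspace \<Rightarrow> 'a qspace \<Rightarrow> bool" where
  "is_quotient_of F X \<longleftrightarrow> (\<exists>M. closed_subspace M X \<and> F = quotient_space X M)"

definition bounded_lin :: "'a qspace \<Rightarrow> 'b qspace \<Rightarrow> ('a \<Rightarrow> 'b) \<Rightarrow> bool" where
  "bounded_lin X Y f \<longleftrightarrow>
     f \<in> lin_maps X Y \<and> (\<exists>K. \<forall>x\<in>carrier X. qnorm Y (f x) \<le> K * qnorm X x)"

text \<open>Meaningful only for maps that are bounded on the unit ball.\<close>

definition op_norm :: "'a qspace \<Rightarrow> 'b qspace \<Rightarrow> ('a \<Rightarrow> 'b) \<Rightarrow> real" where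
  "op_norm X Y f = (SUP x\<in>{x \<in> carrier X. qnorm X x \<le> 1}. qnorm Y (f x))"

definition real_line :: "real qspace" where
  "real_line = \<lparr> carrier = UNIV, mult = (*), one = 1, zero = 0, add = (+), smult = (*), qnorm = abs \<rparr>"

definition dual :: "'a qspace \<Rightarrow> ('a \<Rightarrow> real) qspace" where
  "dual X =
     \<lparr> carrier = {f \<in> extensional (carrier X). bounded_lin X real_line f},
       mult = (\<lambda>f g. \<lambda>x\<in>carrier X. 0),
       one = (\<lambda>x\<in>carrier X. 0),
       zero = (\<lambda>x\<in>carrier X. 0),
       add = (\<lambda>f g. \<lambda>x\<in>carrier X. f x + g x),
       smult = (\<lambda>c f. \<lambda>x\<in>carrier X. c * f x),
       qnorm = op_norm X real_line \<rparr>"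

definition hilbert_space :: "'a qspace \<Rightarrow> ('a \<Rightarrow> 'a \<Rightarrow> real) \<Rightarrow> bool" where
  "hilbert_space H ip \<longleftrightarrow>
     real_vs H \<and>
     (\<forall>x\<in>carrier H. \<forall>y\<in>carrier H. ip x y = ip y x) \<and>
     (\<forall>x\<in>carrier H. \<forall>y\<in>carrier H. \<forall>z\<in>carrier H. ip (x \<oplus>\<^bsub>H\<^esub> y) z = ip x z + ip y z) \<and>
     (\<forall>c. \<forall>x\<in>carrier H. \<forall>y\<in>carrier H. ip (c \<odot>\<^bsub>H\<^esub> x) y = c * ip x y) \<and>
     (\<forall>x\<in>carrier H. 0 \<le> ip x x \<and> (ip x x = 0 \<longleftrightarrow> x = \<zero>\<^bsub>H\<^esub>)) \<and>
     (\<forall>x\<in>carrier H. qnorm H x = sqrt (ip x x)) \<and>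
     q_complete H"

definition orthonormal_basis ::
    "'a qspace \<Rightarrow> ('a \<Rightarrow> 'a \<Rightarrow> real) \<Rightarrow> nat \<Rightarrow> (nat \<Rightarrow> 'a) \<Rightarrow> bool" where
  "orthonormal_basis H ip n e \<longleftrightarrow>
     vectorspace.basis (class_ring :: real ring) H (e ` {1..n}) \<and>
     (\<forall>i\<in>{1..n}. \<forall>j\<in>{1..n}. ip (e i) (e j) = (if i = j then 1 else 0))"

text \<open>
  The Hilbert spaces range over all structures on subsets of the type underlying \<open>E\<close>. This loses
  nothing: if \<open>v (w x) = x\<close> then \<open>w\<close> is an isomorphism onto a closed subspace of \<open>H\<close>, so \<open>H\<close> may
  be replaced by that subspace without increasing either norm, and then transported to the
  carrier of \<open>E\<close>. The value is \<open>\<infinity>\<close> if there is no factorization.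
\<close>

definition euclidean_distance :: "'a qspace \<Rightarrow> ereal" where
  "euclidean_distance E =
     Inf {ereal (op_norm H E v * op_norm E H w) | (H :: 'a qspace) ip v w.
            hilbert_space H ip \<and> bounded_lin E H w \<and> bounded_lin H E v \<and>
            (\<forall>x\<in>carrier E. v (w x) = x)}"

definition lin_rank :: "'a qspace \<Rightarrow> 'b qspace \<Rightarrow> ('a \<Rightarrow> 'b) \<Rightarrow> nat" where
  "lin_rank X Y f = vdim (Y\<lparr>carrier := f ` carrier X\<rparr>)"

definition approx_number :: "nat \<Rightarrow> 'a qspace \<Rightarrow> 'b qspace \<Rightarrow> ('a \<Rightarrow> 'b) \<Rightarrow> real" where
  "approx_number k X Y u =
     Inf {op_norm X Y (\<lambda>x. u x \<ominus>\<^bsub>Y\<^esub> v x) | v. v \<in> lin_maps X Y \<and> lin_rank X Y v < k}"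

text \<open>
  The coordinates on the product space below are independent standard Gaussian variables.
\<close>

definition ell_norm :: "nat \<Rightarrow> (nat \<Rightarrow> 'a) \<Rightarrow> 'b qspace \<Rightarrow> ('a \<Rightarrow> 'b) \<Rightarrow> real" where
  "ell_norm n e Z u =
     sqrt (\<integral>g. (qnorm Z (\<Oplus>\<^bsub>Z\<^esub>k\<in>{1..n}. g k \<odot>\<^bsub>Z\<^esub> u (e k)))\<^sup>2
             \<partial>(Pi\<^sub>M {1..n} (\<lambda>_. std_normal_distribution)))"

text \<open>
  Every finite-dimensional real Hilbert space is isometric to one whose carrier is a set of
  functions \<open>nat \<Rightarrow> real\<close>, so fixing this type for \<open>H\<close> loses nothing.
\<close>

definition weak_cotype2 :: "'a qspace \<Rightarrow> bool" where
  "weak_cotype2 Z \<longleftrightarrow>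
     (\<exists>C. \<forall>(H :: (nat \<Rightarrow> real) qspace) ip n e u.
        hilbert_space H ip \<and> orthonormal_basis H ip n e \<and> u \<in> lin_maps H Z \<longrightarrow>
        (\<forall>k\<in>{1..n}. approx_number k H Z u \<le> C * real k powr (-1/2) * ell_norm n e Z u))"

end

theory Submission
 imports Defs
begin

text \<open>
  Both implications are statements about the seminorms \<open>a \<mapsto> \<parallel>a\<^sub>0 z\<^sub>0 + \<dots> + a\<^sub>n z\<^sub>n\<parallel>\<close> which tuples of
  functionals \<open>z\<^sub>i\<close> in the dual induce on coordinate space. Two translations lead there.
  First, for a map defined on a Euclidean space approximation numbers and Gelfand numbers coincide, so
  weak cotype 2 says that such a seminorm is at most \<open>C \<ell> / sqrt k\<close> times the Euclidean norm on some
  subspace of codimension less than \<open>k\<close>, where \<open>\<ell>\<close> is its Gaussian average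
  (\<open>gelfand_bounded_of_weak_cotype2\<close>, \<open>approx_number_le_of_gel\<close>). Second, the quotients of a
  finite-dimensional quotient \<open>F\<close> of \<open>X\<close> are dual to the subspaces of the annihilator of the kernel of
  \<open>X \<rightarrow> F\<close>, a space of functionals. Passing from a quotient to the dual subspace preserves Euclidean
  estimates (\<open>hilbertian_subspaces_of_euclidean_quotients\<close>); the opposite passage does not, since
  the dual sees only the convex hull of the unit ball of \<open>X\<close>.

  Weak cotype 2 gives Euclidean quotients. The heart is the finite-dimensional statement
  \<open>euclidean_sections\<close>, a theorem of Milman and Pisier: if the Gelfand numbers are bounded as above, an
  \<open>m\<close>-dimensional norm is Euclidean, up to a constant depending on \<open>\<eta>\<close> and \<open>C\<close>, on a subspace of
  dimension at least \<open>(1 - \<eta>) m\<close>. Suppose the norm has distance \<open>d\<close> from the Euclidean one. The map of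
  largest determinant with \<open>\<ell>\<close>-norm \<open>sqrt m\<close> has an inverse of dual \<open>\<ell>\<close>-norm at most \<open>sqrt m\<close> (\<open>lewis\<close>). In the
  position so obtained the Gelfand numbers bound the norm from above on a subspace of small codimension.
  The projection of Gaussian functions onto their linear part has norm \<open>O(sqrt d)\<close> (\<open>k_convexity\<close>,
  by means of the Mehler semigroup), so trace duality bounds the mean width of the unit ball by
  \<open>O(sqrt (d m))\<close> (\<open>mstar_bound\<close>), and the low \<open>M\<^sup>*\<close> estimate (\<open>section_of_small_mean_width\<close>) bounds the
  norm from below on another subspace of small codimension. On the intersection the distance has become
  \<open>exp (c / \<epsilon>) sqrt d\<close> (\<open>distance_improvement\<close>). Taking square roots repeatedly with suitable \<open>\<epsilon>\<close> removes
  \<open>d\<close> (\<open>iterated_improvement\<close>).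

  To return to \<open>X\<close>, let \<open>E\<close> be the quotient of \<open>F\<close> by the common kernel of the functionals in the
  Euclidean subspace. They map the unit ball of \<open>X\<close> to a subset of the ball of radius \<open>D\<close> in \<open>\<real>\<^sup>m\<close>, the closed convex
  hull of which contains the unit ball. A greedy algorithm (\<open>greedy_approximation\<close>) approximates
  every vector by a bounded number of its elements, with a loss depending on \<open>D\<close> and the modulus of concavity \<open>K\<close>
  only. The remaining error is absorbed, because \<open>E\<close> has finite dimension (\<open>euclidean_quotient\<close>).

  Euclidean quotients give weak cotype 2. Let \<open>k\<close> maximise \<open>sqrt k\<close> times the \<open>k\<close>-th Gelfand number. Then the
  Gelfand numbers are nearly constant on a final segment of \<open>{1..k}\<close>, so that there are proportionally many
  orthonormal vectors at which the seminorm is almost as large as its bound \<open>A\<close> on their whole span.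
  Comparing traces, it cannot be much smaller than \<open>A\<close> on any subspace of proportional dimension
  (\<open>trace_lower_bound\<close>). On a Euclidean subspace of their span this yields orthonormal vectors, again
  proportionally many, at which the seminorm is of order \<open>A\<close>, and there a Hilbertian norm has Gaussian
  average of order \<open>A sqrt k\<close> (\<open>ell_lower_bound_flat\<close>). Since projections decrease Gaussian averages
  (\<open>ell_sq_projection\<close>), this is the estimate \<open>A \<le> C \<ell> / sqrt k\<close>
  (\<open>gelfand_estimate_of_hilbertian_subspaces\<close>).
\<close>

section \<open>Coordinate vectors, orthonormal families and seminorms\<close>

text \<open>Vectors are functions on the naturals of which only the coordinates below \<open>n\<close> count, so that the
 dimension may vary within a statement. A map on \<open>\<real>\<^sup>m\<close> is given by the images \<open>U j\<close> of the unit vectors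
 and evaluated by \<open>lin m U\<close>; composing maps composes the column families (\<open>lin_lin\<close>).\<close>

definition ip :: "nat \<Rightarrow> (nat \<Rightarrow> real) \<Rightarrow> (nat \<Rightarrow> real) \<Rightarrow> real" where
 "ip n x y = (\<Sum>i<n. x i * y i)"

definition nrm :: "nat \<Rightarrow> (nat \<Rightarrow> real) \<Rightarrow> real" where
 "nrm n x = sqrt (ip n x x)"

definition lin :: "nat \<Rightarrow> (nat \<Rightarrow> nat \<Rightarrow> real) \<Rightarrow> (nat \<Rightarrow> real) \<Rightarrow> nat \<Rightarrow> real" where
 "lin m U x = (\<lambda>i. \<Sum>j<m. x j * U j i)"

definition orthonormal :: "nat \<Rightarrow> nat \<Rightarrow> (nat \<Rightarrow> nat \<Rightarrow> real) \<Rightarrow> bool" where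
 "orthonormal n k f \<longleftrightarrow> (\<forall>i<k. \<forall>j<k. ip n (f i) (f j) = (if i = j then 1 else 0))"

definition seminorm :: "nat \<Rightarrow> ((nat \<Rightarrow> real) \<Rightarrow> real) \<Rightarrow> bool" where
 "seminorm n q \<longleftrightarrow>
  (\<forall>x y. (\<forall>i<n. x i = y i) \<longrightarrow> q x = q y) \<and>
  (\<forall>x y. q (\<lambda>i. x i + y i) \<le> q x + q y) \<and>
  (\<forall>c x. q (\<lambda>i. c * x i) = \<bar>c\<bar> * q x)"

lemma ip_commute: "ip n x y = ip n y x"
 by (simp add: ip_def mult.commute)

lemma ip_add_left: "ip n (\<lambda>i. x i + y i) z = ip n x z + ip n y z"
 by (simp add: ip_def sum.distrib algebra_simps)

lemma ip_add_right: "ip n z (\<lambda>i. x i + y i) = ip n z x + ip n z y"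
 by (simp add: ip_def sum.distrib algebra_simps)

lemma ip_diff_left: "ip n (\<lambda>i. x i - y i) z = ip n x z - ip n y z"
 by (simp add: ip_def sum_subtractf algebra_simps)

lemma ip_diff_right: "ip n z (\<lambda>i. x i - y i) = ip n z x - ip n z y"
 by (simp add: ip_def sum_subtractf algebra_simps)

lemma ip_scale_left: "ip n (\<lambda>i. c * x i) z = c * ip n x z"
 by (simp add: ip_def sum_distrib_left algebra_simps)

lemma ip_scale_right: "ip n z (\<lambda>i. c * x i) = c * ip n z x"
 by (simp add: ip_def sum_distrib_left algebra_simps)

lemma ip_sum_left: "ip n (\<lambda>i. \<Sum>j\<in>A. g j i) z = (\<Sum>j\<in>A. ip n (g j) z)"
 by (simp add: ip_def sum_distrib_right sum.swap[of _ A])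

lemma ip_sum_right: "ip n z (\<lambda>i. \<Sum>j\<in>A. g j i) = (\<Sum>j\<in>A. ip n z (g j))"
 by (simp add: ip_commute[of n z] ip_sum_left)

lemma ip_lin_left: "ip n (lin m U x) z = (\<Sum>j<m. x j * ip n (U j) z)"
 by (simp add: lin_def ip_sum_left ip_scale_left)

lemma ip_lin_right: "ip n z (lin m U x) = (\<Sum>j<m. x j * ip n z (U j))"
 by (simp add: lin_def ip_sum_right ip_scale_right)

lemma ip_cong: "(\<And>i. i < n \<Longrightarrow> x i = x' i) \<Longrightarrow> (\<And>i. i < n \<Longrightarrow> y i = y' i) \<Longrightarrow> ip n x y = ip n x' y'"
 by (simp add: ip_def)

lemma ip_self_nonneg [simp]: "0 \<le> ip n x x"
 by (simp add: ip_def sum_nonneg)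

lemma nrm_nonneg [simp]: "0 \<le> nrm n x"
 by (simp add: nrm_def)

lemma nrm_sq: "(nrm n x)\<^sup>2 = ip n x x"
 by (simp add: nrm_def)

lemma nrm_cong: "(\<And>i. i < n \<Longrightarrow> x i = y i) \<Longrightarrow> nrm n x = nrm n y"
 by (simp add: nrm_def cong: ip_cong)

lemma nrm_L2_set: "nrm n x = L2_set x {..<n}"
 by (simp add: nrm_def ip_def L2_set_def power2_eq_square)

lemma nrm_eq_0_iff: "nrm n x = 0 \<longleftrightarrow> (\<forall>i<n. x i = 0)"
 by (auto simp: nrm_L2_set L2_set_eq_0_iff)

lemma nrm_pos: "i < n \<Longrightarrow> x i \<noteq> 0 \<Longrightarrow> 0 < nrm n x"
 using nrm_eq_0_iff[of n x] nrm_nonneg[of n x] by (metis less_eq_real_def)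

lemma nrm_triangle: "nrm n (\<lambda>i. x i + y i) \<le> nrm n x + nrm n y"
 by (simp add: nrm_L2_set L2_set_triangle_ineq)

lemma nrm_scale: "nrm n (\<lambda>i. c * x i) = \<bar>c\<bar> * nrm n x"
 by (simp add: nrm_def ip_scale_left ip_scale_right real_sqrt_mult flip: mult.assoc)

lemma ip_le_nrm: "\<bar>ip n x y\<bar> \<le> nrm n x * nrm n y"
proof -
 show ?thesis
  by (simp add: ip_def order.trans[OF sum_abs] abs_mult nrm_L2_set L2_set_mult_ineq)
qed

lemma coord_le_nrm: "i < n \<Longrightarrow> \<bar>x i\<bar> \<le> nrm n x"
 using member_le_L2_set[of "{..<n}" i "\<lambda>i. \<bar>x i\<bar>"] by (simp add: nrm_L2_set L2_set_def)

lemma seminorm_nrm: "seminorm n (nrm n)"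
 by (auto simp: seminorm_def nrm_triangle nrm_scale intro: nrm_cong)

lemma nrm_diff_le: "nrm n (\<lambda>i. x i - y i) \<le> nrm n x + nrm n y"
 using nrm_triangle[of n x "\<lambda>i. - y i"] nrm_scale[of n "-1" y] by simp

lemma seminorm_cong: "seminorm n q \<Longrightarrow> (\<And>i. i < n \<Longrightarrow> x i = y i) \<Longrightarrow> q x = q y"
 by (auto simp: seminorm_def)

lemma seminorm_triangle: "seminorm n q \<Longrightarrow> q (\<lambda>i. x i + y i) \<le> q x + q y"
 by (auto simp: seminorm_def)

lemma seminorm_scale: "seminorm n q \<Longrightarrow> q (\<lambda>i. c * x i) = \<bar>c\<bar> * q x"
 by (auto simp: seminorm_def)

lemma seminorm_zero: "seminorm n q \<Longrightarrow> q (\<lambda>i. 0) = 0"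
 using seminorm_scale[of n q 0] by simp

lemma seminorm_minus: "seminorm n q \<Longrightarrow> q (\<lambda>i. - x i) = q x"
 using seminorm_scale[of n q "-1"] by simp

lemma seminorm_diff_commute: "seminorm n q \<Longrightarrow> q (\<lambda>i. x i - y i) = q (\<lambda>i. y i - x i)"
 using seminorm_minus[of n q "\<lambda>i. x i - y i"] by simp

lemma seminorm_nonneg: assumes "seminorm n q" shows "0 \<le> q x"
 using seminorm_triangle[OF assms, of x "\<lambda>i. - x i"] seminorm_minus[OF assms, of x]
  seminorm_zero[OF assms] by simp

lemma seminorm_diff_le: "seminorm n q \<Longrightarrow> q x - q y \<le> q (\<lambda>i. x i - y i)"
 using seminorm_triangle[of n q y "\<lambda>i. x i - y i"] by simp

lemma seminorm_abs_diff_le: "seminorm n q \<Longrightarrow> \<bar>q x - q y\<bar> \<le> q (\<lambda>i. x i - y i)"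
 using seminorm_diff_le[of n q x y] seminorm_diff_le[of n q y x] seminorm_diff_commute[of n q x y]
 by auto

lemma seminorm_sum:
 assumes "seminorm n q" "finite A"
 shows "q (\<lambda>i. \<Sum>j\<in>A. g j i) \<le> (\<Sum>j\<in>A. q (g j))"
 using assms(2)
proof induction
 case empty then show ?case using seminorm_zero[OF assms(1)] by simp
next
 case (insert a A)
 then show ?case
  using seminorm_triangle[OF assms(1), of "g a" "\<lambda>i. \<Sum>j\<in>A. g j i"] by simp
qed

lemma lin_add: "lin m U (\<lambda>i. x i + y i) = (\<lambda>i. lin m U x i + lin m U y i)"
 by (simp add: lin_def sum.distrib algebra_simps fun_eq_iff)

lemma lin_diff: "lin m U (\<lambda>i. x i - y i) = (\<lambda>i. lin m U x i - lin m U y i)"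
 by (simp add: lin_def sum_subtractf algebra_simps fun_eq_iff)

lemma lin_scale: "lin m U (\<lambda>i. c * x i) = (\<lambda>i. c * lin m U x i)"
 by (simp add: lin_def sum_distrib_left algebra_simps fun_eq_iff)

lemma lin_cong: "(\<And>i. i < m \<Longrightarrow> x i = y i) \<Longrightarrow> lin m U x = lin m U y"
 by (simp add: lin_def fun_eq_iff)

lemma lin_lin: "lin m U (lin k V x) = lin k (\<lambda>j. lin m U (V j)) x"
proof
 fix i
 have "lin m U (lin k V x) i = (\<Sum>j<m. \<Sum>l<k. x l * V l j * U j i)"
  by (simp add: lin_def sum_distrib_right)
 also have "\<dots> = (\<Sum>l<k. \<Sum>j<m. x l * V l j * U j i)" by (rule sum.swap)
 finally show "lin m U (lin k V x) i = lin k (\<lambda>j. lin m U (V j)) x i"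
  by (simp add: lin_def sum_distrib_left mult.assoc)
qed

lemma seminorm_lin:
 assumes "seminorm n q" shows "seminorm m (\<lambda>x. q (lin m U x))"
 unfolding seminorm_def
proof (intro conjI allI impI)
 fix x y :: "nat \<Rightarrow> real" assume "\<forall>i<m. x i = y i"
 then show "q (lin m U x) = q (lin m U y)"
  by (metis lin_cong)
qed (simp_all only: lin_add lin_scale seminorm_triangle[OF assms] seminorm_scale[OF assms])

lemma seminorm_bounded:
 assumes "seminorm n q" shows "\<exists>B\<ge>0. \<forall>x. q x \<le> B * nrm n x"
proof (intro exI conjI allI)
 let ?e = "\<lambda>j i. if i = j then 1 else (0::real)"
 show "0 \<le> (\<Sum>j<n. q (?e j))" by (simp add: sum_nonneg seminorm_nonneg[OF assms])
 fix x
 have "q x = q (\<lambda>i. \<Sum>j<n. x j * ?e j i)"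
  by (rule seminorm_cong[OF assms]) (simp add: if_distrib[of "\<lambda>c. _ * c"] sum.delta cong: if_cong)
 also have "\<dots> \<le> (\<Sum>j<n. q (\<lambda>i. x j * ?e j i))"
  by (rule seminorm_sum[OF assms]) simp
 also have "\<dots> = (\<Sum>j<n. \<bar>x j\<bar> * q (?e j))"
  by (simp only: seminorm_scale[OF assms])
 also have "\<dots> \<le> (\<Sum>j<n. nrm n x * q (?e j))"
  by (intro sum_mono mult_right_mono coord_le_nrm seminorm_nonneg[OF assms]) auto
 finally show "q x \<le> (\<Sum>j<n. q (?e j)) * nrm n x" by (simp add: sum_distrib_left mult.commute)
qed

text \<open>Gaussian elimination: solving an equation for an unknown that occurs in it leaves a system
 with one equation and one unknown less.\<close>
lemma homogeneous_system_set:
 fixes r :: "nat \<Rightarrow> 'i \<Rightarrow> real"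
 assumes "finite I" "k < card I"
 shows "\<exists>a. (\<exists>i\<in>I. a i \<noteq> 0) \<and> (\<forall>j<k. (\<Sum>i\<in>I. a i * r j i) = 0)"
 using assms
proof (induction k arbitrary: I r)
 case 0
 then have "I \<noteq> {}" by auto
 then show ?case by (intro exI[of _ "\<lambda>_. 1"]) auto
next
 case (Suc k)
 show ?case
 proof (cases "\<exists>p\<in>I. r k p \<noteq> 0")
  case False
  from Suc.IH[of I r] Suc.prems obtain a where a: "\<exists>i\<in>I. a i \<noteq> 0" "\<forall>j<k. (\<Sum>i\<in>I. a i * r j i) = 0"
   by auto
  show ?thesis
  using False a by (simp add: sum.neutral exI[of _ a] less_Suc_eq)
 next
  case True
  then obtain p where p: "p \<in> I" "r k p \<noteq> 0" by auto
  let ?I = "I - {p}"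
  have fin: "finite ?I" "k < card ?I" using Suc.prems p by auto
  define s where "s j i = r j i - r j p * r k i / r k p" for j i
  from Suc.IH[OF fin, of s] obtain a where
   a: "\<exists>i\<in>?I. a i \<noteq> 0" "\<forall>j<k. (\<Sum>i\<in>?I. a i * s j i) = 0" by auto
  define b where "b = a(p := - (\<Sum>i\<in>?I. a i * r k i) / r k p)"
  have split: "(\<Sum>i\<in>I. b i * r j i) = b p * r j p + (\<Sum>i\<in>?I. a i * r j i)" for j
  proof -
   have "(\<Sum>i\<in>I. b i * r j i) = b p * r j p + (\<Sum>i\<in>?I. b i * r j i)"
    using Suc.prems(1) p(1) by (rule sum.remove)
   moreover have "(\<Sum>i\<in>?I. b i * r j i) = (\<Sum>i\<in>?I. a i * r j i)"
    by (rule sum.cong) (auto simp: b_def)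
   ultimately show ?thesis by simp
  qed
  have "(\<Sum>i\<in>I. b i * r j i) = 0" if "j < Suc k" for j
  proof (cases "j = k")
   case True
   then show ?thesis using p by (simp add: split) (simp add: b_def)
  next
   case False
   with that a(2) have "0 = (\<Sum>i\<in>?I. a i * s j i)" by simp
   also have "\<dots> = (\<Sum>i\<in>?I. a i * r j i) - (\<Sum>i\<in>?I. a i * r k i) * (r j p / r k p)"
    by (simp add: s_def algebra_simps sum_subtractf sum_distrib_left sum_distrib_right sum_divide_distrib)
   finally show ?thesis using p by (simp add: split) (simp add: b_def field_simps)
  qed
  moreover have "\<exists>i\<in>I. b i \<noteq> 0" using a(1) by (auto simp: b_def)
  ultimately show ?thesis by blast
 qed
qed

lemma homogeneous_system:
 fixes r :: "nat \<Rightarrow> nat \<Rightarrow> real"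
 assumes "k < m"
 shows "\<exists>a. (\<exists>i<m. a i \<noteq> 0) \<and> (\<forall>j<k. ip m a (r j) = 0)"
 using homogeneous_system_set[of "{..<m}" k r] assms by (auto simp: ip_def)

lemma orthonormalD:
 "orthonormal n k f \<Longrightarrow> i < k \<Longrightarrow> j < k \<Longrightarrow> ip n (f i) (f j) = (if i = j then 1 else 0)"
 by (auto simp: orthonormal_def)

lemma orthonormal_nrm: "orthonormal n k f \<Longrightarrow> i < k \<Longrightarrow> nrm n (f i) = 1"
 by (simp add: nrm_def orthonormalD)

lemma orthonormal_ip_lin:
 assumes "orthonormal n k f" "i < k" shows "ip n (f i) (lin k f x) = x i"
proof -
 have "ip n (f i) (lin k f x) = (\<Sum>j<k. x j * (if i = j then 1 else 0))"
  unfolding ip_lin_right by (intro sum.cong) (auto simp: orthonormalD[OF assms(1) assms(2)])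
 also have "\<dots> = x i" using assms(2) by (simp add: if_distrib[of "\<lambda>c. _ * c"] cong: if_cong)
 finally show ?thesis .
qed

lemma orthonormal_isometry:
 assumes "orthonormal n k f" shows "ip n (lin k f x) (lin k f y) = ip k x y"
 by (simp add: ip_lin_left orthonormal_ip_lin[OF assms]) (simp add: ip_def)

lemma orthonormal_nrm_lin:
 assumes "orthonormal n k f" shows "nrm n (lin k f x) = nrm k x"
 by (simp add: nrm_def orthonormal_isometry[OF assms])

lemma orthonormal_Suc:
 assumes "orthonormal n k f" "nrm n v = 1" "\<And>i. i < k \<Longrightarrow> ip n v (f i) = 0"
 shows "orthonormal n (Suc k) (f(k := v))"
proof -
 have "ip n v v = 1" using assms(2) nrm_sq[of n v] by simp
 moreover have "ip n (f i) v = 0" if "i < k" for i using assms(3)[OF that] by (simp add: ip_commute)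
 ultimately show ?thesis using assms
  by (auto simp: orthonormal_def less_Suc_eq)
qed

lemma unit_multiple:
 assumes "0 < nrm n x" shows "nrm n (\<lambda>i. (1 / nrm n x) * x i) = 1"
 using assms by (simp only: nrm_scale) simp

text \<open>Orthonormal families are built vector by vector: at each step the vectors already chosen and the
 prescribed constraints form a homogeneous system with more unknowns than equations.\<close>
lemma unit_vector_in_kernel:
 assumes "k < m" and inj: "\<And>a. \<exists>i<m. a i \<noteq> 0 \<Longrightarrow> 0 < nrm n (lin m M a)"
 shows "\<exists>a. nrm n (lin m M a) = 1 \<and> (\<forall>j<k. ip n (lin m M a) (r j) = 0)"
proof -
 from homogeneous_system[OF assms(1), of "\<lambda>j i. ip n (M i) (r j)"] obtain a where
  a: "\<exists>i<m. a i \<noteq> 0" "\<And>j. j < k \<Longrightarrow> ip m a (\<lambda>i. ip n (M i) (r j)) = 0" by blast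
 have k: "ip n (lin m M a) (r j) = 0" if "j < k" for j
  using a(2)[OF that] by (simp add: ip_lin_left ip_def[of m])
 from inj[OF a(1)] have p: "0 < nrm n (lin m M a)" .
 show ?thesis
  by (intro exI[of _ "\<lambda>i. (1 / nrm n (lin m M a)) * a i"])
   (use unit_multiple[OF p] k in \<open>simp add: lin_scale ip_scale_left del: times_divide_eq_left\<close>)
qed

lemma unit_vector_orthogonal:
 assumes "k < n" shows "\<exists>v. nrm n v = 1 \<and> (\<forall>j<k. ip n v (r j) = 0)"
proof -
 let ?e = "\<lambda>j i. if i = j then 1 else (0::real)"
 have "lin n ?e a i = a i" if "i < n" for a i
  using that by (simp add: lin_def if_distrib[of "\<lambda>c. _ * c"] cong: if_cong)
 then have "\<And>a. \<exists>i<n. a i \<noteq> 0 \<Longrightarrow> 0 < nrm n (lin n ?e a)"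
  by (smt (verit) nrm_cong nrm_pos)
 from unit_vector_in_kernel[OF assms this, of r] show ?thesis by blast
qed

lemma orthonormal_le:
 assumes "orthonormal n k f" shows "k \<le> n"
proof (rule ccontr)
 assume "\<not> k \<le> n"
 then obtain a where a: "\<exists>i<k. a i \<noteq> 0" "\<And>j. j < n \<Longrightarrow> ip k a (\<lambda>i. f i j) = 0"
  using homogeneous_system[of n k "\<lambda>j i. f i j"] by auto
 show False
  by (metis a(2) a(1) nrm_pos[of _ k a] nrm_eq_0_iff lin_def ip_def orthonormal_nrm_lin[OF assms])
qed

lemma orthonormal_in_kernel:
 assumes "s + k \<le> n" shows "\<exists>f. orthonormal n s f \<and> (\<forall>i<s. \<forall>j<k. ip n (f i) (r j) = 0)"
 using assms
proof (induction s)
 case 0 show ?case by (simp add: orthonormal_def)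
next
 case (Suc s)
 then obtain f where f: "orthonormal n s f" "\<forall>i<s. \<forall>j<k. ip n (f i) (r j) = 0" by auto
 obtain v where v: "nrm n v = 1" "\<forall>j<s+k. ip n v ((\<lambda>j. if j < s then f j else r (j - s)) j) = 0"
  using unit_vector_orthogonal[of "s+k" n "\<lambda>j. if j < s then f j else r (j - s)"] Suc.prems by auto
 have "ip n v (f i) = 0" if "i < s" for i using v(2) that by (auto dest: spec[of _ i])
 moreover have "ip n v (r j) = 0" if "j < k" for j using v(2)[rule_format, of "s + j"] that by auto
 ultimately have "orthonormal n (Suc s) (f(s := v))" "\<forall>i<Suc s. \<forall>j<k. ip n ((f(s := v)) i) (r j) = 0"
  using orthonormal_Suc[OF f(1) v(1)] f(2) by (auto simp: less_Suc_eq)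
 then show ?case by blast
qed

lemma orthonormal_extend:
 assumes "orthonormal n k f" "k \<le> m" "m \<le> n"
 shows "\<exists>g. orthonormal n m g \<and> (\<forall>i<k. g i = f i)"
proof -
 obtain h where h: "orthonormal n (m - k) h" "\<forall>i<m-k. \<forall>j<k. ip n (h i) (f j) = 0"
  using orthonormal_in_kernel[of "m - k" k n f] assms(2,3) by auto
 define g where "g i = (if i < k then f i else h (i - k))" for i
 have "orthonormal n m g"
  unfolding orthonormal_def
 proof (intro allI impI)
  fix i j assume "i < m" "j < m"
  then show "ip n (g i) (g j) = (if i = j then 1 else 0)"
   using orthonormalD[OF assms(1), of i j] orthonormalD[OF h(1), of "i - k" "j - k"] h(2)
    ip_commute[of n "f i" "h (j - k)"]
   by (auto simp: g_def)
 qed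
 then show ?thesis by (intro exI[of _ g]) (auto simp: g_def)
qed

lemma orthonormal_expansion:
 assumes "orthonormal n n f" "i < n" shows "x i = (\<Sum>j<n. ip n x (f j) * f j i)"
proof -
 define z where "z i = x i - (\<Sum>j<n. ip n x (f j) * f j i)" for i
 have z: "ip n z (f j) = 0" if "j < n" for j
 proof -
  have "ip n z (f j) = ip n x (f j) - ip n (lin n f (\<lambda>j. ip n x (f j))) (f j)"
   unfolding z_def lin_def by (rule ip_diff_left)
  also have "\<dots> = 0"
   using orthonormal_ip_lin[OF assms(1) that] by (simp add: ip_commute[of _ _ "f j"])
  finally show ?thesis .
 qed
 have "nrm n z = 0"
 proof (rule ccontr)
  assume "nrm n z \<noteq> 0"
  then have p: "0 < nrm n z" using nrm_nonneg[of n z] by linarith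
  have "orthonormal n (Suc n) (f(n := (\<lambda>i. (1 / nrm n z) * z i)))"
   by (rule orthonormal_Suc[OF assms(1) unit_multiple[OF p]])
    (use z in \<open>simp add: ip_scale_left del: times_divide_eq_left\<close>)
  then show False using orthonormal_le by fastforce
 qed
 then show ?thesis using assms(2) by (simp add: nrm_eq_0_iff z_def)
qed

lemma parseval:
 assumes "orthonormal n n f" shows "ip n x y = (\<Sum>j<n. ip n x (f j) * ip n y (f j))"
proof -
 have "ip n x y = ip n (lin n f (\<lambda>j. ip n x (f j))) y"
  by (rule ip_cong) (use orthonormal_expansion[OF assms] in \<open>auto simp: lin_def\<close>)
 then show ?thesis by (simp add: ip_lin_left ip_commute[of n y])
qed

lemma bessel:
 assumes "orthonormal n k f" shows "(\<Sum>j<k. (ip n x (f j))\<^sup>2) \<le> ip n x x"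
proof -
 obtain g where g: "orthonormal n n g" "\<forall>i<k. g i = f i"
  using orthonormal_extend[OF assms orthonormal_le[OF assms] order_refl] by blast
 have "(\<Sum>j<k. (ip n x (f j))\<^sup>2) = (\<Sum>j<k. (ip n x (g j))\<^sup>2)" using g(2) by simp
 also have "\<dots> \<le> (\<Sum>j<n. (ip n x (g j))\<^sup>2)"
  by (rule sum_mono2) (use orthonormal_le[OF assms] in auto)
 also have "\<dots> = ip n x x" by (simp add: parseval[OF g(1), of x x] power2_eq_square)
 finally show ?thesis .
qed

section \<open>Rotation invariance of Gaussian vectors\<close>

definition gauss :: "nat \<Rightarrow> (nat \<Rightarrow> real) measure" where
 "gauss n = Pi\<^sub>M {..<n} (\<lambda>_. std_normal_distribution)"

abbreviation gauss1 :: "real measure" where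
 "gauss1 \<equiv> std_normal_distribution"

lemma prob_space_gauss1: "prob_space gauss1"
 by (rule prob_space_normal_density) simp

lemma sigma_finite_gauss1: "sigma_finite_measure gauss1"
 using prob_space_gauss1 by (rule prob_space_imp_sigma_finite)

lemma product_sigma_finite_gauss1: "product_sigma_finite (\<lambda>_. gauss1)"
 by (simp add: product_sigma_finite_def sigma_finite_gauss1)

lemma prob_space_gauss: "prob_space (gauss n)"
 unfolding gauss_def by (rule prob_space_PiM) (rule prob_space_gauss1)

lemma space_gauss: "space (gauss n) = {..<n} \<rightarrow>\<^sub>E UNIV"
 by (simp add: gauss_def space_PiM)

lemma sets_gauss [measurable_cong]: "sets (gauss n) = sets (Pi\<^sub>M {..<n} (\<lambda>_. borel))"
 unfolding gauss_def by (rule sets_PiM_cong) auto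

lemma measurable_gauss_coord: "i < n \<Longrightarrow> (\<lambda>g. g i) \<in> borel_measurable (gauss n)"
 by (subst measurable_cong_sets[OF sets_gauss refl]) (rule measurable_component_singleton, simp)

lemma nn_integral_gauss_Suc:
 assumes "f \<in> borel_measurable (gauss (Suc n))"
 shows "(\<integral>\<^sup>+x. f x \<partial>gauss (Suc n)) = (\<integral>\<^sup>+x. (\<integral>\<^sup>+t. f (x(n := t)) \<partial>gauss1) \<partial>gauss n)"
 using product_sigma_finite.product_nn_integral_insert[OF product_sigma_finite_gauss1,
   of "{..<n}" n f] assms
 by (simp add: gauss_def lessThan_Suc)

text \<open>A plane rotation by an angle other than \<open>\<pi>\<close> is a product of three shears, and shears preserve
 planar Lebesgue measure by Fubini and translation invariance on the line.\<close>
lemma nn_integral_shear_fst: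
 fixes H :: "real \<Rightarrow> real \<Rightarrow> ennreal"
 assumes [measurable]: "(\<lambda>(x, y). H x y) \<in> borel_measurable (borel \<Otimes>\<^sub>M borel)"
 shows "(\<integral>\<^sup>+x. \<integral>\<^sup>+y. H (x + a * y) y \<partial>lborel \<partial>lborel) = (\<integral>\<^sup>+x. \<integral>\<^sup>+y. H x y \<partial>lborel \<partial>lborel)"
proof -
 have "(\<integral>\<^sup>+x. \<integral>\<^sup>+y. H (x + a * y) y \<partial>lborel \<partial>lborel) = (\<integral>\<^sup>+y. \<integral>\<^sup>+x. H (x + a * y) y \<partial>lborel \<partial>lborel)"
  by (rule lborel_pair.Fubini'[symmetric]) measurable
 also have "\<dots> = (\<integral>\<^sup>+y. \<integral>\<^sup>+x. H x y \<partial>lborel \<partial>lborel)"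
 proof (rule nn_integral_cong)
  fix y
  show "(\<integral>\<^sup>+x. H (x + a * y) y \<partial>lborel) = (\<integral>\<^sup>+x. H x y \<partial>lborel)"
   using nn_integral_real_affine[where c=1 and t="a * y" and f="\<lambda>x. H x y"] by (simp add: add.commute)
 qed
 also have "\<dots> = (\<integral>\<^sup>+x. \<integral>\<^sup>+y. H x y \<partial>lborel \<partial>lborel)"
  by (rule lborel_pair.Fubini') measurable
 finally show ?thesis .
qed

lemma nn_integral_shear_snd:
 fixes H :: "real \<Rightarrow> real \<Rightarrow> ennreal"
 assumes [measurable]: "(\<lambda>(x, y). H x y) \<in> borel_measurable (borel \<Otimes>\<^sub>M borel)"
 shows "(\<integral>\<^sup>+x. \<integral>\<^sup>+y. H x (y + a * x) \<partial>lborel \<partial>lborel) = (\<integral>\<^sup>+x. \<integral>\<^sup>+y. H x y \<partial>lborel \<partial>lborel)"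
proof (rule nn_integral_cong)
 fix x
 show "(\<integral>\<^sup>+y. H x (y + a * x) \<partial>lborel) = (\<integral>\<^sup>+y. H x y \<partial>lborel)"
  using nn_integral_real_affine[where c=1 and t="a * x" and f="H x"] by (simp add: add.commute)
qed

lemma nn_integral_rotation:
 fixes H :: "real \<Rightarrow> real \<Rightarrow> ennreal"
 assumes [measurable]: "(\<lambda>(x, y). H x y) \<in> borel_measurable (borel \<Otimes>\<^sub>M borel)"
  and cs: "c\<^sup>2 + s\<^sup>2 = 1" "0 \<le> c"
 shows "(\<integral>\<^sup>+x. \<integral>\<^sup>+y. H (c * x + s * y) (- s * x + c * y) \<partial>lborel \<partial>lborel) = (\<integral>\<^sup>+x. \<integral>\<^sup>+y. H x y \<partial>lborel \<partial>lborel)"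
proof -
 define a where "a = s / (1 + c)"
 have a: "a * (1 + c) = s" "1 - s * a = c"
  using cs by (auto simp: a_def field_simps power2_eq_square)
 have "H (c * x + s * y) (- s * x + c * y) =
  H ((x + a * y) + a * (y + - s * (x + a * y))) (y + - s * (x + a * y))" for x y
 proof -
  have "y + - s * (x + a * y) = - s * x + (1 - s * a) * y" by (simp add: algebra_simps)
  moreover have "(x + a * y) + a * (y + - s * (x + a * y)) = (1 - s * a) * x + (a * (1 + (1 - s * a))) * y"
   by (simp add: algebra_simps)
  ultimately show ?thesis by (simp only: a)
 qed
 then have "(\<integral>\<^sup>+x. \<integral>\<^sup>+y. H (c * x + s * y) (- s * x + c * y) \<partial>lborel \<partial>lborel)
  = (\<integral>\<^sup>+x. \<integral>\<^sup>+y. H ((x + a * y) + a * (y + - s * (x + a * y))) (y + - s * (x + a * y)) \<partial>lborel \<partial>lborel)"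
  by simp
 also have "\<dots> = (\<integral>\<^sup>+x. \<integral>\<^sup>+y. H (x + a * (y + - s * x)) (y + - s * x) \<partial>lborel \<partial>lborel)"
  by (rule nn_integral_shear_fst[where H="\<lambda>x y. H (x + a * (y + - s * x)) (y + - s * x)"]) measurable
 also have "\<dots> = (\<integral>\<^sup>+x. \<integral>\<^sup>+y. H (x + a * y) y \<partial>lborel \<partial>lborel)"
  by (rule nn_integral_shear_snd[where H="\<lambda>x y. H (x + a * y) y"]) measurable
 also have "\<dots> = (\<integral>\<^sup>+x. \<integral>\<^sup>+y. H x y \<partial>lborel \<partial>lborel)"
  by (rule nn_integral_shear_fst) measurable
 finally show ?thesis .
qed

lemma nn_integral_rotation_gauss:
 fixes H :: "real \<Rightarrow> real \<Rightarrow> ennreal"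
 assumes [measurable]: "(\<lambda>(x, y). H x y) \<in> borel_measurable (borel \<Otimes>\<^sub>M borel)"
  and cs: "c\<^sup>2 + s\<^sup>2 = 1" "0 \<le> c"
 shows "(\<integral>\<^sup>+x. \<integral>\<^sup>+y. H (c * x + s * y) (- s * x + c * y) \<partial>gauss1 \<partial>gauss1) = (\<integral>\<^sup>+x. \<integral>\<^sup>+y. H x y \<partial>gauss1 \<partial>gauss1)"
proof -
 let ?d = "std_normal_density"
 have I: "(\<integral>\<^sup>+x. \<integral>\<^sup>+y. K x y \<partial>gauss1 \<partial>gauss1) =
   (\<integral>\<^sup>+x. \<integral>\<^sup>+y. ennreal (?d x) * ennreal (?d y) * K x y \<partial>lborel \<partial>lborel)"
  if [measurable]: "(\<lambda>(x, y). K x y) \<in> borel_measurable (borel \<Otimes>\<^sub>M borel)"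
  for K :: "real \<Rightarrow> real \<Rightarrow> ennreal"
 proof -
  have i: "(\<integral>\<^sup>+y. K x y \<partial>gauss1) = (\<integral>\<^sup>+y. ennreal (?d y) * K x y \<partial>lborel)" for x
   by (rule nn_integral_density) measurable
  have "(\<integral>\<^sup>+x. \<integral>\<^sup>+y. K x y \<partial>gauss1 \<partial>gauss1) = (\<integral>\<^sup>+x. ennreal (?d x) * (\<integral>\<^sup>+y. ennreal (?d y) * K x y \<partial>lborel) \<partial>lborel)"
   unfolding i by (rule nn_integral_density) measurable
  also have "\<dots> = (\<integral>\<^sup>+x. \<integral>\<^sup>+y. ennreal (?d x) * ennreal (?d y) * K x y \<partial>lborel \<partial>lborel)"
   by (intro nn_integral_cong, subst nn_integral_cmult[symmetric]) (auto simp: mult.assoc)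
  finally show ?thesis .
 qed
 have d: "ennreal (?d (c * x + s * y)) * ennreal (?d (- s * x + c * y)) = ennreal (?d x) * ennreal (?d y)" for x y
 proof -
  have "(c * x + s * y)\<^sup>2 + (- s * x + c * y)\<^sup>2 = (c\<^sup>2 + s\<^sup>2) * (x\<^sup>2 + y\<^sup>2)"
   by (simp add: algebra_simps power2_eq_square)
  then have e: "(c * x + s * y)\<^sup>2 + (- s * x + c * y)\<^sup>2 = x\<^sup>2 + y\<^sup>2" using cs by simp
  have p: "?d u * ?d v = 1 / (2 * pi) * exp (- (u\<^sup>2 + v\<^sup>2) / 2)" for u v
   by (simp add: std_normal_density_def field_simps exp_add[symmetric] add_divide_distrib
     real_sqrt_mult[symmetric])
  have "?d (c * x + s * y) * ?d (- s * x + c * y) = ?d x * ?d y"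
   unfolding p e ..
  then show ?thesis by (simp add: ennreal_mult[symmetric])
 qed
 have "(\<integral>\<^sup>+x. \<integral>\<^sup>+y. H (c * x + s * y) (- s * x + c * y) \<partial>gauss1 \<partial>gauss1) =
  (\<integral>\<^sup>+x. \<integral>\<^sup>+y. ennreal (?d x) * ennreal (?d y) * H (c * x + s * y) (- s * x + c * y) \<partial>lborel \<partial>lborel)"
  by (rule I) measurable
 also have "\<dots> = (\<integral>\<^sup>+x. \<integral>\<^sup>+y. ennreal (?d (c * x + s * y)) * ennreal (?d (- s * x + c * y)) * H (c * x + s * y) (- s * x + c * y) \<partial>lborel \<partial>lborel)"
  by (simp only: d)
 also have "\<dots> = (\<integral>\<^sup>+x. \<integral>\<^sup>+y. ennreal (?d x) * ennreal (?d y) * H x y \<partial>lborel \<partial>lborel)"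
  by (rule nn_integral_rotation[where H="\<lambda>x y. ennreal (?d x) * ennreal (?d y) * H x y", OF _ cs]) measurable
 also have "\<dots> = (\<integral>\<^sup>+x. \<integral>\<^sup>+y. H x y \<partial>gauss1 \<partial>gauss1)"
  by (rule I[symmetric]) measurable
 finally show ?thesis .
qed

definition gauss_preserving :: "nat \<Rightarrow> ((nat \<Rightarrow> real) \<Rightarrow> nat \<Rightarrow> real) \<Rightarrow> bool" where
 "gauss_preserving n T \<longleftrightarrow> T \<in> measurable (gauss n) (gauss n) \<and> distr (gauss n) (gauss n) T = gauss n"

lemma gauss_preserving_comp:
 assumes "gauss_preserving n S" "gauss_preserving n T" shows "gauss_preserving n (\<lambda>x. S (T x))"
proof -
 have "distr (gauss n) (gauss n) (S \<circ> T) = distr (distr (gauss n) (gauss n) T) (gauss n) S"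
  using assms by (intro distr_distr[symmetric]) (auto simp: gauss_preserving_def)
 with assms show ?thesis by (auto simp: gauss_preserving_def o_def)
qed

lemma gauss_preserving_cong:
 assumes "gauss_preserving n S" "\<And>x. x \<in> space (gauss n) \<Longrightarrow> S x = T x"
 shows "gauss_preserving n T"
proof -
 have "T \<in> measurable (gauss n) (gauss n)"
  using assms by (subst measurable_cong[of _ T S]) (auto simp: gauss_preserving_def)
 moreover have "distr (gauss n) (gauss n) T = distr (gauss n) (gauss n) S"
  by (rule distr_cong) (auto simp: assms(2))
 ultimately show ?thesis using assms by (auto simp: gauss_preserving_def)
qed

lemma gauss_preservingI:
 assumes "T \<in> measurable (gauss n) (gauss n)"
  and "\<And>f. f \<in> borel_measurable (gauss n) \<Longrightarrow> (\<integral>\<^sup>+x. f (T x) \<partial>gauss n) = (\<integral>\<^sup>+x. f x \<partial>gauss n)"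
 shows "gauss_preserving n T"
 unfolding gauss_preserving_def
proof
 show "distr (gauss n) (gauss n) T = gauss n"
 proof (rule measure_eqI)
  fix A assume A: "A \<in> sets (distr (gauss n) (gauss n) T)"
  then have "emeasure (distr (gauss n) (gauss n) T) A = (\<integral>\<^sup>+x. indicator A x \<partial>distr (gauss n) (gauss n) T)"
   by simp
  also have "\<dots> = (\<integral>\<^sup>+x. indicator A (T x) \<partial>gauss n)"
   using A assms(1) by (intro nn_integral_distr) auto
  also have "\<dots> = emeasure (gauss n) A"
   using A assms(2)[of "indicator A"] by simp
  finally show "emeasure (distr (gauss n) (gauss n) T) A = emeasure (gauss n) A" .
 qed simp
qed fact

lemma integral_gauss_preserving:
 fixes f :: "(nat \<Rightarrow> real) \<Rightarrow> real"
 assumes "gauss_preserving n T" "f \<in> borel_measurable (gauss n)"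
 shows "(\<integral>x. f (T x) \<partial>gauss n) = (\<integral>x. f x \<partial>gauss n)"
 using integral_distr[of T "gauss n" "gauss n" f] assms by (auto simp: gauss_preserving_def)

lemma integrable_gauss_preserving:
 fixes f :: "(nat \<Rightarrow> real) \<Rightarrow> real"
 assumes "gauss_preserving n T" "integrable (gauss n) f"
 shows "integrable (gauss n) (\<lambda>x. f (T x))"
 using integrable_distr[of T "gauss n" "gauss n" f] assms by (auto simp: gauss_preserving_def)

definition rot :: "nat \<Rightarrow> nat \<Rightarrow> real \<Rightarrow> real \<Rightarrow> (nat \<Rightarrow> real) \<Rightarrow> nat \<Rightarrow> real" where
 "rot i j c s x = x(i := c * x i + s * x j, j := - s * x i + c * x j)"

lemma measurable_gauss_gauss:
 assumes "\<And>i. i < n \<Longrightarrow> (\<lambda>x. T x i) \<in> borel_measurable (gauss n)"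
  and "\<And>x. x \<in> space (gauss n) \<Longrightarrow> T x \<in> extensional {..<n}"
 shows "T \<in> measurable (gauss n) (gauss n)"
 by (subst measurable_cong_sets[OF refl sets_gauss], rule measurable_PiM_single')
  (use assms in \<open>auto simp: PiE_def\<close>)

lemma gauss_preserving_rot:
 assumes ij: "i < n" "j < n" "i \<noteq> j" and cs: "c\<^sup>2 + s\<^sup>2 = 1" "0 \<le> c"
 shows "gauss_preserving n (rot i j c s)"
proof (rule gauss_preservingI)
 show T: "rot i j c s \<in> measurable (gauss n) (gauss n)"
 proof (rule measurable_gauss_gauss)
  fix k assume "k < n"
  with ij show "(\<lambda>x. rot i j c s x k) \<in> borel_measurable (gauss n)"
   using ij measurable_gauss_coord[of i n] measurable_gauss_coord[of j n] measurable_gauss_coord[of k n]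
   by (cases "k = i"; cases "k = j") (auto simp: rot_def)
 next
  fix x assume "x \<in> space (gauss n)"
  with ij show "rot i j c s x \<in> extensional {..<n}"
   by (auto simp: rot_def space_gauss PiE_def extensional_def)
 qed
 fix f :: "(nat \<Rightarrow> real) \<Rightarrow> ennreal" assume f: "f \<in> borel_measurable (gauss n)"
 interpret P: product_sigma_finite "\<lambda>_. gauss1" by (rule product_sigma_finite_gauss1)
 let ?I = "{..<n} - {i, j}" and ?M = "\<lambda>I. Pi\<^sub>M I (\<lambda>_::nat. gauss1)"
 have n: "{..<n} = insert i (insert j ?I)" using ij by auto
 have M: "gauss n = ?M (insert i (insert j ?I))" unfolding gauss_def n[symmetric] ..
 have split: "(\<integral>\<^sup>+x. h x \<partial>gauss n) = (\<integral>\<^sup>+z. \<integral>\<^sup>+a. \<integral>\<^sup>+b. h (z(j := a, i := b)) \<partial>gauss1 \<partial>gauss1 \<partial>?M ?I)"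
  if h: "h \<in> borel_measurable (gauss n)" for h :: "(nat \<Rightarrow> real) \<Rightarrow> ennreal"
 proof -
  have h': "h \<in> borel_measurable (?M (insert i (insert j ?I)))" using h unfolding M .
  have "(\<integral>\<^sup>+x. h x \<partial>gauss n) = (\<integral>\<^sup>+x. \<integral>\<^sup>+b. h (x(i := b)) \<partial>gauss1 \<partial>?M (insert j ?I))"
   unfolding M by (rule P.product_nn_integral_insert) (use ij h' in auto)
  also have "\<dots> = (\<integral>\<^sup>+z. \<integral>\<^sup>+a. \<integral>\<^sup>+b. h (z(j := a, i := b)) \<partial>gauss1 \<partial>gauss1 \<partial>?M ?I)"
  proof (rule P.product_nn_integral_insert)
   have "(\<lambda>(x, b). x(i := b)) \<in> measurable (?M (insert j ?I) \<Otimes>\<^sub>M gauss1) (?M (insert i (insert j ?I)))"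
    by (rule measurable_add_dim)
   then have [measurable]: "(\<lambda>(x, b). h (x(i := b))) \<in> borel_measurable (?M (insert j ?I) \<Otimes>\<^sub>M gauss1)"
    using measurable_compose[OF _ h', of "\<lambda>(x, b). x(i := b)"] by (simp add: case_prod_unfold)
   show "(\<lambda>x. \<integral>\<^sup>+b. h (x(i := b)) \<partial>gauss1) \<in> borel_measurable (?M (insert j ?I))"
    using sigma_finite_measure.borel_measurable_nn_integral[OF sigma_finite_gauss1, of "\<lambda>x b. h (x(i := b))"]
    by measurable
  qed (use ij in auto)
  finally show ?thesis .
 qed
 have fT: "(\<lambda>x. f (rot i j c s x)) \<in> borel_measurable (gauss n)"
  using measurable_compose[OF T f] .
 have "(\<integral>\<^sup>+a. \<integral>\<^sup>+b. f (rot i j c s (z(j := a, i := b))) \<partial>gauss1 \<partial>gauss1) =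
    (\<integral>\<^sup>+a. \<integral>\<^sup>+b. f (z(j := a, i := b)) \<partial>gauss1 \<partial>gauss1)" if z: "z \<in> space (?M ?I)" for z
 proof -
  have m1: "(\<lambda>(a, b). z(j := a, i := b)) \<in> measurable (borel \<Otimes>\<^sub>M borel) (gauss n)"
  proof (subst measurable_cong_sets[OF refl sets_gauss], rule measurable_PiM_single')
   fix k assume "k \<in> {..<n}"
   show "(\<lambda>x. (case x of (a, b) \<Rightarrow> z(j := a, i := b)) k) \<in> borel_measurable (borel \<Otimes>\<^sub>M borel)"
    by (cases "k = i"; cases "k = j") (auto simp: case_prod_unfold)
  qed (use z ij in \<open>auto simp: space_PiM PiE_def extensional_def\<close>)
  have m2: "(\<lambda>(a, b). f (z(j := a, i := b))) \<in> borel_measurable (borel \<Otimes>\<^sub>M borel)"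
   using measurable_compose[OF m1 f] by (simp add: case_prod_unfold)
  have "(\<integral>\<^sup>+a. \<integral>\<^sup>+b. f (rot i j c s (z(j := a, i := b))) \<partial>gauss1 \<partial>gauss1) =
   (\<integral>\<^sup>+a. \<integral>\<^sup>+b. (\<lambda>a b. f (z(j := a, i := b))) (c * a + (- s) * b) (- (- s) * a + c * b) \<partial>gauss1 \<partial>gauss1)"
   using ij by (intro nn_integral_cong) (auto simp: rot_def fun_upd_def add.commute intro!: arg_cong[of _ _ f])
  also have "\<dots> = (\<integral>\<^sup>+a. \<integral>\<^sup>+b. f (z(j := a, i := b)) \<partial>gauss1 \<partial>gauss1)"
   by (rule nn_integral_rotation_gauss[OF m2]) (use cs in auto)
  finally show ?thesis .
 qed
 then show "(\<integral>\<^sup>+x. f (rot i j c s x) \<partial>gauss n) = (\<integral>\<^sup>+x. f x \<partial>gauss n)"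
  unfolding split[OF f] split[OF fT] by (rule nn_integral_cong)
qed

text \<open>The reflection in \<open>f\<close>, restricted because the product space consists of extensional functions.\<close>
definition householder :: "nat \<Rightarrow> (nat \<Rightarrow> real) \<Rightarrow> (nat \<Rightarrow> real) \<Rightarrow> nat \<Rightarrow> real" where
 "householder n f x = (\<lambda>i\<in>{..<n}. x i - 2 * ip n x f * f i)"

lemma measurable_gauss_ip: "(\<lambda>g. ip n g y) \<in> borel_measurable (gauss n)"
 unfolding ip_def by (intro borel_measurable_sum borel_measurable_times borel_measurable_const measurable_gauss_coord) auto

lemma nn_integral_gauss1_uminus:
 assumes [measurable]: "f \<in> borel_measurable borel"
 shows "(\<integral>\<^sup>+x. f (- x) \<partial>gauss1) = (\<integral>\<^sup>+x. f x \<partial>gauss1)"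
proof -
 have "(\<integral>\<^sup>+x. f x \<partial>gauss1) = (\<integral>\<^sup>+x. ennreal (std_normal_density x) * f x \<partial>lborel)"
  by (rule nn_integral_density) measurable
 also have "\<dots> = (\<integral>\<^sup>+x. ennreal (std_normal_density (0 + -1 * x)) * f (0 + -1 * x) \<partial>lborel)"
  by (subst nn_integral_real_affine[where c="-1" and t=0]) auto
 also have "\<dots> = (\<integral>\<^sup>+x. ennreal (std_normal_density x) * f (- x) \<partial>lborel)"
  by (simp add: std_normal_density_def)
 also have "\<dots> = (\<integral>\<^sup>+x. f (- x) \<partial>gauss1)"
  by (rule nn_integral_density[symmetric]) measurable
 finally show ?thesis ..
qed

lemma gauss_preserving_flip:
 assumes i: "i < n" shows "gauss_preserving n (\<lambda>x. x(i := - x i))"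
proof (rule gauss_preservingI)
 show T: "(\<lambda>x. x(i := - x i)) \<in> measurable (gauss n) (gauss n)"
 proof (rule measurable_gauss_gauss)
  fix k assume "k < n"
  then show "(\<lambda>x. (x(i := - x i)) k) \<in> borel_measurable (gauss n)"
   using measurable_gauss_coord[of i n] measurable_gauss_coord[of k n] i by (cases "k = i") auto
 qed (use i in \<open>auto simp: space_gauss PiE_def extensional_def\<close>)
 fix f :: "(nat \<Rightarrow> real) \<Rightarrow> ennreal" assume f: "f \<in> borel_measurable (gauss n)"
 interpret P: product_sigma_finite "\<lambda>_. gauss1" by (rule product_sigma_finite_gauss1)
 let ?I = "{..<n} - {i}" and ?M = "\<lambda>I. Pi\<^sub>M I (\<lambda>_::nat. gauss1)"
 have M: "gauss n = ?M (insert i ?I)" unfolding gauss_def insert_Diff_single using i by (simp add: insert_absorb)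
 have split: "(\<integral>\<^sup>+x. h x \<partial>gauss n) = (\<integral>\<^sup>+z. \<integral>\<^sup>+b. h (z(i := b)) \<partial>gauss1 \<partial>?M ?I)"
  if h: "h \<in> borel_measurable (gauss n)" for h :: "(nat \<Rightarrow> real) \<Rightarrow> ennreal"
  unfolding M by (rule P.product_nn_integral_insert) (use h M in auto)
 have fT: "(\<lambda>x. f (x(i := - x i))) \<in> borel_measurable (gauss n)"
  using measurable_compose[OF T f] .
 have "(\<integral>\<^sup>+b. f ((z(i := b))(i := - (z(i := b)) i)) \<partial>gauss1) = (\<integral>\<^sup>+b. f (z(i := b)) \<partial>gauss1)"
  if z: "z \<in> space (?M ?I)" for z
 proof -
  have m1: "(\<lambda>b. z(i := b)) \<in> measurable borel (gauss n)"
  proof (subst measurable_cong_sets[OF refl sets_gauss], rule measurable_PiM_single')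
   fix k assume "k \<in> {..<n}"
   show "(\<lambda>b. (z(i := b)) k) \<in> borel_measurable borel" by (cases "k = i") auto
  qed (use z i in \<open>auto simp: space_PiM PiE_def extensional_def\<close>)
  show ?thesis
   using nn_integral_gauss1_uminus[OF measurable_compose[OF m1 f]] by simp
 qed
 then show "(\<integral>\<^sup>+x. f (x(i := - x i)) \<partial>gauss n) = (\<integral>\<^sup>+x. f x \<partial>gauss n)"
  unfolding split[OF f] split[OF fT] by (rule nn_integral_cong)
qed

lemma ip_rot:
 assumes ij: "i < n" "j < n" "i \<noteq> j" and cs: "c\<^sup>2 + s\<^sup>2 = 1"
 shows "ip n (rot i j c s x) (rot i j c s y) = ip n x y"
proof -
 have n: "{..<n} = insert i (insert j ({..<n} - {i, j}))" using ij by auto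
 have "ip n (rot i j c s x) (rot i j c s y) = (c * x i + s * x j) * (c * y i + s * y j) +
  ((- s * x i + c * x j) * (- s * y i + c * y j) + (\<Sum>k\<in>{..<n} - {i, j}. x k * y k))"
  unfolding ip_def by (subst n) (use ij in \<open>auto simp: rot_def intro!: sum.cong\<close>)
 also have "(c * x i + s * x j) * (c * y i + s * y j) +
  ((- s * x i + c * x j) * (- s * y i + c * y j) + (\<Sum>k\<in>{..<n} - {i, j}. x k * y k))
  = (c\<^sup>2 + s\<^sup>2) * (x i * y i + x j * y j) + (\<Sum>k\<in>{..<n} - {i, j}. x k * y k)"
  by (simp add: algebra_simps power2_eq_square)
 also have "\<dots> = ip n x y"
  unfolding ip_def cs by (subst (2) n) (use ij in auto)
 finally show ?thesis .
qed

lemma rot_rot: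
 assumes "i \<noteq> j" "c\<^sup>2 + s\<^sup>2 = 1" shows "rot i j c (- s) (rot i j c s x) = x"
proof -
 have "c * (c * x i + s * x j) - s * (- s * x i + c * x j) = (c\<^sup>2 + s\<^sup>2) * x i"
  "s * (c * x i + s * x j) + c * (- s * x i + c * x j) = (c\<^sup>2 + s\<^sup>2) * x j"
  by (simp_all add: algebra_simps power2_eq_square)
 then show ?thesis using assms by (auto simp: rot_def fun_eq_iff)
qed

text \<open>Conjugating by a plane rotation that annihilates the last coordinate of \<open>f\<close> reduces the
 reflection in \<open>f\<close> to the change of sign of one coordinate.\<close>
lemma gauss_preserving_householder:
 assumes "nrm n f = 1" shows "gauss_preserving n (householder n f)"
proof -
 have main: "gauss_preserving n (householder n f)"
  if "k < n" "nrm n f = 1" "\<And>i. k < i \<Longrightarrow> i < n \<Longrightarrow> f i = 0" for k f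
  using that
 proof (induction k arbitrary: f)
  case 0
  have n: "{..<n} = insert 0 {1..<n}" using 0 by auto
  have ip0: "ip n x f = x 0 * f 0" for x
   unfolding ip_def by (subst n) (use 0 in \<open>auto intro!: sum.neutral\<close>)
  have "f 0 * f 0 = 1" using 0(2) nrm_sq[of n f] ip0[of f] by simp
  then have f0: "x 0 * f 0 * f 0 = x 0" for x :: "nat \<Rightarrow> real" by (simp add: mult.assoc)
  have "(x(0 := - x 0)) i = householder n f x i" if "x \<in> space (gauss n)" for x i
   using that 0(3)[of i] \<open>0 < n\<close> f0[of x]
   by (cases "i = 0"; cases "i < n") (auto simp: householder_def ip0 space_gauss PiE_def extensional_def)
  then have "x(0 := - x 0) = householder n f x" if "x \<in> space (gauss n)" for x
   using that by blast
  then show ?case by (rule gauss_preserving_cong[OF gauss_preserving_flip[OF \<open>0 < n\<close>]])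
 next
  case (Suc k)
  let ?l = "Suc k"
  show ?case
  proof (cases "f ?l = 0")
   case True
   have "f i = 0" if "k < i" "i < n" for i
    using True Suc.prems(3)[of i] that by (cases "i = ?l") auto
   then show ?thesis using Suc.prems by (intro Suc.IH) auto
  next
   case False
   define r where "r = sqrt ((f 0)\<^sup>2 + (f ?l)\<^sup>2)"
   have r: "r > 0" "r\<^sup>2 = (f 0)\<^sup>2 + (f ?l)\<^sup>2" using False by (auto simp: r_def intro!: add_nonneg_pos)
   define \<sigma> where "\<sigma> = (if f 0 \<ge> 0 then 1 else -1 :: real)"
   define c s where "c = \<sigma> * f 0 / r" and "s = \<sigma> * f ?l / r"
   have \<sigma>: "\<sigma> * \<sigma> = 1" by (auto simp: \<sigma>_def)
   have "c\<^sup>2 + s\<^sup>2 = (\<sigma> * \<sigma>) * ((f 0)\<^sup>2 + (f ?l)\<^sup>2) / r\<^sup>2"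
    by (simp add: c_def s_def power2_eq_square add_divide_distrib algebra_simps)
   then have "c\<^sup>2 + s\<^sup>2 = r\<^sup>2 / r\<^sup>2" by (simp only: \<sigma> r(2) mult_1)
   then have cs: "c\<^sup>2 + s\<^sup>2 = 1" using r(1) by simp
   have c0: "0 \<le> c" using r by (auto simp: c_def \<sigma>_def)
   have cs': "c\<^sup>2 + (- s)\<^sup>2 = 1" using cs by simp
   have l: "0 < n" "?l < n" "0 \<noteq> ?l" using Suc.prems by auto
   let ?G = "rot 0 ?l c s" and ?G' = "rot 0 ?l c (- s)"
   have nrmG: "nrm n (?G f) = 1" using Suc.prems(2) ip_rot[OF l cs, of f f] by (simp add: nrm_def)
   have "gauss_preserving n (householder n (?G f))"
   proof (rule Suc.IH)
    fix i assume "k < i" "i < n"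
    then show "?G f i = 0"
  by (simp add: r Suc.prems(3)[of i] rot_def c_def s_def)
   qed (use Suc.prems nrmG in auto)
   then have P: "gauss_preserving n (\<lambda>x. ?G' (householder n (?G f) (?G x)))"
    by (rule gauss_preserving_comp[OF gauss_preserving_rot[OF l cs' c0]
       gauss_preserving_comp[OF _ gauss_preserving_rot[OF l cs c0]]])
   show ?thesis
   proof (rule gauss_preserving_cong[OF P])
    fix x assume x: "x \<in> space (gauss n)"
    define a where "a = 2 * ip n x f"
    have h: "householder n (?G f) (?G x) i = (if i < n then ?G (\<lambda>i. x i - a * f i) i else undefined)" for i
     using ip_rot[OF l cs, of x f] l by (auto simp: householder_def rot_def a_def algebra_simps)
    have "?G' (householder n (?G f) (?G x)) i = householder n f x i" for i
    proof (cases "i < n")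
     case True
     have "?G' (householder n (?G f) (?G x)) i = ?G' (?G (\<lambda>i. x i - a * f i)) i"
      using True l by (auto simp: rot_def[of 0 ?l c "- s"] h)
     then show ?thesis
  by (simp add: True rot_rot[OF l(3) cs] householder_def a_def)
    next
     case False
     then show ?thesis using l by (auto simp: rot_def[of 0 ?l c "- s"] h householder_def)
    qed
    then show "?G' (householder n (?G f) (?G x)) = householder n f x" by auto
   qed
  qed
 qed
 have "n \<noteq> 0" using assms by (intro notI) (simp add: nrm_def ip_def)
 then show ?thesis using main[of "n - 1" f] assms by auto
qed

text \<open>Linear functionals of a Gaussian vector, by induction on the dimension: a rotation of the plane
 merges the last coordinate with the functional of the first \<open>n\<close> ones.\<close>
lemma nn_integral_gauss_ip:
 "f \<in> borel_measurable borel \<Longrightarrow> (\<integral>\<^sup>+g. f (ip n g y) \<partial>gauss n) = (\<integral>\<^sup>+t. f (nrm n y * t) \<partial>gauss1)"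
proof (induction n arbitrary: f)
 case 0
 show ?case
  using prob_space.emeasure_space_1[OF prob_space_gauss[of 0]] prob_space.emeasure_space_1[OF prob_space_gauss1]
  by (simp add: ip_def nrm_def)
next
 case (Suc n)
 note [measurable] = Suc.prems
 have f': "(\<lambda>s. \<integral>\<^sup>+t. f (s + t * y n) \<partial>gauss1) \<in> borel_measurable borel"
  using sigma_finite_measure.borel_measurable_nn_integral[OF sigma_finite_gauss1, of "\<lambda>s t. f (s + t * y n)" borel] by measurable
 let ?r = "nrm (Suc n) y"
 have "ip (Suc n) (x(n := t)) y = ip n x y + t * y n" for x t by (simp add: ip_def)
 then have "(\<integral>\<^sup>+g. f (ip (Suc n) g y) \<partial>gauss (Suc n)) = (\<integral>\<^sup>+x. \<integral>\<^sup>+t. f (ip n x y + t * y n) \<partial>gauss1 \<partial>gauss n)"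
  using measurable_compose[OF measurable_gauss_ip Suc.prems] by (subst nn_integral_gauss_Suc) auto
 also have "\<dots> = (\<integral>\<^sup>+s. \<integral>\<^sup>+t. f (nrm n y * s + t * y n) \<partial>gauss1 \<partial>gauss1)" by (rule Suc.IH[OF f'])
 also have "\<dots> = (\<integral>\<^sup>+t. f (?r * t) \<partial>gauss1)"
 proof (cases "?r = 0")
  case True
  then have "nrm n y = 0" "y n = 0" by (auto simp: nrm_eq_0_iff)
  then show ?thesis using True prob_space.emeasure_space_1[OF prob_space_gauss1] by simp
 next
  case False
  have sq: "?r\<^sup>2 = (nrm n y)\<^sup>2 + (y n)\<^sup>2" unfolding nrm_sq by (simp add: ip_def power2_eq_square)
  have "(nrm n y / ?r)\<^sup>2 + (y n / ?r)\<^sup>2 = 1"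
   unfolding power_divide add_divide_distrib[symmetric] sq[symmetric] using False by simp
  from nn_integral_rotation_gauss[of "\<lambda>s t. f (?r * s)", OF _ this] show ?thesis
   using False prob_space.emeasure_space_1[OF prob_space_gauss1] by (simp add: distrib_left mult.commute)
 qed
 finally show ?case .
qed

lemma distr_gauss_ip: "distr (gauss n) borel (\<lambda>g. ip n g y) = distr gauss1 borel (\<lambda>t. nrm n y * t)"
proof (rule measure_eqI)
 fix A assume "A \<in> sets (distr (gauss n) borel (\<lambda>g. ip n g y))"
 then have "indicator A \<in> borel_measurable borel" "A \<in> sets borel" by auto
 with nn_integral_gauss_ip[of "indicator A" n y]
 show "emeasure (distr (gauss n) borel (\<lambda>g. ip n g y)) A = emeasure (distr gauss1 borel (\<lambda>t. nrm n y * t)) A"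
  using measurable_gauss_ip by (simp add: nn_integral_distr flip: nn_integral_indicator)
qed simp

lemma integral_gauss_ip:
 fixes F :: "real \<Rightarrow> real"
 assumes [measurable]: "F \<in> borel_measurable borel"
 shows "(\<integral>g. F (ip n g y) \<partial>gauss n) = (\<integral>t. F (nrm n y * t) \<partial>gauss1)"
proof -
 have "(\<integral>g. F (ip n g y) \<partial>gauss n) = (\<integral>t. F t \<partial>distr (gauss n) borel (\<lambda>g. ip n g y))"
  by (rule integral_distr[symmetric]) (use measurable_gauss_ip in auto)
 also have "\<dots> = (\<integral>t. F (nrm n y * t) \<partial>gauss1)"
  unfolding distr_gauss_ip by (rule integral_distr) auto
 finally show ?thesis .
qed

lemma integrable_gauss_ip:
 fixes F :: "real \<Rightarrow> real"
 assumes [measurable]: "F \<in> borel_measurable borel"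
 shows "integrable (gauss n) (\<lambda>g. F (ip n g y)) \<longleftrightarrow> integrable gauss1 (\<lambda>t. F (nrm n y * t))"
proof -
 have "integrable (gauss n) (\<lambda>g. F (ip n g y)) \<longleftrightarrow> integrable (distr (gauss n) borel (\<lambda>g. ip n g y)) F"
  by (rule integrable_distr_eq[symmetric]) (use measurable_gauss_ip in auto)
 also have "\<dots> \<longleftrightarrow> integrable gauss1 (\<lambda>t. F (nrm n y * t))"
  unfolding distr_gauss_ip by (rule integrable_distr_eq) auto
 finally show ?thesis .
qed

lemma gauss1_moments:
 shows integrable_gauss1_id: "integrable gauss1 (\<lambda>t. t)"
  and integral_gauss1_id: "(\<integral>t. t \<partial>gauss1) = 0"
  and integrable_gauss1_sq: "integrable gauss1 (\<lambda>t. t\<^sup>2)"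
  and integral_gauss1_sq: "(\<integral>t. t\<^sup>2 \<partial>gauss1) = 1"
  and integral_gauss1_abs: "(\<integral>t. \<bar>t\<bar> \<partial>gauss1) = sqrt (2 / pi)"
proof -
 show "integrable gauss1 (\<lambda>t. t)" using integrable_std_normal_moment[of 1]
  by (subst integrable_density) auto
 show "(\<integral>t. t \<partial>gauss1) = 0" using integral_std_normal_moment_odd[of 0]
  by (subst integral_density) auto
 show "integrable gauss1 (\<lambda>t. t\<^sup>2)" using integrable_std_normal_moment[of 2]
  by (subst integrable_density) auto
 show "(\<integral>t. t\<^sup>2 \<partial>gauss1) = 1" using integral_std_normal_moment_even[of 1]
  by (subst integral_density) auto
 show "(\<integral>t. \<bar>t\<bar> \<partial>gauss1) = sqrt (2 / pi)" using integral_std_normal_moment_abs_odd[of 0]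
  by (subst integral_density) auto
qed

lemma integrable_gauss_ip_sq: "integrable (gauss n) (\<lambda>g. (ip n g y)\<^sup>2)"
 using integrable_gauss_ip[of "\<lambda>t. t\<^sup>2" n y] integrable_gauss1_sq
 by (simp add: power_mult_distrib)

lemma integral_gauss_ip_sq: "(\<integral>g. (ip n g y)\<^sup>2 \<partial>gauss n) = ip n y y"
 using integral_gauss_ip[of "\<lambda>t. t\<^sup>2" n y] integral_gauss1_sq
 by (simp add: power_mult_distrib nrm_sq)

lemma integrable_gauss_ip_mult: "integrable (gauss n) (\<lambda>g. ip n g y * ip n g z)"
proof -
 have *: "(\<lambda>g. ip n g y * ip n g z) = (\<lambda>g. ((ip n g (\<lambda>i. y i + z i))\<^sup>2 - (ip n g y)\<^sup>2 - (ip n g z)\<^sup>2) / 2)"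
  by (simp add: ip_add_right power2_eq_square algebra_simps fun_eq_iff)
 show ?thesis unfolding * by (intro integrable_divide Bochner_Integration.integrable_diff integrable_gauss_ip_sq)
qed

lemma integral_gauss_ip_mult: "(\<integral>g. ip n g y * ip n g z \<partial>gauss n) = ip n y z"
proof -
 have *: "(\<lambda>g. ip n g y * ip n g z) = (\<lambda>g. ((ip n g (\<lambda>i. y i + z i))\<^sup>2 - (ip n g y)\<^sup>2 - (ip n g z)\<^sup>2) / 2)"
  by (simp add: ip_add_right power2_eq_square algebra_simps fun_eq_iff)
 have "(\<integral>g. ip n g y * ip n g z \<partial>gauss n) =
  (ip n (\<lambda>i. y i + z i) (\<lambda>i. y i + z i) - ip n y y - ip n z z) / 2"
  unfolding * by (simp add: integrable_gauss_ip_sq integral_gauss_ip_sq)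
 then show ?thesis by (simp add: ip_add_right ip_add_left ip_commute[of n z y])
qed

text \<open>Elements of the product space are undefined from the coordinate \<open>n\<close> on. Replacing those values by
 \<open>0\<close> makes the inclusion into the space of all sequences measurable, on which a seminorm is
 continuous, being Lipschitz in finitely many coordinates.\<close>

definition pad :: "nat \<Rightarrow> (nat \<Rightarrow> real) \<Rightarrow> nat \<Rightarrow> real" where
 "pad n g i = (if i < n then g i else 0)"

lemma continuous_on_ip_self: "continuous_on UNIV (\<lambda>x::nat \<Rightarrow> real. ip n (\<lambda>i. x i - y i) (\<lambda>i. x i - y i))"
 unfolding ip_def
 by (intro continuous_intros continuous_on_product_coordinates)

lemma continuous_on_seminorm:
 assumes "seminorm n q" shows "continuous_on UNIV q"
proof -
 obtain B where B: "B \<ge> 0" "\<And>x. q x \<le> B * nrm n x" using seminorm_bounded[OF assms] by blast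
 show ?thesis
  unfolding continuous_on_def
 proof
  fix y
  have "((\<lambda>x. B * nrm n (\<lambda>i. x i - y i)) \<longlongrightarrow> B * nrm n (\<lambda>i. y i - y i)) (at y)"
   unfolding nrm_def
   by (intro tendsto_intros) (use continuous_on_ip_self[of n y] in \<open>simp only: continuous_on_def, blast\<close>)
  then have "((\<lambda>x. B * nrm n (\<lambda>i. x i - y i)) \<longlongrightarrow> 0) (at y)" by (simp add: nrm_def ip_def)
  then have "((\<lambda>x. q x - q y) \<longlongrightarrow> 0) (at y)"
   by (rule Lim_null_comparison[rotated])
    (use seminorm_abs_diff_le[OF assms] B(2) in \<open>auto intro!: always_eventually order.trans[OF seminorm_abs_diff_le[OF assms]]\<close>)
  then show "(q \<longlongrightarrow> q y) (at y)" using Lim_null[of q "q y" "at y"] by simp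
 qed
qed

lemma measurable_gauss_seminorm:
 assumes "seminorm n q" shows "q \<in> borel_measurable (gauss n)"
proof -
 have 1: "q \<in> borel_measurable (Pi\<^sub>M UNIV (\<lambda>_. borel))"
  using borel_measurable_continuous_onI[OF continuous_on_seminorm[OF assms]]
  by (subst measurable_cong_sets[OF sets_PiM_equal_borel refl])
 have 2: "pad n \<in> measurable (gauss n) (Pi\<^sub>M UNIV (\<lambda>_. borel))"
 proof (rule measurable_PiM_single')
  fix i
  show "(\<lambda>g. pad n g i) \<in> borel_measurable (gauss n)"
   using measurable_gauss_coord[of i n] by (cases "i < n") (auto simp: pad_def)
 qed auto
 have "q (pad n g) = q g" for g by (rule seminorm_cong[OF assms]) (simp add: pad_def)
 with measurable_compose[OF 2 1] show ?thesis by simp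
qed

lemma integrable_gauss_nrm_sq: "integrable (gauss n) (\<lambda>g. ip n g g)"
 unfolding ip_def
proof (rule Bochner_Integration.integrable_sum)
 fix i assume i: "i \<in> {..<n}"
 let ?e = "\<lambda>j. if j = i then 1 else (0::real)"
 have "ip n g ?e = g i" for g
  using i by (simp add: ip_def if_distrib[of "\<lambda>c. _ * c"] cong: if_cong)
 then show "integrable (gauss n) (\<lambda>g. g i * g i)"
  using integrable_gauss_ip_sq[of n ?e] by (simp add: power2_eq_square)
qed

lemma integral_gauss_nrm_sq: "(\<integral>g. ip n g g \<partial>gauss n) = real n"
proof -
 have "integrable (gauss n) (\<lambda>g. g i * g i) \<and> (\<integral>g. g i * g i \<partial>gauss n) = 1" if i: "i < n" for i
 proof -
  let ?e = "\<lambda>j. if j = i then 1 else (0::real)"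
  have e: "ip n g ?e = g i" for g
   using i by (simp add: ip_def if_distrib[of "\<lambda>c. _ * c"] cong: if_cong)
  show ?thesis
   using integrable_gauss_ip_sq[of n ?e] integral_gauss_ip_sq[of n ?e] by (simp add: power2_eq_square e)
 qed
 then show ?thesis unfolding ip_def by simp
qed

lemma integrable_gauss_seminorm_sq:
 assumes "seminorm n q" shows "integrable (gauss n) (\<lambda>g. (q g)\<^sup>2)"
proof -
 obtain B where B: "B \<ge> 0" "\<And>x. q x \<le> B * nrm n x" using seminorm_bounded[OF assms] by blast
 show ?thesis
 proof (rule Bochner_Integration.integrable_bound)
  show "integrable (gauss n) (\<lambda>g. B\<^sup>2 * ip n g g)" using integrable_gauss_nrm_sq by simp
  show "(\<lambda>g. (q g)\<^sup>2) \<in> borel_measurable (gauss n)" using measurable_gauss_seminorm[OF assms] by measurable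
  have "(q g)\<^sup>2 \<le> B\<^sup>2 * ip n g g" for g
   using power_mono[OF B(2) seminorm_nonneg[OF assms], of g 2] by (simp add: power_mult_distrib nrm_sq)
  then show "AE g in gauss n. norm ((q g)\<^sup>2) \<le> norm (B\<^sup>2 * ip n g g)" by auto
 qed
qed

text \<open>The \<open>\<ell>\<close>-norm of the identity, as a map from \<open>\<real>\<^sup>n\<close> into the space normed by \<open>q\<close>; that of a map \<open>U\<close> is
 obtained from the seminorm \<open>\<lambda>x. q (lin n U x)\<close>.\<close>
definition ell :: "nat \<Rightarrow> ((nat \<Rightarrow> real) \<Rightarrow> real) \<Rightarrow> real" where
 "ell n q = sqrt (\<integral>g. (q g)\<^sup>2 \<partial>gauss n)"

lemma ell_sq: "(ell n q)\<^sup>2 = (\<integral>g. (q g)\<^sup>2 \<partial>gauss n)"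
 by (simp add: ell_def)

lemma ell_nonneg: "0 \<le> ell n q"
 by (simp add: ell_def)

text \<open>\<open>x - \<langle>x, f\<rangle> f\<close> is the mean of \<open>x\<close> and its reflection in \<open>f\<close>, which has the same law.\<close>
lemma ell_sq_remove_direction:
 assumes q: "seminorm n q" and f: "nrm n f = 1"
 shows "(\<integral>x. (q (\<lambda>i. x i - ip n x f * f i))\<^sup>2 \<partial>gauss n) \<le> (\<integral>x. (q x)\<^sup>2 \<partial>gauss n)"
proof -
 let ?R = "householder n f"
 have P: "gauss_preserving n ?R" by (rule gauss_preserving_householder[OF f])
 have I: "integrable (gauss n) (\<lambda>x. (q x)\<^sup>2)" by (rule integrable_gauss_seminorm_sq[OF q])
 have I': "integrable (gauss n) (\<lambda>x. (q (?R x))\<^sup>2)"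
  using integrable_gauss_preserving[OF P I] .
 have E: "(\<integral>x. (q (?R x))\<^sup>2 \<partial>gauss n) = (\<integral>x. (q x)\<^sup>2 \<partial>gauss n)"
  by (rule integral_gauss_preserving[OF P]) (use measurable_gauss_seminorm[OF q] in measurable)
 have q': "seminorm n (\<lambda>x. q (\<lambda>i. x i - ip n x f * f i))"
  unfolding seminorm_def
 proof (intro conjI allI impI)
  fix x y :: "nat \<Rightarrow> real" assume "\<forall>i<n. x i = y i"
  then show "q (\<lambda>i. x i - ip n x f * f i) = q (\<lambda>i. y i - ip n y f * f i)"
   by (intro seminorm_cong[OF q]) (auto simp: ip_cong[of n x y f f])
 next
  fix x y :: "nat \<Rightarrow> real"
  show "q (\<lambda>i. (x i + y i) - ip n (\<lambda>i. x i + y i) f * f i) \<le>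
   q (\<lambda>i. x i - ip n x f * f i) + q (\<lambda>i. y i - ip n y f * f i)"
   using seminorm_triangle[OF q, of "\<lambda>i. x i - ip n x f * f i" "\<lambda>i. y i - ip n y f * f i"]
   by (simp add: ip_add_left algebra_simps)
 next
  fix c :: real and x
  show "q (\<lambda>i. c * x i - ip n (\<lambda>i. c * x i) f * f i) = \<bar>c\<bar> * q (\<lambda>i. x i - ip n x f * f i)"
   using seminorm_scale[OF q, of c "\<lambda>i. x i - ip n x f * f i"]
   by (simp add: ip_scale_left algebra_simps)
 qed
 have le: "(q (\<lambda>i. x i - ip n x f * f i))\<^sup>2 \<le> ((q x)\<^sup>2 + (q (?R x))\<^sup>2) / 2" for x
 proof -
  have "q (\<lambda>i. x i - ip n x f * f i) = q (\<lambda>i. (1/2) * (x i + ?R x i))"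
   by (rule seminorm_cong[OF q]) (simp add: householder_def)
  also have "\<dots> = (1/2) * q (\<lambda>i. x i + ?R x i)" by (simp only: seminorm_scale[OF q])
  also have "\<dots> \<le> (1/2) * (q x + q (?R x))" using seminorm_triangle[OF q, of x "?R x"] by simp
  finally have a: "q (\<lambda>i. x i - ip n x f * f i) \<le> (1/2) * (q x + q (?R x))" .
  have "(q (\<lambda>i. x i - ip n x f * f i))\<^sup>2 \<le> ((1/2) * (q x + q (?R x)))\<^sup>2"
   by (rule power_mono[OF a seminorm_nonneg[OF q]])
  also have "\<dots> \<le> ((q x)\<^sup>2 + (q (?R x))\<^sup>2) / 2"
   using sum_squares_bound[of "q x" "q (?R x)"] by (simp add: power2_eq_square algebra_simps)
  finally show ?thesis .
 qed
 have "(\<integral>x. (q (\<lambda>i. x i - ip n x f * f i))\<^sup>2 \<partial>gauss n) \<le> (\<integral>x. ((q x)\<^sup>2 + (q (?R x))\<^sup>2) / 2 \<partial>gauss n)"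
  by (rule integral_mono[OF integrable_gauss_seminorm_sq[OF q'] _ le]) (use I I' in auto)
 also have "\<dots> = (\<integral>x. (q x)\<^sup>2 \<partial>gauss n)" using I I' E by simp
 finally show ?thesis .
qed

text \<open>Averaging over reflections shows that the Gaussian second moment of a seminorm decreases
 under orthogonal projections.\<close>
lemma ell_sq_projection:
 assumes q: "seminorm n q" and f: "orthonormal n s f"
 shows "(\<integral>x. (q (lin s f (\<lambda>j. ip n x (f j))))\<^sup>2 \<partial>gauss n) \<le> (\<integral>x. (q x)\<^sup>2 \<partial>gauss n)"
proof -
 have sn: "s \<le> n" by (rule orthonormal_le[OF f])
 obtain g where g: "orthonormal n n g" "\<forall>i<s. g i = f i"
  using orthonormal_extend[OF f sn order_refl] by blast
 define P where "P t x = lin t g (\<lambda>j. ip n x (g j))" for t x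
 have P_add: "P t (\<lambda>i. x i + y i) = (\<lambda>i. P t x i + P t y i)" for t x y
  by (simp add: P_def ip_add_left lin_add)
 have P_scale: "P t (\<lambda>i. c * x i) = (\<lambda>i. c * P t x i)" for t c x
  by (simp add: P_def ip_scale_left lin_scale)
 have sP: "seminorm n (\<lambda>x. q (P t x))" for t
  unfolding seminorm_def
 proof (intro conjI allI impI)
  fix x y :: "nat \<Rightarrow> real" assume "\<forall>i<n. x i = y i"
  then show "q (P t x) = q (P t y)"
  by (simp add: P_def ip_cong[of n x y])
 qed (simp_all add: P_add P_scale seminorm_triangle[OF q] seminorm_scale[OF q])
 have "(\<integral>x. (q (P t x))\<^sup>2 \<partial>gauss n) \<le> (\<integral>x. (q x)\<^sup>2 \<partial>gauss n)" if "t \<le> n" for t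
  using that
 proof (induction t rule: inc_induct)
  case base
  have "q (P n x) = q x" for x
   by (rule seminorm_cong[OF q]) (simp add: P_def lin_def orthonormal_expansion[OF g(1), of _ x])
  then show ?case by simp
 next
  case (step t)
  have "P t x = P (Suc t) (\<lambda>i. x i - ip n x (g t) * g t i)" for x
  proof -
   have "ip n (\<lambda>i. x i - ip n x (g t) * g t i) (g j) = (if j = t then 0 else ip n x (g j))" if "j < Suc t" for j
    using orthonormalD[OF g(1), of t j] that step by (simp add: ip_diff_left ip_scale_left)
   then show ?thesis by (auto simp: P_def lin_def intro!: sum.cong)
  qed
  then have "(\<integral>x. (q (P t x))\<^sup>2 \<partial>gauss n) = (\<integral>x. (q (P (Suc t) (\<lambda>i. x i - ip n x (g t) * g t i)))\<^sup>2 \<partial>gauss n)"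
   by simp
  also have "\<dots> \<le> (\<integral>x. (q (P (Suc t) x))\<^sup>2 \<partial>gauss n)"
   by (rule ell_sq_remove_direction[OF sP orthonormal_nrm[OF g(1)]]) (use step in auto)
  finally show ?case using step.IH by simp
 qed
 from this[OF sn] show ?thesis
  using g(2) by (simp add: P_def lin_def)
qed

section \<open>Gelfand numbers\<close>

text \<open>\<open>gel n q j c\<close> says that \<open>q\<close> is bounded by \<open>c\<close> times the Euclidean norm on some subspace of
 codimension at most \<open>j\<close>.\<close>
definition gel :: "nat \<Rightarrow> ((nat \<Rightarrow> real) \<Rightarrow> real) \<Rightarrow> nat \<Rightarrow> real \<Rightarrow> bool" where
 "gel n q j c \<longleftrightarrow> (\<exists>r. \<forall>x. (\<forall>i<j. ip n (r i) x = 0) \<longrightarrow> q x \<le> c * nrm n x)"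

lemma gel_mono:
 assumes "gel n q j c" "c \<le> d" shows "gel n q j d"
proof -
 show ?thesis
  using assms(2) assms(1) by (fastforce simp: mult_right_mono gel_def order.trans)
qed

lemma gel_mono_index: "gel n q j c \<Longrightarrow> j \<le> k \<Longrightarrow> gel n q k c"
 unfolding gel_def by (metis less_le_trans)

lemma orthonormal_in_image:
 assumes inj: "\<And>a. \<exists>i<m. a i \<noteq> 0 \<Longrightarrow> 0 < nrm n (lin m M a)" and "s + k \<le> m"
 shows "\<exists>f a. orthonormal n s f \<and> (\<forall>i<s. f i = lin m M (a i) \<and> (\<forall>j<k. ip n (f i) (r j) = 0))"
 using assms(2)
proof (induction s)
 case 0 show ?case by (simp add: orthonormal_def)
next
 case (Suc s)
 then obtain f a where f: "orthonormal n s f" "\<forall>i<s. f i = lin m M (a i) \<and> (\<forall>j<k. ip n (f i) (r j) = 0)" by auto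
 obtain b where b: "nrm n (lin m M b) = 1" "\<forall>j<s+k. ip n (lin m M b) ((\<lambda>j. if j < s then f j else r (j - s)) j) = 0"
  using unit_vector_in_kernel[OF _ inj, of "s + k" "\<lambda>j. if j < s then f j else r (j - s)"] Suc.prems by auto
 have "ip n (lin m M b) (f i) = 0" if "i < s" for i using b(2) that by (auto dest: spec[of _ i])
 moreover have "ip n (lin m M b) (r j) = 0" if "j < k" for j using b(2)[rule_format, of "s + j"] that by auto
 ultimately have "orthonormal n (Suc s) (f(s := lin m M b))"
  "\<forall>i<Suc s. (f(s := lin m M b)) i = lin m M ((a(s := b)) i) \<and> (\<forall>j<k. ip n ((f(s := lin m M b)) i) (r j) = 0)"
  using orthonormal_Suc[OF f(1) b(1)] f(2) by (auto simp: less_Suc_eq)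
 then show ?case by blast
qed

text \<open>If \<open>p\<close> is at least \<open>A\<close> on an orthonormal system, at most \<open>B\<close> on its span, with \<open>B\<close> close to
 \<open>A\<close>, then no subspace of proportional dimension can make \<open>p\<close> small: compare traces of the matrix
 of norming functionals.\<close>
lemma trace_lower_bound:
 assumes x: "\<And>i. i < k \<Longrightarrow> \<exists>r. (\<forall>y. ip n r y \<le> p y) \<and> A \<le> ip n r (x i)"
  and B: "\<And>a. p (lin k x a) \<le> B * nrm k a" "0 \<le> B"
  and f: "orthonormal k s f" "\<sigma> * real k \<le> real s" "0 < k"
  and c: "\<And>a. p (lin k x (lin s f a)) \<le> c * nrm s a" "0 \<le> c"
 shows "A \<le> c + B * sqrt (1 - \<sigma>)"
proof -
 obtain r where r: "\<And>i y. i < k \<Longrightarrow> ip n (r i) y \<le> p y" "\<And>i. i < k \<Longrightarrow> A \<le> ip n (r i) (x i)"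
  using x by metis
 define R where "R i l = ip n (r i) (x l)" for i l
 have R: "ip k (R i) a = ip n (r i) (lin k x a)" for i a
  by (simp add: ip_lin_right) (simp add: R_def ip_def[of k] mult.commute)
 have self: "nrm k v \<le> d" if "ip k v v \<le> d * nrm k v" "0 \<le> d" for k v d
 proof (cases "nrm k v = 0")
  case False
  then have "nrm k v > 0" using nrm_nonneg[of k v] by linarith
  moreover have "nrm k v * nrm k v \<le> d * nrm k v"
   using that nrm_sq[of k v] by (simp add: power2_eq_square)
  ultimately show ?thesis by simp
 qed (use that in auto)
 \<comment> \<open>testing the functional on its own coefficient vector bounds its Euclidean norm\<close>
 have RB: "nrm k (R i) \<le> B" if "i < k" for i
  by (rule self) (use r(1)[OF that] B R in \<open>auto intro: order.trans\<close>)
 define b where "b i j = ip k (R i) (f j)" for i j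
 have bc: "nrm s (b i) \<le> c" if "i < k" for i
 proof (rule self)
  have "ip s (b i) (b i) = ip k (R i) (lin s f (b i))"
   by (simp add: ip_lin_right) (simp add: b_def ip_def[of s])
  also have "\<dots> \<le> c * nrm s (b i)" using r(1)[OF that] c R by (auto intro: order.trans)
  finally show "ip s (b i) (b i) \<le> c * nrm s (b i)" .
 qed fact
 \<comment> \<open>\<open>t i\<close> is the squared length of the projection of the \<open>i\<close>-th unit vector to the span of \<open>f\<close>\<close>
 define t where "t i = (\<Sum>j<s. (f j i)\<^sup>2)" for i
 let ?e = "\<lambda>i l. if l = i then 1 else (0::real)"
 have e: "ip k v (?e i) = v i" "ip k (?e i) v = v i" if "i < k" for v i
  using that by (simp_all add: ip_def if_distrib[of "\<lambda>c. c * _"] if_distrib[of "\<lambda>c. _ * c"] cong: if_cong)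
 have t1: "t i \<le> 1" if "i < k" for i
  using bessel[OF f(1), of "?e i"] that by (simp add: e t_def)
 have nonneg_t: "0 \<le> t i" for i by (simp add: t_def sum_nonneg)
 have main: "A \<le> c + B * sqrt (1 - t i)" if i: "i < k" for i
 proof -
  define w where "w l = ?e i l - lin s f (\<lambda>j. f j i) l" for l
  have "A \<le> R i i" using r(2)[OF i] by (simp add: R_def)
  also have "R i i = ip k (R i) (lin s f (\<lambda>j. f j i)) + ip k (R i) w"
   unfolding w_def by (simp only: ip_diff_right e[OF i])
  also have "ip k (R i) (lin s f (\<lambda>j. f j i)) = ip s (\<lambda>j. f j i) (b i)"
   by (simp add: ip_lin_right) (simp add: b_def ip_def[of s])
  also have "\<dots> \<le> nrm s (\<lambda>j. f j i) * nrm s (b i)" using ip_le_nrm[of s "\<lambda>j. f j i" "b i"] by simp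
  also have "\<dots> \<le> 1 * c"
  proof (rule mult_mono)
   show "nrm s (\<lambda>j. f j i) \<le> 1" using t1[OF i] by (simp add: nrm_def ip_def t_def power2_eq_square)
  qed (use bc[OF i] in auto)
  also have "ip k (R i) w \<le> nrm k (R i) * nrm k w" using ip_le_nrm[of k "R i" w] by simp
  also have "\<dots> \<le> B * nrm k w" by (rule mult_right_mono[OF RB[OF i]]) simp
  also have "nrm k w = sqrt (1 - t i)"
  proof -
   have "ip k w w = 1 - 2 * lin s f (\<lambda>j. f j i) i + ip s (\<lambda>j. f j i) (\<lambda>j. f j i)"
    unfolding w_def
    by (simp add: ip_diff_left ip_diff_right e[OF i] orthonormal_isometry[OF f(1)])
   also have "\<dots> = 1 - t i" by (simp add: lin_def ip_def t_def power2_eq_square)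
   finally show ?thesis by (simp add: nrm_def)
  qed
  finally show ?thesis by simp
 qed
 have sum_t: "(\<Sum>i<k. t i) = real s"
 proof -
  have "(\<Sum>i<k. t i) = (\<Sum>j<s. ip k (f j) (f j))"
   unfolding t_def ip_def by (subst sum.swap) (simp add: power2_eq_square)
  also have "\<dots> = (\<Sum>j<s. 1)" by (rule sum.cong) (auto simp: orthonormalD[OF f(1)])
  finally show ?thesis by simp
 qed
 have "real k * A \<le> (\<Sum>i<k. c + B * sqrt (1 - t i))"
  using sum_mono[of "{..<k}" "\<lambda>_. A" "\<lambda>i. c + B * sqrt (1 - t i)"] main by simp
 also have "\<dots> = real k * c + B * (\<Sum>i<k. sqrt (1 - t i))"
  by (simp add: sum.distrib sum_distrib_left)
 also have "(\<Sum>i<k. sqrt (1 - t i)) \<le> real k * sqrt (1 - \<sigma>)"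
 proof -
  have "(\<Sum>i<k. sqrt (1 - t i))\<^sup>2 \<le> (\<Sum>i<k. 1\<^sup>2) * (\<Sum>i<k. (sqrt (1 - t i))\<^sup>2)"
   using Cauchy_Schwarz_ineq_sum[of "\<lambda>_. 1" "\<lambda>i. sqrt (1 - t i)" "{..<k}"] by simp
  also have "(\<Sum>i<k. (sqrt (1 - t i))\<^sup>2) = (\<Sum>i<k. 1 - t i)"
   by (rule sum.cong) (use t1 in auto)
  also have "\<dots> = real k - real s" by (simp add: sum_subtractf sum_t)
  also have "(\<Sum>i<k. 1\<^sup>2) * (real k - real s) \<le> real k * (real k * (1 - \<sigma>))"
   using mult_left_mono[OF f(2), of "real k"] by (simp add: algebra_simps)
  also have "\<dots> = (real k)\<^sup>2 * (1 - \<sigma>)" by (simp add: power2_eq_square)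
  finally have "(\<Sum>i<k. sqrt (1 - t i))\<^sup>2 \<le> (real k)\<^sup>2 * (1 - \<sigma>)" .
  then have "sqrt ((\<Sum>i<k. sqrt (1 - t i))\<^sup>2) \<le> sqrt ((real k)\<^sup>2 * (1 - \<sigma>))" by (rule real_sqrt_le_mono)
  moreover have "0 \<le> (\<Sum>i<k. sqrt (1 - t i))" by (rule sum_nonneg) (use t1 in auto)
  ultimately show ?thesis by (simp add: real_sqrt_mult)
 qed
 finally have "real k * A \<le> real k * c + B * (real k * sqrt (1 - \<sigma>))"
  using B(2) by (simp add: mult_left_mono)
 then have "real k * A \<le> real k * (c + B * sqrt (1 - \<sigma>))" by (simp add: algebra_simps)
 then show ?thesis using f(3) by simp
qed

section \<open>Euclidean subspaces imply Gelfand number estimates\<close>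

text \<open>Every \<open>k\<close>-dimensional subspace on which \<open>p\<close> is a norm has a subspace of dimension at least \<open>\<delta> k\<close> on which \<open>p\<close>
 is within \<open>C\<close> of a Hilbertian norm; the map \<open>L\<close> parametrises that subspace so that the Hilbertian norm is the
 standard one.\<close>
definition hilbertian_subspaces :: "real \<Rightarrow> real \<Rightarrow> ((nat \<Rightarrow> real) \<Rightarrow> real) \<Rightarrow> bool" where
 "hilbertian_subspaces \<delta> C p \<longleftrightarrow>
  (\<forall>k U. (\<forall>a. (\<exists>i<k. a i \<noteq> 0) \<longrightarrow> 0 < p (lin k U a)) \<longrightarrow>
   (\<exists>m L. \<delta> * real k \<le> real m \<and>
     (\<forall>a. nrm m a \<le> p (lin k U (lin m L a)) \<and> p (lin k U (lin m L a)) \<le> C * nrm m a)))"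

text \<open>For the Hilbertian norm carried to the image of \<open>T\<close>, the second Gaussian moment is the sum of
 its squares on the orthonormal vectors \<open>h i\<close>, each at least \<open>(c / C)\<^sup>2\<close>; projecting to the span of the
 \<open>h i\<close> does not increase the average of \<open>p\<close>.\<close>
lemma ell_lower_bound:
 assumes p: "seminorm n p" and h: "orthonormal n s h"
  and T: "\<And>i. i < s \<Longrightarrow> h i = lin m T (a i)" "\<And>b. nrm m b \<le> p (lin m T b)" "\<And>b. p (lin m T b) \<le> C * nrm m b"
  and c: "\<And>i. i < s \<Longrightarrow> c \<le> p (h i)" "0 \<le> c" "0 < C"
 shows "c / C * sqrt s \<le> ell n p"
proof -
 have a: "(c / C)\<^sup>2 \<le> ip m (a i) (a i)" if "i < s" for i
 proof -
  have "c / C \<le> nrm m (a i)"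
  using c(1)[OF that] T(3)[of "a i"] T(1)[OF that] c(3) by (simp add: field_simps)
  then show ?thesis using c by (simp add: nrm_sq[symmetric] power_mono)
 qed
 have hl: "lin s h b = lin m T (lin s a b)" for b
 proof -
  have "lin s h b = lin s (\<lambda>j. lin m T (a j)) b" using T(1) by (simp add: lin_def)
  then show ?thesis by (simp add: lin_lin)
 qed
 let ?b = "\<lambda>x j. ip n x (h j)"
 have sq: "ip m (lin s a b) (lin s a b) = (\<Sum>i<s. \<Sum>j<s. b i * b j * ip m (a i) (a j))" for b
  by (subst ip_lin_left, subst ip_lin_right) (simp add: sum_distrib_left mult.assoc)
 have I: "integrable (gauss n) (\<lambda>x. ip m (lin s a (?b x)) (lin s a (?b x)))"
  unfolding sq by (intro Bochner_Integration.integrable_sum integrable_mult_left integrable_gauss_ip_mult)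
 have "(c / C)\<^sup>2 * real s \<le> (\<Sum>i<s. ip m (a i) (a i))"
  using sum_mono[of "{..<s}" "\<lambda>_. (c / C)\<^sup>2", OF a] by (simp add: mult.commute)
 also have "\<dots> = (\<Sum>i<s. \<Sum>j<s. ip n (h i) (h j) * ip m (a i) (a j))"
  by (rule sum.cong) (use orthonormalD[OF h] in \<open>auto simp: if_distrib[of "\<lambda>c. c * _"] cong: if_cong\<close>)
 also have "\<dots> = (\<Sum>i<s. \<Sum>j<s. (\<integral>x. ip n x (h i) * ip n x (h j) \<partial>gauss n) * ip m (a i) (a j))"
  by (simp add: integral_gauss_ip_mult)
 also have "\<dots> = (\<integral>x. ip m (lin s a (?b x)) (lin s a (?b x)) \<partial>gauss n)"
  unfolding sq by (simp add: integrable_gauss_ip_mult)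
 also have "\<dots> \<le> (\<integral>x. (p (lin s h (?b x)))\<^sup>2 \<partial>gauss n)"
 proof (rule integral_mono[OF I])
  show "integrable (gauss n) (\<lambda>x. (p (lin s h (?b x)))\<^sup>2)"
  proof (rule integrable_gauss_seminorm_sq)
   show "seminorm n (\<lambda>x. p (lin s h (?b x)))"
    unfolding seminorm_def
   proof (intro conjI allI impI)
    fix x y :: "nat \<Rightarrow> real" assume "\<forall>i<n. x i = y i"
    then show "p (lin s h (?b x)) = p (lin s h (?b y))" by (simp add: ip_cong[of n x y])
   qed (simp_all add: ip_add_left ip_scale_left lin_add lin_scale seminorm_triangle[OF p] seminorm_scale[OF p])
  qed
  fix x
  have "(nrm m (lin s a (?b x)))\<^sup>2 \<le> (p (lin s h (?b x)))\<^sup>2"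
   unfolding hl by (rule power_mono[OF T(2)]) simp
  then show "ip m (lin s a (?b x)) (lin s a (?b x)) \<le> (p (lin s h (?b x)))\<^sup>2" by (simp add: nrm_sq)
 qed
 also have "\<dots> \<le> (\<integral>x. (p x)\<^sup>2 \<partial>gauss n)" by (rule ell_sq_projection[OF p h])
 finally have "sqrt ((c / C)\<^sup>2 * real s) \<le> ell n p" unfolding ell_def by (rule real_sqrt_le_mono)
 then show ?thesis using c by (simp add: real_sqrt_mult)
qed

text \<open>A family of vectors on which \<open>p\<close> is nearly constant, at a level that \<open>p\<close> barely exceeds on its
 span, forces a large Gaussian average.\<close>
lemma ell_lower_bound_flat:
 assumes p: "seminorm n p" and H: "hilbertian_subspaces \<delta> C p"
  and \<delta>: "0 < \<delta>" "\<delta> \<le> 1" and C: "0 < C"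
  and x: "orthonormal n k x" "0 < k"
   "\<And>i. i < k \<Longrightarrow> \<exists>r. (\<forall>y. ip n r y \<le> p y) \<and> A \<le> ip n r (x i)"
  and B: "\<And>a. p (lin k x a) \<le> B * nrm k a" "0 \<le> B"
  and c: "c + B * sqrt (1 - \<delta> / 4) < A" "0 \<le> c"
 shows "c / C * sqrt (3 / 8 * \<delta> * real k) \<le> ell n p"
proof -
 \<comment> \<open>the kernel of \<open>p\<close> may use up a quarter of the dimension, and half of the Euclidean subspace is
  consumed by the selection below; subspaces of proportion \<open>\<delta> / 4\<close> remain\<close>
 define \<sigma> where "\<sigma> = \<delta> / 4"
 have large: "\<exists>a. c * nrm s a < p (lin k x (lin s f a))" if "orthonormal k s f" "\<sigma> * real k \<le> real s" for s f
 proof (rule ccontr)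
  assume "\<nexists>a. c * nrm s a < p (lin k x (lin s f a))"
  then have "p (lin k x (lin s f a)) \<le> c * nrm s a" for a by (simp add: not_less)
  from trace_lower_bound[OF x(3) B that(1) that(2) x(2) this c(2)] c(1) show False
   by (simp add: \<sigma>_def)
 qed
 have px: "p (lin k x a) = p (lin k x b)" if "nrm k (\<lambda>i. a i - b i) = 0" for a b
  using that by (intro arg_cong[where f=p] lin_cong) (simp add: nrm_eq_0_iff)
 \<comment> \<open>a maximal orthonormal family in the kernel of \<open>p\<close> has few elements\<close>
 define K where "K s \<longleftrightarrow> (\<exists>f. orthonormal k s f \<and> (\<forall>i<s. p (lin k x (f i)) = 0))" for s
 have "K 0" by (auto simp: K_def orthonormal_def)
 moreover have K_bound: "s \<le> k" if "K s" for s using that orthonormal_le by (auto simp: K_def)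
 ultimately obtain s where s: "K s" "\<And>t. K t \<Longrightarrow> t \<le> s"
  using GreatestI_nat[of K 0 k] Greatest_le_nat[of K _ k] by blast
 then obtain f where f: "orthonormal k s f" "\<And>i. i < s \<Longrightarrow> p (lin k x (f i)) = 0" by (auto simp: K_def)
 have "real s < \<sigma> * real k"
 proof (rule ccontr)
  assume "\<not> real s < \<sigma> * real k"
  then obtain a where a: "c * nrm s a < p (lin k x (lin s f a))" using large[OF f(1)] by auto
  have "p (lin k x (lin s f a)) = p (\<lambda>i. \<Sum>j<s. a j * lin k x (f j) i)"
   by (simp add: lin_lin) (simp add: lin_def)
  also have "\<dots> \<le> (\<Sum>j<s. p (\<lambda>i. a j * lin k x (f j) i))" by (rule seminorm_sum[OF p]) simp
  also have "\<dots> = 0" by (simp add: seminorm_scale[OF p] f(2))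
  finally have "c * nrm s a < 0" using a by simp
  moreover have "0 \<le> c * nrm s a" using c(2) by simp
  ultimately show False by linarith
 qed
 note s_small = this
 obtain g where g: "orthonormal k (k - s) g" "\<And>i j. i < k - s \<Longrightarrow> j < s \<Longrightarrow> ip k (g i) (f j) = 0"
  using orthonormal_in_kernel[of "k - s" s k f] K_bound[OF s(1)] by auto
 let ?k = "k - s"
 define U where "U l = lin k x (g l)" for l
 have U: "lin ?k U a = lin k x (lin ?k g a)" for a by (simp add: U_def[abs_def] lin_lin)
 have U_pos: "0 < p (lin ?k U a)" if a: "\<exists>i<?k. a i \<noteq> 0" for a
 proof (rule ccontr)
  assume "\<not> 0 < p (lin ?k U a)"
  then have z: "p (lin k x (lin ?k g a)) = 0" using seminorm_nonneg[OF p] U by (metis less_eq_real_def)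
  define v where "v = lin ?k g a"
  have v: "nrm k v > 0" using a nrm_pos unfolding v_def orthonormal_nrm_lin[OF g(1)] by blast
  define w where "w i = (1 / nrm k v) * v i" for i
  have w: "nrm k w = 1" unfolding w_def by (rule unit_multiple[OF v])
  have "p (lin k x w) = 0"
   unfolding w_def by (simp only: lin_scale seminorm_scale[OF p]) (simp add: v_def z)
  moreover have "ip k w (f j) = 0" if "j < s" for j
   unfolding w_def ip_scale_left v_def ip_lin_left using g(2)[OF _ that] by simp
  ultimately have "K (Suc s)"
   unfolding K_def using orthonormal_Suc[OF f(1) w] f(2)
   by (intro exI[of _ "f(s := w)"]) (auto simp: less_Suc_eq)
  then show False using s(2)[of "Suc s"] by simp
 qed
 from H U_pos obtain m L where m: "\<delta> * real ?k \<le> real m"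
  and L: "\<And>a. nrm m a \<le> p (lin ?k U (lin m L a))" "\<And>a. p (lin ?k U (lin m L a)) \<le> C * nrm m a"
  unfolding hilbertian_subspaces_def by metis
 define M where "M j = lin ?k g (L j)" for j
 have M: "lin m M a = lin ?k g (lin m L a)" for a by (simp add: M_def[abs_def] lin_lin)
 have xM: "lin k x (lin m M a) = lin ?k U (lin m L a)" for a by (simp add: M U)
 have M_inj: "0 < nrm k (lin m M a)" if "\<exists>i<m. a i \<noteq> 0" for a
 proof (rule ccontr)
  assume "\<not> 0 < nrm k (lin m M a)"
  then have "nrm k (lin m M a) = 0" using nrm_nonneg[of k "lin m M a"] by linarith
  then have "p (lin k x (lin m M a)) = p (lin k x (\<lambda>_. 0))" by (intro px) simp
  also have "\<dots> = 0" by (simp add: lin_def seminorm_zero[OF p])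
  finally have "nrm m a \<le> 0" using L(1)[of a] xM by simp
  then show False using that nrm_pos[of _ m a] by force
 qed
 have k1: "(3/4) * real k \<le> real ?k"
  using s_small \<delta> K_bound[OF s(1)] mult_right_mono[OF \<delta>(2), of "real k"] by (simp add: \<sigma>_def of_nat_diff)
 have m_large: "(3/4) * \<delta> * real k \<le> real m"
 proof -
  have "(3/4) * \<delta> * real k = \<delta> * ((3/4) * real k)" by simp
  also have "\<dots> \<le> \<delta> * real ?k" by (rule mult_left_mono[OF k1]) (use \<delta> in simp)
  finally show ?thesis using m by linarith
 qed
 define T where "T j = lin k x (M j)" for j
 have T: "lin m T a = lin ?k U (lin m L a)" for a
 proof -
  have "lin m T a = lin k x (lin m M a)" by (simp only: T_def[abs_def] lin_lin)
  then show ?thesis by (simp only: xM)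
 qed
 \<comment> \<open>as long as at most half of the Euclidean subspace has been used, its part orthogonal to the vectors
  chosen so far is large enough to contain a further vector on which \<open>p\<close> is large\<close>
 have greedy: "\<exists>h a. orthonormal n t h \<and> (\<forall>i<t. h i = lin m T (a i) \<and> c \<le> p (h i))" if "real t < real m / 2 + 1" for t
  using that
 proof (induction t)
  case 0 show ?case by (simp add: orthonormal_def)
 next
  case (Suc t)
  then obtain h a where h: "orthonormal n t h" "\<forall>i<t. h i = lin m T (a i) \<and> c \<le> p (h i)" by auto
  have tm: "t \<le> m" using Suc.prems by linarith
  obtain f b where f: "orthonormal k (m - t) f"
   "\<And>i. i < m - t \<Longrightarrow> f i = lin m M (b i)" "\<And>i j. i < m - t \<Longrightarrow> j < t \<Longrightarrow> ip k (f i) (\<lambda>l. ip n (x l) (h j)) = 0"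
   using orthonormal_in_image[OF M_inj, of "m - t" t "\<lambda>j l. ip n (x l) (h j)"] tm by (metis le_add_diff_inverse2 order_refl)
  have "\<sigma> * real k \<le> real (m - t)"
   using Suc.prems m_large tm \<delta> by (simp add: \<sigma>_def of_nat_diff)
  from large[OF f(1) this] obtain d where d: "c * nrm (m - t) d < p (lin k x (lin (m - t) f d))" by blast
  define y where "y = lin k x (lin (m - t) f d)"
  have ny: "nrm n y = nrm (m - t) d"
   by (simp add: y_def orthonormal_nrm_lin[OF x(1)] orthonormal_nrm_lin[OF f(1)])
  have y_pos: "nrm n y > 0"
  proof (rule ccontr)
   assume "\<not> nrm n y > 0"
   then have "nrm (m - t) d = 0" unfolding ny using nrm_nonneg[of "m - t" d] by linarith
   moreover from this have "p y = p (lin k x (\<lambda>_. 0))"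
    unfolding y_def by (intro px) (simp add: orthonormal_nrm_lin[OF f(1)])
   ultimately show False using d by (simp add: y_def lin_def seminorm_zero[OF p])
  qed
  define v where "v i = (1 / nrm n y) * y i" for i
  have v1: "nrm n v = 1" unfolding v_def by (rule unit_multiple[OF y_pos])
  have "c \<le> p v"
   using d y_pos unfolding v_def seminorm_scale[OF p] by (simp add: y_def[symmetric] ny[symmetric] field_simps)
  moreover have "v = lin m T (\<lambda>l. (1 / nrm n y) * lin (m - t) b d l)"
  proof -
   have "lin (m - t) f d = lin m M (lin (m - t) b d)"
    by (simp add: lin_lin) (simp add: lin_def f(2))
   then have "y = lin m T (lin (m - t) b d)" by (simp add: y_def T xM)
   then show ?thesis unfolding lin_scale by (simp only: v_def[abs_def])
  qed
  moreover have "ip n v (h j) = 0" if "j < t" for j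
  proof -
   have "ip n y (h j) = ip k (lin (m - t) f d) (\<lambda>l. ip n (x l) (h j))"
    unfolding y_def by (simp add: ip_lin_left[of n k]) (simp add: ip_def[of k])
   also have "\<dots> = 0" by (simp add: ip_lin_left f(3)[OF _ that])
   finally show ?thesis unfolding v_def ip_scale_left by simp
  qed
  ultimately show ?case
   using orthonormal_Suc[OF h(1) v1] h(2)
   by (intro exI[of "\<lambda>h. \<exists>a. orthonormal n (Suc t) h \<and> _ h a" "h(t := v)"]
     exI[of "\<lambda>a. orthonormal n (Suc t) _ \<and> _ a" "a(t := (\<lambda>l. (1 / nrm n y) * lin (m - t) b d l))"])
    (auto simp: less_Suc_eq)
 qed
 define t where "t = (m + 1) div 2"
 have "real t < real m / 2 + 1" "real m / 2 \<le> real t" unfolding t_def by linarith+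
 then obtain h a where h: "orthonormal n t h" "\<forall>i<t. h i = lin m T (a i) \<and> c \<le> p (h i)" and t: "real m / 2 \<le> real t"
  using greedy by blast
 have "c / C * sqrt t \<le> ell n p"
  by (rule ell_lower_bound[OF p h(1), of m T a C c]) (use h(2) L T c C in auto)
 moreover have "c / C * sqrt (3 / 8 * \<delta> * real k) \<le> c / C * sqrt t"
  using m_large t c C by (intro mult_left_mono real_sqrt_le_mono) auto
 ultimately show ?thesis by linarith
qed

text \<open>Choosing \<open>k\<close> so that the Gelfand number of order \<open>k\<close>, weighted by \<open>sqrt k\<close>, is largest makes the
 Gelfand numbers nearly constant on a final segment of \<open>{1..k}\<close> of proportional length.\<close>
theorem gelfand_estimate_of_hilbertian_subspaces:
 fixes \<delta> C :: real
 assumes \<delta>: "0 < \<delta>" "\<delta> \<le> 1" and C: "0 < C"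
 shows "\<exists>C'. \<forall>n p k c. seminorm n p \<longrightarrow>
  (\<forall>x e. 0 < e \<longrightarrow> (\<exists>r. (\<forall>y. ip n r y \<le> p y) \<and> p x - e \<le> ip n r x)) \<longrightarrow>
  hilbertian_subspaces \<delta> C p \<longrightarrow>
  k \<in> {1..n} \<longrightarrow> C' / sqrt k * ell n p < c \<longrightarrow> gel n p (k - 1) c"
proof -
 \<comment> \<open>\<open>\<rho>\<close> is the tolerance for which \<open>trace_lower_bound\<close> still leaves a positive constant: it makes
  \<open>3 \<rho> + (1 + 2 \<rho>) \<theta> < 1 - 2 \<rho>\<close>. A segment of proportion \<open>\<kappa>\<close> changes the weight \<open>sqrt k\<close> by the factor
  \<open>1 + \<rho>\<close> only\<close>
 define \<theta> where "\<theta> = sqrt (1 - \<delta> / 4)"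
 have \<theta>: "0 \<le> \<theta>" "\<theta> < 1" using \<delta> by (auto simp: \<theta>_def)
 define \<rho> where "\<rho> = (1 - \<theta>) / 8"
 have \<rho>: "0 < \<rho>" "\<rho> \<le> 1/8" using \<theta> by (auto simp: \<rho>_def)
 define \<kappa> where "\<kappa> = 1 - 1 / (1 + \<rho>)\<^sup>2"
 have \<kappa>: "0 < \<kappa>" "\<kappa> < 1" using \<rho> by (auto simp: \<kappa>_def one_less_power)
 define S where "S = sqrt (3 / 8 * \<delta> * \<kappa>)"
 have S: "0 < S" using \<delta> \<kappa> by (simp add: S_def)
 define C' where "C' = C / (3 * \<rho> * S)"
 show ?thesis
 proof (intro exI[of _ C'] allI impI)
  fix n p k0 c0
  assume p: "seminorm n p"
   and dual: "\<forall>x e. 0 < e \<longrightarrow> (\<exists>r. (\<forall>y. ip n r y \<le> p y) \<and> p x - e \<le> ip n r x)"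
   and H: "hilbertian_subspaces \<delta> C p"
   and k0: "k0 \<in> {1..n}" and c0: "C' / sqrt k0 * ell n p < c0"
  define G where "G k = {c. 0 \<le> c \<and> gel n p (k - 1) c}" for k
  define g where "g k = Inf (G k)" for k
  obtain B0 where B0: "0 \<le> B0" "\<And>x. p x \<le> B0 * nrm n x" using seminorm_bounded[OF p] by blast
  have G: "G k \<noteq> {}" "bdd_below (G k)" for k
   using B0 by (auto simp: G_def gel_def bdd_below_def)
  have g_nonneg: "0 \<le> g k" for k
   unfolding g_def by (rule cInf_greatest[OF G(1)]) (auto simp: G_def)
  have g_less: "gel n p (k - 1) c" if "g k < c" for k c
   using that cInf_lessD[OF G(1)[of k], of c] gel_mono[of n p "k - 1" _ c] by (force simp: g_def G_def)
  have g_le: "g k \<le> c" if "gel n p (k - 1) c" "0 \<le> c" for k c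
   unfolding g_def by (rule cInf_lower[OF _ G(2)]) (use that in \<open>simp add: G_def\<close>)
  obtain k where k: "k \<in> {1..n}" "\<And>j. j \<in> {1..n} \<Longrightarrow> sqrt j * g j \<le> sqrt k * g k"
  proof -
   let ?V = "(\<lambda>j. sqrt (real j) * g j) ` {1..n}"
   have "Max ?V \<in> ?V" using k0 by (intro Max_in) auto
   then obtain k where k: "Max ?V = sqrt (real k) * g k" "k \<in> {1..n}" by (rule imageE)
   have "sqrt (real j) * g j \<le> sqrt (real k) * g k" if "j \<in> {1..n}" for j
    unfolding k(1)[symmetric] by (rule Max_ge) (use that in auto)
   with k(2) show ?thesis by (rule that)
  qed
  have main: "sqrt k * g k \<le> C' * ell n p"
  proof (cases "g k = 0")
   case True
   then show ?thesis using C \<rho> S ell_nonneg by (simp add: C'_def)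
  next
   case False
   define A where "A = g k"
   have A: "0 < A" using False g_nonneg[of k] by (simp add: A_def)
   define j where "j = nat \<lceil>k / (1 + \<rho>)\<^sup>2\<rceil>"
   have kpos: "0 < real k" using k by simp
   have kr: "0 < real k / (1 + \<rho>)\<^sup>2" using kpos \<rho> by simp
   have kle: "real k / (1 + \<rho>)\<^sup>2 \<le> real k"
    using kpos \<rho> by (simp add: divide_le_eq one_le_power)
   have j: "1 \<le> j" "j \<le> k" "real k / (1 + \<rho>)\<^sup>2 \<le> real j" "real j < real k / (1 + \<rho>)\<^sup>2 + 1"
    unfolding j_def using kr kle by linarith+
   define k' where "k' = k - (j - 1)"
   have k': "0 < k'" "\<kappa> * real k \<le> real k'" "j - 1 + k' = k"
    using j by (auto simp: k'_def \<kappa>_def of_nat_diff algebra_simps)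
   \<comment> \<open>by the choice of \<open>k\<close>, the Gelfand number of order \<open>j\<close> exceeds the one of order \<open>k\<close> at most by the factor \<open>sqrt (k / j)\<close>\<close>
   have "g j < (1 + 2 * \<rho>) * A"
   proof -
    have "sqrt k \<le> sqrt ((1 + \<rho>)\<^sup>2 * real j)"
  using j(3) \<rho> by (simp add: divide_le_eq mult.commute real_sqrt_le_mono)
    then have "sqrt k \<le> (1 + \<rho>) * sqrt j" using \<rho> by (simp add: real_sqrt_mult)
    then have "sqrt k * A \<le> (1 + \<rho>) * sqrt j * A" using A by (intro mult_right_mono) auto
    moreover have "sqrt j * g j \<le> sqrt k * A" using k(2)[of j] j k(1) by (auto simp: A_def)
    ultimately have "sqrt j * g j \<le> sqrt j * ((1 + \<rho>) * A)" by (simp add: mult_ac)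
    then have "g j \<le> (1 + \<rho>) * A" using j(1) by simp
    also have "\<dots> < (1 + 2 * \<rho>) * A" using A \<rho> by simp
    finally show ?thesis .
   qed
   from g_less[OF this] obtain r where
    r: "\<And>x. (\<forall>i<j-1. ip n (r i) x = 0) \<Longrightarrow> p x \<le> (1 + 2 * \<rho>) * A * nrm n x"
    unfolding gel_def by blast
   \<comment> \<open>the vectors are found one by one: fewer than \<open>k\<close> constraints cannot force \<open>p\<close> below \<open>(1 - \<rho>) A\<close>, by
    definition of the Gelfand number of order \<open>k\<close>\<close>
   have "\<exists>x. orthonormal n t x \<and> (\<forall>i<t. (1 - \<rho>) * A \<le> p (x i) \<and> (\<forall>l<j-1. ip n (r l) (x i) = 0))"
    if "t \<le> k'" for t
    using that
   proof (induction t)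
    case 0 show ?case by (simp add: orthonormal_def)
   next
    case (Suc t)
    then obtain x where x: "orthonormal n t x" "\<forall>i<t. (1 - \<rho>) * A \<le> p (x i) \<and> (\<forall>l<j-1. ip n (r l) (x i) = 0)"
     by auto
    let ?r = "\<lambda>i. if i < j - 1 then r i else x (i - (j - 1))"
    have "\<not> gel n p (j - 1 + t) ((1 - \<rho>) * A)"
    proof
     assume "gel n p (j - 1 + t) ((1 - \<rho>) * A)"
     then have "gel n p (k - 1) ((1 - \<rho>) * A)"
      by (rule gel_mono_index) (use Suc.prems k' in linarith)
     then have "g k \<le> (1 - \<rho>) * A" by (rule g_le) (use A \<rho> in simp)
     then show False using A \<rho> by (simp add: A_def)
    qed
    then obtain y where y: "\<forall>i<j - 1 + t. ip n (?r i) y = 0" "(1 - \<rho>) * A * nrm n y < p y"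
  by (smt (verit) gel_def contrapos_nn exI[of _ ?r] not_all not_imp not_le exE conjE)
    have "nrm n y \<noteq> 0" using y(2) B0(2)[of y] by auto
    then have y_pos: "0 < nrm n y" using nrm_nonneg[of n y] by linarith
    define v where "v i = (1 / nrm n y) * y i" for i
    have v: "nrm n v = 1" unfolding v_def by (rule unit_multiple[OF y_pos])
    have "(1 - \<rho>) * A \<le> p v"
     using y(2) y_pos unfolding v_def seminorm_scale[OF p] by (simp add: field_simps)
    moreover have "ip n (r l) v = 0" if "l < j - 1" for l
     using y(1)[rule_format, of l] that unfolding v_def ip_scale_right by simp
    moreover have "ip n v (x i) = 0" if "i < t" for i
     using y(1)[rule_format, of "j - 1 + i"] that unfolding v_def ip_scale_left by (simp add: ip_commute)
    ultimately show ?case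
     using x(2) by (intro exI[of _ "x(t := v)"] conjI orthonormal_Suc[OF x(1) v]) (auto simp: less_Suc_eq)
   qed
   from this[of k'] obtain x where x: "orthonormal n k' x" "\<And>i. i < k' \<Longrightarrow> (1 - \<rho>) * A \<le> p (x i)"
    "\<And>i l. i < k' \<Longrightarrow> l < j - 1 \<Longrightarrow> ip n (r l) (x i) = 0" by blast
   have "3 * \<rho> * A / C * sqrt (3 / 8 * \<delta> * real k') \<le> ell n p"
   proof (rule ell_lower_bound_flat[OF p H \<delta> C x(1) k'(1)])
    fix i assume i: "i < k'"
    have "0 < \<rho> * A" using \<rho> A by simp
    with dual obtain s where "\<forall>y. ip n s y \<le> p y" "p (x i) - \<rho> * A \<le> ip n s (x i)" by blast
    then show "\<exists>s. (\<forall>y. ip n s y \<le> p y) \<and> (1 - 2 * \<rho>) * A \<le> ip n s (x i)"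
     using x(2)[OF i] by (intro exI[of _ s]) (auto simp: algebra_simps)
   next
    fix a
    have "p (lin k' x a) \<le> (1 + 2 * \<rho>) * A * nrm n (lin k' x a)"
     by (rule r) (auto simp: ip_lin_right x(3))
    then show "p (lin k' x a) \<le> (1 + 2 * \<rho>) * A * nrm k' a" by (simp add: orthonormal_nrm_lin[OF x(1)])
   next
    show "0 \<le> (1 + 2 * \<rho>) * A" "0 \<le> 3 * \<rho> * A" using A \<rho> by auto
    have "3 * \<rho> + (1 + 2 * \<rho>) * \<theta> < 1 - 2 * \<rho>"
    proof -
     have "2 * \<rho> * \<theta> \<le> 2 * \<rho> * 1" using \<theta> \<rho> by (intro mult_left_mono) auto
     moreover have "8 * \<rho> = 1 - \<theta>" by (simp add: \<rho>_def)
     moreover have "(1 + 2 * \<rho>) * \<theta> = \<theta> + 2 * \<rho> * \<theta>" by (simp add: algebra_simps)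
     ultimately show ?thesis using \<rho>(1) by linarith
    qed
    from mult_strict_right_mono[OF this A]
    show "3 * \<rho> * A + (1 + 2 * \<rho>) * A * sqrt (1 - \<delta> / 4) < (1 - 2 * \<rho>) * A"
     by (simp add: \<theta>_def algebra_simps)
   qed
   moreover have "S * sqrt k \<le> sqrt (3 / 8 * \<delta> * real k')"
   using k'(2) \<delta> mult_left_mono[OF k'(2), of "3 / 8 * \<delta>"] by (simp add: mult.assoc real_sqrt_le_mono S_def real_sqrt_mult[symmetric])
   then have "3 * \<rho> * A / C * (S * sqrt k) \<le> 3 * \<rho> * A / C * sqrt (3 / 8 * \<delta> * real k')"
    using A \<rho> C by (intro mult_left_mono) auto
   ultimately have "3 * \<rho> * A / C * (S * sqrt k) \<le> ell n p" by linarith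
   then show ?thesis using S C \<rho> by (simp add: C'_def A_def field_simps)
  qed
  have "g k0 \<le> C' / sqrt k0 * ell n p"
  using main k(2)[OF k0] k0 by (simp add: field_simps)
  then show "gel n p (k0 - 1) c0" using c0 by (intro g_less) linarith
 qed
qed

section \<open>Sections of small diameter\<close>

lemma prod_indicator: "finite I \<Longrightarrow> (\<Prod>i\<in>I. indicator (A i) (x i)) = (if \<forall>i\<in>I. x i \<in> A i then 1 else (0::ennreal))"
 by (induction I rule: finite_induct) auto

text \<open>A rotation mixes two independent Gaussian vectors into one of the same law. It suffices to
 compare the two measures on boxes, where everything factors into the plane rotations of single coordinates.\<close>
definition mix :: "nat \<Rightarrow> real \<Rightarrow> real \<Rightarrow> (nat \<Rightarrow> real) \<times> (nat \<Rightarrow> real) \<Rightarrow> nat \<Rightarrow> real" where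
 "mix n c s z = (\<lambda>i\<in>{..<n}. c * fst z i + s * snd z i)"

lemma measurable_mix: "mix n c s \<in> measurable (gauss n \<Otimes>\<^sub>M gauss n) (gauss n)"
proof (subst measurable_cong_sets[OF refl sets_gauss], rule measurable_PiM_single')
 fix i assume i: "i \<in> {..<n}"
 then have [measurable]: "(\<lambda>z. fst z i) \<in> borel_measurable (gauss n \<Otimes>\<^sub>M gauss n)" "(\<lambda>z. snd z i) \<in> borel_measurable (gauss n \<Otimes>\<^sub>M gauss n)"
  using measurable_compose[OF measurable_fst measurable_gauss_coord] measurable_compose[OF measurable_snd measurable_gauss_coord] by auto
 show "(\<lambda>z. mix n c s z i) \<in> borel_measurable (gauss n \<Otimes>\<^sub>M gauss n)"
  unfolding mix_def restrict_apply'[OF i] by measurable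
qed (simp add: mix_def Pi_def PiE_def extensional_def)

lemma distr_mix:
 assumes cs: "c\<^sup>2 + s\<^sup>2 = 1" "0 \<le> c"
 shows "distr (gauss n \<Otimes>\<^sub>M gauss n) (gauss n) (mix n c s) = gauss n"
proof -
 interpret P: product_sigma_finite "\<lambda>_. gauss1" by (rule product_sigma_finite_gauss1)
 interpret N: prob_space "gauss n" by (rule prob_space_gauss)
 interpret N1: prob_space gauss1 by (rule prob_space_gauss1)
 let ?D = "distr (gauss n \<Otimes>\<^sub>M gauss n) (gauss n) (mix n c s)"
 have "?D = Pi\<^sub>M {..<n} (\<lambda>_. gauss1)"
 proof (rule P.PiM_eqI)
  fix A :: "nat \<Rightarrow> real set" assume A: "\<And>i. i \<in> {..<n} \<Longrightarrow> A i \<in> sets gauss1"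
  let ?h = "\<lambda>i t u. indicator (A i) (c * t + s * u) :: ennreal"
  have u1: "emeasure gauss1 UNIV = 1" using N1.emeasure_space_1 by simp
  have hm[measurable]: "(\<lambda>(t, u). ?h i t u) \<in> borel_measurable (borel \<Otimes>\<^sub>M borel)" if "i < n" for i
   using A[of i] that by (simp add: case_prod_unfold)
  have B: "Pi\<^sub>E {..<n} A \<in> sets (gauss n)" unfolding gauss_def using A by (intro sets_PiM_I_finite) auto
  have "emeasure ?D (Pi\<^sub>E {..<n} A) = (\<integral>\<^sup>+z. indicator (Pi\<^sub>E {..<n} A) (mix n c s z) \<partial>(gauss n \<Otimes>\<^sub>M gauss n))"
   using B by (subst nn_integral_distr[OF measurable_mix, symmetric]) auto
  also have "\<dots> = (\<integral>\<^sup>+z. (\<Prod>i<n. ?h i (fst z i) (snd z i)) \<partial>(gauss n \<Otimes>\<^sub>M gauss n))"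
   by (intro nn_integral_cong) (auto simp: prod_indicator indicator_def mix_def PiE_iff)
  also have "\<dots> = (\<integral>\<^sup>+x. \<integral>\<^sup>+y. (\<Prod>i<n. ?h i (x i) (y i)) \<partial>gauss n \<partial>gauss n)"
  proof (subst N.nn_integral_fst[symmetric])
   have "(\<lambda>z. ?h i (fst z i) (snd z i)) \<in> borel_measurable (gauss n \<Otimes>\<^sub>M gauss n)" if i: "i < n" for i
    using measurable_compose[OF measurable_Pair[OF measurable_compose[OF measurable_fst measurable_gauss_coord[OF i]] measurable_compose[OF measurable_snd measurable_gauss_coord[OF i]]] hm[OF i]]
    by simp
   then show "(\<lambda>z. \<Prod>i<n. ?h i (fst z i) (snd z i)) \<in> borel_measurable (gauss n \<Otimes>\<^sub>M gauss n)"
    by (intro borel_measurable_prod_ennreal) auto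
  qed simp
  also have "\<dots> = (\<integral>\<^sup>+x. (\<Prod>i<n. \<integral>\<^sup>+u. ?h i (x i) u \<partial>gauss1) \<partial>gauss n)"
   unfolding gauss_def by (intro nn_integral_cong P.product_nn_integral_prod) (use A in auto)
  also have "\<dots> = (\<Prod>i<n. \<integral>\<^sup>+t. \<integral>\<^sup>+u. ?h i t u \<partial>gauss1 \<partial>gauss1)"
   unfolding gauss_def
  proof (rule P.product_nn_integral_prod)
   show "(\<lambda>t. \<integral>\<^sup>+u. ?h i t u \<partial>gauss1) \<in> borel_measurable gauss1" if "i \<in> {..<n}" for i
    using sigma_finite_measure.borel_measurable_nn_integral[OF sigma_finite_gauss1, of "?h i" borel] hm[of i] that by simp
  qed simp
  also have "\<dots> = (\<Prod>i<n. emeasure gauss1 (A i))"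
  proof (rule prod.cong[OF refl])
   fix i assume i: "i \<in> {..<n}"
   have "(\<integral>\<^sup>+t. \<integral>\<^sup>+u. ?h i t u \<partial>gauss1 \<partial>gauss1) = (\<integral>\<^sup>+t. \<integral>\<^sup>+u. indicator (A i) t \<partial>gauss1 \<partial>gauss1)"
    using nn_integral_rotation_gauss[of "\<lambda>x y. indicator (A i) x" c s] A[OF i] cs by simp
   then show "(\<integral>\<^sup>+t. \<integral>\<^sup>+u. ?h i t u \<partial>gauss1 \<partial>gauss1) = emeasure gauss1 (A i)"
    using A[OF i] by (simp add: u1)
  qed
  finally show "emeasure ?D (Pi\<^sub>E {..<n} A) = (\<Prod>i\<in>{..<n}. emeasure gauss1 (A i))" .
 qed (simp_all add: gauss_def)
 then show ?thesis by (simp add: gauss_def)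
qed

lemma has_integral_mix:
 fixes f :: "(nat \<Rightarrow> real) \<Rightarrow> real"
 assumes "c\<^sup>2 + s\<^sup>2 = 1" "0 \<le> c" "integrable (gauss n) f"
 shows "has_bochner_integral (gauss n \<Otimes>\<^sub>M gauss n) (\<lambda>z. f (mix n c s z)) (\<integral>x. f x \<partial>gauss n)"
 using integrable_distr_eq[OF measurable_mix, of f n c s] integral_distr[OF measurable_mix, of f n c s] assms
 by (simp add: has_bochner_integral_iff distr_mix)

lemma ip_mix: "ip n (mix n c s z) x = c * ip n (fst z) x + s * ip n (snd z) x"
proof -
 have "ip n (mix n c s z) x = ip n (\<lambda>i. c * fst z i + s * snd z i) x" by (rule ip_cong) (auto simp: mix_def)
 then show ?thesis by (simp add: ip_add_left ip_scale_left)
qed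

lemma integrable_Max:
 fixes f :: "'b \<Rightarrow> 'a \<Rightarrow> real"
 shows "finite K \<Longrightarrow> K \<noteq> {} \<Longrightarrow> (\<And>x. x \<in> K \<Longrightarrow> integrable M (f x)) \<Longrightarrow> integrable M (\<lambda>g. Max ((\<lambda>x. f x g) ` K))"
proof (induction K rule: finite_ne_induct)
 case (insert x F)
 then have "integrable M (\<lambda>g. max (f x g) (Max ((\<lambda>x. f x g) ` F)))" by (intro integrable_max) auto
 then show ?case using insert(1,2) by simp
qed simp

lemma gauss_abs_ip: "has_bochner_integral (gauss n) (\<lambda>g. \<bar>ip n g x\<bar>) (sqrt (2 / pi) * nrm n x)"
proof -
 have "integrable gauss1 (\<lambda>t. \<bar>nrm n x * t\<bar>)" by (intro integrable_abs integrable_mult_right integrable_gauss1_id)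
 moreover have "(\<integral>t. \<bar>nrm n x * t\<bar> \<partial>gauss1) = sqrt (2 / pi) * nrm n x" by (simp add: abs_mult integral_gauss1_abs)
 ultimately show ?thesis
  using integrable_gauss_ip[of abs n x] integral_gauss_ip[of abs n x] by (simp only: has_bochner_integral_iff borel_measurable_abs measurable_ident_sets)
qed

lemma integrable_ip: "integrable (gauss n) (\<lambda>g. ip n g x)"
 using integrable_gauss_ip[of "\<lambda>t. t" n x] by (simp add: integrable_gauss1_id)

text \<open>The number \<open>sqrt (2 / \<pi>) \<parallel>x\<parallel>\<close> is the mean of \<open>|\<langle>g, x\<rangle>|\<close>. Replacing it by an independent copy bounds
 the left-hand side by the average of the expected maxima with \<open>2 |\<langle>g, x\<rangle>|\<close> and with \<open>- 2 |\<langle>g, x\<rangle>|\<close>. Absolute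
 values disappear when both are taken together: for each \<open>g\<close> the sum of the two maxima is at most the sum of
 those with \<open>2 \<langle>g, x\<rangle>\<close> and with \<open>- 2 \<langle>g, x\<rangle>\<close>, in the order decided by the sign at the maximising vector of the
 first, and \<open>g\<close> and \<open>- g\<close> have the same law.\<close>
lemma contraction_principle:
 assumes K: "finite K" "K \<noteq> {}"
 shows "(\<integral>g. Max ((\<lambda>x. a x + sqrt (2 / pi) * nrm n x - \<bar>ip n g x\<bar>) ` K) \<partial>gauss n) \<le>
  (\<integral>g. Max ((\<lambda>x. a x + 2 * ip n g x) ` K) \<partial>gauss n)"
proof -
 interpret P: prob_space "gauss n" by (rule prob_space_gauss)
 let ?A = "\<lambda>s g. Max ((\<lambda>x. a x + s * \<bar>ip n g x\<bar>) ` K)" and ?M = "\<lambda>s g. Max ((\<lambda>x. a x + s * ip n g x) ` K)"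
 define \<nu> :: real where "\<nu> = -2"
 have I: "integrable (gauss n) (?A s)" "integrable (gauss n) (?M s)" for s
  using K gauss_abs_ip[of n] integrable_ip[of n] by (auto intro!: integrable_Max simp: has_bochner_integral_iff)
 have p: "a x + 2 * (sqrt (2 / pi) * nrm n x) \<le> (\<integral>g. ?A 2 g \<partial>gauss n)" if "x \<in> K" for x
 proof -
  have "(\<integral>g. a x + 2 * \<bar>ip n g x\<bar> \<partial>gauss n) \<le> (\<integral>g. ?A 2 g \<partial>gauss n)"
   using gauss_abs_ip[of n x] K that by (intro integral_mono I Max_ge) (auto simp: has_bochner_integral_iff)
  then show ?thesis using gauss_abs_ip[of n x] P.prob_space by (simp add: has_bochner_integral_iff)
 qed
 have "(\<integral>g. Max ((\<lambda>x. a x + sqrt (2 / pi) * nrm n x - \<bar>ip n g x\<bar>) ` K) \<partial>gauss n) \<le> (\<integral>g. (\<integral>g. ?A 2 g \<partial>gauss n) / 2 + ?A \<nu> g / 2 \<partial>gauss n)"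
 proof (rule integral_mono)
  show "integrable (gauss n) (\<lambda>g. Max ((\<lambda>x. a x + sqrt (2 / pi) * nrm n x - \<bar>ip n g x\<bar>) ` K))"
   using K gauss_abs_ip[of n] by (auto intro!: integrable_Max simp: has_bochner_integral_iff)
  show "integrable (gauss n) (\<lambda>g. (\<integral>g. ?A 2 g \<partial>gauss n) / 2 + ?A \<nu> g / 2)" using I by simp
  show "Max ((\<lambda>x. a x + sqrt (2 / pi) * nrm n x - \<bar>ip n g x\<bar>) ` K) \<le> (\<integral>g. ?A 2 g \<partial>gauss n) / 2 + ?A \<nu> g / 2" for g
  proof (subst Max_le_iff)
   have "a x + \<nu> * \<bar>ip n g x\<bar> \<le> ?A \<nu> g" if "x \<in> K" for x using K that by (intro Max_ge) auto
   then show "\<forall>y\<in>(\<lambda>x. a x + sqrt (2 / pi) * nrm n x - \<bar>ip n g x\<bar>) ` K. y \<le> (\<integral>g. ?A 2 g \<partial>gauss n) / 2 + ?A \<nu> g / 2"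
    using p by (fastforce simp: \<nu>_def)
  qed (use K in auto)
 qed
 also have "\<dots> = (\<integral>g. (?A 2 g + ?A \<nu> g) / 2 \<partial>gauss n)" using I P.prob_space by (simp add: add_divide_distrib)
 also have "\<dots> \<le> (\<integral>g. (?M 2 g + ?M \<nu> g) / 2 \<partial>gauss n)"
 proof (rule integral_mono)
  fix g
  have m: "a x + s * ip n g x \<le> ?M s g" if "x \<in> K" for x s using K that by (intro Max_ge) auto
  have "?A 2 g \<in> (\<lambda>x. a x + 2 * \<bar>ip n g x\<bar>) ` K" "?A \<nu> g \<in> (\<lambda>x. a x + \<nu> * \<bar>ip n g x\<bar>) ` K" using K by (auto intro!: Max_in)
  then obtain x y where xy: "x \<in> K" "y \<in> K" "?A 2 g = a x + 2 * \<bar>ip n g x\<bar>" "?A \<nu> g = a y + \<nu> * \<bar>ip n g y\<bar>" by blast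
  show "(?A 2 g + ?A \<nu> g) / 2 \<le> (?M 2 g + ?M \<nu> g) / 2"
   unfolding xy(3,4) using m[OF xy(1), of 2] m[OF xy(1), of \<nu>] m[OF xy(2), of 2] m[OF xy(2), of \<nu>] by (auto simp: abs_if \<nu>_def)
 qed (use I in auto)
 also have "\<dots> = (\<integral>g. ?M 2 g \<partial>gauss n)"
 proof -
  have e: "?M 2 (mix n 0 (-1) z) = ?M \<nu> (snd z)" "?M \<nu> (mix n 0 1 z) = ?M \<nu> (snd z)" for z
   by (simp_all add: ip_mix \<nu>_def)
  have "(\<integral>g. ?M 2 g \<partial>gauss n) = (\<integral>g. ?M \<nu> g \<partial>gauss n)"
   using has_integral_mix[OF _ _ I(2)[of 2], of 0 "-1"] has_integral_mix[OF _ _ I(2)[of \<nu>], of 0 1]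
   unfolding e by (intro has_bochner_integral_eq) auto
  then show ?thesis using I by simp
 qed
 finally show ?thesis .
qed

lemma integrable_gauss_nrm: "integrable (gauss n) (nrm n)" and integral_gauss_nrm_le: "(\<integral>g. nrm n g \<partial>gauss n) \<le> sqrt n"
proof -
 interpret P: prob_space "gauss n" by (rule prob_space_gauss)
 have b: "nrm n g * (2 * sqrt n) \<le> ip n g g + n" for g
  using sum_squares_bound[of "nrm n g" "sqrt n"] by (simp add: nrm_sq)
 have b': "nrm n g \<le> ip n g g + 1" for g
  using sum_squares_bound[of "nrm n g" 1] by (simp add: nrm_sq) (use nrm_nonneg[of n g] in linarith)
 show I: "integrable (gauss n) (nrm n)"
 proof (rule Bochner_Integration.integrable_bound[where f="\<lambda>g. ip n g g + 1"])
  have "norm (nrm n g) \<le> norm (ip n g g + 1)" for g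
   unfolding real_norm_def using b'[of g] nrm_nonneg[of n g] by linarith
  then show "AE g in gauss n. norm (nrm n g) \<le> norm (ip n g g + 1)" by simp
 qed (use integrable_gauss_nrm_sq measurable_gauss_seminorm[OF seminorm_nrm] in auto)
 show "(\<integral>g. nrm n g \<partial>gauss n) \<le> sqrt n"
 proof (cases "n = 0")
  case False
  have "(\<integral>g. nrm n g * (2 * sqrt n) \<partial>gauss n) \<le> (\<integral>g. ip n g g + n \<partial>gauss n)"
   by (rule integral_mono) (use I integrable_gauss_nrm_sq b in auto)
  then have "(\<integral>g. nrm n g \<partial>gauss n) * (2 * sqrt n) \<le> sqrt n * (2 * sqrt n)"
   using integrable_gauss_nrm_sq[of n] integral_gauss_nrm_sq[of n] P.prob_space by simp
  then show ?thesis using False by (simp add: mult_le_cancel_right)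
 qed (simp add: nrm_def ip_def)
qed

text \<open>The first-moment method for one random row \<open>r\<close>: by \<open>contraction_principle\<close> the deficit
 \<open>sqrt (2 / \<pi>) \<parallel>x\<parallel> - |\<langle>r, x\<rangle>|\<close> costs no more than an independent Gaussian term \<open>2 \<langle>r, x\<rangle>\<close>, and
 \<open>t \<langle>g, x\<rangle> + 2 \<langle>r, x\<rangle>\<close> has the law of \<open>sqrt (t\<^sup>2 + 4) \<langle>g, x\<rangle>\<close>. The term \<open>\<kappa> \<parallel>r\<parallel>\<close> keeps the length of the
 row under control.\<close>
lemma gaussian_row:
 assumes K: "finite K" "K \<noteq> {}" and \<kappa>: "0 \<le> \<kappa>" and t: "0 \<le> t"
 shows "\<exists>r. (\<integral>g. Max ((\<lambda>x. a x + sqrt (2 / pi) * nrm n x - \<bar>ip n r x\<bar> + t * ip n g x) ` K) \<partial>gauss n) + \<kappa> * nrm n r \<le>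
  (\<integral>g. Max ((\<lambda>x. a x + sqrt (t\<^sup>2 + 4) * ip n g x) ` K) \<partial>gauss n) + \<kappa> * sqrt n"
proof -
 interpret P: prob_space "gauss n" by (rule prob_space_gauss)
 interpret PP: pair_prob_space "gauss n" "gauss n" by unfold_locales
 let ?H = "\<lambda>z. Max ((\<lambda>x. a x + sqrt (2 / pi) * nrm n x - \<bar>ip n (snd z) x\<bar> + t * ip n (fst z) x) ` K)"
 let ?T = "sqrt (t\<^sup>2 + 4)"
 let ?F = "\<lambda>g. Max ((\<lambda>x. a x + ?T * ip n g x) ` K)"
 have "0 < t\<^sup>2 + 4" by (rule add_nonneg_pos) auto
 then have T: "0 < ?T" "(t / ?T)\<^sup>2 + (2 / ?T)\<^sup>2 = 1" "0 \<le> t / ?T"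
  using t by (auto simp: power_divide add_divide_distrib[symmetric])
 have i: "integrable (gauss n \<Otimes>\<^sub>M gauss n) (\<lambda>z. ip n (fst z) x)" "integrable (gauss n \<Otimes>\<^sub>M gauss n) (\<lambda>z. ip n (snd z) x)" for x
  using has_integral_mix[OF _ _ integrable_ip[of n x], of 1 0] has_integral_mix[OF _ _ integrable_ip[of n x], of 0 1]
  by (simp_all add: ip_mix has_bochner_integral_iff)
 then have IH: "integrable (gauss n \<Otimes>\<^sub>M gauss n) ?H" using K by (intro integrable_Max) auto
 have IF: "integrable (gauss n) ?F" using K integrable_ip by (intro integrable_Max) auto
 note M = has_integral_mix[OF T(2,3) IF]
 have e: "?F (mix n (t / ?T) (2 / ?T) z) = Max ((\<lambda>x. a x + t * ip n (fst z) x + 2 * ip n (snd z) x) ` K)" for z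
  using T(1) by (intro arg_cong[of _ _ Max] image_cong) (auto simp: ip_mix field_simps)
 have "(\<integral>r. (\<integral>g. ?H (g, r) \<partial>gauss n) \<partial>gauss n) = (\<integral>g. (\<integral>r. ?H (g, r) \<partial>gauss n) \<partial>gauss n)"
  using PP.Fubini_integral[of "\<lambda>g r. ?H (g, r)"] IH by (simp add: case_prod_unfold)
 also have "\<dots> \<le> (\<integral>g. (\<integral>r. ?F (mix n (t / ?T) (2 / ?T) (g, r)) \<partial>gauss n) \<partial>gauss n)"
 proof (rule integral_mono)
  show "integrable (gauss n) (\<lambda>g. \<integral>r. ?H (g, r) \<partial>gauss n)" by (rule PP.integrable_fst'[OF IH])
  show "integrable (gauss n) (\<lambda>g. \<integral>r. ?F (mix n (t / ?T) (2 / ?T) (g, r)) \<partial>gauss n)"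
   using M by (intro PP.integrable_fst') (simp add: has_bochner_integral_iff)
  show "(\<integral>r. ?H (g, r) \<partial>gauss n) \<le> (\<integral>r. ?F (mix n (t / ?T) (2 / ?T) (g, r)) \<partial>gauss n)" for g
   unfolding e using contraction_principle[OF K, where a="\<lambda>x. a x + t * ip n g x" and n=n] by (simp add: algebra_simps)
 qed
 also have "\<dots> = (\<integral>g. ?F g \<partial>gauss n)"
  using PP.integral_fst'[of "\<lambda>z. ?F (mix n (t / ?T) (2 / ?T) z)"] M by (simp add: has_bochner_integral_iff)
 finally have le: "(\<integral>r. (\<integral>g. ?H (g, r) \<partial>gauss n) \<partial>gauss n) \<le> (\<integral>g. ?F g \<partial>gauss n)" .
 let ?G = "\<lambda>r. (\<integral>g. ?H (g, r) \<partial>gauss n) + \<kappa> * nrm n r"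
 have I: "integrable (gauss n) (\<lambda>r. \<integral>g. ?H (g, r) \<partial>gauss n)"
  using PP.integrable_snd[of "\<lambda>g r. ?H (g, r)"] IH by (simp add: case_prod_unfold)
 have G: "(\<integral>r. ?G r \<partial>gauss n) \<le> (\<integral>g. ?F g \<partial>gauss n) + \<kappa> * sqrt n"
  using I integrable_gauss_nrm le mult_left_mono[OF integral_gauss_nrm_le[of n] \<kappa>] by simp
 have "\<exists>r. ?G r \<le> (\<integral>g. ?F g \<partial>gauss n) + \<kappa> * sqrt n"
 proof (rule ccontr)
  assume "\<nexists>r. ?G r \<le> (\<integral>g. ?F g \<partial>gauss n) + \<kappa> * sqrt n"
  then have "\<And>r. (\<integral>g. ?F g \<partial>gauss n) + \<kappa> * sqrt n < ?G r" by (auto simp: not_le)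
  then have "(\<integral>g. ?F g \<partial>gauss n) + \<kappa> * sqrt n < (\<integral>r. ?G r \<partial>gauss n)"
   using I integrable_gauss_nrm by (intro P.expectation_greater) auto
  then show False using G by linarith
 qed
 then show ?thesis by simp
qed

text \<open>The variances of successive rows add up, so that \<open>k\<close> rows cost the mean width \<open>2 sqrt k\<close> times, while
 each of them contributes \<open>\<parallel>x\<parallel>\<close> on the left.\<close>
lemma gaussian_rows:
 assumes K: "finite K" "K \<noteq> {}" and \<kappa>: "0 \<le> \<kappa>"
 shows "\<exists>r. (\<forall>x\<in>K. a x + real k * (sqrt (2 / pi) * nrm n x) - (\<Sum>i<k. \<bar>ip n (r i) x\<bar>) + \<kappa> * (\<Sum>i<k. nrm n (r i)) \<le>
  (\<integral>g. Max ((\<lambda>x. a x + 2 * sqrt k * ip n g x) ` K) \<partial>gauss n) + k * (\<kappa> * sqrt n))"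
proof (induction k arbitrary: a)
 case 0
 interpret P: prob_space "gauss n" by (rule prob_space_gauss)
 show ?case using K P.prob_space by simp
next
 case (Suc k)
 let ?c = "sqrt (2 / pi)"
 have "sqrt ((2 * sqrt (real k))\<^sup>2 + 4) = 2 * sqrt (real (Suc k))"
  by (rule real_sqrt_unique) (auto simp: power_mult_distrib algebra_simps)
 with gaussian_row[OF K \<kappa>, where t="2 * sqrt k" and a=a and n=n] obtain r0 where
  r0: "(\<integral>g. Max ((\<lambda>x. a x + ?c * nrm n x - \<bar>ip n r0 x\<bar> + 2 * sqrt k * ip n g x) ` K) \<partial>gauss n) + \<kappa> * nrm n r0 \<le>
   (\<integral>g. Max ((\<lambda>x. a x + 2 * sqrt (Suc k) * ip n g x) ` K) \<partial>gauss n) + \<kappa> * sqrt n" by auto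
 obtain r where r: "\<forall>x\<in>K. (a x + ?c * nrm n x - \<bar>ip n r0 x\<bar>) + real k * (?c * nrm n x) - (\<Sum>i<k. \<bar>ip n (r i) x\<bar>) + \<kappa> * (\<Sum>i<k. nrm n (r i)) \<le>
  (\<integral>g. Max ((\<lambda>x. a x + ?c * nrm n x - \<bar>ip n r0 x\<bar> + 2 * sqrt k * ip n g x) ` K) \<partial>gauss n) + k * (\<kappa> * sqrt n)"
  using Suc[of "\<lambda>x. a x + ?c * nrm n x - \<bar>ip n r0 x\<bar>"] by blast
 have s: "(\<Sum>i<Suc k. h ((r(k := r0)) i)) = (\<Sum>i<k. h (r i)) + h r0" for h :: "(nat \<Rightarrow> real) \<Rightarrow> real" by simp
 show ?case
  by (rule exI[of _ "r(k := r0)"], unfold s[of "\<lambda>v. \<bar>ip n v _\<bar>"] s[of "nrm n"]) (use r r0 in \<open>fastforce simp: algebra_simps\<close>)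
qed

text \<open>The low \<open>M\<^sup>*\<close> estimate: sections by random subspaces of codimension \<open>k\<close> of a set of mean width
 \<open>w\<close> have radius of order \<open>w / sqrt k\<close>. On the section the inner products with the rows vanish, and
 only \<open>k \<parallel>x\<parallel> \<le> O(sqrt k) w\<close> is left of \<open>gaussian_rows\<close>. The set is given by a finite \<open>\<kappa>\<close>-net \<open>K\<close>.\<close>
lemma section_of_small_mean_width:
 fixes k :: nat
 assumes K: "finite K" "K \<noteq> {}" and w: "(\<integral>g. Max ((\<lambda>q. \<bar>ip n g q\<bar>) ` K) \<partial>gauss n) \<le> w" and k: "0 < k" and \<kappa>: "0 \<le> \<kappa>"
 shows "\<exists>r. \<forall>y. (\<forall>i<k. ip n (r i) y = 0) \<longrightarrow> (\<exists>q\<in>K. nrm n (\<lambda>i. y i - q i) \<le> \<kappa>) \<longrightarrow>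
  sqrt (2 / pi) * nrm n y \<le> 2 * w / sqrt k + \<kappa> * sqrt n + \<kappa>"
proof -
 interpret P: prob_space "gauss n" by (rule prob_space_gauss)
 let ?c = "sqrt (2 / pi)"
 have c: "0 \<le> ?c" "?c \<le> 1" using pi_ge_two by (auto simp: divide_le_eq)
 have I: "integrable (gauss n) (\<lambda>g. Max ((\<lambda>q. \<bar>ip n g q\<bar>) ` K))" using K gauss_abs_ip[of n] by (auto intro!: integrable_Max simp: has_bochner_integral_iff)
 have "(\<integral>g. Max ((\<lambda>x. 0 + 2 * sqrt k * ip n g x) ` K) \<partial>gauss n) \<le> (\<integral>g. 2 * sqrt k * Max ((\<lambda>q. \<bar>ip n g q\<bar>) ` K) \<partial>gauss n)"
 proof (rule integral_mono)
  show "integrable (gauss n) (\<lambda>g. Max ((\<lambda>x. 0 + 2 * sqrt k * ip n g x) ` K))" using K integrable_ip by (intro integrable_Max) auto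
  fix g
  have "ip n g x \<le> Max ((\<lambda>q. \<bar>ip n g q\<bar>) ` K)" if "x \<in> K" for x
   by (rule order.trans[OF abs_ge_self]) (use K that in \<open>simp add: Max_ge\<close>)
  then show "Max ((\<lambda>x. 0 + 2 * sqrt k * ip n g x) ` K) \<le> 2 * sqrt k * Max ((\<lambda>q. \<bar>ip n g q\<bar>) ` K)" using K by (auto simp: mult_left_mono)
 qed (use I in simp)
 also have "\<dots> \<le> 2 * sqrt k * w" using mult_left_mono[OF w, of "2 * sqrt k"] by simp
 finally have m: "(\<integral>g. Max ((\<lambda>x. 0 + 2 * sqrt k * ip n g x) ` K) \<partial>gauss n) \<le> 2 * sqrt k * w" .
 obtain r where r: "\<And>x. x \<in> K \<Longrightarrow> 0 + real k * (?c * nrm n x) - (\<Sum>i<k. \<bar>ip n (r i) x\<bar>) + \<kappa> * (\<Sum>i<k. nrm n (r i)) \<le>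
  (\<integral>g. Max ((\<lambda>x. 0 + 2 * sqrt k * ip n g x) ` K) \<partial>gauss n) + k * (\<kappa> * sqrt n)"
  using gaussian_rows[OF K \<kappa>, where a="\<lambda>_. 0" and k=k and n=n] by blast
 show ?thesis
 proof (intro exI[of _ r] allI impI)
  fix y assume y: "\<forall>i<k. ip n (r i) y = 0" and "\<exists>q\<in>K. nrm n (\<lambda>i. y i - q i) \<le> \<kappa>"
  then obtain q where q: "q \<in> K" "nrm n (\<lambda>i. y i - q i) \<le> \<kappa>" by blast
  have "(\<Sum>i<k. \<bar>ip n (r i) q\<bar>) \<le> (\<Sum>i<k. nrm n (r i) * \<kappa>)"
  proof (rule sum_mono)
   fix i assume "i \<in> {..<k}"
   then have "\<bar>ip n (r i) q\<bar> = \<bar>ip n (r i) (\<lambda>i. y i - q i)\<bar>" using y by (simp add: ip_diff_right)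
   also have "\<dots> \<le> nrm n (r i) * nrm n (\<lambda>i. y i - q i)" by (rule ip_le_nrm)
   also have "\<dots> \<le> nrm n (r i) * \<kappa>" using q(2) by (intro mult_left_mono) auto
   finally show "\<bar>ip n (r i) q\<bar> \<le> nrm n (r i) * \<kappa>" .
  qed
  then have "real k * (?c * nrm n q) \<le> 2 * sqrt k * w + k * (\<kappa> * sqrt n)"
   using r[OF q(1)] m by (simp add: sum_distrib_left mult.commute)
  also have "\<dots> = real k * (2 * w / sqrt k + \<kappa> * sqrt n)" using k by (simp add: field_simps)
  finally have b: "?c * nrm n q \<le> 2 * w / sqrt k + \<kappa> * sqrt n" using k by simp
  have "nrm n y \<le> nrm n q + \<kappa>" using nrm_triangle[of n q "\<lambda>i. y i - q i"] q(2) by simp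
  from mult_left_mono[OF this c(1)] have "?c * nrm n y \<le> ?c * nrm n q + ?c * \<kappa>" by (simp add: distrib_left)
  moreover have "?c * \<kappa> \<le> \<kappa>" using c \<kappa> by (intro mult_left_le_one_le) auto
  ultimately show "?c * nrm n y \<le> 2 * w / sqrt k + \<kappa> * sqrt n + \<kappa>" using b by linarith
 qed
qed

section \<open>The Mehler kernel\<close>

text \<open>The Mehler kernel is the integral kernel, with respect to the Gaussian measure, of the operator that multiplies Hermite
 polynomials of degree \<open>k\<close> by \<open>s\<^sup>k\<close>. That it contracts by \<open>s\<^sup>2\<close> on the complement of degrees \<open>0\<close> and \<open>1\<close>
 can be read off the semigroup property and the trace of the kernel, without Hermite expansions.\<close>

definition mehler :: "real \<Rightarrow> real \<Rightarrow> real \<Rightarrow> real" where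
 "mehler s x y = exp (- (s\<^sup>2 * x\<^sup>2 + s\<^sup>2 * y\<^sup>2 - 2 * s * x * y) / (2 * (1 - s\<^sup>2))) / sqrt (1 - s\<^sup>2)"

definition mehler_kernel :: "nat \<Rightarrow> real \<Rightarrow> (nat \<Rightarrow> real) \<Rightarrow> (nat \<Rightarrow> real) \<Rightarrow> real" where
 "mehler_kernel n s x y = (\<Prod>i<n. mehler s (x i) (y i))"

text \<open>What remains of the kernel after its components on the constants and on the linear functions
 are removed.\<close>
definition mehler_rest :: "nat \<Rightarrow> real \<Rightarrow> (nat \<Rightarrow> real) \<Rightarrow> (nat \<Rightarrow> real) \<Rightarrow> real" where
 "mehler_rest n s x y = mehler_kernel n s x y - 1 - s * ip n x y"

lemma mehler_nonneg: "s\<^sup>2 < 1 \<Longrightarrow> 0 \<le> mehler s x y"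
 by (simp add: mehler_def)

lemma mehler_commute: "mehler s x y = mehler s y x"
 by (simp add: mehler_def algebra_simps)

lemma mehler_rest_commute: "mehler_rest n s x y = mehler_rest n s y x"
 by (simp add: mehler_rest_def mehler_kernel_def mehler_commute[of s "x _"] ip_commute[of n x])

lemma integral_gauss1_density:
 fixes f :: "real \<Rightarrow> real"
 assumes "f \<in> borel_measurable borel"
 shows "integrable gauss1 f \<longleftrightarrow> integrable lborel (\<lambda>y. std_normal_density y * f y)"
  "(\<integral>y. f y \<partial>gauss1) = (\<integral>y. std_normal_density y * f y \<partial>lborel)"
 using assms by (simp_all add: integrable_density integral_density)

lemma mehler_moments:
 assumes s: "s\<^sup>2 < 1"
 shows "has_bochner_integral gauss1 (\<lambda>y. mehler s x y) 1"
  "has_bochner_integral gauss1 (\<lambda>y. y * mehler s x y) (s * x)"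
proof -
 have m: "(\<lambda>y. mehler s x y) \<in> borel_measurable borel" unfolding mehler_def by measurable
 note [measurable] = m
 have p: "0 < sqrt (1 - s\<^sup>2)" using s by simp
 have e: "- (y - s * x)\<^sup>2 / (2 * (sqrt (1 - s\<^sup>2))\<^sup>2) =
  - y\<^sup>2 / 2 + - (s\<^sup>2 * x\<^sup>2 + s\<^sup>2 * y\<^sup>2 - 2 * s * x * y) / (2 * (1 - s\<^sup>2))" for y
  using s by (simp add: field_simps power2_eq_square)
 have d: "std_normal_density y * mehler s x y = normal_density (s * x) (sqrt (1 - s\<^sup>2)) y" for y
  unfolding normal_density_def e exp_add mehler_def using s
  by (simp add: std_normal_density_def real_sqrt_mult)
 have d': "std_normal_density y * (y * mehler s x y) = normal_density (s * x) (sqrt (1 - s\<^sup>2)) y * y" for y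
  using d[of y] by (simp add: mult_ac)
 show "has_bochner_integral gauss1 (\<lambda>y. mehler s x y) 1"
  by (simp add: has_bochner_integral_iff integral_gauss1_density d integrable_normal_density[OF p] integral_normal_density[OF p])
 show "has_bochner_integral gauss1 (\<lambda>y. y * mehler s x y) (s * x)"
  using integrable_normal_moment_nz_1[OF p, of "s * x"] integral_normal_moment_nz_1[OF p, of "s * x"]
  by (simp add: has_bochner_integral_iff integral_gauss1_density d')
qed

text \<open>By completing the square; the kernels form a semigroup in \<open>- log s\<close>.\<close>
lemma mehler_comp:
 assumes s: "s\<^sup>2 < 1"
 shows "has_bochner_integral gauss1 (\<lambda>z. mehler s x z * mehler s y z) (mehler (s\<^sup>2) x y)"
proof -
 define a where "a = 1 - s\<^sup>2"
 define e where "e = 1 + s\<^sup>2"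
 define \<mu> where "\<mu> = s * (x + y) / e"
 define \<sigma> where "\<sigma> = sqrt (a / e)"
 have ae: "0 < a" "0 < e" "1 - (s\<^sup>2)\<^sup>2 = a * e"
  using s by (auto simp: a_def e_def add_pos_nonneg algebra_simps power2_eq_square)
 have \<sigma>: "0 < \<sigma>" "\<sigma>\<^sup>2 = a / e" using ae by (auto simp: \<sigma>_def)
 have d: "std_normal_density z * (mehler s x z * mehler s y z) = mehler (s\<^sup>2) x y * normal_density \<mu> \<sigma> z" for z
 proof -
  have p: "a * e * z\<^sup>2 + e * (2 * s\<^sup>2 * z\<^sup>2 + s\<^sup>2 * (x\<^sup>2 + y\<^sup>2) - 2 * s * z * (x + y)) =
   (s\<^sup>2)\<^sup>2 * x\<^sup>2 + (s\<^sup>2)\<^sup>2 * y\<^sup>2 - 2 * s\<^sup>2 * x * y + (e * z - s * (x + y))\<^sup>2"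
   by (simp add: a_def e_def power2_eq_square algebra_simps)
  have "- z\<^sup>2 / 2 + (- (s\<^sup>2 * z\<^sup>2 + s\<^sup>2 * x\<^sup>2 - 2 * s * z * x) / (2 * a) + - (s\<^sup>2 * z\<^sup>2 + s\<^sup>2 * y\<^sup>2 - 2 * s * z * y) / (2 * a))
   = - (a * e * z\<^sup>2 + e * (2 * s\<^sup>2 * z\<^sup>2 + s\<^sup>2 * (x\<^sup>2 + y\<^sup>2) - 2 * s * z * (x + y))) / (2 * (a * e))"
   using ae by (simp add: field_simps)
  also have "\<dots> = - ((s\<^sup>2)\<^sup>2 * x\<^sup>2 + (s\<^sup>2)\<^sup>2 * y\<^sup>2 - 2 * s\<^sup>2 * x * y) / (2 * (a * e)) + - (z - \<mu>)\<^sup>2 / (2 * \<sigma>\<^sup>2)"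
  proof -
   have "(z - \<mu>)\<^sup>2 / (2 * \<sigma>\<^sup>2) = (e * z - s * (x + y))\<^sup>2 / (2 * (a * e))"
    using ae(1,2) unfolding \<sigma> \<mu>_def by (simp add: power2_eq_square field_simps)
   then show ?thesis unfolding p minus_divide_left[symmetric] add_divide_distrib by simp
  qed
  finally have E: "exp (- z\<^sup>2 / 2) * (exp (- (s\<^sup>2 * z\<^sup>2 + s\<^sup>2 * x\<^sup>2 - 2 * s * z * x) / (2 * a)) * exp (- (s\<^sup>2 * z\<^sup>2 + s\<^sup>2 * y\<^sup>2 - 2 * s * z * y) / (2 * a)))
   = exp (- ((s\<^sup>2)\<^sup>2 * x\<^sup>2 + (s\<^sup>2)\<^sup>2 * y\<^sup>2 - 2 * s\<^sup>2 * x * y) / (2 * (a * e))) * exp (- (z - \<mu>)\<^sup>2 / (2 * \<sigma>\<^sup>2))"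
   by (simp only: exp_add[symmetric])
  have "sqrt (2 * pi) * (sqrt a * sqrt a) = sqrt (a * e) * sqrt (2 * pi * \<sigma>\<^sup>2)"
   using ae unfolding \<sigma> by (simp add: real_sqrt_mult real_sqrt_divide)
  then show ?thesis
   unfolding mehler_commute[of s x z] mehler_commute[of s y z] unfolding std_normal_density_def mehler_def ae(3) a_def[symmetric] unfolding normal_density_def
   by (simp only: times_divide_times_eq times_divide_eq_left times_divide_eq_right mult_1 divide_divide_eq_left E)
 qed
 have m: "(\<lambda>z. mehler s x z * mehler s y z) \<in> borel_measurable borel" unfolding mehler_def by measurable
 show ?thesis
  by (simp add: has_bochner_integral_iff integral_gauss1_density[OF m] d integrable_normal_density[OF \<sigma>(1)] integral_normal_density[OF \<sigma>(1)])
qed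

text \<open>In terms of the eigenvalues \<open>s\<^sup>2\<^sup>k\<close> this trace is a geometric series. It equals the squared Hilbert--Schmidt
 norm of the kernel with parameter \<open>s\<close>.\<close>
lemma mehler_trace:
 assumes "s\<^sup>2 < 1" shows "has_bochner_integral gauss1 (\<lambda>x. mehler (s\<^sup>2) x x) (1 / (1 - s\<^sup>2))"
proof -
 define q where "q = s\<^sup>2"
 have q: "0 \<le> q" "0 < 1 - q" "0 < 1 + q" "1 - q\<^sup>2 = (1 - q) * (1 + q)" using assms by (auto simp: q_def power2_eq_square algebra_simps add_pos_nonneg)
 define \<sigma> where "\<sigma> = sqrt ((1 + q) / (1 - q))"
 have \<sigma>: "0 < \<sigma>" "\<sigma>\<^sup>2 = (1 + q) / (1 - q)" using q by (auto simp: \<sigma>_def)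
 have d: "std_normal_density x * mehler q x x = 1 / (1 - q) * normal_density 0 \<sigma> x" for x
 proof -
  have n: "- (q\<^sup>2 * x\<^sup>2 + q\<^sup>2 * x\<^sup>2 - 2 * q * x * x) = (1 - q) * (2 * (q * x\<^sup>2))" by (simp add: power2_eq_square algebra_simps)
  have "- x\<^sup>2 / 2 + - (q\<^sup>2 * x\<^sup>2 + q\<^sup>2 * x\<^sup>2 - 2 * q * x * x) / (2 * ((1 - q) * (1 + q))) = - x\<^sup>2 / 2 + q * x\<^sup>2 / (1 + q)"
   unfolding n using q(2,3) by (simp add: mult.left_commute[of 2]) (simp add: field_simps)
  also have "\<dots> = - (x - 0)\<^sup>2 / (2 * \<sigma>\<^sup>2)" using q(2,3) unfolding \<sigma> by (simp add: field_simps)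
  finally have E: "exp (- x\<^sup>2 / 2) * exp (- (q\<^sup>2 * x\<^sup>2 + q\<^sup>2 * x\<^sup>2 - 2 * q * x * x) / (2 * ((1 - q) * (1 + q)))) = exp (- (x - 0)\<^sup>2 / (2 * \<sigma>\<^sup>2))"
   by (simp only: exp_add[symmetric])
  have "2 * pi * ((1 - q) * (1 + q)) = (1 - q)\<^sup>2 * (2 * pi * \<sigma>\<^sup>2)"
   using q(2) unfolding \<sigma> by (simp add: power2_eq_square)
  then have "sqrt (2 * pi) * sqrt ((1 - q) * (1 + q)) = (1 - q) * sqrt (2 * pi * \<sigma>\<^sup>2)"
   using q(2) unfolding real_sqrt_mult[symmetric] by (simp only: real_sqrt_mult[of "_\<^sup>2"]) simp
  then show ?thesis
   unfolding std_normal_density_def mehler_def q(4) unfolding normal_density_def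
   by (simp only: times_divide_times_eq times_divide_eq_left times_divide_eq_right mult_1 divide_divide_eq_left E)
 qed
 have m: "(\<lambda>x. mehler q x x) \<in> borel_measurable borel" unfolding mehler_def by measurable
 show ?thesis unfolding q_def[symmetric]
  by (simp add: has_bochner_integral_iff integral_gauss1_density[OF m] d integrable_normal_density[OF \<sigma>(1)] integral_normal_density[OF \<sigma>(1)])
qed

lemma has_bochner_integral_gauss_prod:
 fixes f :: "nat \<Rightarrow> real \<Rightarrow> real"
 assumes "\<And>i. i < n \<Longrightarrow> has_bochner_integral gauss1 (f i) (c i)"
 shows "has_bochner_integral (gauss n) (\<lambda>x. \<Prod>i<n. f i (x i)) (\<Prod>i<n. c i)"
 using assms product_sigma_finite.product_integrable_prod[OF product_sigma_finite_gauss1, of "{..<n}" f]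
  product_sigma_finite.product_integral_prod[OF product_sigma_finite_gauss1, of "{..<n}" f]
 by (simp add: has_bochner_integral_iff gauss_def)

lemma has_bochner_integral_gauss_const: "has_bochner_integral (gauss n) (\<lambda>_. c) (c::real)"
proof -
 interpret prob_space "gauss n" by (rule prob_space_gauss)
 show ?thesis by (simp add: has_bochner_integral_iff prob_space)
qed

lemma mehler_kernel_moments:
 assumes s: "s\<^sup>2 < 1"
 shows "has_bochner_integral (gauss n) (mehler_kernel n s x) 1"
  "has_bochner_integral (gauss n) (\<lambda>y. mehler_kernel n s x y * ip n y z) (s * ip n x z)"
  "has_bochner_integral (gauss n) (\<lambda>z. mehler_kernel n s x z * mehler_kernel n s y z) (mehler_kernel n (s\<^sup>2) x y)"
  "has_bochner_integral (gauss n) (\<lambda>x. mehler_kernel n (s\<^sup>2) x x) ((1 / (1 - s\<^sup>2)) ^ n)"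
proof -
 show "has_bochner_integral (gauss n) (mehler_kernel n s x) 1"
  using has_bochner_integral_gauss_prod[OF mehler_moments(1)[OF s], of n x] by (simp add: mehler_kernel_def[abs_def])
 have "has_bochner_integral (gauss n) (\<lambda>y. mehler_kernel n s x y * y i) (s * x i)" if i: "i < n" for i
 proof -
  have p: "(\<Prod>k<n. (if k = i then a k else 1) * b k) = (\<Prod>k<n. b k) * a i" for a b :: "nat \<Rightarrow> real"
   using i by (simp add: prod.distrib)
  have "has_bochner_integral (gauss n) (\<lambda>y. \<Prod>k<n. (if k = i then y k else 1) * mehler s (x k) (y k))
   (\<Prod>k<n. (if k = i then s * x k else 1) * 1)"
   by (rule has_bochner_integral_gauss_prod) (use mehler_moments[OF s] in auto)
  then show ?thesis unfolding p by (simp add: mehler_kernel_def)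
 qed
 then have "has_bochner_integral (gauss n) (\<lambda>y. \<Sum>i<n. mehler_kernel n s x y * y i * z i) (\<Sum>i<n. s * x i * z i)"
  by (intro has_bochner_integral_sum has_bochner_integral_mult_left) auto
 then show "has_bochner_integral (gauss n) (\<lambda>y. mehler_kernel n s x y * ip n y z) (s * ip n x z)"
  by (simp add: ip_def sum_distrib_left mult.assoc)
 show "has_bochner_integral (gauss n) (\<lambda>z. mehler_kernel n s x z * mehler_kernel n s y z) (mehler_kernel n (s\<^sup>2) x y)"
  unfolding mehler_kernel_def prod.distrib[symmetric]
  by (rule has_bochner_integral_gauss_prod[of n "\<lambda>i z. mehler s (x i) z * mehler s (y i) z"]) (rule mehler_comp[OF s])
 show "has_bochner_integral (gauss n) (\<lambda>x. mehler_kernel n (s\<^sup>2) x x) ((1 / (1 - s\<^sup>2)) ^ n)"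
  using has_bochner_integral_gauss_prod[of n "\<lambda>i z. mehler (s\<^sup>2) z z", OF mehler_trace[OF s]] by (simp add: mehler_kernel_def)
qed

lemma has_bochner_integral_ip:
 "has_bochner_integral (gauss n) (\<lambda>z. ip n z x) 0" "has_bochner_integral (gauss n) (\<lambda>z. ip n z x * ip n z y) (ip n x y)"
 using integrable_gauss_ip[of "\<lambda>t. t" n x] integral_gauss_ip[of "\<lambda>t. t" n x] integrable_gauss_ip_mult[of n x y] integral_gauss_ip_mult[of n x y]
 by (simp_all add: has_bochner_integral_iff gauss1_moments)

lemma mehler_rest_comp:
 assumes s: "s\<^sup>2 < 1"
 shows "has_bochner_integral (gauss n) (\<lambda>z. mehler_rest n s x z * mehler_rest n s y z) (mehler_rest n (s\<^sup>2) x y)"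
proof -
 let ?K = "mehler_kernel n s"
 have e: "mehler_rest n s x z * mehler_rest n s y z = ?K x z * ?K y z - ?K x z - ?K y z - s * (?K x z * ip n z y)
  - s * (?K y z * ip n z x) + 1 + s * ip n z x + s * ip n z y + s\<^sup>2 * (ip n z x * ip n z y)" for z
  unfolding mehler_rest_def ip_commute[of n _ z] by (simp add: power2_eq_square algebra_simps)
 have "has_bochner_integral (gauss n) (\<lambda>z. mehler_rest n s x z * mehler_rest n s y z)
  (mehler_kernel n (s\<^sup>2) x y - 1 - 1 - s * (s * ip n x y) - s * (s * ip n y x) + 1 + s * 0 + s * 0 + s\<^sup>2 * ip n x y)"
  unfolding e by (intro has_bochner_integral_add has_bochner_integral_diff has_bochner_integral_mult_right has_bochner_integral_gauss_const mehler_kernel_moments[OF s] has_bochner_integral_ip)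
 then show ?thesis by (simp add: mehler_rest_def ip_commute[of n y] power2_eq_square algebra_simps)
qed

text \<open>The trace of the \<open>n\<close>-dimensional kernel to second order in \<open>q = s\<^sup>2\<close>: after removal of degrees \<open>0\<close> and \<open>1\<close> it is
 \<open>O(q\<^sup>2)\<close>. The constant grows with \<open>n\<close>, which is harmless because the argument by
 \<open>quadratic_bound_of_square_bound\<close> forgets it.\<close>
lemma power_inverse_le: "\<exists>C\<ge>0. \<forall>q. 0 \<le> q \<and> q \<le> 1 / 2 \<longrightarrow> (1 / (1 - q)) ^ n \<le> 1 + q * real n + C * q\<^sup>2"
proof (induction n)
 case (Suc n)
 then obtain C where C: "C \<ge> 0" "\<And>q. 0 \<le> q \<Longrightarrow> q \<le> 1 / 2 \<Longrightarrow> (1 / (1 - q)) ^ n \<le> 1 + q * real n + C * q\<^sup>2" by auto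
 have "(1 / (1 - q)) ^ Suc n \<le> 1 + q * real (Suc n) + (2 + 2 * real n + 2 * C) * q\<^sup>2" if q: "0 \<le> q" "q \<le> 1 / 2" for q
 proof -
  have "q * (q * q) \<le> q * (q * (1/2))" using q by (intro mult_left_mono) auto
  then have i: "1 / (1 - q) \<le> 1 + q + 2 * q\<^sup>2" using q by (simp add: divide_le_eq algebra_simps power2_eq_square)
  have h: "1 / (1 - q) \<le> 2" using q by (simp add: divide_le_eq)
  have "(1 / (1 - q)) ^ Suc n \<le> (1 + q * real n + C * q\<^sup>2) * (1 / (1 - q))"
   using mult_right_mono[OF C(2)[OF q], of "1 / (1 - q)"] q by (simp add: mult.commute)
  also have "\<dots> = 1 / (1 - q) + q * real n * (1 / (1 - q)) + C * q\<^sup>2 * (1 / (1 - q))" by (simp only: distrib_right mult_1)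
  also have "\<dots> \<le> (1 + q + 2 * q\<^sup>2) + q * real n * (1 + 2 * q) + C * q\<^sup>2 * 2"
  proof (intro add_mono mult_left_mono i h)
   have "2 * q * q \<le> q" using q by (intro mult_left_le_one_le) auto
   then show "1 / (1 - q) \<le> 1 + 2 * q" using q by (simp add: divide_le_eq algebra_simps)
  qed (use q C(1) in auto)
  finally show ?thesis by (simp add: algebra_simps power2_eq_square)
 qed
 then show ?case using C(1) by (intro exI[of _ "2 + 2 * real n + 2 * C"]) auto
qed (auto intro: exI[of _ 0])

lemma mehler_rest_trace:
 assumes s: "s\<^sup>2 < 1"
 shows "has_bochner_integral (gauss n) (\<lambda>x. mehler_rest n (s\<^sup>2) x x) ((1 / (1 - s\<^sup>2)) ^ n - 1 - s\<^sup>2 * real n)"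
proof -
 have "has_bochner_integral (gauss n) (\<lambda>x. ip n x x) (real n)"
  by (simp add: has_bochner_integral_iff integrable_gauss_nrm_sq integral_gauss_nrm_sq)
 then show ?thesis unfolding mehler_rest_def
  by (intro has_bochner_integral_diff has_bochner_integral_mult_right has_bochner_integral_gauss_const mehler_kernel_moments(4)[OF s])
qed

section \<open>Square integrable functions\<close>

definition L2 :: "'b measure \<Rightarrow> ('b \<Rightarrow> real) \<Rightarrow> bool" where
 "L2 M f \<longleftrightarrow> f \<in> borel_measurable M \<and> integrable M (\<lambda>x. (f x)\<^sup>2)"

lemma abs_mult_le_sum_squares: "\<bar>a * b\<bar> \<le> a\<^sup>2 + b\<^sup>2" for a b :: real
 using sum_squares_bound[of "\<bar>a\<bar>" "\<bar>b\<bar>"] abs_ge_zero[of "a * b"] unfolding abs_mult power2_abs by linarith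

lemma L2_integrable_mult:
 assumes "L2 M f" "L2 M g" shows "integrable M (\<lambda>x. f x * g x)"
proof (rule Bochner_Integration.integrable_bound[where f="\<lambda>x. (f x)\<^sup>2 + (g x)\<^sup>2"])
 show "AE x in M. norm (f x * g x) \<le> norm ((f x)\<^sup>2 + (g x)\<^sup>2)"
  by (auto intro!: AE_I2 order.trans[OF _ abs_ge_self] abs_mult_le_sum_squares)
qed (use assms in \<open>auto simp: L2_def\<close>)

lemma L2_cauchy_schwarz:
 assumes fg: "L2 M f" "L2 M g"
 shows "(\<integral>x. f x * g x \<partial>M)\<^sup>2 \<le> (\<integral>x. (f x)\<^sup>2 \<partial>M) * (\<integral>x. (g x)\<^sup>2 \<partial>M)"
proof -
 let ?F = "\<integral>x. (f x)\<^sup>2 \<partial>M" and ?G = "\<integral>x. (g x)\<^sup>2 \<partial>M" and ?P = "\<integral>x. f x * g x \<partial>M"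
 have q: "0 \<le> ?F - 2 * c * ?P + c\<^sup>2 * ?G" for c
 proof -
  have e: "(f x - c * g x)\<^sup>2 = (f x)\<^sup>2 - 2 * c * (f x * g x) + c\<^sup>2 * (g x)\<^sup>2" for x
   by (simp add: power2_eq_square algebra_simps)
  have "0 \<le> (\<integral>x. (f x - c * g x)\<^sup>2 \<partial>M)" by simp
  also have "\<dots> = ?F - 2 * c * ?P + c\<^sup>2 * ?G" unfolding e using fg L2_integrable_mult[OF fg] by (simp add: L2_def)
  finally show ?thesis .
 qed
 show ?thesis
 proof (cases "?G = 0")
  case True
  have "?P = 0"
   using q[of "(?F + 1) / (2 * ?P)"] True by (cases "?P = 0") (auto simp: field_simps)
  then show ?thesis using True by simp
 next
  case False
  then have "0 < ?G" by (simp add: less_le)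
  moreover have "?P\<^sup>2 / ?G \<le> ?F" using q[of "?P / ?G"] False by (simp add: power2_eq_square)
  ultimately show ?thesis by (rule pos_divide_le_eq[THEN iffD1])
 qed
qed

lemma L2_kernel_swap:
 assumes M: "sigma_finite_measure M" and k: "L2 (M \<Otimes>\<^sub>M M) (\<lambda>(x, y). k x y)" and a: "L2 M a" and b: "L2 M b"
 shows "(\<integral>x. a x * (\<integral>y. k x y * b y \<partial>M) \<partial>M) = (\<integral>y. b y * (\<integral>x. k x y * a x \<partial>M) \<partial>M)"
proof -
 interpret MM: pair_sigma_finite M M using M by (simp add: pair_sigma_finite_def)
 have [measurable]: "a \<in> borel_measurable M" "b \<in> borel_measurable M" using a b by (auto simp: L2_def)
 have "integrable (M \<Otimes>\<^sub>M M) (\<lambda>(x, y). (a x * b y)\<^sup>2)"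
 using a b by (simp add: L2_def power_mult_distrib MM.Fubini_integrable)
 then have "L2 (M \<Otimes>\<^sub>M M) (\<lambda>(x, y). a x * b y)"
  by (simp add: L2_def case_prod_unfold)
 from L2_integrable_mult[OF this k] have "integrable (M \<Otimes>\<^sub>M M) (\<lambda>(x, y). a x * b y * k x y)"
  by (simp add: case_prod_unfold)
 from MM.Fubini_integral[OF this] show ?thesis
  by (simp add: mult_ac flip: integral_mult_right_zero)
qed

text \<open>Squaring the argument at least squares the ratio of \<open>h p\<close> and \<open>A p\<^sup>2\<close>. If the ratio exceeded \<open>1\<close> at
 \<open>q\<close>, it would therefore be unbounded along \<open>q\<close>, \<open>q\<^sup>2\<close>, \<open>q\<^sup>4\<close>, ..., whatever the constant \<open>c\<close>.\<close>
lemma quadratic_bound_of_square_bound: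
 fixes h :: "real \<Rightarrow> real"
 assumes A: "0 < A" and sq: "\<And>p. 0 < p \<Longrightarrow> p < 1 \<Longrightarrow> (h p)\<^sup>2 \<le> A * h (p\<^sup>2)"
  and bd: "\<And>p. 0 < p \<Longrightarrow> p \<le> 1 / 2 \<Longrightarrow> h p \<le> c * p\<^sup>2" and q: "0 < q" "q \<le> 1 / 2"
 shows "h q \<le> A * q\<^sup>2"
proof (rule ccontr)
 assume h: "\<not> h q \<le> A * q\<^sup>2"
 define r where "r = h q / (A * q\<^sup>2)"
 have r: "1 < r" using h A q by (simp add: r_def less_divide_eq)
 have p: "0 < q ^ 2 ^ k" "q ^ 2 ^ k \<le> 1 / 2" for k
  using q power_decreasing[of 1 "2 ^ k" q] by auto
 have "r ^ 2 ^ k * (A * (q ^ 2 ^ k)\<^sup>2) \<le> h (q ^ 2 ^ k)" for k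
 proof (induction k)
  case (Suc k)
  let ?p = "q ^ 2 ^ k"
  have "A * (r ^ 2 ^ Suc k * (A * (q ^ 2 ^ Suc k)\<^sup>2)) = (r ^ 2 ^ k * (A * ?p\<^sup>2))\<^sup>2"
   by (simp add: power_mult power_mult_distrib power2_eq_square mult_ac)
  also have "\<dots> \<le> (h ?p)\<^sup>2" by (rule power_mono[OF Suc]) (use r A in simp)
  also have "\<dots> \<le> A * h (q ^ 2 ^ Suc k)" using sq[of ?p] p[of k] by (simp add: power_mult mult.commute[of 2])
  finally show ?case using A by simp
 qed (use A q in \<open>simp add: r_def\<close>)
 then have "r ^ 2 ^ k * (A * (q ^ 2 ^ k)\<^sup>2) \<le> c * (q ^ 2 ^ k)\<^sup>2" for k by (rule order.trans) (rule bd[OF p])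
 from this[unfolded mult.assoc[symmetric]] have u: "r ^ 2 ^ k * A \<le> c" for k
  by (rule mult_right_le_imp_le) (use q in simp)
 obtain k where "c / A < r ^ k" using real_arch_pow[OF r] by blast
 also have "\<dots> \<le> r ^ 2 ^ k" using r by (intro power_increasing) (auto intro: less_imp_le less_exp)
 also have "\<dots> \<le> c / A" using u[of k] A by (simp add: le_divide_eq)
 finally show False by simp
qed

definition mehler_rest_op :: "nat \<Rightarrow> real \<Rightarrow> ((nat \<Rightarrow> real) \<Rightarrow> real) \<Rightarrow> (nat \<Rightarrow> real) \<Rightarrow> real" where
 "mehler_rest_op n s f x = (\<integral>y. mehler_rest n s x y * f y \<partial>gauss n)"

lemma measurable_mehler_kernel: "(\<lambda>(x, y). mehler_kernel n s x y) \<in> borel_measurable (gauss n \<Otimes>\<^sub>M gauss n)"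
by (simp add: case_prod_unfold mehler_kernel_def mehler_def borel_measurable_prod)

lemma measurable_mehler_rest: "(\<lambda>(x, y). mehler_rest n s x y) \<in> borel_measurable (gauss n \<Otimes>\<^sub>M gauss n)"
using measurable_mehler_kernel[of n s] by (simp add: ip_def borel_measurable_sum case_prod_unfold mehler_rest_def)

lemma L2_mehler_rest:
 assumes s: "s\<^sup>2 < 1"
 shows "x \<in> space (gauss n) \<Longrightarrow> L2 (gauss n) (mehler_rest n s x)"
  "L2 (gauss n \<Otimes>\<^sub>M gauss n) (\<lambda>(x, y). mehler_rest n s x y)"
proof -
 interpret P: prob_space "gauss n" by (rule prob_space_gauss)
 interpret PP: pair_sigma_finite "gauss n" "gauss n" by (simp add: pair_sigma_finite_def P.sigma_finite_measure_axioms)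
 have I: "integrable (gauss n) (\<lambda>y. (mehler_rest n s x y)\<^sup>2)" "(\<integral>y. (mehler_rest n s x y)\<^sup>2 \<partial>gauss n) = mehler_rest n (s\<^sup>2) x x" for x
  using mehler_rest_comp[OF s, of n x x] by (simp_all add: has_bochner_integral_iff power2_eq_square)
 show "L2 (gauss n) (mehler_rest n s x)" if "x \<in> space (gauss n)"
  unfolding L2_def using I(1) measurable_compose[OF measurable_Pair1'[OF that] measurable_mehler_rest, of s] by simp
 have "integrable (gauss n \<Otimes>\<^sub>M gauss n) (\<lambda>(x, y). (mehler_rest n s x y)\<^sup>2)"
 proof (rule PP.Fubini_integrable)
  show "(\<lambda>(x, y). (mehler_rest n s x y)\<^sup>2) \<in> borel_measurable (gauss n \<Otimes>\<^sub>M gauss n)"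
   using measurable_mehler_rest[of n s] unfolding case_prod_unfold by measurable
 qed (use I mehler_rest_trace[OF s] in \<open>auto simp: has_bochner_integral_iff\<close>)
 then show "L2 (gauss n \<Otimes>\<^sub>M gauss n) (\<lambda>(x, y). mehler_rest n s x y)"
  unfolding L2_def using measurable_mehler_rest[of n s] by (simp add: case_prod_unfold)
qed

text \<open>On the orthogonal complement of the constants and the linear functions the semigroup contracts by
 \<open>s\<^sup>2\<close>: by the semigroup property \<open>h p = \<langle>R\<^sub>p f, f\<rangle>\<close> satisfies \<open>(h p)\<^sup>2 \<le> \<parallel>f\<parallel>\<^sup>2 h (p\<^sup>2)\<close>, and the
 Hilbert--Schmidt norm of the kernel shows that \<open>h\<close> vanishes to second order.\<close>
lemma mehler_rest_op_bound:
 assumes s: "s \<noteq> 0" "s\<^sup>2 \<le> 1 / 2" and f: "L2 (gauss n) f"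
 shows "L2 (gauss n) (mehler_rest_op n s f)"
  "(\<integral>x. (mehler_rest_op n s f x)\<^sup>2 \<partial>gauss n) \<le> (s\<^sup>2)\<^sup>2 * (\<integral>x. (f x)\<^sup>2 \<partial>gauss n)"
proof -
 interpret P: prob_space "gauss n" by (rule prob_space_gauss)
 let ?R = "\<lambda>s. mehler_rest_op n s f"
 define A where "A = (\<integral>x. (f x)\<^sup>2 \<partial>gauss n)"
 have A0: "0 \<le> A" by (simp add: A_def)
 have sq_int: "(\<integral>y. (mehler_rest n p x y)\<^sup>2 \<partial>gauss n) = mehler_rest n (p\<^sup>2) x x" if "p\<^sup>2 < 1" for p x
  using mehler_rest_comp[OF that, of n x x] by (simp add: has_bochner_integral_iff power2_eq_square)
 have pt: "(?R p x)\<^sup>2 \<le> mehler_rest n (p\<^sup>2) x x * A" if "p\<^sup>2 < 1" "x \<in> space (gauss n)" for p x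
  using L2_cauchy_schwarz[OF L2_mehler_rest(1)[OF that] f] sq_int[OF that(1), of x] by (simp add: mehler_rest_op_def A_def)
 have [measurable]: "f \<in> borel_measurable (gauss n)" using f by (simp add: L2_def)
 have Rm: "?R p \<in> borel_measurable (gauss n)" for p
  unfolding mehler_rest_op_def[abs_def]
  by (rule P.borel_measurable_lebesgue_integral) (use measurable_mehler_rest[of n p] in \<open>simp add: case_prod_unfold\<close>)
 have R2: "L2 (gauss n) (?R p)" if p: "p\<^sup>2 < 1" for p
  unfolding L2_def
 proof (rule conjI[OF Rm], rule Bochner_Integration.integrable_bound[where f="\<lambda>x. mehler_rest n (p\<^sup>2) x x * A"])
  show "integrable (gauss n) (\<lambda>x. mehler_rest n (p\<^sup>2) x x * A)"
   using mehler_rest_trace[OF p, of n] by (simp add: has_bochner_integral_iff)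
  show "(\<lambda>x. (?R p x)\<^sup>2) \<in> borel_measurable (gauss n)" using Rm by measurable
  show "AE x in gauss n. norm ((?R p x)\<^sup>2) \<le> norm (mehler_rest n (p\<^sup>2) x x * A)"
   using order.trans[OF pt[OF p] abs_ge_self] by (intro AE_I2) simp
 qed
 then show "L2 (gauss n) (?R s)" using s by simp
 define h where "h p = (\<integral>x. f x * ?R p x \<partial>gauss n)" for p
 have h_sq: "(\<integral>x. (?R p x)\<^sup>2 \<partial>gauss n) = h (p\<^sup>2)" if p: "p\<^sup>2 < 1" for p
 proof -
  note swap = L2_kernel_swap[OF P.sigma_finite_measure_axioms L2_mehler_rest(2)[OF p, of n]]
  have "(\<integral>x. mehler_rest n p x z * mehler_rest n p y x \<partial>gauss n) = mehler_rest n (p\<^sup>2) y z" for y z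
   using mehler_rest_comp[OF p, of n y z] by (simp add: mehler_rest_commute[of n p _ z] has_bochner_integral_iff mult.commute)
  then have "(\<integral>x. mehler_rest n p x y * ?R p x \<partial>gauss n) = ?R (p\<^sup>2) y" if y: "y \<in> space (gauss n)" for y
   using swap[OF L2_mehler_rest(1)[OF p y] f]
   by (simp add: mehler_rest_op_def mehler_rest_commute[of n p _ y] mult.commute[of "f _"])
  then show ?thesis
  by (smt (verit) swap[OF R2[OF p] f] h_def Bochner_Integration.integral_cong power2_eq_square mehler_rest_op_def[of n p f, symmetric])
 qed
 have h1: "(h p)\<^sup>2 \<le> A * h (p\<^sup>2)" if "p\<^sup>2 < 1" for p
  using L2_cauchy_schwarz[OF f R2[OF that]] h_sq[OF that] by (simp add: h_def A_def)
 obtain C where C: "C \<ge> 0" "\<And>q. 0 \<le> q \<Longrightarrow> q \<le> 1 / 2 \<Longrightarrow> (1 / (1 - q)) ^ n \<le> 1 + q * real n + C * q\<^sup>2"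
  using power_inverse_le[of n] by auto
 have h2: "h p \<le> sqrt C * A * p\<^sup>2" if p: "0 < p" "p \<le> 1 / 2" for p
 proof -
  have p2: "p\<^sup>2 \<le> 1 / 2" using p mult_mono[of p "1/2" p "1/2"] by (simp add: power2_eq_square)
  then have p1: "p\<^sup>2 < 1" by simp
  have "h (p\<^sup>2) \<le> (\<integral>x. mehler_rest n (p\<^sup>2) x x * A \<partial>gauss n)"
   unfolding h_sq[OF p1, symmetric]
   by (rule integral_mono) (use R2[OF p1] pt[OF p1] mehler_rest_trace[OF p1, of n] in \<open>auto simp: L2_def has_bochner_integral_iff\<close>)
  also have "\<dots> = ((1 / (1 - p\<^sup>2)) ^ n - 1 - p\<^sup>2 * real n) * A"
   using mehler_rest_trace[OF p1, of n] by (simp add: has_bochner_integral_iff)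
  also have "\<dots> \<le> C * (p\<^sup>2)\<^sup>2 * A" using C(2)[of "p\<^sup>2"] p2 A0 by (intro mult_right_mono) auto
  finally have "(h p)\<^sup>2 \<le> A * (C * (p\<^sup>2)\<^sup>2 * A)" using h1[OF p1] mult_left_mono[OF _ A0] by (meson order.trans)
  also have "\<dots> = (sqrt C * A * p\<^sup>2)\<^sup>2" using C(1) by (simp add: power_mult_distrib power2_eq_square)
  finally show ?thesis by (rule power2_le_imp_le) (use C(1) A0 in simp)
 qed
 have "(\<integral>x. (?R s x)\<^sup>2 \<partial>gauss n) = h (s\<^sup>2)" using h_sq s by simp
 also have "\<dots> \<le> A * (s\<^sup>2)\<^sup>2"
 proof (cases "A = 0")
  case True
  have "(s\<^sup>2)\<^sup>2 < 1" using s power_mono[of "s\<^sup>2" "1/2" 2] by (simp add: power2_eq_square)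
  then show ?thesis using h1[of "s\<^sup>2"] True by simp
 next
  case False
  show ?thesis
  proof (rule quadratic_bound_of_square_bound[OF _ _ h2])
   show "0 < A" using False A0 by simp
   show "(h p)\<^sup>2 \<le> A * h (p\<^sup>2)" if "0 < p" "p < 1" for p using that by (intro h1) (simp add: power_less_one_iff)
  qed (use s in auto)
 qed
 finally show "(\<integral>x. (?R s x)\<^sup>2 \<partial>gauss n) \<le> (s\<^sup>2)\<^sup>2 * (\<integral>x. (f x)\<^sup>2 \<partial>gauss n)" by (simp add: A_def mult.commute)
qed

section \<open>K-convexity\<close>

definition mehler_op :: "nat \<Rightarrow> real \<Rightarrow> ((nat \<Rightarrow> real) \<Rightarrow> real) \<Rightarrow> (nat \<Rightarrow> real) \<Rightarrow> real" where
 "mehler_op n s f x = (\<integral>y. mehler_kernel n s x y * f y \<partial>gauss n)"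

definition linear_part :: "nat \<Rightarrow> ((nat \<Rightarrow> real) \<Rightarrow> real) \<Rightarrow> (nat \<Rightarrow> real) \<Rightarrow> real" where
 "linear_part n f x = (\<Sum>i<n. x i * (\<integral>y. y i * f y \<partial>gauss n))"

lemma L2_bounded:
 assumes "f \<in> borel_measurable (gauss n)" "\<And>x. \<bar>f x\<bar> \<le> B" shows "L2 (gauss n) f"
proof -
 interpret P: prob_space "gauss n" by (rule prob_space_gauss)
 have "(f x)\<^sup>2 \<le> B\<^sup>2" for x using power_mono[OF assms(2)[of x], of 2] by simp
 then show ?thesis
  unfolding L2_def using assms(1) by (auto intro!: P.integrable_const_bound[of _ "B\<^sup>2"])
qed

lemma L2_coord: "i < n \<Longrightarrow> L2 (gauss n) (\<lambda>y. y i)"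
 using integrable_gauss_ip_sq[of n "\<lambda>j. if j = i then 1 else 0"] measurable_gauss_coord[of i n]
 by (simp add: L2_def ip_def if_distrib[of "\<lambda>c. _ * c"] cong: if_cong)

lemma integrable_L2:
 assumes "L2 (gauss n) f" shows "integrable (gauss n) f"
 using L2_integrable_mult[OF L2_bounded[of "\<lambda>_. 1" n 1] assms] by simp

lemma L2_partition:
 assumes "finite J" "\<And>j. j \<in> J \<Longrightarrow> f j \<in> borel_measurable (gauss n)" "\<And>j y. 0 \<le> f j y" "\<And>y. (\<Sum>j\<in>J. f j y) = 1" "j \<in> J"
 shows "L2 (gauss n) (f j)"
proof (rule L2_bounded[of _ _ 1])
 show "\<bar>f j y\<bar> \<le> 1" for y using member_le_sum[of j J "\<lambda>j. f j y"] assms by auto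
qed (use assms in simp)

lemma mehler_op_expansion:
 assumes s: "s\<^sup>2 < 1" and f: "L2 (gauss n) f" and x: "x \<in> space (gauss n)"
 shows "integrable (gauss n) (\<lambda>y. mehler_kernel n s x y * f y)"
  "mehler_rest_op n s f x = mehler_op n s f x - (\<integral>y. f y \<partial>gauss n) - s * linear_part n f x"
proof -
 have e: "mehler_kernel n s x y * f y = mehler_rest n s x y * f y + f y + s * (\<Sum>i<n. x i * (y i * f y))" for y
  by (simp add: mehler_rest_def ip_def algebra_simps sum_distrib_left)
 have "has_bochner_integral (gauss n) (\<lambda>y. mehler_kernel n s x y * f y) (mehler_rest_op n s f x + (\<integral>y. f y \<partial>gauss n) + s * linear_part n f x)"
  unfolding mehler_rest_op_def e linear_part_def
  by (intro has_bochner_integral_add has_bochner_integral_mult_right has_bochner_integral_sum has_bochner_integral_integrable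
    L2_integrable_mult[OF L2_mehler_rest(1)[OF s x] f] integrable_L2[OF f] L2_integrable_mult[OF L2_coord f]) auto
 then show "integrable (gauss n) (\<lambda>y. mehler_kernel n s x y * f y)"
  "mehler_rest_op n s f x = mehler_op n s f x - (\<integral>y. f y \<partial>gauss n) - s * linear_part n f x"
  by (simp_all add: has_bochner_integral_iff mehler_op_def)
qed

lemma mehler_op_sum:
 assumes s: "s\<^sup>2 < 1" and f: "\<And>j. j \<in> J \<Longrightarrow> L2 (gauss n) (f j)" and x: "x \<in> space (gauss n)"
 shows "mehler_op n s (\<lambda>y. \<Sum>j\<in>J. c j * f j y) x = (\<Sum>j\<in>J. c j * mehler_op n s (f j) x)"
using mehler_op_expansion(1)[OF s f x] by (simp add: mehler_op_def sum_distrib_left mult_ac Bochner_Integration.integral_sum)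

lemma mehler_op_nonneg: "s\<^sup>2 < 1 \<Longrightarrow> (\<And>x. 0 \<le> f x) \<Longrightarrow> 0 \<le> mehler_op n s f x"
 unfolding mehler_op_def mehler_kernel_def
 by (intro integral_nonneg_AE AE_I2 mult_nonneg_nonneg prod_nonneg) (simp_all add: mehler_nonneg)

lemma mehler_op_one: "s\<^sup>2 < 1 \<Longrightarrow> mehler_op n s (\<lambda>_. 1) x = 1"
 using mehler_kernel_moments(1)[of s n x] by (simp add: mehler_op_def has_bochner_integral_iff)

text \<open>The odd part of the semigroup annihilates constants and multiplies linear functions by \<open>s\<close>; after
 division by \<open>s\<close> it differs from the projection to the linear functions by this term.\<close>
definition odd_defect :: "nat \<Rightarrow> real \<Rightarrow> ((nat \<Rightarrow> real) \<Rightarrow> real) \<Rightarrow> (nat \<Rightarrow> real) \<Rightarrow> real" where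
 "odd_defect n s f x = (mehler_op n s f x - mehler_op n (- s) f x) / (2 * s) - linear_part n f x"

lemma odd_defect_bound:
 assumes s: "0 < s" "s\<^sup>2 \<le> 1 / 2" and f: "L2 (gauss n) f"
 shows "integrable (gauss n) (\<lambda>x. (odd_defect n s f x)\<^sup>2)"
  "(\<integral>x. (odd_defect n s f x)\<^sup>2 \<partial>gauss n) \<le> s\<^sup>2 * (\<integral>x. (f x)\<^sup>2 \<partial>gauss n)"
proof -
 let ?a = "mehler_rest_op n s f" and ?b = "mehler_rest_op n (- s) f" and ?A = "\<integral>x. (f x)\<^sup>2 \<partial>gauss n"
 have s1: "s\<^sup>2 < 1" "(- s)\<^sup>2 < 1" "s \<noteq> 0" "- s \<noteq> 0" "(- s)\<^sup>2 \<le> 1 / 2" using s by auto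
 have ab: "L2 (gauss n) ?a" "L2 (gauss n) ?b" "(\<integral>x. (?a x)\<^sup>2 \<partial>gauss n) \<le> (s\<^sup>2)\<^sup>2 * ?A" "(\<integral>x. (?b x)\<^sup>2 \<partial>gauss n) \<le> (s\<^sup>2)\<^sup>2 * ?A"
  using mehler_rest_op_bound[OF s1(3) s(2) f] mehler_rest_op_bound[OF s1(4,5) f] by simp_all
 have o: "odd_defect n s f x = (?a x - ?b x) / (2 * s)" if "x \<in> space (gauss n)" for x
  using s mehler_op_expansion(2)[OF s1(1) f that] mehler_op_expansion(2)[OF s1(2) f that] by (simp add: odd_defect_def field_simps)
 have I: "integrable (gauss n) (\<lambda>x. ((?a x - ?b x) / (2 * s))\<^sup>2)"
  using ab(1,2) L2_integrable_mult[OF ab(1,2)] unfolding power_divide power2_diff L2_def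
  by (intro integrable_divide Bochner_Integration.integrable_diff Bochner_Integration.integrable_add) (auto simp: mult.assoc)
 then show 1: "integrable (gauss n) (\<lambda>x. (odd_defect n s f x)\<^sup>2)"
  by (rule Bochner_Integration.integrable_cong[THEN iffD1, rotated 2]) (simp_all add: o)
 have "(\<integral>x. (odd_defect n s f x)\<^sup>2 \<partial>gauss n) \<le> (\<integral>x. ((?a x)\<^sup>2 + (?b x)\<^sup>2) / (2 * s\<^sup>2) \<partial>gauss n)"
 proof (rule integral_mono[OF 1])
  show "integrable (gauss n) (\<lambda>x. ((?a x)\<^sup>2 + (?b x)\<^sup>2) / (2 * s\<^sup>2))" using ab(1,2) by (simp add: L2_def)
  fix x assume "x \<in> space (gauss n)"
  moreover have "(a - b)\<^sup>2 / (4 * s\<^sup>2) \<le> (a\<^sup>2 + b\<^sup>2) / (2 * s\<^sup>2)" for a b :: real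
  proof -
   have "(a - b)\<^sup>2 / (4 * s\<^sup>2) \<le> (2 * (a\<^sup>2 + b\<^sup>2)) / (2 * (2 * s\<^sup>2))"
  using zero_le_power2[of "a + b"] by (simp add: power2_eq_square algebra_simps divide_right_mono)
   then show ?thesis by (simp only: mult_divide_mult_cancel_left_if) simp
  qed
  ultimately show "(odd_defect n s f x)\<^sup>2 \<le> ((?a x)\<^sup>2 + (?b x)\<^sup>2) / (2 * s\<^sup>2)"
   by (simp add: o power_divide power_mult_distrib)
 qed
 also have "\<dots> = ((\<integral>x. (?a x)\<^sup>2 \<partial>gauss n) + (\<integral>x. (?b x)\<^sup>2 \<partial>gauss n)) / (2 * s\<^sup>2)" using ab(1,2) by (simp add: L2_def)
 also have "\<dots> \<le> ((s\<^sup>2)\<^sup>2 * ?A + (s\<^sup>2)\<^sup>2 * ?A) / (2 * s\<^sup>2)" using ab(3,4) s by (intro divide_right_mono) auto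
 also have "\<dots> = s\<^sup>2 * ?A" using s by (simp add: power2_eq_square)
 finally show "(\<integral>x. (odd_defect n s f x)\<^sup>2 \<partial>gauss n) \<le> s\<^sup>2 * ?A" .
qed

text \<open>The projection onto linear functions is bounded by a multiple of \<open>sqrt d\<close> on bounded functions with
 values in a space at distance \<open>d\<close> from Euclidean space: the odd part of the semigroup at parameter
 \<open>s\<close> costs \<open>1 / s\<close> in any norm, and what it misses is of order \<open>s\<close> in the Euclidean norm.\<close>
lemma k_convexity:
 assumes N: "seminorm m N" "\<And>x. nrm m x \<le> N x" "\<And>x. N x \<le> d * nrm m x" and d: "1 \<le> d"
  and J: "finite J" and x: "\<And>j. j \<in> J \<Longrightarrow> N (x j) \<le> 1"
  and f: "\<And>j. j \<in> J \<Longrightarrow> f j \<in> borel_measurable (gauss n)" "\<And>j y. 0 \<le> f j y" "\<And>y. (\<Sum>j\<in>J. f j y) = 1"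
 shows "(\<integral>g. (N (lin n (\<lambda>i c. \<Sum>j\<in>J. x j c * (\<integral>y. y i * f j y \<partial>gauss n)) g))\<^sup>2 \<partial>gauss n) \<le> 6 * d"
proof -
 interpret P: prob_space "gauss n" by (rule prob_space_gauss)
 let ?w = "\<lambda>i c. \<Sum>j\<in>J. x j c * (\<integral>y. y i * f j y \<partial>gauss n)"
 \<comment> \<open>balances the two contributions \<open>2 / s\<^sup>2\<close> and \<open>2 d\<^sup>2 s\<^sup>2\<close> up to constants\<close>
 define s where "s = sqrt (1 / (2 * d))"
 have s: "0 < s" "s\<^sup>2 = 1 / (2 * d)" using d by (auto simp: s_def)
 have s2: "s\<^sup>2 \<le> 1 / 2" using d by (simp add: s(2) field_simps)
 have s1: "s\<^sup>2 < 1" "(- s)\<^sup>2 < 1" using s2 by auto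
 note fb = L2_partition[OF J f]
 have U: "mehler_op n t (\<lambda>y. \<Sum>j\<in>J. c j * f j y) g = (\<Sum>j\<in>J. c j * mehler_op n t (f j) g)"
  if "t\<^sup>2 < 1" "g \<in> space (gauss n)" for t g c by (rule mehler_op_sum[OF that(1) fb that(2)])
 define \<psi> where "\<psi> j g = (mehler_op n s (f j) g - mehler_op n (- s) (f j) g) / (2 * s)" for j g
 define F where "F c = (\<lambda>y. \<Sum>j\<in>J. x j c * f j y)" for c
 have F_sum: "(\<Sum>c<m. (F c y)\<^sup>2) \<le> 1" for y
 proof -
  have "nrm m (\<lambda>c. \<Sum>j\<in>J. f j y * x j c) \<le> (\<Sum>j\<in>J. nrm m (\<lambda>c. f j y * x j c))"
   by (rule seminorm_sum[OF seminorm_nrm J])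
  also have "\<dots> = (\<Sum>j\<in>J. f j y * nrm m (x j))" by (simp add: nrm_scale f(2))
  also have "\<dots> \<le> (\<Sum>j\<in>J. f j y * 1)"
   by (intro sum_mono mult_left_mono f(2)) (use x N(2) in \<open>auto intro: order.trans\<close>)
  finally have "(nrm m (\<lambda>c. \<Sum>j\<in>J. f j y * x j c))\<^sup>2 \<le> 1" using power_mono[of _ 1 2] by (fastforce simp: f(3))
  then show ?thesis unfolding nrm_sq ip_def F_def by (simp only: power2_eq_square mult.commute)
 qed
 have Fb: "L2 (gauss n) (F c)" if "c < m" for c
 proof (rule L2_bounded[of _ _ 1])
  show "F c \<in> borel_measurable (gauss n)" unfolding F_def[abs_def] using f(1) by simp
  have "(F c y)\<^sup>2 \<le> 1" for y
   using member_le_sum[of c "{..<m}" "\<lambda>c. (F c y)\<^sup>2"] F_sum[of y] that by simp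
  then show "\<bar>F c y\<bar> \<le> 1" for y by (simp add: abs_square_le_1)
 qed
 have lin_F: "linear_part n (F c) g = (\<Sum>j\<in>J. x j c * linear_part n (f j) g)" for c g
 proof -
  have "(\<integral>y. y i * F c y \<partial>gauss n) = (\<Sum>j\<in>J. x j c * (\<integral>y. y i * f j y \<partial>gauss n))" if i: "i < n" for i
  proof -
   have e: "y i * F c y = (\<Sum>j\<in>J. x j c * (y i * f j y))" for y by (simp add: F_def sum_distrib_left mult_ac)
   show ?thesis unfolding e using L2_integrable_mult[OF L2_coord[OF i] fb] by (subst Bochner_Integration.integral_sum) auto
  qed
  then show ?thesis by (simp add: linear_part_def sum_distrib_left sum.swap[of _ J] mult_ac)
 qed
 have lin_eq: "lin n ?w g c = linear_part n (F c) g" for g c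
  unfolding lin_F by (simp add: lin_def linear_part_def sum_distrib_left sum.swap[of _ J] mult_ac)
 have defect: "odd_defect n s (F c) g = (\<Sum>j\<in>J. \<psi> j g * x j c) - lin n ?w g c" if g: "g \<in> space (gauss n)" for g c
  unfolding odd_defect_def lin_eq F_def U[OF s1(1) g] U[OF s1(2) g] \<psi>_def
  by (simp add: sum_subtractf sum_divide_distrib right_diff_distrib diff_divide_distrib mult.commute)
 \<comment> \<open>the semigroup is positive and preserves constants, so the coefficients of the odd part have
  absolute sum at most \<open>1 / s\<close>\<close>
 have \<psi>1: "(\<Sum>j\<in>J. \<bar>\<psi> j g\<bar>) \<le> 1 / s" if g: "g \<in> space (gauss n)" for g
 proof -
  have "(\<Sum>j\<in>J. \<bar>\<psi> j g\<bar>) \<le> (\<Sum>j\<in>J. (mehler_op n s (f j) g + mehler_op n (- s) (f j) g) / (2 * s))"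
  proof (rule sum_mono)
   fix j
   have "0 \<le> mehler_op n s (f j) g" "0 \<le> mehler_op n (- s) (f j) g" using mehler_op_nonneg s1 f(2) by auto
   then show "\<bar>\<psi> j g\<bar> \<le> (mehler_op n s (f j) g + mehler_op n (- s) (f j) g) / (2 * s)"
    unfolding \<psi>_def abs_divide using s(1) by (simp add: divide_right_mono)
  qed
  also have "\<dots> = ((\<Sum>j\<in>J. mehler_op n s (f j) g) + (\<Sum>j\<in>J. mehler_op n (- s) (f j) g)) / (2 * s)"
   by (simp add: sum.distrib sum_divide_distrib add_divide_distrib)
  also have "(\<Sum>j\<in>J. mehler_op n t (f j) g) = 1" if "t\<^sup>2 < 1" for t
   using U[OF that g, of "\<lambda>_. 1"] by (simp add: f(3) mehler_op_one[OF that])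
  then have "((\<Sum>j\<in>J. mehler_op n s (f j) g) + (\<Sum>j\<in>J. mehler_op n (- s) (f j) g)) / (2 * s) = 1 / s" using s1 s(1) by simp
  finally show ?thesis .
 qed
 \<comment> \<open>the linear part is the odd part, estimated in \<open>N\<close>, minus the defect, estimated in the Euclidean norm at the cost of \<open>d\<close>\<close>
 have sq: "(N (lin n ?w g))\<^sup>2 \<le> 2 / s\<^sup>2 + (\<Sum>c<m. 2 * d\<^sup>2 * (odd_defect n s (F c) g)\<^sup>2)" if g: "g \<in> space (gauss n)" for g
 proof -
  let ?D = "\<lambda>c. odd_defect n s (F c) g"
  have "N (lin n ?w g) \<le> N (\<lambda>c. \<Sum>j\<in>J. \<psi> j g * x j c) + N (\<lambda>c. (-1) * ?D c)"
  using seminorm_triangle[OF N(1), of "\<lambda>c. \<Sum>j\<in>J. \<psi> j g * x j c" "\<lambda>c. (-1) * ?D c"] by (simp add: fun_eq_iff defect[OF g])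
  also have "N (\<lambda>c. \<Sum>j\<in>J. \<psi> j g * x j c) \<le> (\<Sum>j\<in>J. N (\<lambda>c. \<psi> j g * x j c))" by (rule seminorm_sum[OF N(1) J])
  also have "\<dots> \<le> (\<Sum>j\<in>J. \<bar>\<psi> j g\<bar>)"
   unfolding seminorm_scale[OF N(1)] by (rule sum_mono) (use x in \<open>simp add: mult_left_le seminorm_nonneg[OF N(1)]\<close>)
  also have "\<dots> \<le> 1 / s" by (rule \<psi>1[OF g])
  also have "N (\<lambda>c. (-1) * ?D c) \<le> d * nrm m ?D" unfolding seminorm_scale[OF N(1)] using N(3) by simp
  finally have "(N (lin n ?w g))\<^sup>2 \<le> (1 / s + d * nrm m ?D)\<^sup>2"
   by (intro power_mono seminorm_nonneg[OF N(1)]) simp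
  also have "\<dots> \<le> 2 * (1 / s)\<^sup>2 + 2 * (d * nrm m ?D)\<^sup>2"
   using sum_squares_bound[of "1 / s" "d * nrm m ?D"] unfolding power2_sum by linarith
  also have "\<dots> = 2 / s\<^sup>2 + (\<Sum>c<m. 2 * d\<^sup>2 * (?D c)\<^sup>2)"
   unfolding power_mult_distrib nrm_sq ip_def by (simp add: power_divide sum_distrib_left mult.assoc power2_eq_square)
  finally show ?thesis .
 qed
 note O = odd_defect_bound[OF s(1) s2 Fb]
 have H: "has_bochner_integral (gauss n) (\<lambda>g. 2 / s\<^sup>2 + (\<Sum>c<m. 2 * d\<^sup>2 * (odd_defect n s (F c) g)\<^sup>2))
  (2 / s\<^sup>2 + (\<Sum>c<m. 2 * d\<^sup>2 * (\<integral>g. (odd_defect n s (F c) g)\<^sup>2 \<partial>gauss n)))"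
  by (intro has_bochner_integral_add has_bochner_integral_sum has_bochner_integral_mult_right has_bochner_integral_integrable has_bochner_integral_gauss_const O(1)) simp
 have "(\<integral>g. (N (lin n ?w g))\<^sup>2 \<partial>gauss n) \<le> (\<integral>g. 2 / s\<^sup>2 + (\<Sum>c<m. 2 * d\<^sup>2 * (odd_defect n s (F c) g)\<^sup>2) \<partial>gauss n)"
  by (rule integral_mono[OF integrable_gauss_seminorm_sq[OF seminorm_lin[OF N(1)]] _ sq]) (use H in \<open>auto simp: has_bochner_integral_iff\<close>)
 also have "\<dots> = 2 / s\<^sup>2 + (\<Sum>c<m. 2 * d\<^sup>2 * (\<integral>g. (odd_defect n s (F c) g)\<^sup>2 \<partial>gauss n))"
  using H by (simp only: has_bochner_integral_iff)
 also have "\<dots> \<le> 2 / s\<^sup>2 + (\<Sum>c<m. 2 * d\<^sup>2 * (s\<^sup>2 * (\<integral>y. (F c y)\<^sup>2 \<partial>gauss n)))"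
  using O(2) by (intro add_left_mono sum_mono mult_left_mono) auto
 also have "\<dots> = 2 / s\<^sup>2 + 2 * d\<^sup>2 * s\<^sup>2 * (\<integral>y. (\<Sum>c<m. (F c y)\<^sup>2) \<partial>gauss n)"
  using Fb by (simp add: L2_def Bochner_Integration.integral_sum sum_distrib_left mult.assoc)
 also have "(\<integral>y. (\<Sum>c<m. (F c y)\<^sup>2) \<partial>gauss n) \<le> (\<integral>y. 1 \<partial>gauss n)"
  using Fb by (intro integral_mono F_sum) (auto simp: L2_def)
 then have "2 / s\<^sup>2 + 2 * d\<^sup>2 * s\<^sup>2 * (\<integral>y. (\<Sum>c<m. (F c y)\<^sup>2) \<partial>gauss n) \<le> 2 / s\<^sup>2 + 2 * d\<^sup>2 * s\<^sup>2 * 1"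
  using P.prob_space by (intro add_left_mono mult_left_mono) auto
 also have "\<dots> \<le> 6 * d" using d unfolding s(2) by (simp add: power2_eq_square)
 finally show ?thesis .
qed

text \<open>Ties are shared equally among the maximisers; this makes the choice measurable without an order
 on the index set.\<close>
lemma argmax_partition:
 fixes h :: "'j \<Rightarrow> 'a \<Rightarrow> real"
 assumes J: "finite J" "J \<noteq> {}" and h: "\<And>j. j \<in> J \<Longrightarrow> h j \<in> borel_measurable M"
 shows "\<exists>f. (\<forall>j\<in>J. f j \<in> borel_measurable M) \<and> (\<forall>j y. 0 \<le> f j y) \<and> (\<forall>y. (\<Sum>j\<in>J. f j y) = (1::real)) \<and>
  (\<forall>y. (\<Sum>j\<in>J. f j y * h j y) = Max ((\<lambda>j. h j y) ` J))"
proof -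
 let ?M = "\<lambda>y. Max ((\<lambda>j. h j y) ` J)"
 define a where "a j y = (if h j y = ?M y then 1 else (0::real))" for j y
 define f where "f j y = a j y / (\<Sum>i\<in>J. a i y)" for j y
 have M: "?M \<in> borel_measurable M" using J(1) h by (rule borel_measurable_Max)
 have am: "a j \<in> borel_measurable M" if "j \<in> J" for j
  unfolding a_def[abs_def] using M h[OF that] by measurable
 have pos: "0 < (\<Sum>i\<in>J. a i y)" for y
 proof -
  have "?M y \<in> (\<lambda>j. h j y) ` J" using J by (intro Max_in) auto
  then obtain j where j: "j \<in> J" "h j y = ?M y" by auto
  have "a j y \<le> (\<Sum>i\<in>J. a i y)" using J(1) j(1) by (intro member_le_sum) (auto simp: a_def)
  then show ?thesis using j by (simp add: a_def)
 qed
 have s1: "(\<Sum>j\<in>J. f j y) = 1" for y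
  using pos[of y] by (simp add: f_def sum_divide_distrib[symmetric])
 have "(\<Sum>j\<in>J. f j y * h j y) = ?M y" for y
 proof -
  have "(\<Sum>j\<in>J. f j y * h j y) = (\<Sum>j\<in>J. f j y * ?M y)" by (rule sum.cong) (auto simp: f_def a_def)
  also have "\<dots> = ?M y" using s1[of y] by (simp add: sum_distrib_right[symmetric])
  finally show ?thesis .
 qed
 moreover have "f j \<in> borel_measurable M" if "j \<in> J" for j
  unfolding f_def[abs_def] using am that by (intro borel_measurable_divide borel_measurable_sum)
 moreover have "0 \<le> f j y" for j y using pos[of y] by (simp add: f_def a_def)
 ultimately show ?thesis using s1 by blast
qed

text \<open>Trace duality turns K-convexity into a bound for the dual Gaussian process: writing the maximum as
 a sum over a measurable choice of the maximising vector exhibits its expectation as the trace of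
 \<open>V\<close> times the linear part of that choice.\<close>
lemma mstar_bound:
 assumes N: "seminorm m N" "\<And>x. nrm m x \<le> N x" "\<And>x. N x \<le> d * nrm m x" and d: "1 \<le> d"
  and V: "\<And>W. (\<Sum>i<n. lin m V (W i) i) \<le> D * ell n (\<lambda>g. N (lin n W g))" and D: "0 \<le> D"
  and X0: "finite X0" "X0 \<noteq> {}" "\<And>x. x \<in> X0 \<Longrightarrow> N x \<le> 1"
 shows "(\<integral>g. Max ((\<lambda>q. \<bar>ip n g q\<bar>) ` lin m V ` X0) \<partial>gauss n) \<le> D * sqrt (6 * d)"
proof -
 interpret P: prob_space "gauss n" by (rule prob_space_gauss)
 \<comment> \<open>closing the set under negation replaces the maximum of absolute values by a maximum of linear functionals\<close>
 define J where "J = X0 \<union> (\<lambda>x i. - x i) ` X0"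
 have J: "finite J" "J \<noteq> {}" using X0 by (auto simp: J_def)
 have NJ: "N x \<le> 1" if "x \<in> J" for x
  using that X0(3) seminorm_minus[OF N(1)] by (auto simp: J_def)
 let ?h = "\<lambda>x g. ip n g (lin m V x)"
 obtain f where f: "\<forall>j\<in>J. f j \<in> borel_measurable (gauss n)" "\<forall>j y. 0 \<le> f j y" "\<forall>y. (\<Sum>j\<in>J. f j y) = 1"
  "\<forall>y. (\<Sum>j\<in>J. f j y * ?h j y) = Max ((\<lambda>j. ?h j y) ` J)"
  using argmax_partition[of J ?h, OF J measurable_gauss_ip] by blast
 define W where "W i c = (\<Sum>x\<in>J. x c * (\<integral>y. y i * f x y \<partial>gauss n))" for i c
 have eq: "Max ((\<lambda>q. \<bar>ip n g q\<bar>) ` lin m V ` X0) \<le> (\<Sum>x\<in>J. f x g * ?h x g)" for g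
 proof -
  have "\<bar>?h x g\<bar> \<le> Max ((\<lambda>j. ?h j g) ` J)" if x: "x \<in> X0" for x
  proof -
   have "?h x g \<le> Max ((\<lambda>j. ?h j g) ` J)" using x J by (intro Max_ge) (auto simp: J_def)
   moreover have "?h (\<lambda>i. - x i) g \<le> Max ((\<lambda>j. ?h j g) ` J)" using x J by (intro Max_ge) (auto simp: J_def)
   moreover have "?h (\<lambda>i. - x i) g = - ?h x g"
    using lin_scale[of m V "-1" x] ip_scale_right[of n g "-1" "lin m V x"] by simp
   ultimately show ?thesis by linarith
  qed
  then show ?thesis using X0 f(4) by (subst Max_le_iff) auto
 qed
 have int: "has_bochner_integral (gauss n) (\<lambda>g. f x g * ?h x g) (\<Sum>i<n. lin m V x i * (\<integral>g. g i * f x g \<partial>gauss n))" if x: "x \<in> J" for x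
 proof -
  have e: "f x g * ?h x g = (\<Sum>i<n. lin m V x i * (g i * f x g))" for g
   by (simp add: ip_def sum_distrib_left mult_ac)
  have "L2 (gauss n) (f x)" using L2_partition[OF J(1), of f n x] f x by blast
  then show ?thesis
   unfolding e by (intro has_bochner_integral_sum has_bochner_integral_mult_right has_bochner_integral_integrable L2_integrable_mult[OF L2_coord]) auto
 qed
 then have sum: "has_bochner_integral (gauss n) (\<lambda>g. \<Sum>x\<in>J. f x g * ?h x g) (\<Sum>x\<in>J. \<Sum>i<n. lin m V x i * (\<integral>g. g i * f x g \<partial>gauss n))"
  by (intro has_bochner_integral_sum)
 have "(\<integral>g. Max ((\<lambda>q. \<bar>ip n g q\<bar>) ` lin m V ` X0) \<partial>gauss n) \<le> (\<integral>g. (\<Sum>x\<in>J. f x g * ?h x g) \<partial>gauss n)"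
 proof (rule integral_mono')
  show "integrable (gauss n) (\<lambda>g. \<Sum>x\<in>J. f x g * ?h x g)" using sum by (simp only: has_bochner_integral_iff)
  have "0 \<le> Max ((\<lambda>q. \<bar>ip n g q\<bar>) ` lin m V ` X0)" for g
   using X0(1,2) by (subst Max_ge_iff) auto
  then show "0 \<le> (\<Sum>x\<in>J. f x g * ?h x g)" for g using eq by (rule order.trans)
 qed (rule eq)
 also have "\<dots> = (\<Sum>x\<in>J. \<Sum>i<n. lin m V x i * (\<integral>g. g i * f x g \<partial>gauss n))"
  using sum by (simp only: has_bochner_integral_iff)
 also have "\<dots> = (\<Sum>i<n. lin m V (W i) i)"
  by (simp add: lin_def W_def sum_distrib_right sum_distrib_left sum.swap[of _ J] mult_ac)
 also have "\<dots> \<le> D * ell n (\<lambda>g. N (lin n W g))" by (rule V)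
 also have "\<dots> \<le> D * sqrt (6 * d)"
 by (simp add: ell_def W_def[abs_def] real_sqrt_le_mono k_convexity[OF N d J(1) NJ] f mult_left_mono[OF _ D])
 finally show ?thesis .
qed

section \<open>Lewis ellipsoids\<close>

text \<open>The matrix with columns \<open>U j\<close>.\<close>
definition mt :: "nat \<Rightarrow> (nat \<Rightarrow> nat \<Rightarrow> real) \<Rightarrow> real mat" where
 "mt m U = mat m m (\<lambda>(i, j). U j i)"

lemma det_mt: "det (mt m U) = (\<Sum>p\<in>{p. p permutes {0..<m}}. signof p * (\<Prod>i=0..<m. U (p i) i))"
by (simp add: mt_def det_def)

lemma tendsto_det_mt:
 assumes "\<And>i j. i < m \<Longrightarrow> j < m \<Longrightarrow> ((\<lambda>k. Us k i j) \<longlongrightarrow> U i j) F"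
 shows "((\<lambda>k. det (mt m (Us k))) \<longlongrightarrow> det (mt m U)) F"
 unfolding det_mt
proof (intro tendsto_sum tendsto_mult tendsto_const tendsto_prod)
 fix p i assume "p \<in> {p. p permutes {0..<m}}" "i \<in> {0..<m}"
 then show "((\<lambda>k. Us k (p i) i) \<longlongrightarrow> U (p i) i) F" using permutes_in_image[of p "{0..<m}" i] by (intro assms) auto
qed

lemma det_mt_lin: "det (mt m (\<lambda>j. lin m U (V j))) = det (mt m U) * det (mt m V)"
proof -
 have "mt m (\<lambda>j. lin m U (V j)) = mt m U * mt m V"
  by (rule eq_matI) (auto simp: mt_def lin_def scalar_prod_def atLeast0LessThan mult.commute)
 then show ?thesis by (simp add: det_mult[of _ m] mt_def)
qed

lemma mt_inverse:
 assumes "det (mt m U) \<noteq> 0"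
 shows "\<exists>V. (\<forall>x. \<forall>i<m. lin m U (lin m V x) i = x i) \<and> (\<forall>x. \<forall>i<m. lin m V (lin m U x) i = x i)"
proof -
 have U: "mt m U \<in> carrier_mat m m" by (simp add: mt_def)
 from det_non_zero_imp_unit[OF U assms, where b="()"] obtain B where
  B: "B \<in> carrier_mat m m" "B * mt m U = 1\<^sub>m m" "mt m U * B = 1\<^sub>m m"
  by (auto simp: Units_def ring_mat_def)
 define V where "V j i = B $$ (i, j)" for j i
 have BV: "B = mt m V" using B(1) by (auto simp: mt_def V_def)
 have key: "lin m A (lin m A' x) i = x i" if AA: "mt m A * mt m A' = 1\<^sub>m m" and i: "i < m" for A A' x i
 proof -
  have e: "lin m A (A' j) i = (if i = j then 1 else 0)" if j: "j < m" for j
  proof -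
   have "lin m A (A' j) i = (mt m A * mt m A') $$ (i, j)"
    using j \<open>i < m\<close> by (simp add: mt_def lin_def scalar_prod_def atLeast0LessThan mult.commute)
   also have "\<dots> = (if i = j then 1 else 0)" unfolding AA using j i by simp
   finally show ?thesis .
  qed
  have "lin m A (lin m A' x) i = (\<Sum>j<m. x j * lin m A (A' j) i)" unfolding lin_lin by (simp add: lin_def)
  also have "\<dots> = (\<Sum>j<m. if i = j then x j else 0)" by (rule sum.cong) (auto simp: e)
  also have "\<dots> = x i" using i by simp
  finally show ?thesis .
 qed
 show ?thesis using key B(2,3) unfolding BV by (intro exI[of _ V]) blast
qed

text \<open>In the Leibniz expansion of \<open>det (1 + t A)\<close> every permutation but the identity moves two points and
 contributes at order \<open>t\<^sup>2\<close> only.\<close>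
lemma det_derivative_at_one:
 "((\<lambda>t. det (mt m (\<lambda>j i. (if i = j then 1 else 0) + t * A j i))) has_real_derivative (\<Sum>i<m. A i i)) (at 0)"
proof -
 let ?S = "{p. p permutes {0..<m}}"
 let ?f = "\<lambda>p i t. (if i = p i then 1 else 0) + t * A (p i) i"
 have fin: "finite ?S" by (simp add: finite_permutations)
 have d: "((\<lambda>t. \<Sum>p\<in>?S. signof p * (\<Prod>i=0..<m. ?f p i t)) has_real_derivative
  (\<Sum>p\<in>?S. signof p * (\<Sum>i=0..<m. A (p i) i * (\<Prod>j\<in>{0..<m} - {i}. ?f p j 0)))) (at 0)"
  by (intro DERIV_sum DERIV_cmult has_field_derivative_prod) (auto intro!: derivative_eq_intros)
 have z: "(\<Sum>i=0..<m. A (p i) i * (\<Prod>j\<in>{0..<m} - {i}. ?f p j 0)) = 0" if p: "p permutes {0..<m}" "p \<noteq> id" for p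
 proof (rule sum.neutral, rule ballI)
  fix i assume i: "i \<in> {0..<m}"
  have "\<exists>j\<in>{0..<m} - {i}. p j \<noteq> j"
  proof (rule ccontr)
   assume c: "\<not> ?thesis"
   have fx: "p j = j" if "j \<noteq> i" for j using c that p(1) by (cases "j < m") (auto simp: permutes_def)
   have "p i = i"
   by (metis permutes_inj[OF p(1)] fx injD ccontr)
   then have "p x = x" for x using fx by (cases "x = i") auto
   then have "p = id" by auto
   with p(2) show False by simp
  qed
  then obtain j where j: "j \<in> {0..<m} - {i}" "p j \<noteq> j" by blast
  then show "A (p i) i * (\<Prod>j\<in>{0..<m} - {i}. ?f p j 0) = 0"
  by (simp add: prod_zero bexI[of _ j])
 qed
 have "(\<Sum>p\<in>?S. signof p * (\<Sum>i=0..<m. A (p i) i * (\<Prod>j\<in>{0..<m} - {i}. ?f p j 0))) =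
  signof id * (\<Sum>i=0..<m. A (id i) i * (\<Prod>j\<in>{0..<m} - {i}. ?f id j 0))"
  using z by (subst sum.remove[OF fin, of id]) (auto simp: permutes_id intro!: sum.neutral)
 also have "\<dots> = (\<Sum>i<m. A i i)" by (simp add: atLeast0LessThan sign_id)
 finally show ?thesis using d by (simp add: det_mt)
qed

lemma integral_nrm_lin_sq: "(\<integral>g. (nrm k (lin n W g))\<^sup>2 \<partial>gauss n) = (\<Sum>i<k. \<Sum>j<n. (W j i)\<^sup>2)"
proof -
 have e: "(nrm k (lin n W g))\<^sup>2 = (\<Sum>i<k. (ip n g (\<lambda>j. W j i))\<^sup>2)" for g
  unfolding nrm_sq ip_def lin_def by (simp add: power2_eq_square)
 show ?thesis unfolding e
  by (subst Bochner_Integration.integral_sum)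
   (auto simp: integrable_gauss_ip_sq integral_gauss_ip_sq, simp add: ip_def power2_eq_square)
qed

text \<open>Convexity of the square in the form \<open>(a + t b)\<^sup>2 \<le> (1 + t) (a\<^sup>2 + t b\<^sup>2)\<close>.\<close>
lemma ell_sq_mono_combination:
 assumes N: "seminorm k N" and t: "0 < t"
 shows "(ell n (\<lambda>g. N (lin n (\<lambda>j i. U j i + t * W j i) g)))\<^sup>2 \<le>
  (1 + t) * ((ell n (\<lambda>g. N (lin n U g)))\<^sup>2 + t * (ell n (\<lambda>g. N (lin n W g)))\<^sup>2)"
proof -
 have i: "integrable (gauss n) (\<lambda>g. (N (lin n A g))\<^sup>2)" for A
  by (rule integrable_gauss_seminorm_sq[OF seminorm_lin[OF N]])
 have pw: "(N (lin n (\<lambda>j i. U j i + t * W j i) g))\<^sup>2 \<le> (1 + t) * ((N (lin n U g))\<^sup>2 + t * (N (lin n W g))\<^sup>2)" for g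
 proof -
  let ?a = "N (lin n U g)" and ?b = "N (lin n W g)"
  have "lin n (\<lambda>j i. U j i + t * W j i) g = (\<lambda>i. lin n U g i + t * lin n W g i)"
   by (auto simp: lin_def sum.distrib sum_distrib_left algebra_simps)
  then have "N (lin n (\<lambda>j i. U j i + t * W j i) g) \<le> ?a + t * ?b"
   using seminorm_triangle[OF N, of "lin n U g" "\<lambda>i. t * lin n W g i"] seminorm_scale[OF N, of t] t by simp
  then have "(N (lin n (\<lambda>j i. U j i + t * W j i) g))\<^sup>2 \<le> (?a + t * ?b)\<^sup>2"
   by (rule power_mono) (rule seminorm_nonneg[OF N])
  also have "\<dots> = (1 + t) * (?a\<^sup>2 + t * ?b\<^sup>2) - t * (?a - ?b)\<^sup>2" by (simp add: power2_eq_square algebra_simps)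
  also have "\<dots> \<le> (1 + t) * (?a\<^sup>2 + t * ?b\<^sup>2)" using t by simp
  finally show ?thesis .
 qed
 have "(\<integral>g. (N (lin n (\<lambda>j i. U j i + t * W j i) g))\<^sup>2 \<partial>gauss n) \<le>
   (\<integral>g. (1 + t) * ((N (lin n U g))\<^sup>2 + t * (N (lin n W g))\<^sup>2) \<partial>gauss n)"
  by (rule integral_mono[OF i _ pw]) (intro integrable_mult_right Bochner_Integration.integrable_add i)
 also have "\<dots> = (1 + t) * ((\<integral>g. (N (lin n U g))\<^sup>2 \<partial>gauss n) + t * (\<integral>g. (N (lin n W g))\<^sup>2 \<partial>gauss n))"
  using i by simp
 finally show ?thesis by (simp only: ell_sq)
qed

lemma ell_scale:
 assumes "seminorm k N"
 shows "ell n (\<lambda>g. N (lin n (\<lambda>j i. c * U j i) g)) = \<bar>c\<bar> * ell n (\<lambda>g. N (lin n U g))"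
proof -
 have "lin n (\<lambda>j i. c * U j i) g = (\<lambda>i. c * lin n U g i)" for g
  by (auto simp: lin_def sum_distrib_left mult_ac)
 then show ?thesis
  by (simp add: ell_def seminorm_scale[OF assms] power_mult_distrib real_sqrt_mult)
qed

text \<open>Maximising the determinant over the maps with \<open>\<ell>\<close>-norm at most \<open>sqrt m\<close> yields, by comparing
 with the competitors \<open>(U + t W) / (1 + t)\<close> as \<open>t\<close> tends to \<open>0\<close>, a map whose inverse has dual
 \<open>\<ell>\<close>-norm at most \<open>sqrt m\<close> as well.\<close>
lemma lewis:
 assumes N: "seminorm m N" "\<And>x. nrm m x \<le> N x" "\<And>x. N x \<le> d * nrm m x" and d: "1 \<le> d" and m: "0 < m"
 shows "\<exists>U V. (\<forall>x. \<forall>i<m. lin m U (lin m V x) i = x i) \<and> (\<forall>x. \<forall>i<m. lin m V (lin m U x) i = x i) \<and>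
  ell m (\<lambda>g. N (lin m U g)) \<le> sqrt m \<and> (\<forall>W. (\<Sum>i<m. lin m V (W i) i) \<le> sqrt m * ell m (\<lambda>g. N (lin m W g)))"
proof -
 interpret P: prob_space "gauss m" by (rule prob_space_gauss)
 define Q where "Q U = (ell m (\<lambda>g. N (lin m U g)))\<^sup>2" for U
 have i: "integrable (gauss m) (\<lambda>g. (N (lin m A g))\<^sup>2)" for A
  by (rule integrable_gauss_seminorm_sq[OF seminorm_lin[OF N(1)]])
 have i2: "integrable (gauss m) (\<lambda>g. (nrm m (lin m A g))\<^sup>2)" for A
  by (rule integrable_gauss_seminorm_sq[OF seminorm_lin[OF seminorm_nrm]])
 have Qlow: "(\<Sum>i<m. \<Sum>j<m. (U j i)\<^sup>2) \<le> Q U" for U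
  unfolding Q_def ell_sq integral_nrm_lin_sq[symmetric]
  by (rule integral_mono[OF i2 i]) (simp add: N(2) power_mono)
 have Qup: "Q U \<le> d\<^sup>2 * (\<Sum>i<m. \<Sum>j<m. (U j i)\<^sup>2)" for U
 proof -
  have "Q U \<le> (\<integral>g. d\<^sup>2 * (nrm m (lin m U g))\<^sup>2 \<partial>gauss m)"
   unfolding Q_def ell_sq
   by (rule integral_mono[OF i integrable_mult_right[OF i2]])
    (use N(3) seminorm_nonneg[OF N(1)] in \<open>simp add: power_mono flip: power_mult_distrib\<close>)
  then show ?thesis by (simp add: integral_nrm_lin_sq)
 qed
 have entry: "\<bar>U j i\<bar> \<le> sqrt m" if "Q U \<le> m" "i < m" "j < m" for U i j
 proof -
  have "(U j i)\<^sup>2 \<le> (\<Sum>j<m. (U j i)\<^sup>2)" using that(3) by (intro member_le_sum) auto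
  also have "\<dots> \<le> (\<Sum>i<m. \<Sum>j<m. (U j i)\<^sup>2)" using that(2) by (intro member_le_sum[of i "{..<m}" "\<lambda>i. \<Sum>j<m. (U j i)\<^sup>2"]) (auto intro: sum_nonneg)
  also have "\<dots> \<le> m" using Qlow[of U] that(1) by linarith
  finally show ?thesis by (rule real_le_rsqrt[of "\<bar>U j i\<bar>", simplified])
 qed
 \<comment> \<open>the entries below \<open>m\<close> are bounded on \<open>S\<close> by comparison with the Hilbert--Schmidt norm, and \<open>Q\<close> and the
  determinant depend on these only, so a maximising sequence has a limit in every entry\<close>
 define S where "S = {U. Q U \<le> m}"
 define I where "I j i = (if i = j then 1 else (0::real))" for j i :: nat
 have I0: "(\<lambda>j i. (1 / d) * I j i) \<in> S"
 proof -
  have "(\<Sum>i<m. \<Sum>j<m. (1 / d * I j i)\<^sup>2) = (\<Sum>i<m. \<Sum>j<m. if j = i then (1 / d)\<^sup>2 else 0)"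
   by (intro sum.cong) (auto simp: I_def)
  also have "\<dots> = real m * (1 / d)\<^sup>2" by simp
  finally show ?thesis using Qup[of "\<lambda>j i. 1 / d * I j i"] d by (simp add: S_def power_divide)
 qed
 have linI: "lin m (\<lambda>j i. c * I j i) x i = c * x i" if "i < m" for c x i
 proof -
  have "lin m (\<lambda>j i. c * I j i) x i = (\<Sum>j<m. if j = i then c * x i else 0)"
   unfolding lin_def by (rule sum.cong) (auto simp: I_def)
  then show ?thesis using that by simp
 qed
 have detI: "det (mt m I) = 1"
 proof -
  have "mt m I = 1\<^sub>m m" by (rule eq_matI) (auto simp: mt_def I_def)
  then show ?thesis by simp
 qed
 have detc: "det (mt m (\<lambda>j i. c * U j i)) = c ^ m * det (mt m U)" for c U
 proof -
  have "mt m (\<lambda>j i. c * U j i) = c \<cdot>\<^sub>m mt m U" by (rule eq_matI) (auto simp: mt_def)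
  then show ?thesis by (simp add: mt_def)
 qed
 let ?D = "(\<lambda>U. det (mt m U)) ` S"
 have bdd: "bdd_above ?D"
 proof (rule bdd_aboveI2)
  fix U assume U: "U \<in> S"
  have "det (mt m U) \<le> (\<Sum>p\<in>{p. p permutes {0..<m}}. \<Prod>i=0..<m. sqrt m)"
   unfolding det_mt
  proof (rule sum_mono)
   fix p assume p: "p \<in> {p. p permutes {0..<m}}"
   have "signof p * (\<Prod>i=0..<m. U (p i) i) \<le> \<bar>signof p * (\<Prod>i=0..<m. U (p i) i)\<bar>" by (rule abs_ge_self)
   also have "\<dots> = (\<Prod>i=0..<m. \<bar>U (p i) i\<bar>)" by (simp add: abs_mult abs_prod sign_def)
   also have "\<dots> \<le> (\<Prod>i=0..<m. sqrt m)"
   proof (rule prod_mono)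
    fix i assume i: "i \<in> {0..<m}"
    then show "0 \<le> \<bar>U (p i) i\<bar> \<and> \<bar>U (p i) i\<bar> \<le> sqrt m"
  using p permutes_in_image[of p "{0..<m}" i] entry[of U i "p i"] U i by (simp add: S_def)
   qed
   finally show "signof p * (\<Prod>i=0..<m. U (p i) i) \<le> (\<Prod>i=0..<m. sqrt m)" .
  qed
  then show "det (mt m U) \<le> (\<Sum>p\<in>{p. p permutes {0..<m}}. \<Prod>i=0..<m. sqrt m)" .
 qed
 have ne: "?D \<noteq> {}" using I0 by blast
 have "\<exists>U\<in>S. Sup ?D - 1 / Suc k < det (mt m U)" for k
  using less_cSup_iff[OF ne bdd, of "Sup ?D - 1 / Suc k"] by auto
 then obtain Us where Us: "\<And>k. Us k \<in> S" "\<And>k. Sup ?D - 1 / Suc k < det (mt m (Us k))" by metis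
 obtain U r where r: "strict_mono (r :: nat \<Rightarrow> nat)"
  and lim: "\<forall>e>0. eventually (\<lambda>k. \<forall>p\<in>{..<m} \<times> {..<m}. dist (Us (r k) (fst p) (snd p)) (U (fst p) (snd p)) < e) sequentially"
 proof -
  have "\<exists>l r. strict_mono (r :: nat \<Rightarrow> nat) \<and> (\<forall>e>0. eventually (\<lambda>k. \<forall>p\<in>{..<m} \<times> {..<m}. dist (Us (r k) (fst p) (snd p)) (l (fst p) (snd p)) < e) sequentially)"
  proof (rule compact_lemma_general[where proj="\<lambda>U p. U (fst p) (snd p)" and unproj="\<lambda>e i j. e (i, j)", rule_format])
   show "bounded ((\<lambda>x. x (fst p) (snd p)) ` range Us)" if "p \<in> {..<m} \<times> {..<m}" for p
    unfolding bounded_iff using entry Us(1) that by (intro exI[of _ "sqrt m"]) (auto simp: S_def)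
  qed auto
  then show ?thesis using that by blast
 qed
 have lim': "(\<lambda>k. Us (r k) i j) \<longlonglongrightarrow> U i j" if "i < m" "j < m" for i j
  unfolding tendsto_iff using lim that by (auto elim!: eventually_mono)
 have US: "U \<in> S"
 proof -
  have Qt: "Q U \<le> (1 + t) * real m" if t: "0 < t" for t
  proof (rule LIMSEQ_le_const)
   let ?W = "\<lambda>k j i. (1 / t) * (U j i - Us (r k) j i)"
   let ?b = "\<lambda>k. (1 + t) * (m + t * (d\<^sup>2 * (\<Sum>i<m. \<Sum>j<m. (?W k j i)\<^sup>2)))"
   have "?b \<longlonglongrightarrow> (1 + t) * (m + t * (d\<^sup>2 * (\<Sum>i<m. \<Sum>j<m. ((1 / t) * (U j i - U j i))\<^sup>2)))"
    by (intro tendsto_intros lim') auto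
   then show "?b \<longlonglongrightarrow> (1 + t) * m" by simp
   have "Q U \<le> ?b k" for k
   proof -
    have "Q U \<le> (1 + t) * (Q (Us (r k)) + t * Q (?W k))"
  using t ell_sq_mono_combination[OF N(1) t, of m "Us (r k)" "?W k"] by (simp add: fun_eq_iff Q_def)
    also have "\<dots> \<le> ?b k" using t Us(1)[of "r k"] Qup[of "?W k"]
     by (intro mult_left_mono add_mono) (auto simp: S_def)
    finally show ?thesis .
   qed
   then show "\<exists>k0. \<forall>k\<ge>k0. Q U \<le> ?b k" by blast
  qed
  have "Q U \<le> real m + e" if "0 < e" for e
  proof -
   have "Q U \<le> (1 + e / m) * m" using Qt[of "e / m"] that m by simp
   moreover have "(1 + e / m) * m = real m + e" using m by (simp add: field_simps)
   ultimately show ?thesis by simp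
  qed
  then show ?thesis unfolding S_def by (auto intro: field_le_epsilon)
 qed
 have max: "det (mt m W) \<le> det (mt m U)" if "W \<in> S" for W
 proof -
  have "(\<lambda>k. det (mt m (Us (r k)))) \<longlonglongrightarrow> det (mt m U)" by (rule tendsto_det_mt) (rule lim')
  moreover have "(\<lambda>k. Sup ?D - 1 / Suc (r k)) \<longlonglongrightarrow> Sup ?D - 0"
   by (intro tendsto_intros LIMSEQ_subseq_LIMSEQ[OF lim_inverse_n'[THEN LIMSEQ_Suc] r, unfolded o_def])
  ultimately have "Sup ?D \<le> det (mt m U)"
   by (intro LIMSEQ_le[of "\<lambda>k. Sup ?D - 1 / Suc (r k)" _ "\<lambda>k. det (mt m (Us (r k)))"])
    (simp_all only: diff_0_right less_imp_le[OF Us(2)], blast)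
  moreover have "det (mt m W) \<le> Sup ?D" using that bdd by (intro cSup_upper) auto
  ultimately show ?thesis by simp
 qed
 have pos: "0 < det (mt m U)"
 proof -
  have "0 < (1 / d) ^ m * det (mt m I)" using d detI by simp
  then show ?thesis using max[OF I0] unfolding detc by linarith
 qed
 then obtain V where V: "\<forall>x. \<forall>i<m. lin m U (lin m V x) i = x i" "\<forall>x. \<forall>i<m. lin m V (lin m U x) i = x i"
  using mt_inverse[of m U] by auto
 \<comment> \<open>after normalisation \<open>U + t W\<close> competes with \<open>U\<close>, so \<open>det (1 + t V W) \<le> (1 + t)\<^sup>m\<close>; the
  derivatives at \<open>0\<close> are the trace of \<open>V W\<close> and \<open>m\<close>\<close>
 have tr: "(\<Sum>i<m. lin m V (W i) i) \<le> m" if W: "Q W \<le> m" for W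
 proof -
  let ?A = "\<lambda>j. lin m V (W j)"
  let ?f = "\<lambda>t. det (mt m (\<lambda>j i. (if i = j then 1 else 0) + t * ?A j i))"
  have b: "?f t \<le> (1 + t) ^ m" if t: "0 < t" for t
  proof -
   let ?Z = "\<lambda>j i. U j i + t * W j i"
   have "Q ?Z \<le> (1 + t) * (Q U + t * Q W)"
    using ell_sq_mono_combination[OF N(1) t, of m U W] unfolding Q_def .
   also have "\<dots> \<le> (1 + t) * (m + t * m)" using US W t by (intro mult_left_mono add_mono) (auto simp: S_def)
   finally have "Q ?Z \<le> (1 + t)\<^sup>2 * m" by (simp add: power2_eq_square algebra_simps)
   then have "(1 / (1 + t))\<^sup>2 * Q ?Z \<le> m" using t by (simp add: field_simps)
   moreover have "Q (\<lambda>j i. (1 / (1 + t)) * ?Z j i) = (1 / (1 + t))\<^sup>2 * Q ?Z"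
    unfolding Q_def ell_scale[OF N(1)] by (simp add: power_mult_distrib power_divide)
   ultimately have "(\<lambda>j i. (1 / (1 + t)) * ?Z j i) \<in> S" unfolding S_def by simp
   then have "(1 / (1 + t)) ^ m * det (mt m ?Z) \<le> det (mt m U)" using max by (simp only: detc[symmetric])
   then have 1: "det (mt m ?Z) \<le> (1 + t) ^ m * det (mt m U)" using t by (simp add: power_divide field_simps)
   have "mt m ?Z = mt m (\<lambda>j. lin m U (\<lambda>i. (if i = j then 1 else 0) + t * ?A j i))"
   proof -
    have "lin m U (\<lambda>i. (if i = j then 1 else 0) + t * ?A j i) i = U j i + t * W j i" if "j < m" "i < m" for j i
    proof -
     have "lin m U (\<lambda>i. if i = j then 1 else 0) i = (\<Sum>k<m. if k = j then U j i else 0)"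
      unfolding lin_def by (rule sum.cong) auto
     also have "\<dots> = U j i" using that by simp
     finally show ?thesis using that V(1) by (simp add: lin_add lin_scale)
    qed
    then show ?thesis by (intro eq_matI) (auto simp: mt_def)
   qed
   then have "det (mt m ?Z) = det (mt m U) * ?f t" by (simp only: det_mt_lin)
   with 1 pos show ?thesis by (simp add: mult.commute)
  qed
  have f0: "?f 0 = 1" using detI by (simp add: I_def[abs_def])
  have "((\<lambda>t. (1 + t) ^ m - ?f t) has_real_derivative (real m * (1 + 0) ^ (m - 1) * 1 - (\<Sum>i<m. ?A i i))) (at 0)"
   by (intro DERIV_diff det_derivative_at_one) (auto intro!: derivative_eq_intros)
  then have der: "((\<lambda>t. (1 + t) ^ m - ?f t) has_real_derivative (m - (\<Sum>i<m. ?A i i))) (at 0)" by simp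
  show ?thesis
  proof (rule ccontr)
   assume "\<not> ?thesis"
   then have "m - (\<Sum>i<m. ?A i i) < 0" by simp
   from DERIV_neg_dec_right[OF der this] obtain e where e: "0 < e"
    "\<And>h. 0 < h \<Longrightarrow> h < e \<Longrightarrow> (1 + (0 + h)) ^ m - ?f (0 + h) < (1 + 0) ^ m - ?f 0" by blast
   from e(2)[of "e / 2"] e(1) b[of "e / 2"] show False by (simp add: f0[simplified])
  qed
 qed
 have tr': "(\<Sum>i<m. lin m V (W i) i) \<le> sqrt m * ell m (\<lambda>g. N (lin m W g))" for W
 proof -
  let ?l = "ell m (\<lambda>g. N (lin m W g))"
  have "(\<Sum>i<m. lin m V (W i) i) \<le> sqrt m * s" if s: "?l < s" for s
  proof -
   have s0: "0 < s" using s ell_nonneg[of m "\<lambda>g. N (lin m W g)"] by linarith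
   let ?c = "sqrt m / s"
   have "ell m (\<lambda>g. N (lin m (\<lambda>j i. ?c * W j i) g)) = ?c * ?l" unfolding ell_scale[OF N(1)] using s0 by simp
   also have "\<dots> \<le> ?c * s" using s s0 by (intro mult_left_mono) auto
   also have "\<dots> = sqrt m" using s0 by simp
   finally have "Q (\<lambda>j i. ?c * W j i) \<le> (sqrt m)\<^sup>2" unfolding Q_def by (rule power_mono) (rule ell_nonneg)
   then have "(\<Sum>i<m. lin m V (\<lambda>k. ?c * W i k) i) \<le> m" by (intro tr) simp
   then have "?c * (\<Sum>i<m. lin m V (W i) i) \<le> m" unfolding lin_scale sum_distrib_left .
   then have "sqrt m * (\<Sum>i<m. lin m V (W i) i) \<le> sqrt m * (sqrt m * s)" using s0 by (simp add: field_simps)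
   then show ?thesis using m by simp
  qed
  then show ?thesis using dense_ge[of "?l" "(\<Sum>i<m. lin m V (W i) i) / sqrt m"] m by (simp add: field_simps)
 qed
 have "ell m (\<lambda>g. N (lin m U g)) \<le> sqrt m"
  using US ell_nonneg by (intro real_le_rsqrt) (simp add: S_def Q_def)
 with V tr' show ?thesis by blast
qed

section \<open>Almost full Euclidean sections\<close>

text \<open>Weak cotype 2 in terms of Gelfand numbers, for all maps from Euclidean spaces into the space
 normed by \<open>N\<close>. The strict inequality admits every constant above an infimum that need not be
 attained.\<close>
definition gelfand_bounded :: "real \<Rightarrow> ((nat \<Rightarrow> real) \<Rightarrow> real) \<Rightarrow> bool" where
 "gelfand_bounded C N \<longleftrightarrow>
  (\<forall>m U k c. 1 \<le> k \<and> k \<le> m \<and> C / sqrt k * ell m (\<lambda>x. N (lin m U x)) < c \<longrightarrow>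
    gel m (\<lambda>x. N (lin m U x)) (k - 1) c)"

lemma gelfand_boundedD:
 assumes "gelfand_bounded C N" and "1 \<le> k" "k \<le> m" "C / sqrt k * ell m (\<lambda>x. N (lin m U x)) < c"
 shows "gel m (\<lambda>x. N (lin m U x)) (k - 1) c"
 by (rule assms(1)[unfolded gelfand_bounded_def, rule_format]) (use assms(2-4) in simp)

lemma gelfand_bounded_lin: "gelfand_bounded C N \<Longrightarrow> gelfand_bounded C (\<lambda>x. N (lin k W x))"
 unfolding gelfand_bounded_def lin_lin by (intro allI impI) (elim allE impE, assumption, assumption)

lemma euclidean_net:
 assumes \<delta>: "0 < \<delta>" shows "\<exists>\<Theta>. finite \<Theta> \<and> (\<forall>x. nrm n x \<le> 1 \<longrightarrow> (\<exists>\<theta>\<in>\<Theta>. nrm n (\<lambda>i. x i - \<theta> i) \<le> \<delta>))"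
proof -
 obtain k :: nat where k: "real n / \<delta> < k" using reals_Archimedean2 by blast
 moreover have "0 \<le> real n / \<delta>" using \<delta> by simp
 ultimately have k0: "0 < real k" by linarith
 let ?\<Theta> = "(\<lambda>f i. real_of_int (f i) / k) ` (Pi\<^sub>E {..<n} (\<lambda>_. {- int k..int k}))"
 have "\<exists>\<theta>\<in>?\<Theta>. nrm n (\<lambda>i. x i - \<theta> i) \<le> \<delta>" if x: "nrm n x \<le> 1" for x
 proof
  define f where "f = (\<lambda>i\<in>{..<n}. \<lfloor>x i * k\<rfloor>)"
  have "f i \<in> {- int k..int k}" if "i < n" for i
  proof -
   have "\<bar>x i\<bar> \<le> 1" using coord_le_nrm[OF that, of x] x by linarith
   then have "x i * k \<le> k" "- real k \<le> x i * k" using k0 mult_right_mono[of "x i" 1 k] mult_right_mono[of "-1" "x i" k] by (auto simp: abs_le_iff)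
   then show ?thesis using that by (simp add: f_def le_floor_iff floor_le_iff)
  qed
  then show "(\<lambda>i. real_of_int (f i) / k) \<in> ?\<Theta>" by (intro imageI) (auto simp: f_def PiE_def extensional_def)
  have "\<bar>x i - f i / k\<bar> \<le> 1 / k" if "i < n" for i
  proof -
   have "\<bar>x i * k - f i\<bar> \<le> 1" using that unfolding f_def by simp linarith
   then have "\<bar>(x i * k - f i) / k\<bar> \<le> 1 / k" using k0 by (simp add: abs_divide divide_right_mono)
   then show ?thesis using k0 by (simp add: diff_divide_distrib)
  qed
  then have "nrm n (\<lambda>i. x i - f i / k) \<le> (\<Sum>i<n. 1 / k)"
   unfolding nrm_L2_set by (intro order.trans[OF L2_set_le_sum_abs] sum_mono) auto
  also have "\<dots> \<le> \<delta>" using k k0 \<delta> by (simp add: field_simps)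
  finally show "nrm n (\<lambda>i. x i - f i / k) \<le> \<delta>" .
 qed
 then show ?thesis by (intro exI[of _ ?\<Theta>]) (auto intro!: finite_PiE)
qed

text \<open>The net has to lie in the unit ball of \<open>N\<close> itself, so each Euclidean net point is replaced by a
 nearby point of that ball if there is one.\<close>
lemma unit_ball_net:
 assumes N: "seminorm n N" "\<And>x. nrm n x \<le> N x" and q: "seminorm n q" and \<kappa>: "0 < \<kappa>"
 shows "\<exists>X. finite X \<and> X \<noteq> {} \<and> (\<forall>x\<in>X. N x \<le> 1) \<and> (\<forall>x. N x \<le> 1 \<longrightarrow> (\<exists>y\<in>X. q (\<lambda>i. x i - y i) \<le> \<kappa>))"
proof -
 obtain B where B: "0 \<le> B" "\<And>x. q x \<le> B * nrm n x" using seminorm_bounded[OF q] by blast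
 define \<delta> where "\<delta> = \<kappa> / (2 * B + 1)"
 have \<delta>: "0 < \<delta>" "(2 * B + 1) * \<delta> = \<kappa>" using \<kappa> B(1) by (auto simp: \<delta>_def)
 obtain \<Theta> where \<Theta>: "finite \<Theta>" "\<And>x. nrm n x \<le> 1 \<Longrightarrow> \<exists>\<theta>\<in>\<Theta>. nrm n (\<lambda>i. x i - \<theta> i) \<le> \<delta>"
  using euclidean_net[OF \<delta>(1), of n] by blast
 let ?near = "\<lambda>\<theta> x. N x \<le> 1 \<and> nrm n (\<lambda>i. x i - \<theta> i) \<le> \<delta>"
 define X where "X = (\<lambda>\<theta>. SOME x. ?near \<theta> x) ` {\<theta> \<in> \<Theta>. \<exists>x. ?near \<theta> x}"
 have near: "?near \<theta> (SOME x. ?near \<theta> x)" if "\<exists>x. ?near \<theta> x" for \<theta> using someI_ex[OF that] .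
 have net: "\<exists>y\<in>X. q (\<lambda>i. x i - y i) \<le> \<kappa>" if x: "N x \<le> 1" for x
 proof -
  obtain \<theta> where t: "\<theta> \<in> \<Theta>" "nrm n (\<lambda>i. x i - \<theta> i) \<le> \<delta>" using \<Theta>(2)[of x] N(2)[of x] x by force
  let ?y = "SOME y. ?near \<theta> y"
  have ex: "\<exists>y. ?near \<theta> y" using x t(2) by blast
  note y = near[OF ex]
  have "nrm n (\<lambda>i. x i - ?y i) = nrm n (\<lambda>i. (x i - \<theta> i) - (?y i - \<theta> i))" by (rule nrm_cong) simp
  also have "\<dots> \<le> nrm n (\<lambda>i. x i - \<theta> i) + nrm n (\<lambda>i. ?y i - \<theta> i)" by (rule nrm_diff_le)
  also have "\<dots> \<le> 2 * \<delta>" using t(2) y by simp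
  finally have "nrm n (\<lambda>i. x i - ?y i) \<le> 2 * \<delta>" .
  then have "q (\<lambda>i. x i - ?y i) \<le> B * (2 * \<delta>)"
   using B by (meson order.trans mult_left_mono)
  also have "\<dots> \<le> \<kappa>" using \<delta> by (simp add: algebra_simps)
  finally have "q (\<lambda>i. x i - ?y i) \<le> \<kappa>" .
  moreover have "?y \<in> X" using t(1) ex by (auto simp: X_def)
  ultimately show ?thesis by blast
 qed
 have "N (\<lambda>_. 0) \<le> 1" using seminorm_zero[OF N(1)] by simp
 from net[OF this] have "X \<noteq> {}" by blast
 moreover have "finite X" using \<Theta>(1) by (simp add: X_def)
 moreover have "\<forall>x\<in>X. N x \<le> 1" using near by (auto simp: X_def)
 ultimately show ?thesis using net by blast
qed

text \<open>One improvement step. In Lewis position the Gelfand numbers bound the norm from above on a large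
 subspace, and the low \<open>M\<^sup>*\<close> estimate bounds it from below on another one; only the square root of
 the old distance enters, through the K-convexity constant.\<close>
lemma distance_improvement:
 assumes N: "seminorm m N" "\<And>x. nrm m x \<le> N x" "\<And>x. N x \<le> d * nrm m x" and d: "1 \<le> d" and m: "0 < m"
  and C: "gelfand_bounded C N" "0 \<le> C" and \<epsilon>: "0 < \<epsilon>" "\<epsilon> < 1"
 shows "\<exists>k W. (1 - \<epsilon>) * m \<le> real k \<and> (\<forall>x. nrm k x \<le> N (lin k W x)) \<and>
  (\<forall>x. N (lin k W x) \<le> exp ((41 + 40 * C) / \<epsilon>) * sqrt d * nrm k x)"
proof -
 obtain U V where UV: "\<And>x i. i < m \<Longrightarrow> lin m U (lin m V x) i = x i" "\<And>x i. i < m \<Longrightarrow> lin m V (lin m U x) i = x i"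
  and U: "ell m (\<lambda>g. N (lin m U g)) \<le> sqrt m"
  and V: "\<And>W. (\<Sum>i<m. lin m V (W i) i) \<le> sqrt m * ell m (\<lambda>g. N (lin m W g))"
  using lewis[OF N d m] by blast
 have upper: "gel m (\<lambda>x. N (lin m U x)) (k - 1) ((C + 1) * sqrt m / sqrt k)" if "1 \<le> k" "k \<le> m" for k
 proof (rule gelfand_boundedD[OF C(1) that])
  have "C / sqrt k * ell m (\<lambda>g. N (lin m U g)) \<le> C / sqrt k * sqrt m" using U C(2) by (intro mult_left_mono) auto
  also have "\<dots> < (C + 1) * sqrt m / sqrt k" using m that(1) by (simp add: field_simps)
  finally show "C / sqrt k * ell m (\<lambda>g. N (lin m U g)) < (C + 1) * sqrt m / sqrt k" .
 qed
 have d0: "1 \<le> sqrt d" using d by simp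
 have dist: ?thesis if k: "(1 - \<epsilon>) * m \<le> real k" and W: "\<And>x. nrm k x \<le> A * N (lin k W x)" "\<And>x. N (lin k W x) \<le> c * nrm k x"
  and A: "0 \<le> A" and Ac: "A * c \<le> exp ((41 + 40 * C) / \<epsilon>) * sqrt d" for k W A c
 proof (intro exI conjI allI)
  let ?W = "\<lambda>j i. A * W j i"
  have e: "N (lin k ?W x) = A * N (lin k W x)" for x
  proof -
   have "lin k ?W x = (\<lambda>i. A * lin k W x i)" by (auto simp: lin_def sum_distrib_left mult_ac)
   then show ?thesis using seminorm_scale[OF N(1)] A by simp
  qed
  show "(1 - \<epsilon>) * m \<le> real k" by (rule k)
  show "nrm k x \<le> N (lin k ?W x)" for x unfolding e by (rule W)
  show "N (lin k ?W x) \<le> exp ((41 + 40 * C) / \<epsilon>) * sqrt d * nrm k x" for x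
  by (smt (verit) W(2) A mult_right_mono[OF Ac nrm_nonneg, of k x] mult_left_mono mult.assoc e)
 qed
 have exp1: "x \<le> exp x" for x :: real using exp_ge_add_one_self[of x] by linarith
 have "(40 * C + 40) / \<epsilon> * (1 / \<epsilon>) \<le> exp ((40 * C + 40) / \<epsilon>) * exp (1 / \<epsilon>)"
  using \<epsilon> C(2) by (intro mult_mono exp1) auto
 also have "\<dots> = exp ((41 + 40 * C) / \<epsilon>)" by (simp add: exp_add[symmetric] add_divide_distrib)
 finally have E: "40 * (C + 1) * (1 / \<epsilon>) * (1 / \<epsilon>) \<le> exp ((41 + 40 * C) / \<epsilon>)" by simp
 show ?thesis
 proof (cases "\<epsilon> * m < 2")
  case True
  \<comment> \<open>no codimension is spent, but the dimension is at most \<open>2 / \<epsilon>\<close>, so that bounds depending on \<open>m\<close>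
    are admissible; this one tests trace duality on maps of rank one\<close>
  have low: "nrm m x \<le> sqrt m * N (lin m U x)" for x
  proof (cases "nrm m x = 0")
   case True
   then show ?thesis using seminorm_nonneg[OF N(1)] by simp
  next
   case False
   have "(\<Sum>i<m. lin m V (\<lambda>c. x i * lin m U x c) i) \<le> sqrt m * ell m (\<lambda>g. N (lin m (\<lambda>i c. x i * lin m U x c) g))"
    by (rule V)
   also have "(\<Sum>i<m. lin m V (\<lambda>c. x i * lin m U x c) i) = ip m x x"
    by (simp add: lin_scale UV(2) ip_def)
   also have "ell m (\<lambda>g. N (lin m (\<lambda>i c. x i * lin m U x c) g)) = nrm m x * N (lin m U x)"
   proof -
    have "lin m (\<lambda>i c. x i * lin m U x c) g = (\<lambda>c. ip m g x * lin m U x c)" for g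
     by (simp only: lin_def[of m "\<lambda>i c. x i * lin m U x c"] ip_def sum_distrib_right mult.assoc)
    then show ?thesis
  by (simp add: seminorm_scale[OF N(1)] power_mult_distrib seminorm_nonneg[OF N(1)] ell_def integral_gauss_ip_sq real_sqrt_mult nrm_def)
   qed
   finally have "nrm m x * nrm m x \<le> nrm m x * (sqrt m * N (lin m U x))"
    by (simp add: nrm_sq[symmetric] power2_eq_square mult_ac)
   then show ?thesis using False nrm_nonneg[of m x] by simp
  qed
  obtain r where r: "\<And>x. N (lin m U x) \<le> (C + 1) * sqrt m * nrm m x"
   using upper[of 1] m by (auto simp: gel_def)
  show ?thesis
  proof (rule dist[OF _ low r])
   show "(1 - \<epsilon>) * m \<le> real m" using \<epsilon> by (simp add: algebra_simps)
   have "sqrt m * ((C + 1) * sqrt m) = (C + 1) * m" by (simp add: mult_ac)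
   also have "\<dots> \<le> (C + 1) * (40 * (1 / \<epsilon>))" using True C \<epsilon> by (intro mult_left_mono) (auto simp: field_simps)
   also have "\<dots> \<le> (C + 1) * (40 * (1 / \<epsilon>)) * (1 / \<epsilon>)"
    using mult_left_mono[of 1 "1 / \<epsilon>" "(C + 1) * (40 * (1 / \<epsilon>))"] C \<epsilon> by simp
   also have "\<dots> \<le> exp ((41 + 40 * C) / \<epsilon>)" using E by (simp add: mult_ac)
   also have "\<dots> \<le> exp ((41 + 40 * C) / \<epsilon>) * sqrt d" using d0 by simp
   finally show "sqrt m * ((C + 1) * sqrt m) \<le> exp ((41 + 40 * C) / \<epsilon>) * sqrt d" .
  qed simp
 next
  case False
  \<comment> \<open>half of the codimension is spent on the lower bound and half on the upper bound\<close>
  define k where "k = nat \<lfloor>\<epsilon> * m / 2\<rfloor>"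
  have k0: "real k \<le> \<epsilon> * m / 2" unfolding k_def using \<epsilon> by (intro of_nat_floor) simp
  have k2: "\<epsilon> * m / 2 < real k + 1" unfolding k_def using \<epsilon> by linarith
  have k1: "1 \<le> k" using False by (simp add: k_def le_nat_iff)
  have "\<epsilon> * m \<le> 1 * real m" using \<epsilon> by (intro mult_right_mono) auto
  then have km: "2 * k \<le> m" using k0 by linarith
  have mk: "real m / k \<le> 4 / \<epsilon>"
  using k1 k2 \<epsilon> by (simp add: field_simps)
  \<comment> \<open>fine enough for the net to contribute no more than a constant to the low \<open>M\<^sup>*\<close> estimate\<close>
  let ?\<kappa> = "1 / sqrt m"
  have \<kappa>: "0 < ?\<kappa>" "?\<kappa> \<le> 1" "?\<kappa> * sqrt m = 1" using m by auto
  obtain X where X: "finite X" "X \<noteq> {}" "\<And>x. x \<in> X \<Longrightarrow> N x \<le> 1"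
   "\<And>x. N x \<le> 1 \<Longrightarrow> \<exists>y\<in>X. nrm m (lin m V (\<lambda>i. x i - y i)) \<le> ?\<kappa>"
   using unit_ball_net[OF N(1,2) seminorm_lin[OF seminorm_nrm[of m]] \<kappa>(1), of V] by blast
  have w: "(\<integral>g. Max ((\<lambda>q. \<bar>ip m g q\<bar>) ` lin m V ` X) \<partial>gauss m) \<le> sqrt m * sqrt (6 * d)"
   using mstar_bound[OF N d V _ X(1,2,3)] by simp
  define A where "A = 20 * (1 / \<epsilon>) * sqrt d"
  have A0: "0 < A" using \<epsilon> d by (simp add: A_def)
  have s: "sqrt m / sqrt k \<le> 2 * (1 / \<epsilon>)"
  proof -
   have "sqrt m / sqrt k = sqrt (m / k)" by (simp add: real_sqrt_divide)
   also have "\<dots> \<le> sqrt (4 / \<epsilon>)" using mk by simp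
   also have "\<dots> \<le> 2 * (1 / \<epsilon>)"
   proof (rule real_le_lsqrt)
    show "4 / \<epsilon> \<le> (2 * (1 / \<epsilon>))\<^sup>2" using \<epsilon> by (simp add: power2_eq_square field_simps)
   qed (use \<epsilon> in auto)
   finally show ?thesis .
  qed
  obtain r1 where r1: "\<And>y. \<forall>i<k. ip m (r1 i) y = 0 \<Longrightarrow> \<exists>q\<in>lin m V ` X. nrm m (\<lambda>i. y i - q i) \<le> ?\<kappa> \<Longrightarrow>
    sqrt (2 / pi) * nrm m y \<le> 2 * (sqrt m * sqrt (6 * d)) / sqrt k + ?\<kappa> * sqrt m + ?\<kappa>"
   using section_of_small_mean_width[OF _ _ w, of k ?\<kappa>] X(1,2) k1 \<kappa>(1) by (auto simp del: divide_le_0_1_iff)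
  have r1: "nrm m (lin m V x) \<le> A" if x: "N x \<le> 1" and y: "\<forall>i<k. ip m (r1 i) (lin m V x) = 0" for x
  proof -
   obtain z where z: "z \<in> X" "nrm m (lin m V (\<lambda>i. x i - z i)) \<le> ?\<kappa>" using X(4)[OF x] by blast
   then have "\<exists>q\<in>lin m V ` X. nrm m (\<lambda>i. lin m V x i - q i) \<le> ?\<kappa>" by (auto simp: lin_diff)
   from r1[OF y this] have "sqrt (2 / pi) * nrm m (lin m V x) \<le> 2 * (sqrt m / sqrt k) * sqrt (6 * d) + 2"
    using \<kappa>(2) unfolding \<kappa>(3) by simp
   also have "\<dots> \<le> 2 * (2 * (1 / \<epsilon>)) * (5 / 2 * sqrt d) + 2 * ((1 / \<epsilon>) * sqrt d)"
   proof (intro add_mono mult_mono s)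
    have "sqrt 6 \<le> 5 / 2" by (rule real_le_lsqrt) (auto simp: power2_eq_square)
    then show "sqrt (6 * d) \<le> 5 / 2 * sqrt d" using d by (simp add: real_sqrt_mult mult_right_mono)
    have "1 * 1 \<le> (1 / \<epsilon>) * sqrt d" by (rule mult_mono) (use \<epsilon> d0 in auto)
    then show "2 \<le> 2 * ((1 / \<epsilon>) * sqrt d)" by linarith
   qed (use \<epsilon> d in auto)
   also have "\<dots> = 12 * (1 / \<epsilon>) * sqrt d" by simp
   finally have "sqrt (2 / pi) * nrm m (lin m V x) \<le> 12 * (1 / \<epsilon>) * sqrt d" .
   moreover have "3 / 5 * nrm m (lin m V x) \<le> sqrt (2 / pi) * nrm m (lin m V x)"
    using pi_less_4 by (intro mult_right_mono real_le_rsqrt) (auto simp: field_simps power2_eq_square)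
   ultimately show ?thesis unfolding A_def by linarith
  qed
  have low: "nrm m y \<le> A * N (lin m U y)" if y: "\<forall>i<k. ip m (r1 i) y = 0" for y
  proof -
   have "nrm m y \<le> A * t" if t: "N (lin m U y) < t" for t
   proof -
    have t0: "0 < t" using t seminorm_nonneg[OF N(1)] by (meson le_less_trans)
    let ?x = "\<lambda>i. (1 / t) * lin m U y i"
    have "N ?x = (1 / t) * N (lin m U y)" unfolding seminorm_scale[OF N(1)] using t0 by simp
    also have "\<dots> \<le> 1" using t t0 by simp
    finally have x: "N ?x \<le> 1" .
    have "ip m (r1 i) (lin m V ?x) = (1 / t) * ip m (r1 i) y" for i
    proof -
     have "ip m (r1 i) (lin m V ?x) = ip m (r1 i) (\<lambda>i. (1 / t) * y i)"
      by (rule ip_cong) (simp_all only: lin_scale UV(2))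
     then show ?thesis by (simp only: ip_scale_right)
    qed
    then have "nrm m (lin m V ?x) \<le> A" using r1 x y by (metis mult_zero_right)
    moreover have "nrm m (lin m V ?x) = nrm m (\<lambda>i. (1 / t) * y i)"
     by (rule nrm_cong) (simp only: lin_scale UV(2))
    moreover have "\<dots> = (1 / t) * nrm m y" unfolding nrm_scale using t0 by simp
    ultimately have "(1 / t) * nrm m y \<le> A" by linarith
    then show ?thesis using t0 by (simp add: field_simps)
   qed
   then have "nrm m y \<le> A * N (lin m U y) + e" if e: "0 < e" for e
   proof -
    show ?thesis using \<open>\<And>t. N (lin m U y) < t \<Longrightarrow> nrm m y \<le> A * t\<close>[of "N (lin m U y) + e / A"] e A0
     by (simp add: distrib_left)
   qed
   then show ?thesis by (rule field_le_epsilon)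
  qed
  obtain r2 where r2: "\<And>x. (\<forall>i<k-1. ip m (r2 i) x = 0) \<Longrightarrow> N (lin m U x) \<le> (C + 1) * sqrt m / sqrt k * nrm m x"
   using upper[of k] k1 km by (auto simp: gel_def)
  define r where "r i = (if i < k then r1 i else r2 (i - k))" for i
  obtain f where f: "orthonormal m (m - 2 * k) f" "\<forall>i<m-2*k. \<forall>j<2*k. ip m (f i) (r j) = 0"
   using orthonormal_in_kernel[of "m - 2 * k" "2 * k" m r] km by auto
  have ker: "ip m (r j) (lin (m - 2 * k) f x) = 0" if "j < 2 * k" for j x
   unfolding ip_lin_right using f(2) that by (intro sum.neutral) (auto simp: ip_commute)
  have ker1: "\<forall>j<k. ip m (r1 j) (lin (m - 2 * k) f x) = 0" for x
  proof (intro allI impI)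
   fix j assume "j < k" then show "ip m (r1 j) (lin (m - 2 * k) f x) = 0" using ker[of j x] by (simp add: r_def)
  qed
  have ker2: "\<forall>j<k-1. ip m (r2 j) (lin (m - 2 * k) f x) = 0" for x
  proof (intro allI impI)
   fix j assume "j < k - 1" then show "ip m (r2 j) (lin (m - 2 * k) f x) = 0"
    using ker[of "k + j" x] by (simp add: r_def)
  qed
  show ?thesis
  proof (rule dist[where k="m - 2 * k" and W="\<lambda>j. lin m U (f j)" and A=A and c="(C + 1) * sqrt m / sqrt k"])
   show "(1 - \<epsilon>) * m \<le> real (m - 2 * k)" using k0 km by (simp add: algebra_simps)
   show "nrm (m - 2 * k) x \<le> A * N (lin (m - 2 * k) (\<lambda>j. lin m U (f j)) x)" for x
    using low[OF ker1[of x]] by (simp only: orthonormal_nrm_lin[OF f(1)] lin_lin)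
   show "N (lin (m - 2 * k) (\<lambda>j. lin m U (f j)) x) \<le> (C + 1) * sqrt m / sqrt k * nrm (m - 2 * k) x" for x
    using r2[OF ker2[of x]] by (simp only: orthonormal_nrm_lin[OF f(1)] lin_lin)
   show "0 \<le> A" using A0 by simp
   have "A * ((C + 1) * (sqrt m / sqrt k)) \<le> A * ((C + 1) * (2 * (1 / \<epsilon>)))"
    using A0 C(2) s by (intro mult_left_mono) auto
   also have "\<dots> = 40 * (C + 1) * (1 / \<epsilon>) * (1 / \<epsilon>) * sqrt d" by (simp add: A_def)
   also have "\<dots> \<le> exp ((41 + 40 * C) / \<epsilon>) * sqrt d" using E d by (intro mult_right_mono) auto
   finally show "A * ((C + 1) * sqrt m / sqrt k) \<le> exp ((41 + 40 * C) / \<epsilon>) * sqrt d" by simp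
  qed
 qed
qed

text \<open>The proportions \<open>\<eta> / 3 * (3 / 4) ^ J\<close>, taken with the smallest first, have sum less than \<open>\<eta>\<close>. Each
 improvement halves the logarithm of the distance and adds \<open>(41 + 40 C) / \<epsilon>\<close>, which together multiply the
 bound \<open>12 (41 + 40 C) / \<eta> * (4 / 3) ^ J\<close> on the logarithm by \<open>3 / 4\<close>.\<close>
lemma iterated_improvement:
 assumes C: "0 \<le> C" and \<eta>: "0 < \<eta>" "\<eta> < 1"
 shows "seminorm m N \<Longrightarrow> (\<And>x. nrm m x \<le> N x) \<Longrightarrow> (\<And>x. N x \<le> exp (12 * (41 + 40 * C) / \<eta> * (4 / 3) ^ J) * nrm m x) \<Longrightarrow>
  0 < m \<Longrightarrow> gelfand_bounded C N \<Longrightarrow>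
  \<exists>k W. (1 - \<eta> * (1 - (3 / 4) ^ J)) * m \<le> real k \<and> (\<forall>x. nrm k x \<le> N (lin k W x)) \<and>
  (\<forall>x. N (lin k W x) \<le> exp (12 * (41 + 40 * C) / \<eta>) * nrm k x)"
proof (induction J arbitrary: m N)
 case 0
 let ?e = "\<lambda>j i. if i = j then 1 else (0::real)"
 have e: "N (lin m ?e x) = N x" for x
 proof (rule seminorm_cong[OF 0(1)])
  fix i assume "i < m"
  have "lin m ?e x i = (\<Sum>j<m. if j = i then x i else 0)" unfolding lin_def by (rule sum.cong) auto
  then show "lin m ?e x i = x i" using \<open>i < m\<close> by simp
 qed
 show ?case using 0(2,3) by (intro exI[of _ m] exI[of _ ?e]) (simp add: e)
next
 case (Suc J)
 let ?c = "41 + 40 * C"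
 define \<epsilon> where "\<epsilon> = \<eta> / 3 * (3 / 4) ^ Suc J"
 let ?d = "exp (12 * ?c / \<eta> * (4 / 3) ^ Suc J)"
 have p: "(3 / 4 :: real) ^ Suc J \<le> 1" by (rule power_le_one) auto
 have \<epsilon>: "0 < \<epsilon>" "\<epsilon> < 1"
  using \<eta> p mult_mono[of "\<eta> / 3" "1 / 3" "(3 / 4) ^ Suc J" 1] by (auto simp: \<epsilon>_def)
 have d: "1 \<le> ?d" using C \<eta> by simp
 from distance_improvement[OF Suc.prems(1-3) d Suc.prems(4,5) C \<epsilon>] obtain k W where
  k: "(1 - \<epsilon>) * m \<le> real k" and W: "\<And>x. nrm k x \<le> N (lin k W x)"
   "\<And>x. N (lin k W x) \<le> exp (?c / \<epsilon>) * sqrt ?d * nrm k x" by blast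
 have "0 < (1 - \<epsilon>) * m" using \<epsilon> Suc.prems(4) by simp
 then have k0: "0 < k" using k by linarith
 have "exp (c / \<epsilon>) * sqrt (exp (12 * c / \<eta> * (4 / 3) ^ Suc J)) = exp (12 * c / \<eta> * (4 / 3) ^ J)" for c
 proof -
  have "sqrt (exp y) = exp (y / 2)" for y :: real
   by (rule real_sqrt_unique) (simp_all add: power2_eq_square exp_add[symmetric])
  moreover have "c / \<epsilon> + 12 * c / \<eta> * (4 / 3) ^ Suc J / 2 = 12 * c / \<eta> * (4 / 3) ^ J"
  using \<eta> by (simp add: power_mult_distrib[symmetric] eq_divide_eq \<epsilon>_def field_simps)
  ultimately show ?thesis by (simp only: exp_add[symmetric])
 qed
 from this[of ?c] W(2) have W2: "N (lin k W x) \<le> exp (12 * ?c / \<eta> * (4 / 3) ^ J) * nrm k x" for x by (simp only:)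
 from Suc.IH[OF seminorm_lin[OF Suc.prems(1)] W(1) W2 k0 gelfand_bounded_lin[OF Suc.prems(5)]]
 obtain l W' where l: "(1 - \<eta> * (1 - (3 / 4) ^ J)) * k \<le> real l"
  and W': "\<And>x. nrm l x \<le> N (lin k W (lin l W' x))" "\<And>x. N (lin k W (lin l W' x)) \<le> exp (12 * ?c / \<eta>) * nrm l x" by blast
 let ?s = "\<eta> * (1 - (3 / 4) ^ J)"
 have s: "0 \<le> ?s" "?s \<le> 1"
 proof -
  have q: "0 \<le> 1 - (3 / 4 :: real) ^ J" "1 - (3 / 4 :: real) ^ J \<le> 1" by (auto intro: power_le_one)
  show "0 \<le> ?s" using q \<eta> by (intro mult_nonneg_nonneg) auto
  show "?s \<le> 1" using q \<eta> mult_mono[of \<eta> 1 "1 - (3 / 4) ^ J" 1] by auto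
 qed
 have "(1 - \<eta> * (1 - (3 / 4) ^ Suc J)) * m = (1 - ?s - \<epsilon>) * m" by (simp add: \<epsilon>_def algebra_simps)
 also have "(1 - ?s - \<epsilon>) * m \<le> (1 - ?s) * ((1 - \<epsilon>) * m)"
 proof -
  have "0 \<le> ?s * (\<epsilon> * m)" using \<epsilon> by (intro mult_nonneg_nonneg[OF s(1)]) simp
  moreover have "(1 - s) * ((1 - \<epsilon>) * m) = (1 - s - \<epsilon>) * m + s * (\<epsilon> * m)" for s by (simp add: algebra_simps)
  ultimately show ?thesis by simp
 qed
 also have "\<dots> \<le> (1 - ?s) * k" using k s by (intro mult_left_mono) auto
 also have "\<dots> \<le> real l" by (rule l)
 finally have "(1 - \<eta> * (1 - (3 / 4) ^ Suc J)) * m \<le> real l" .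
 with W' show ?case unfolding lin_lin by blast
qed

theorem euclidean_sections:
 assumes C: "gelfand_bounded C N" "0 \<le> C" and \<eta>: "0 < \<eta>" "\<eta> < 1"
  and N: "seminorm m N" and b: "0 < b" "\<And>x. b * nrm m x \<le> N x"
 shows "\<exists>k W. (1 - \<eta>) * m \<le> real k \<and> (\<forall>x. nrm k x \<le> N (lin k W x)) \<and>
  (\<forall>x. N (lin k W x) \<le> exp (12 * (41 + 40 * C) / \<eta>) * nrm k x)"
proof (cases "m = 0")
 case True
 show ?thesis
  using seminorm_zero[OF N] True by (simp add: lin_def exI[of _ 0] nrm_def ip_def)
next
 case False
 let ?S = "\<lambda>j i. if i = j then 1 / b else (0::real)"
 let ?N = "\<lambda>x. N (lin m ?S x)"
 have NS: "?N x = 1 / b * N x" for x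
 proof -
  have "?N x = N (\<lambda>i. (1 / b) * x i)"
  proof (rule seminorm_cong[OF N])
   fix i assume "i < m"
   have "lin m ?S x i = (\<Sum>j<m. if j = i then 1 / b * x i else 0)" unfolding lin_def by (rule sum.cong) auto
   then show "lin m ?S x i = (1 / b) * x i" using \<open>i < m\<close> by simp
  qed
  also have "\<dots> = 1 / b * N x" unfolding seminorm_scale[OF N] using b(1) by simp
  finally show ?thesis .
 qed
 obtain B where B: "\<And>x. ?N x \<le> B * nrm m x" using seminorm_bounded[OF seminorm_lin[OF N], of m ?S] by blast
 let ?a = "12 * (41 + 40 * C) / \<eta>"
 have a: "1 \<le> ?a" using C(2) \<eta> by (simp add: field_simps)
 obtain J where J: "B < (4 / 3) ^ J" using real_arch_pow[of "4 / 3" B] by auto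
 have "B \<le> exp (?a * (4 / 3) ^ J)"
 proof -
  have "1 * (4 / 3) ^ J \<le> ?a * (4 / 3) ^ J" by (rule mult_right_mono[OF a]) simp
  then show ?thesis using J exp_ge_add_one_self[of "?a * (4 / 3) ^ J"] by linarith
 qed
 then have up: "?N x \<le> exp (?a * (4 / 3) ^ J) * nrm m x" for x
  using B mult_right_mono[OF _ nrm_nonneg] by (meson order.trans)
 have low: "nrm m x \<le> ?N x" for x using b by (simp add: NS field_simps)
 from iterated_improvement[OF C(2) \<eta> seminorm_lin[OF N] low up _ gelfand_bounded_lin[OF C(1)]] False
 obtain k W where k: "(1 - \<eta> * (1 - (3 / 4) ^ J)) * m \<le> real k"
  and W: "\<And>x. nrm k x \<le> N (lin m ?S (lin k W x))" "\<And>x. N (lin m ?S (lin k W x)) \<le> exp ?a * nrm k x" by blast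
 have "(1 - \<eta>) * m \<le> (1 - \<eta> * (1 - (3 / 4) ^ J)) * m"
  using \<eta> by (intro mult_right_mono) (auto simp: algebra_simps)
 with k W show ?thesis unfolding lin_lin by (meson order.trans)
qed

section \<open>Real vector spaces with carriers\<close>

locale real_space =
 fixes V :: "'a qspace" (structure)
 assumes vs: "real_vs V"
begin

sublocale vectorspace "class_ring :: real ring" V by (rule vs)

lemma v_smult [simp, intro]: "x \<in> carrier V \<Longrightarrow> c \<odot>\<^bsub>V\<^esub> x \<in> carrier V"
 by (rule smult_closed) simp_all

lemma v_compat: "x \<in> carrier V \<Longrightarrow> (c * d) \<odot>\<^bsub>V\<^esub> x = c \<odot>\<^bsub>V\<^esub> (d \<odot>\<^bsub>V\<^esub> x)"
 using smult_assoc1[of c d x] by simp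

lemma v_one [simp]: "x \<in> carrier V \<Longrightarrow> 1 \<odot>\<^bsub>V\<^esub> x = x"
 using smult_one[of x] by simp

lemma v_ladd: "x \<in> carrier V \<Longrightarrow> (c + d) \<odot>\<^bsub>V\<^esub> x = c \<odot>\<^bsub>V\<^esub> x \<oplus>\<^bsub>V\<^esub> d \<odot>\<^bsub>V\<^esub> x"
 using smult_l_distr[of c d x] by simp

lemma v_radd: "x \<in> carrier V \<Longrightarrow> y \<in> carrier V \<Longrightarrow> c \<odot>\<^bsub>V\<^esub> (x \<oplus>\<^bsub>V\<^esub> y) = c \<odot>\<^bsub>V\<^esub> x \<oplus>\<^bsub>V\<^esub> c \<odot>\<^bsub>V\<^esub> y"
 using smult_r_distr[of c x y] by simp

lemma v_null [simp]: "x \<in> carrier V \<Longrightarrow> 0 \<odot>\<^bsub>V\<^esub> x = \<zero>\<^bsub>V\<^esub>"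
 using smult_l_null[of x] by simp

lemma v_zero_r [simp]: "c \<odot>\<^bsub>V\<^esub> \<zero>\<^bsub>V\<^esub> = \<zero>\<^bsub>V\<^esub>"
 using smult_r_null[of c] by simp

lemma v_uminus: "x \<in> carrier V \<Longrightarrow> \<ominus>\<^bsub>V\<^esub> x = (- 1) \<odot>\<^bsub>V\<^esub> x"
proof -
 assume x: "x \<in> carrier V"
 have "(- 1) \<odot>\<^bsub>V\<^esub> x \<oplus>\<^bsub>V\<^esub> x = \<zero>\<^bsub>V\<^esub>"
  using x v_ladd[of x 1 "- 1"] by (simp add: M.a_comm)
 then show ?thesis using x by (intro M.minus_equality) auto
qed

lemma v_minus: "x \<in> carrier V \<Longrightarrow> y \<in> carrier V \<Longrightarrow> x \<ominus>\<^bsub>V\<^esub> y = x \<oplus>\<^bsub>V\<^esub> (- 1) \<odot>\<^bsub>V\<^esub> y"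
 by (simp add: a_minus_def v_uminus)

end

lemma real_vsI:
 fixes V :: "'a qspace"
 assumes "\<zero>\<^bsub>V\<^esub> \<in> carrier V" "\<And>x y. x \<in> carrier V \<Longrightarrow> y \<in> carrier V \<Longrightarrow> x \<oplus>\<^bsub>V\<^esub> y \<in> carrier V"
  and "\<And>c x. x \<in> carrier V \<Longrightarrow> c \<odot>\<^bsub>V\<^esub> x \<in> carrier V"
  and "\<And>x y. x \<in> carrier V \<Longrightarrow> y \<in> carrier V \<Longrightarrow> x \<oplus>\<^bsub>V\<^esub> y = y \<oplus>\<^bsub>V\<^esub> x"
  and "\<And>x y z. x \<in> carrier V \<Longrightarrow> y \<in> carrier V \<Longrightarrow> z \<in> carrier V \<Longrightarrow> (x \<oplus>\<^bsub>V\<^esub> y) \<oplus>\<^bsub>V\<^esub> z = x \<oplus>\<^bsub>V\<^esub> (y \<oplus>\<^bsub>V\<^esub> z)"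
  and "\<And>x. x \<in> carrier V \<Longrightarrow> x \<oplus>\<^bsub>V\<^esub> \<zero>\<^bsub>V\<^esub> = x" "\<And>x. x \<in> carrier V \<Longrightarrow> x \<oplus>\<^bsub>V\<^esub> (- 1) \<odot>\<^bsub>V\<^esub> x = \<zero>\<^bsub>V\<^esub>"
  and "\<And>c d x. x \<in> carrier V \<Longrightarrow> (c * d) \<odot>\<^bsub>V\<^esub> x = c \<odot>\<^bsub>V\<^esub> (d \<odot>\<^bsub>V\<^esub> x)" "\<And>x. x \<in> carrier V \<Longrightarrow> 1 \<odot>\<^bsub>V\<^esub> x = x"
  and "\<And>c d x. x \<in> carrier V \<Longrightarrow> (c + d) \<odot>\<^bsub>V\<^esub> x = c \<odot>\<^bsub>V\<^esub> x \<oplus>\<^bsub>V\<^esub> d \<odot>\<^bsub>V\<^esub> x"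
  and "\<And>c x y. x \<in> carrier V \<Longrightarrow> y \<in> carrier V \<Longrightarrow> c \<odot>\<^bsub>V\<^esub> (x \<oplus>\<^bsub>V\<^esub> y) = c \<odot>\<^bsub>V\<^esub> x \<oplus>\<^bsub>V\<^esub> c \<odot>\<^bsub>V\<^esub> y"
 shows "real_vs V"
proof (rule vs_criteria[OF class_field])
 show "\<forall>v\<in>carrier V. \<exists>neg_v\<in>carrier V. v \<oplus>\<^bsub>V\<^esub> neg_v = \<zero>\<^bsub>V\<^esub>" using assms(3,7) by blast
 show "\<forall>v w. v \<in> carrier V \<and> w \<in> carrier V \<longrightarrow> v \<oplus>\<^bsub>V\<^esub> w = w \<oplus>\<^bsub>V\<^esub> v" using assms(4) by simp
qed (simp_all add: assms(1-3,5-11))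

definition lfun :: "'a qspace \<Rightarrow> ('a \<Rightarrow> real) \<Rightarrow> bool" where
 "lfun V f \<longleftrightarrow> (\<forall>x\<in>carrier V. \<forall>y\<in>carrier V. f (x \<oplus>\<^bsub>V\<^esub> y) = f x + f y) \<and>
  (\<forall>c. \<forall>x\<in>carrier V. f (c \<odot>\<^bsub>V\<^esub> x) = c * f x)"

lemma lfunD:
 assumes "lfun V f"
 shows "x \<in> carrier V \<Longrightarrow> y \<in> carrier V \<Longrightarrow> f (x \<oplus>\<^bsub>V\<^esub> y) = f x + f y" "x \<in> carrier V \<Longrightarrow> f (c \<odot>\<^bsub>V\<^esub> x) = c * f x"
 using assms by (auto simp: lfun_def)

lemma lfun_sum: "(\<And>i. i < n \<Longrightarrow> lfun V (f i)) \<Longrightarrow> lfun V (\<lambda>x. \<Sum>i<n. a i * f i x)"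
 by (auto simp: lfun_def sum.distrib sum_distrib_left algebra_simps)

lemma lin_maps_real_line: "f \<in> lin_maps V real_line \<longleftrightarrow> lfun V f"
 by (auto simp: module_hom_def real_line_def lfun_def)

text \<open>A linear combination of a tuple: entries that occur repeatedly count separately, unlike in
 combinations over a set of vectors.\<close>
primrec lc :: "'a qspace \<Rightarrow> nat \<Rightarrow> (nat \<Rightarrow> 'a) \<Rightarrow> (nat \<Rightarrow> real) \<Rightarrow> 'a" where
 "lc V 0 b a = \<zero>\<^bsub>V\<^esub>"
| "lc V (Suc n) b a = lc V n b a \<oplus>\<^bsub>V\<^esub> a n \<odot>\<^bsub>V\<^esub> b n"

text \<open>A basis of \<open>V\<close> together with its dual basis.\<close>
definition coords :: "'a qspace \<Rightarrow> nat \<Rightarrow> (nat \<Rightarrow> 'a) \<Rightarrow> (nat \<Rightarrow> 'a \<Rightarrow> real) \<Rightarrow> bool" where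
 "coords V n b \<phi> \<longleftrightarrow> (\<forall>i<n. b i \<in> carrier V \<and> lfun V (\<phi> i)) \<and>
  (\<forall>i<n. \<forall>j<n. \<phi> i (b j) = (if i = j then 1 else 0)) \<and>
  (\<forall>x\<in>carrier V. (\<forall>i<n. \<phi> i x = 0) \<longrightarrow> x = \<zero>\<^bsub>V\<^esub>)"

lemma lc_cong: "(\<And>i. i < n \<Longrightarrow> a i = a' i) \<Longrightarrow> (\<And>i. i < n \<Longrightarrow> b i = b' i) \<Longrightarrow> lc V n b a = lc V n b' a'"
 by (induction n) auto

context real_space
begin

lemma lfun_zero: "lfun V f \<Longrightarrow> f \<zero>\<^bsub>V\<^esub> = 0"
 using lfunD(2)[of V f "\<zero>\<^bsub>V\<^esub>" 0] by simp

lemma lfun_diff: "lfun V f \<Longrightarrow> x \<in> carrier V \<Longrightarrow> y \<in> carrier V \<Longrightarrow> f (x \<ominus>\<^bsub>V\<^esub> y) = f x - f y"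
 by (simp add: v_minus lfunD)

lemma lc_closed: "(\<And>i. i < n \<Longrightarrow> b i \<in> carrier V) \<Longrightarrow> lc V n b a \<in> carrier V"
 by (induction n) auto

lemma lc_zero: "(\<And>i. i < n \<Longrightarrow> b i \<in> carrier V) \<Longrightarrow> (\<And>i. i < n \<Longrightarrow> a i = 0) \<Longrightarrow> lc V n b a = \<zero>\<^bsub>V\<^esub>"
 by (induction n) auto

lemma lc_scale: "(\<And>i. i < n \<Longrightarrow> b i \<in> carrier V) \<Longrightarrow> lc V n b (\<lambda>i. c * a i) = c \<odot>\<^bsub>V\<^esub> lc V n b a"
 by (induction n) (auto simp: v_radd lc_closed v_compat)

lemma lc_add: "(\<And>i. i < n \<Longrightarrow> b i \<in> carrier V) \<Longrightarrow> lc V n b (\<lambda>i. x i + y i) = lc V n b x \<oplus>\<^bsub>V\<^esub> lc V n b y"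
proof (induction n)
 case (Suc n)
 let ?X = "lc V n b x" and ?Y = "lc V n b y" and ?x = "x n \<odot>\<^bsub>V\<^esub> b n" and ?y = "y n \<odot>\<^bsub>V\<^esub> b n"
 show ?case
  using Suc Suc.prems by (simp add: v_ladd lc_closed M.add.m_ac)
qed simp

lemma lc_diff:
 assumes "\<And>i. i < n \<Longrightarrow> b i \<in> carrier V"
 shows "lc V n b (\<lambda>i. x i - y i) = lc V n b x \<ominus>\<^bsub>V\<^esub> lc V n b y"
 using lc_add[OF assms, where x=x and y="\<lambda>i. - 1 * y i"] lc_scale[OF assms, where c="- 1" and a=y] lc_closed[OF assms]
 by (simp add: v_minus)

lemma lc_unit: "(\<And>i. i < n \<Longrightarrow> b i \<in> carrier V) \<Longrightarrow> j < n \<Longrightarrow> lc V n b (\<lambda>i. if i = j then 1 else 0) = b j"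
proof (induction n)
 case (Suc n)
 show ?case
 using Suc.prems Suc by (simp add: lc_zero)
qed simp

lemma lfun_lc: "lfun V f \<Longrightarrow> (\<And>i. i < n \<Longrightarrow> b i \<in> carrier V) \<Longrightarrow> f (lc V n b a) = (\<Sum>i<n. a i * f (b i))"
 by (induction n) (auto simp: lfun_zero lfunD lc_closed)

lemma finsum_eq_lc:
 "(\<And>i. i \<in> {1..n} \<Longrightarrow> b i \<in> carrier V) \<Longrightarrow> (\<Oplus>\<^bsub>V\<^esub>k\<in>{1..n}. a k \<odot>\<^bsub>V\<^esub> b k) = lc V n (\<lambda>i. b (Suc i)) (\<lambda>i. a (Suc i))"
proof (induction n)
 case (Suc n)
 have e: "{1..Suc n} = insert (Suc n) {1..n}" by auto
 have "(\<Oplus>\<^bsub>V\<^esub>k\<in>{1..Suc n}. a k \<odot>\<^bsub>V\<^esub> b k) = a (Suc n) \<odot>\<^bsub>V\<^esub> b (Suc n) \<oplus>\<^bsub>V\<^esub> (\<Oplus>\<^bsub>V\<^esub>k\<in>{1..n}. a k \<odot>\<^bsub>V\<^esub> b k)"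
  unfolding e using Suc.prems by (intro M.finsum_insert) auto
 then show ?case using Suc lc_closed[of n "\<lambda>i. b (Suc i)" "\<lambda>i. a (Suc i)"] by (simp add: M.a_comm)
qed simp

lemma lincomb_eq_lc:
 "(\<And>i. i < n \<Longrightarrow> b i \<in> carrier V) \<Longrightarrow> inj_on b {..<n} \<Longrightarrow> lincomb a (b ` {..<n}) = lc V n b (\<lambda>i. a (b i))"
proof (induction n)
 case 0 then show ?case by (simp add: lincomb_def)
next
 case (Suc n)
 have n: "b n \<notin> b ` {..<n}"
 proof
  assume "b n \<in> b ` {..<n}"
  then obtain i where "i < n" "b n = b i" by auto
  then show False using inj_onD[OF Suc.prems(2), of n i] by simp
 qed
 have e: "b ` {..<Suc n} = insert (b n) (b ` {..<n})" by (auto simp: lessThan_Suc)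
 have "lincomb a (b ` {..<Suc n}) = a (b n) \<odot>\<^bsub>V\<^esub> b n \<oplus>\<^bsub>V\<^esub> lincomb a (b ` {..<n})"
  unfolding e lincomb_def using Suc.prems n by (intro M.finsum_insert) auto
 moreover have "inj_on b {..<n}" using Suc.prems(2) by (rule inj_on_subset) auto
 ultimately show ?case using Suc lc_closed[of n b] by (simp add: M.a_comm)
qed

lemma lc_in_span: "(\<And>i. i < n \<Longrightarrow> b i \<in> carrier V) \<Longrightarrow> lc V n b a \<in> span (b ` {..<n})"
proof -
 assume b: "\<And>i. i < n \<Longrightarrow> b i \<in> carrier V"
 then have s: "b ` {..<n} \<subseteq> carrier V" by auto
 have i: "b i \<in> span (b ` {..<n})" if "i < n" for i using in_own_span[OF s] that by auto
 interpret S: LinearCombinations.submodule class_ring "span (b ` {..<n})" V using span_is_submodule[OF s] .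
 have "k \<le> n \<Longrightarrow> lc V k b a \<in> span (b ` {..<n})" for k
 proof (induction k)
  case 0 show ?case by simp
 next
  case (Suc k)
  then show ?case
  by (simp add: i[of k] S.smult_closed[of "a k" "b k"] S.m_closed)
 qed
 then show ?thesis by simp
qed

lemma dim_le_of_spanning:
 assumes b: "\<And>i. i < n \<Longrightarrow> b i \<in> carrier V" and g: "\<And>x. x \<in> carrier V \<Longrightarrow> \<exists>a. x = lc V n b a"
 shows "fin_dim" "dim \<le> n"
proof -
 have s: "b ` {..<n} \<subseteq> carrier V" using b by auto
 have G: "gen_set (b ` {..<n})"
  using g lc_in_span[of n b] b s span_is_subset2 by (fastforce)
 show "fin_dim" unfolding fin_dim_def using s G by blast
 have "dim \<le> card (b ` {..<n})" by (rule gen_ge_dim[OF _ s G]) simp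
 also have "\<dots> \<le> n" using card_image_le[of "{..<n}" b] by simp
 finally show "dim \<le> n" .
qed

lemma coordsD:
 assumes "coords V n b \<phi>"
 shows "i < n \<Longrightarrow> b i \<in> carrier V" "i < n \<Longrightarrow> lfun V (\<phi> i)"
  "i < n \<Longrightarrow> j < n \<Longrightarrow> \<phi> i (b j) = (if i = j then 1 else 0)"
  "x \<in> carrier V \<Longrightarrow> (\<And>i. i < n \<Longrightarrow> \<phi> i x = 0) \<Longrightarrow> x = \<zero>\<^bsub>V\<^esub>"
 using assms by (auto simp: coords_def)

lemma coords_lc: assumes c: "coords V n b \<phi>" and i: "i < n" shows "\<phi> i (lc V n b a) = a i"
proof -
 have "\<phi> i (lc V n b a) = (\<Sum>j<n. a j * \<phi> i (b j))" by (rule lfun_lc[OF coordsD(2)[OF c i] coordsD(1)[OF c]])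
 also have "\<dots> = (\<Sum>j<n. if i = j then a j else 0)" by (rule sum.cong) (auto simp: coordsD(3)[OF c i])
 finally show ?thesis using i by simp
qed

lemma eq_of_minus_eq_zero: "x \<in> carrier V \<Longrightarrow> y \<in> carrier V \<Longrightarrow> x \<ominus>\<^bsub>V\<^esub> y = \<zero>\<^bsub>V\<^esub> \<Longrightarrow> x = y"
 by (metis M.minus_equality M.minus_minus M.a_inv_closed a_minus_def)

lemma coords_eqI:
 assumes c: "coords V n b \<phi>" and "x \<in> carrier V" "y \<in> carrier V" "\<And>i. i < n \<Longrightarrow> \<phi> i x = \<phi> i y"
 shows "x = y"
proof -
 have "x \<ominus>\<^bsub>V\<^esub> y = \<zero>\<^bsub>V\<^esub>"
 proof (rule coordsD(4)[OF c])
  show "x \<ominus>\<^bsub>V\<^esub> y \<in> carrier V" using assms(2,3) by (rule M.minus_closed)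
  fix i assume i: "i < n"
  show "\<phi> i (x \<ominus>\<^bsub>V\<^esub> y) = 0" using lfun_diff[OF coordsD(2)[OF c i] assms(2,3)] assms(4)[OF i] by simp
 qed
 then show ?thesis by (rule eq_of_minus_eq_zero[OF assms(2,3)])
qed

lemma coords_expansion: "coords V n b \<phi> \<Longrightarrow> x \<in> carrier V \<Longrightarrow> x = lc V n b (\<lambda>i. \<phi> i x)"
 by (rule coords_eqI, assumption, assumption, rule lc_closed, erule coordsD(1), assumption, simp add: coords_lc)

lemma coords_basis:
 assumes c: "coords V n b \<phi>"
 shows "basis (b ` {..<n})" "fin_dim" "dim = n"
proof -
 have inj: "inj_on b {..<n}"
 proof (rule inj_onI)
  fix i j assume "i \<in> {..<n}" "j \<in> {..<n}" "b i = b j"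
  then show "i = j" using coordsD(3)[OF c, of i i] coordsD(3)[OF c, of i j] by (auto split: if_splits)
 qed
 have b: "\<And>i. i < n \<Longrightarrow> b i \<in> carrier V" by (rule coordsD(1)[OF c])
 have s: "b ` {..<n} \<subseteq> carrier V" using b by auto
 have L: "lincomb a (b ` {..<n}) = lc V n b (\<lambda>i. a (b i))" for a using b inj by (rule lincomb_eq_lc)
 show B: "basis (b ` {..<n})"
 proof (subst basis_criterion[OF _ s], simp, intro allI impI ex_ex1I)
  fix x assume x: "x \<in> carrier V"
  let ?a = "restrict (\<lambda>v. \<phi> (the_inv_into {..<n} b v) x) (b ` {..<n})"
  have "lincomb ?a (b ` {..<n}) = lc V n b (\<lambda>i. \<phi> i x)"
   unfolding L by (rule lc_cong) (auto simp: the_inv_into_f_f[OF inj])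
  then show "\<exists>a. a \<in> b ` {..<n} \<rightarrow>\<^sub>E carrier class_ring \<and> lincomb a (b ` {..<n}) = x"
   using coords_expansion[OF c x] by (intro exI[of _ ?a]) (auto simp: class_ring_simps)
 next
  fix x a a' assume x: "x \<in> carrier V"
   and a: "a \<in> b ` {..<n} \<rightarrow>\<^sub>E carrier class_ring \<and> lincomb a (b ` {..<n}) = x"
   and a': "a' \<in> b ` {..<n} \<rightarrow>\<^sub>E carrier class_ring \<and> lincomb a' (b ` {..<n}) = x"
  have "a (b i) = a' (b i)" if "i < n" for i
  by (metis a a' coords_lc[OF c that] L that)
  then show "a = a'" using a a' by (intro PiE_ext[of a "b ` {..<n}" "\<lambda>_. carrier class_ring" a']) auto
 qed
 then show "fin_dim" unfolding fin_dim_def basis_def by (intro exI[of _ "b ` {..<n}"]) auto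
 show "dim = n" using dim_basis[OF _ B] card_image[OF inj] by simp
qed

lemma coords_of_basis:
 assumes b: "\<And>i. i < n \<Longrightarrow> b i \<in> carrier V" and inj: "inj_on b {..<n}" and B: "basis (b ` {..<n})"
 shows "\<exists>\<phi>. coords V n b \<phi>"
proof -
 have s: "b ` {..<n} \<subseteq> carrier V" using b by auto
 have L: "lincomb a (b ` {..<n}) = lc V n b (\<lambda>i. a (b i))" for a using b inj by (rule lincomb_eq_lc)
 have crit: "\<And>v. v \<in> carrier V \<Longrightarrow> \<exists>!a. a \<in> b ` {..<n} \<rightarrow>\<^sub>E carrier class_ring \<and> lincomb a (b ` {..<n}) = v"
  using B basis_criterion[OF _ s] by simp
 define \<phi> where "\<phi> i x = (THE a. a \<in> b ` {..<n} \<rightarrow>\<^sub>E carrier class_ring \<and> lincomb a (b ` {..<n}) = x) (b i)" for i x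
 have expand: "lc V n b (\<lambda>i. \<phi> i x) = x" if x: "x \<in> carrier V" for x
  using theI'[OF crit[OF x]] L unfolding \<phi>_def by metis
 have uniq: "\<phi> i (lc V n b a) = a i" if i: "i < n" for i a
 proof -
  let ?a = "restrict (\<lambda>v. a (the_inv_into {..<n} b v)) (b ` {..<n})"
  have "lincomb ?a (b ` {..<n}) = lc V n b a"
   unfolding L by (rule lc_cong) (auto simp: the_inv_into_f_f[OF inj])
  then have "(THE a'. a' \<in> b ` {..<n} \<rightarrow>\<^sub>E carrier class_ring \<and> lincomb a' (b ` {..<n}) = lc V n b a) = ?a"
   by (intro the1_equality crit lc_closed b) (auto simp: class_ring_simps)
  then show ?thesis using i the_inv_into_f_f[OF inj, of i] by (simp add: \<phi>_def)
 qed
 have "coords V n b \<phi>"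
  unfolding coords_def
 proof (intro conjI allI impI ballI)
  fix i assume i: "i < n"
  show "b i \<in> carrier V" by (rule b[OF i])
  show "lfun V (\<phi> i)"
   unfolding lfun_def
  proof (intro conjI ballI allI)
   fix x y assume xy: "x \<in> carrier V" "y \<in> carrier V"
   have "\<phi> i (lc V n b (\<lambda>i. \<phi> i x + \<phi> i y)) = \<phi> i x + \<phi> i y" by (rule uniq[OF i])
   then show "\<phi> i (x \<oplus>\<^bsub>V\<^esub> y) = \<phi> i x + \<phi> i y" using xy by (simp only: lc_add[OF b] expand)
  next
   fix c x assume x: "x \<in> carrier V"
   have "\<phi> i (lc V n b (\<lambda>i. c * \<phi> i x)) = c * \<phi> i x" by (rule uniq[OF i])
   then show "\<phi> i (c \<odot>\<^bsub>V\<^esub> x) = c * \<phi> i x" using x by (simp only: lc_scale[OF b] expand)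
  qed
 next
  fix i j assume ij: "i < n" "j < n"
  have "\<phi> i (lc V n b (\<lambda>i. if i = j then 1 else 0)) = (if i = j then 1 else 0)" by (rule uniq[OF ij(1)])
  then show "\<phi> i (b j) = (if i = j then 1 else 0)" by (simp only: lc_unit[OF b ij(2)])
 next
  fix x assume x: "x \<in> carrier V" "\<forall>i<n. \<phi> i x = 0"
  then show "x = \<zero>\<^bsub>V\<^esub>" using expand[OF x(1)] lc_zero[OF b, where a="\<lambda>i. \<phi> i x"] by simp
 qed
 then show ?thesis by blast
qed

lemma coords_of_fin_dim: assumes fin_dim shows "\<exists>b \<phi>. coords V dim b \<phi>"
proof -
 obtain B where B: "finite B" "basis B" using finite_basis_exists[OF assms] by blast
 then obtain b where b: "bij_betw b {0..<card B} B" using ex_bij_betw_nat_finite by blast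
 have e: "b ` {..<dim} = B" and i: "inj_on b {..<dim}"
  using b dim_basis[OF B] by (auto simp: bij_betw_def atLeast0LessThan)
 have "b j \<in> carrier V" if "j < dim" for j
 proof -
  show ?thesis
  using e that B(2) by (fastforce simp: basis_def)
 qed
 then show ?thesis using coords_of_basis[OF _ i] B(2) unfolding e by blast
qed

end

lemma lin_mapsD:
 assumes "u \<in> lin_maps V W"
 shows "x \<in> carrier V \<Longrightarrow> u x \<in> carrier W"
  "x \<in> carrier V \<Longrightarrow> y \<in> carrier V \<Longrightarrow> u (x \<oplus>\<^bsub>V\<^esub> y) = u x \<oplus>\<^bsub>W\<^esub> u y"
  "x \<in> carrier V \<Longrightarrow> u (c \<odot>\<^bsub>V\<^esub> x) = c \<odot>\<^bsub>W\<^esub> u x"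
 using assms unfolding module_hom_def by auto

lemma lin_map_zero:
 assumes V: "real_vs V" and W: "real_vs W" and u: "u \<in> lin_maps V W"
 shows "u \<zero>\<^bsub>V\<^esub> = \<zero>\<^bsub>W\<^esub>"
proof -
 interpret V: real_space V by (rule real_space.intro[OF V])
 interpret W: real_space W by (rule real_space.intro[OF W])
 show ?thesis
  by (metis lin_mapsD(3)[OF u V.M.zero_closed] V.v_zero_r W.v_null[OF lin_mapsD(1)[OF u V.M.zero_closed]])
qed

lemma hom_lc:
 assumes V: "real_vs V" and W: "real_vs W" and u: "u \<in> lin_maps V W"
 shows "(\<And>i. i < n \<Longrightarrow> b i \<in> carrier V) \<Longrightarrow> u (lc V n b a) = lc W n (\<lambda>i. u (b i)) a"
proof (induction n)
 case 0
 show ?case using lin_map_zero[OF V W u] by (simp only: lc.simps)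
next
 case (Suc n)
 interpret V: real_space V by (rule real_space.intro[OF V])
 have b: "b i \<in> carrier V" if "i < n" for i by (rule Suc.prems[OF less_SucI[OF that]])
 have c: "lc V n b a \<in> carrier V" using b by (rule V.lc_closed)
 have d: "b n \<in> carrier V" using Suc.prems[OF lessI] .
 show ?case
  unfolding lc.simps lin_mapsD(2)[OF u c V.v_smult[OF d]] lin_mapsD(3)[OF u d] using Suc.IH[OF b] by (simp only:)
qed

section \<open>Norms of operators, duals and quotients\<close>

text \<open>What quasi-normed spaces, Hilbert spaces, duals and the real line have in common. Operator norms
 and duals are governed by definiteness and homogeneity.\<close>
definition homogeneous_space :: "'a qspace \<Rightarrow> bool" where
 "homogeneous_space V \<longleftrightarrow> real_vs V \<and>
  (\<forall>x\<in>carrier V. 0 \<le> qnorm V x \<and> (qnorm V x = 0 \<longleftrightarrow> x = \<zero>\<^bsub>V\<^esub>)) \<and>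
  (\<forall>c. \<forall>x\<in>carrier V. qnorm V (c \<odot>\<^bsub>V\<^esub> x) = \<bar>c\<bar> * qnorm V x)"

lemma quasi_normed_homogeneous: "quasi_normed_space V \<Longrightarrow> homogeneous_space V"
 by (simp add: quasi_normed_space_def homogeneous_space_def)

lemma hilbert_homogeneous: assumes "hilbert_space H h" shows "homogeneous_space H"
proof -
 have vs: "real_vs H" and sym: "\<And>x y. x \<in> carrier H \<Longrightarrow> y \<in> carrier H \<Longrightarrow> h x y = h y x"
  and sc: "\<And>c x y. x \<in> carrier H \<Longrightarrow> y \<in> carrier H \<Longrightarrow> h (c \<odot>\<^bsub>H\<^esub> x) y = c * h x y"
  and pos: "\<And>x. x \<in> carrier H \<Longrightarrow> 0 \<le> h x x \<and> (h x x = 0 \<longleftrightarrow> x = \<zero>\<^bsub>H\<^esub>)"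
  and q: "\<And>x. x \<in> carrier H \<Longrightarrow> qnorm H x = sqrt (h x x)"
  using assms unfolding hilbert_space_def by auto
 interpret H: real_space H by (rule real_space.intro[OF vs])
 show ?thesis
  unfolding homogeneous_space_def
 proof (intro conjI allI ballI)
  fix c x assume x: "x \<in> carrier H"
  have c: "c \<odot>\<^bsub>H\<^esub> x \<in> carrier H" by (rule H.v_smult[OF x])
  have "h (c \<odot>\<^bsub>H\<^esub> x) (c \<odot>\<^bsub>H\<^esub> x) = c * (c * h x x)"
   unfolding sc[OF x c] sym[OF x c] sc[OF x x] ..
  then show "qnorm H (c \<odot>\<^bsub>H\<^esub> x) = \<bar>c\<bar> * qnorm H x"
   by (simp add: q[OF c] q[OF x] real_sqrt_mult flip: mult.assoc)
 qed (use vs pos q in auto)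
qed

lemma homogeneousD:
 assumes "homogeneous_space V"
 shows "real_vs V" "x \<in> carrier V \<Longrightarrow> 0 \<le> qnorm V x" "x \<in> carrier V \<Longrightarrow> qnorm V x = 0 \<longleftrightarrow> x = \<zero>\<^bsub>V\<^esub>"
  "x \<in> carrier V \<Longrightarrow> qnorm V (c \<odot>\<^bsub>V\<^esub> x) = \<bar>c\<bar> * qnorm V x"
 using assms by (auto simp: homogeneous_space_def)

lemma homogeneous_zero: assumes "homogeneous_space V" shows "\<zero>\<^bsub>V\<^esub> \<in> carrier V" "qnorm V \<zero>\<^bsub>V\<^esub> = 0"
proof -
 interpret V: real_space V by (rule real_space.intro[OF homogeneousD(1)[OF assms]])
 show "\<zero>\<^bsub>V\<^esub> \<in> carrier V" by (rule V.M.zero_closed)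
 then show "qnorm V \<zero>\<^bsub>V\<^esub> = 0" using homogeneousD(3)[OF assms] by blast
qed

lemma homogeneous_real_line: "homogeneous_space real_line"
 unfolding homogeneous_space_def
proof (intro conjI)
 show "real_vs real_line" by (rule real_vsI) (auto simp: real_line_def algebra_simps)
qed (auto simp: real_line_def abs_mult)

lemma op_norm_le:
 assumes "homogeneous_space X" "\<And>x. x \<in> carrier X \<Longrightarrow> qnorm X x \<le> 1 \<Longrightarrow> qnorm Y (f x) \<le> c"
 shows "op_norm X Y f \<le> c"
 unfolding op_norm_def
proof (rule cSUP_least)
 show "{x \<in> carrier X. qnorm X x \<le> 1} \<noteq> {}" using homogeneous_zero[OF assms(1)] by force
qed (use assms(2) in auto)

lemma op_norm_bdd:
 assumes X: "homogeneous_space X" and K: "\<And>x. x \<in> carrier X \<Longrightarrow> qnorm Y (f x) \<le> K * qnorm X x"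
 shows "bdd_above ((\<lambda>x. qnorm Y (f x)) ` {x \<in> carrier X. qnorm X x \<le> 1})"
proof (rule bdd_aboveI2)
 fix x assume x: "x \<in> {x \<in> carrier X. qnorm X x \<le> 1}"
 have "K * qnorm X x \<le> \<bar>K\<bar> * 1" using x homogeneousD(2)[OF X] by (intro mult_mono) auto
 then show "qnorm Y (f x) \<le> \<bar>K\<bar>" using K[of x] x by auto
qed

lemma op_norm_upper:
 assumes X: "homogeneous_space X" and K: "\<And>x. x \<in> carrier X \<Longrightarrow> qnorm Y (f x) \<le> K * qnorm X x"
  and x: "x \<in> carrier X" "qnorm X x \<le> 1"
 shows "qnorm Y (f x) \<le> op_norm X Y f"
 unfolding op_norm_def by (rule cSUP_upper[OF _ op_norm_bdd[OF X K]]) (use x in auto)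

lemma op_norm_bound:
 assumes X: "homogeneous_space X" and Y: "homogeneous_space Y" and f: "bounded_lin X Y f" and x: "x \<in> carrier X"
 shows "qnorm Y (f x) \<le> op_norm X Y f * qnorm X x"
proof -
 obtain K where K: "\<And>x. x \<in> carrier X \<Longrightarrow> qnorm Y (f x) \<le> K * qnorm X x" and l: "f \<in> lin_maps X Y"
  using f by (auto simp: bounded_lin_def)
 interpret X: real_space X by (rule real_space.intro[OF homogeneousD(1)[OF X]])
 show ?thesis
 proof (cases "x = \<zero>\<^bsub>X\<^esub>")
  case True
  then show ?thesis using lin_map_zero[OF homogeneousD(1)[OF X] homogeneousD(1)[OF Y] l]
   homogeneous_zero(2)[OF X] homogeneous_zero(2)[OF Y] by simp
 next
  case False
  define r where "r = qnorm X x"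
  have r: "0 < r" using False homogeneousD(2,3)[OF X x] by (auto simp: r_def less_le)
  have c: "(1 / r) \<odot>\<^bsub>X\<^esub> x \<in> carrier X" by (rule X.v_smult[OF x])
  have le1: "qnorm X ((1 / r) \<odot>\<^bsub>X\<^esub> x) \<le> 1"
   unfolding homogeneousD(4)[OF X x] r_def[symmetric] using r by simp
  have "qnorm Y (f ((1 / r) \<odot>\<^bsub>X\<^esub> x)) \<le> op_norm X Y f"
   by (rule op_norm_upper[OF X _ c le1]) (rule K)
  then have "(1 / r) * qnorm Y (f x) \<le> op_norm X Y f"
   using r by (simp add: lin_mapsD(3)[OF l x] homogeneousD(4)[OF Y lin_mapsD(1)[OF l x]])
  then show ?thesis using r by (simp add: r_def[symmetric] field_simps)
 qed
qed

lemma op_norm_nonneg: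
 assumes X: "homogeneous_space X" and Y: "homogeneous_space Y" and f: "f \<in> lin_maps X Y"
  and K: "\<And>x. x \<in> carrier X \<Longrightarrow> qnorm Y (f x) \<le> K * qnorm X x"
 shows "0 \<le> op_norm X Y f"
by (smt (verit) homogeneous_zero[OF X] homogeneousD(2)[OF Y lin_mapsD(1)[OF f homogeneous_zero(1)[OF X]]] op_norm_upper[OF X K])

subsection \<open>The dual\<close>

context
 fixes X :: "'a qspace"
 assumes X: "homogeneous_space X"
begin

lemma dual_carrier_iff:
 "f \<in> carrier (dual X) \<longleftrightarrow> f \<in> extensional (carrier X) \<and> lfun X f \<and> (\<exists>K. \<forall>x\<in>carrier X. \<bar>f x\<bar> \<le> K * qnorm X x)"
proof -
 have q: "qnorm real_line = abs" by (simp add: real_line_def)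
 show ?thesis
  by (simp add: dual_def bounded_lin_def lin_maps_real_line q)
qed

lemma dualD:
 assumes "f \<in> carrier (dual X)"
 shows "f \<in> extensional (carrier X)" "lfun X f"
 using assms by (auto simp: dual_carrier_iff)

lemma dual_qnorm: "qnorm (dual X) = op_norm X real_line"
 by (simp add: dual_def)

lemma dual_bound: assumes f: "f \<in> carrier (dual X)" and x: "x \<in> carrier X" shows "\<bar>f x\<bar> \<le> qnorm (dual X) f * qnorm X x"
proof -
 have "bounded_lin X real_line f" using f by (simp add: dual_def)
 from op_norm_bound[OF X homogeneous_real_line this x] show ?thesis by (simp add: dual_qnorm) (simp add: real_line_def)
qed

lemma dual_norm_le:
 assumes "\<And>x. x \<in> carrier X \<Longrightarrow> qnorm X x \<le> 1 \<Longrightarrow> \<bar>f x\<bar> \<le> c"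
 shows "qnorm (dual X) f \<le> c"
 unfolding dual_qnorm by (rule op_norm_le[OF X]) (use assms in \<open>simp add: real_line_def\<close>)

lemma dual_simps:
 "\<zero>\<^bsub>dual X\<^esub> = (\<lambda>x\<in>carrier X. 0)" "f \<oplus>\<^bsub>dual X\<^esub> g = (\<lambda>x\<in>carrier X. f x + g x)" "c \<odot>\<^bsub>dual X\<^esub> f = (\<lambda>x\<in>carrier X. c * f x)"
 by (simp_all add: dual_def)

lemma real_vs_dual: "real_vs (dual X)"
proof -
 interpret X: real_space X by (rule real_space.intro[OF homogeneousD(1)[OF X]])
 have closed: "restrict h (carrier X) \<in> carrier (dual X)"
  if h: "lfun X h" "\<And>x. x \<in> carrier X \<Longrightarrow> \<bar>h x\<bar> \<le> K * qnorm X x" for h K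
  unfolding dual_carrier_iff using h by (auto simp: lfun_def)
 have und: "f x = undefined" if "f \<in> carrier (dual X)" "x \<notin> carrier X" for f x
  using dualD(1)[OF that(1)] that(2) by (rule extensional_arb)
 show ?thesis
 proof (rule real_vsI)
  show "\<zero>\<^bsub>dual X\<^esub> \<in> carrier (dual X)" unfolding dual_simps
   by (rule closed[of "\<lambda>_. 0" 0]) (auto simp: lfun_def)
 next
  fix f g assume f: "f \<in> carrier (dual X)" and g: "g \<in> carrier (dual X)"
  have "\<bar>f x + g x\<bar> \<le> (qnorm (dual X) f + qnorm (dual X) g) * qnorm X x" if "x \<in> carrier X" for x
   using dual_bound[OF f that] dual_bound[OF g that] by (simp add: distrib_right)
  moreover have "lfun X (\<lambda>x. f x + g x)" using dualD(2)[OF f] dualD(2)[OF g] by (simp add: lfun_def algebra_simps)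
  ultimately show "f \<oplus>\<^bsub>dual X\<^esub> g \<in> carrier (dual X)" unfolding dual_simps by (intro closed)
 next
  fix c f assume f: "f \<in> carrier (dual X)"
  have "\<bar>c * f x\<bar> \<le> (\<bar>c\<bar> * qnorm (dual X) f) * qnorm X x" if "x \<in> carrier X" for x
   using mult_left_mono[OF dual_bound[OF f that], of "\<bar>c\<bar>"] by (simp add: abs_mult mult.assoc)
  moreover have "lfun X (\<lambda>x. c * f x)" using dualD(2)[OF f] by (simp add: lfun_def algebra_simps)
  ultimately show "c \<odot>\<^bsub>dual X\<^esub> f \<in> carrier (dual X)" unfolding dual_simps by (intro closed)
 qed (auto simp: dual_simps restrict_def fun_eq_iff algebra_simps und)
qed

lemma lc_dual:
 "(\<And>i. i < n \<Longrightarrow> z i \<in> carrier (dual X)) \<Longrightarrow> x \<in> carrier X \<Longrightarrow> lc (dual X) n z a x = (\<Sum>i<n. a i * z i x)"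
 by (induction n) (simp_all add: dual_simps)

lemma dual_nonneg: assumes f: "f \<in> carrier (dual X)" shows "0 \<le> qnorm (dual X) f"
proof -
 obtain K where K: "\<And>x. x \<in> carrier X \<Longrightarrow> \<bar>f x\<bar> \<le> K * qnorm X x" using f by (auto simp: dual_carrier_iff)
 have l: "f \<in> lin_maps X real_line" using dualD(2)[OF f] by (simp add: lin_maps_real_line)
 show ?thesis unfolding dual_qnorm
  by (rule op_norm_nonneg[OF X homogeneous_real_line l, of K]) (use K in \<open>simp add: real_line_def\<close>)
qed

lemma homogeneous_dual: "homogeneous_space (dual X)"
 unfolding homogeneous_space_def
proof (intro conjI ballI allI real_vs_dual)
 interpret X: real_space X by (rule real_space.intro[OF homogeneousD(1)[OF X]])
 fix f assume f: "f \<in> carrier (dual X)"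
 show "0 \<le> qnorm (dual X) f" by (rule dual_nonneg[OF f])
 show "qnorm (dual X) f = 0 \<longleftrightarrow> f = \<zero>\<^bsub>dual X\<^esub>"
 proof
  assume z: "qnorm (dual X) f = 0"
  have "f x = 0" if "x \<in> carrier X" for x using dual_bound[OF f that] z by simp
  moreover have "f = restrict f (carrier X)" using dualD(1)[OF f] by (simp add: extensional_restrict)
  ultimately show "f = \<zero>\<^bsub>dual X\<^esub>" unfolding dual_simps by (metis (no_types, lifting) restrict_ext)
 next
  assume "f = \<zero>\<^bsub>dual X\<^esub>"
  then have "qnorm (dual X) f \<le> 0" by (intro dual_norm_le) (simp add: dual_simps)
  then show "qnorm (dual X) f = 0" using dual_nonneg[OF f] by simp
 qed
next
 fix c f assume f: "f \<in> carrier (dual X)"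
 interpret D: real_space "dual X" by (rule real_space.intro[OF real_vs_dual])
 have le: "qnorm (dual X) (c \<odot>\<^bsub>dual X\<^esub> f) \<le> \<bar>c\<bar> * qnorm (dual X) f" if f: "f \<in> carrier (dual X)" for c f
 proof (rule dual_norm_le)
  fix x assume x: "x \<in> carrier X" "qnorm X x \<le> 1"
  show "\<bar>(c \<odot>\<^bsub>dual X\<^esub> f) x\<bar> \<le> \<bar>c\<bar> * qnorm (dual X) f"
  using op_norm_upper[OF X, of real_line f] f x by (fastforce simp: dual_carrier_iff real_line_def dual_simps abs_mult mult_left_mono dual_qnorm)
 qed
 show "qnorm (dual X) (c \<odot>\<^bsub>dual X\<^esub> f) = \<bar>c\<bar> * qnorm (dual X) f"
 proof (cases "c = 0")
  case True
  have "qnorm (dual X) (c \<odot>\<^bsub>dual X\<^esub> f) \<le> 0" by (intro dual_norm_le) (simp add: True dual_simps)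
  moreover have "c \<odot>\<^bsub>dual X\<^esub> f \<in> carrier (dual X)" by (rule D.v_smult[OF f])
  ultimately show ?thesis using True dual_nonneg[OF D.v_smult[OF f, of c]] by simp
 next
  case False
  have "qnorm (dual X) ((1 / c) \<odot>\<^bsub>dual X\<^esub> (c \<odot>\<^bsub>dual X\<^esub> f)) \<le> \<bar>1 / c\<bar> * qnorm (dual X) (c \<odot>\<^bsub>dual X\<^esub> f)"
   by (rule le[OF D.v_smult[OF f]])
  moreover have "(1 / c) \<odot>\<^bsub>dual X\<^esub> (c \<odot>\<^bsub>dual X\<^esub> f) = f" using False f by (simp flip: D.v_compat)
  ultimately have "\<bar>c\<bar> * qnorm (dual X) f \<le> qnorm (dual X) (c \<odot>\<^bsub>dual X\<^esub> f)" using False by (simp add: field_simps)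
  with le[OF f, of c] show ?thesis by simp
 qed
qed

end

subsection \<open>Quotients\<close>

lemma quasi_triangle:
 assumes X: "quasi_normed_space X"
 shows "\<exists>K\<ge>1. \<forall>x\<in>carrier X. \<forall>y\<in>carrier X. qnorm X (x \<oplus>\<^bsub>X\<^esub> y) \<le> K * (qnorm X x + qnorm X y)"
proof -
 note hX = quasi_normed_homogeneous[OF X]
 obtain K where K: "\<And>x y. x \<in> carrier X \<Longrightarrow> y \<in> carrier X \<Longrightarrow> qnorm X (x \<oplus>\<^bsub>X\<^esub> y) \<le> K * (qnorm X x + qnorm X y)"
  using X unfolding quasi_normed_space_def by blast
 have "qnorm X (x \<oplus>\<^bsub>X\<^esub> y) \<le> max 1 K * (qnorm X x + qnorm X y)" if "x \<in> carrier X" "y \<in> carrier X" for x y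
 proof -
  show ?thesis
  by (smt (verit) homogeneousD(2)[OF hX that(1)] homogeneousD(2)[OF hX that(2)] K[OF that] mult_right_mono)
 qed
 then show ?thesis by (intro exI[of _ "max 1 K"]) auto
qed

locale closed_quotient =
 fixes X :: "'a qspace" and M :: "'a set"
 assumes X: "quasi_normed_space X" and closed: "closed_subspace M X"
begin

lemma hX: "homogeneous_space X" by (rule quasi_normed_homogeneous[OF X])

sublocale X: real_space X by (rule real_space.intro[OF homogeneousD(1)[OF hX]])

abbreviation cl :: "'a \<Rightarrow> 'a set" where "cl x \<equiv> M +>\<^bsub>X\<^esub> x"
abbreviation Q :: "'a set qspace" where "Q \<equiv> quotient_space X M"

lemma M_sub: "LinearCombinations.submodule (class_ring :: real ring) M X"
 using closed by (simp add: closed_subspace_def VectorSpace.subspace_def)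

lemma M_facts: "M \<subseteq> carrier X" "\<zero>\<^bsub>X\<^esub> \<in> M" "x \<in> M \<Longrightarrow> y \<in> M \<Longrightarrow> x \<oplus>\<^bsub>X\<^esub> y \<in> M" "x \<in> M \<Longrightarrow> c \<odot>\<^bsub>X\<^esub> x \<in> M"
 using LinearCombinations.submodule.subset[OF M_sub] LinearCombinations.submodule.zero_closed[OF M_sub]
  LinearCombinations.submodule.m_closed[OF M_sub, of x y] LinearCombinations.submodule.smult_closed[OF M_sub, of c x]
 by simp_all

lemma mem_cl: "y \<in> cl x \<longleftrightarrow> (\<exists>h\<in>M. y = h \<oplus>\<^bsub>X\<^esub> x)"
 by (auto simp: a_r_coset_def')

lemma cl_subset: "x \<in> carrier X \<Longrightarrow> cl x \<subseteq> carrier X"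
 using M_facts(1) by (auto simp: mem_cl subset_iff)

lemma self_cl: "x \<in> carrier X \<Longrightarrow> x \<in> cl x"
 using M_facts(2) by (auto simp: mem_cl intro!: bexI[of _ "\<zero>\<^bsub>X\<^esub>"])

lemma cl_eqI: assumes m: "m \<in> M" and y: "y \<in> carrier X" shows "cl (m \<oplus>\<^bsub>X\<^esub> y) = cl y"
proof
 have mX: "m \<in> carrier X" using M_facts(1) m by blast
 show "cl (m \<oplus>\<^bsub>X\<^esub> y) \<subseteq> cl y"
 proof
  fix z assume "z \<in> cl (m \<oplus>\<^bsub>X\<^esub> y)"
  then obtain h where h: "h \<in> M" "z = h \<oplus>\<^bsub>X\<^esub> (m \<oplus>\<^bsub>X\<^esub> y)" by (auto simp: mem_cl)
  have "z = (h \<oplus>\<^bsub>X\<^esub> m) \<oplus>\<^bsub>X\<^esub> y"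
  using M_facts(1) h(1) h(2) mX y by (fastforce simp: X.M.a_assoc)
  then show "z \<in> cl y" using M_facts(3)[OF h(1) m] by (auto simp: mem_cl)
 qed
 show "cl y \<subseteq> cl (m \<oplus>\<^bsub>X\<^esub> y)"
 proof
  fix z assume "z \<in> cl y"
  then obtain h where h: "h \<in> M" "z = h \<oplus>\<^bsub>X\<^esub> y" by (auto simp: mem_cl)
  let ?n = "(- 1) \<odot>\<^bsub>X\<^esub> m"
  have n: "?n \<oplus>\<^bsub>X\<^esub> m = \<zero>\<^bsub>X\<^esub>" using mX by (simp add: X.v_uminus[symmetric] X.M.l_neg)
  have "(h \<oplus>\<^bsub>X\<^esub> ?n) \<oplus>\<^bsub>X\<^esub> (m \<oplus>\<^bsub>X\<^esub> y) = h \<oplus>\<^bsub>X\<^esub> ((?n \<oplus>\<^bsub>X\<^esub> m) \<oplus>\<^bsub>X\<^esub> y)"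
  using M_facts(1) h(1) mX y X.v_smult[OF mX, of "- 1"] by (fastforce simp: X.M.a_assoc)
  also have "\<dots> = z" unfolding n using h(2) y by simp
  finally show "z \<in> cl (m \<oplus>\<^bsub>X\<^esub> y)" unfolding mem_cl
   using M_facts(3)[OF h(1) M_facts(4)[OF m, of "- 1"]] by (intro bexI[of _ "h \<oplus>\<^bsub>X\<^esub> ?n"]) simp_all
 qed
qed

lemma cl_memD: assumes x: "x \<in> carrier X" and y: "y \<in> cl x" shows "y \<in> carrier X" "cl y = cl x"
proof -
 show "y \<in> carrier X" using y cl_subset[OF x] by blast
 show "cl y = cl x" using y cl_eqI[OF _ x] by (auto simp: mem_cl)
qed

lemma cl_eq_iff: assumes x: "x \<in> carrier X" and y: "y \<in> carrier X" shows "cl x = cl y \<longleftrightarrow> x \<ominus>\<^bsub>X\<^esub> y \<in> M"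
proof
 assume "cl x = cl y"
 then obtain h where h: "h \<in> M" "x = h \<oplus>\<^bsub>X\<^esub> y" using self_cl[OF x] by (auto simp: mem_cl)
 show "x \<ominus>\<^bsub>X\<^esub> y \<in> M"
  using M_facts(1) h(1) h(2) y h by (fastforce simp: a_minus_def X.M.a_assoc X.M.r_neg)
next
 assume m: "x \<ominus>\<^bsub>X\<^esub> y \<in> M"
 show "cl x = cl y"
  using x y cl_eqI[OF m y] by (simp add: a_minus_def X.M.a_assoc X.M.l_neg)
qed

lemma cl_zero: "cl \<zero>\<^bsub>X\<^esub> = M"
 using M_facts(1) by (auto simp: mem_cl subset_iff)

lemma Q_carrier: "carrier Q = cl ` carrier X"
 by (auto simp: quotient_space_def A_RCOSETS_def')

lemma Q_cases: assumes "\<xi> \<in> carrier Q" obtains x where "x \<in> carrier X" "\<xi> = cl x"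
 using assms by (auto simp: Q_carrier)

lemma Q_zero: "\<zero>\<^bsub>Q\<^esub> = cl \<zero>\<^bsub>X\<^esub>"
 unfolding cl_zero by (simp add: quotient_space_def)

lemma Q_add: assumes x: "x \<in> carrier X" and y: "y \<in> carrier X" shows "cl x \<oplus>\<^bsub>Q\<^esub> cl y = cl (x \<oplus>\<^bsub>X\<^esub> y)"
proof -
 have e: "(h \<oplus>\<^bsub>X\<^esub> x) \<oplus>\<^bsub>X\<^esub> (k \<oplus>\<^bsub>X\<^esub> y) = (h \<oplus>\<^bsub>X\<^esub> k) \<oplus>\<^bsub>X\<^esub> (x \<oplus>\<^bsub>X\<^esub> y)" if "h \<in> M" "k \<in> M" for h k
 proof -
  have "h \<in> carrier X" "k \<in> carrier X" using that M_facts(1) by auto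
  then show ?thesis using x y by (simp add: X.M.a_assoc X.M.a_lcomm)
 qed
 have "cl x <+>\<^bsub>X\<^esub> cl y = cl (x \<oplus>\<^bsub>X\<^esub> y)"
 proof
  show "cl x <+>\<^bsub>X\<^esub> cl y \<subseteq> cl (x \<oplus>\<^bsub>X\<^esub> y)"
  using e M_facts(3) by (fastforce simp: set_add_def' mem_cl)
  show "cl (x \<oplus>\<^bsub>X\<^esub> y) \<subseteq> cl x <+>\<^bsub>X\<^esub> cl y"
  proof
   fix z assume "z \<in> cl (x \<oplus>\<^bsub>X\<^esub> y)"
   then obtain h where h: "h \<in> M" "z = h \<oplus>\<^bsub>X\<^esub> (x \<oplus>\<^bsub>X\<^esub> y)" by (auto simp: mem_cl)
   have "z = (h \<oplus>\<^bsub>X\<^esub> x) \<oplus>\<^bsub>X\<^esub> y"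
  using h(1) M_facts(1) h(2) x y by (fastforce simp: X.M.a_assoc)
   moreover have "h \<oplus>\<^bsub>X\<^esub> x \<in> cl x" using h(1) by (auto simp: mem_cl)
   ultimately show "z \<in> cl x <+>\<^bsub>X\<^esub> cl y" using self_cl[OF y] by (auto simp: set_add_def')
  qed
 qed
 then show ?thesis by (simp add: quotient_space_def)
qed

lemma Q_smult: assumes x: "x \<in> carrier X" shows "c \<odot>\<^bsub>Q\<^esub> cl x = cl (c \<odot>\<^bsub>X\<^esub> x)"
proof -
 have "cl (c \<odot>\<^bsub>X\<^esub> y) = cl (c \<odot>\<^bsub>X\<^esub> x)" if "y \<in> cl x" for y
 proof -
  from that obtain h where h: "h \<in> M" "y = h \<oplus>\<^bsub>X\<^esub> x" by (auto simp: mem_cl)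
  show ?thesis
  using h(1) M_facts(1) h(2) x cl_eqI[OF M_facts(4)[OF h(1)] X.v_smult[OF x]] by (fastforce simp: X.v_radd)
 qed
 then have "(\<Union>y\<in>cl x. cl (c \<odot>\<^bsub>X\<^esub> y)) = (\<Union>y\<in>cl x. cl (c \<odot>\<^bsub>X\<^esub> x))"
  by (rule SUP_cong[OF refl])
 also have "\<dots> = cl (c \<odot>\<^bsub>X\<^esub> x)" using self_cl[OF x] by blast
 finally have "(\<Union>y\<in>cl x. cl (c \<odot>\<^bsub>X\<^esub> y)) = cl (c \<odot>\<^bsub>X\<^esub> x)" .
 then show ?thesis by (simp add: quotient_space_def)
qed

lemma cl_in: "x \<in> carrier X \<Longrightarrow> cl x \<in> carrier Q"
 by (auto simp: Q_carrier)

lemma cl_lin_map: "cl \<in> lin_maps X Q"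
 unfolding module_hom_def using Q_add[symmetric] Q_smult[symmetric] cl_in by auto

lemma real_vs_Q: "real_vs Q"
proof (rule real_vsI)
 show "\<zero>\<^bsub>Q\<^esub> \<in> carrier Q" unfolding Q_zero by (rule cl_in) simp
next
 fix x y assume "x \<in> carrier Q" "y \<in> carrier Q"
 then show "x \<oplus>\<^bsub>Q\<^esub> y \<in> carrier Q" "x \<oplus>\<^bsub>Q\<^esub> y = y \<oplus>\<^bsub>Q\<^esub> x"
  by (auto elim!: Q_cases simp: Q_add X.M.a_comm intro!: cl_in)
next
 fix c x assume "x \<in> carrier Q"
 then show "c \<odot>\<^bsub>Q\<^esub> x \<in> carrier Q" by (auto elim!: Q_cases simp: Q_smult intro!: cl_in)
next
 fix x y z assume "x \<in> carrier Q" "y \<in> carrier Q" "z \<in> carrier Q"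
 then show "(x \<oplus>\<^bsub>Q\<^esub> y) \<oplus>\<^bsub>Q\<^esub> z = x \<oplus>\<^bsub>Q\<^esub> (y \<oplus>\<^bsub>Q\<^esub> z)" by (auto elim!: Q_cases simp: Q_add X.M.a_assoc)
next
 fix x assume "x \<in> carrier Q"
 then obtain x' where x': "x' \<in> carrier X" "x = cl x'" by (rule Q_cases)
 show "x \<oplus>\<^bsub>Q\<^esub> \<zero>\<^bsub>Q\<^esub> = x" "1 \<odot>\<^bsub>Q\<^esub> x = x" using x' by (simp_all add: Q_zero Q_add Q_smult)
 show "x \<oplus>\<^bsub>Q\<^esub> (- 1) \<odot>\<^bsub>Q\<^esub> x = \<zero>\<^bsub>Q\<^esub>"
  using x' by (simp add: Q_zero Q_add Q_smult X.v_uminus[symmetric] X.M.r_neg)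
 show "(c * d) \<odot>\<^bsub>Q\<^esub> x = c \<odot>\<^bsub>Q\<^esub> (d \<odot>\<^bsub>Q\<^esub> x)" "(c + d) \<odot>\<^bsub>Q\<^esub> x = c \<odot>\<^bsub>Q\<^esub> x \<oplus>\<^bsub>Q\<^esub> d \<odot>\<^bsub>Q\<^esub> x" for c d
  using x' by (simp_all add: Q_add Q_smult X.v_compat X.v_ladd)
next
 fix c x y assume "x \<in> carrier Q" "y \<in> carrier Q"
 then show "c \<odot>\<^bsub>Q\<^esub> (x \<oplus>\<^bsub>Q\<^esub> y) = c \<odot>\<^bsub>Q\<^esub> x \<oplus>\<^bsub>Q\<^esub> c \<odot>\<^bsub>Q\<^esub> y"
  by (auto elim!: Q_cases simp: Q_add Q_smult X.v_radd)
qed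

lemma Q_norm: "qnorm Q \<xi> = (INF x\<in>\<xi>. qnorm X x)"
 by (simp add: quotient_space_def)

lemma Q_norm_bdd: "x \<in> carrier X \<Longrightarrow> bdd_below (qnorm X ` cl x)"
 using cl_subset homogeneousD(2)[OF hX] by (intro bdd_belowI2[where m=0]) auto

lemma Q_norm_le: "x \<in> carrier X \<Longrightarrow> qnorm Q (cl x) \<le> qnorm X x"
 unfolding Q_norm by (rule cINF_lower[OF Q_norm_bdd self_cl])

lemma Q_norm_lift:
 assumes "\<xi> \<in> carrier Q" "qnorm Q \<xi> < c" obtains x where "x \<in> carrier X" "\<xi> = cl x" "qnorm X x < c"
proof -
 obtain x where x: "x \<in> carrier X" "\<xi> = cl x" using assms(1) by (rule Q_cases)
 have "\<exists>y\<in>cl x. qnorm X y < c"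
  using assms(2) self_cl[OF x(1)] Q_norm_bdd[OF x(1)] unfolding x(2) Q_norm by (subst (asm) cINF_less_iff) auto
 then show ?thesis using cl_memD[OF x(1)] x(2) that by metis
qed

lemma Q_norm_nonneg: "\<xi> \<in> carrier Q \<Longrightarrow> 0 \<le> qnorm Q \<xi>"
proof (erule Q_cases)
 fix x assume x: "x \<in> carrier X" "\<xi> = cl x"
 show "0 \<le> qnorm Q \<xi>" unfolding x(2) Q_norm
  using self_cl[OF x(1)] cl_subset[OF x(1)] homogeneousD(2)[OF hX] by (intro cINF_greatest) auto
qed

lemma Q_norm_zero: assumes x: "x \<in> carrier X" and z: "qnorm Q (cl x) = 0" shows "x \<in> M"
proof -
 have "\<exists>y. y \<in> carrier X \<and> cl x = cl y \<and> qnorm X y < 1 / Suc n" for n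
  by (rule Q_norm_lift[OF cl_in[OF x], of "1 / Suc n"]) (use z in auto)
 then obtain y where y: "\<And>n. y n \<in> carrier X" "\<And>n. cl x = cl (y n)" "\<And>n. qnorm X (y n) < 1 / Suc n" by metis
 have e: "(x \<ominus>\<^bsub>X\<^esub> y n) \<ominus>\<^bsub>X\<^esub> x = (- 1) \<odot>\<^bsub>X\<^esub> y n" for n
 proof -
  have "(x \<ominus>\<^bsub>X\<^esub> y n) \<ominus>\<^bsub>X\<^esub> x = \<ominus>\<^bsub>X\<^esub> y n \<oplus>\<^bsub>X\<^esub> (x \<oplus>\<^bsub>X\<^esub> \<ominus>\<^bsub>X\<^esub> x)"
   using x y(1)[of n] by (simp add: a_minus_def X.M.a_ac)
  then show ?thesis unfolding X.M.r_neg[OF x] X.v_uminus[OF y(1), symmetric] using y(1)[of n] by simp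
 qed
 have "q_tendsto X (\<lambda>n. x \<ominus>\<^bsub>X\<^esub> y n) x"
  unfolding q_tendsto_def e homogeneousD(4)[OF hX y(1)]
 proof (rule tendsto_sandwich[of "\<lambda>_. 0" _ _ "\<lambda>n. 1 / Suc n"])
  show "(\<lambda>n. 1 / real (Suc n)) \<longlonglongrightarrow> 0" by (rule LIMSEQ_Suc[OF lim_1_over_n])
 qed (use y(3) homogeneousD(2)[OF hX y(1)] in \<open>auto intro!: eventuallyI less_imp_le\<close>)
 then show ?thesis
  by (metis cl_eq_iff[OF x y(1)] y(2) x closed[unfolded closed_subspace_def, THEN conjunct2, rule_format, of "\<lambda>n. x \<ominus>\<^bsub>X\<^esub> y n" x])
qed

lemma Q_triangle:
 assumes K: "\<And>x y. x \<in> carrier X \<Longrightarrow> y \<in> carrier X \<Longrightarrow> qnorm X (x \<oplus>\<^bsub>X\<^esub> y) \<le> K * (qnorm X x + qnorm X y)" "1 \<le> K"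
  and x: "\<xi> \<in> carrier Q" "\<zeta> \<in> carrier Q"
 shows "qnorm Q (\<xi> \<oplus>\<^bsub>Q\<^esub> \<zeta>) \<le> K * (qnorm Q \<xi> + qnorm Q \<zeta>)"
proof (rule field_le_epsilon)
 fix e :: real assume e: "0 < e"
 let ?e = "e / (2 * K)"
 have e': "0 < ?e" using e K(2) by simp
 obtain x where x': "x \<in> carrier X" "\<xi> = cl x" "qnorm X x < qnorm Q \<xi> + ?e"
  by (rule Q_norm_lift[OF x(1), of "qnorm Q \<xi> + ?e"]) (use e' in auto)
 obtain y where y: "y \<in> carrier X" "\<zeta> = cl y" "qnorm X y < qnorm Q \<zeta> + ?e"
  by (rule Q_norm_lift[OF x(2), of "qnorm Q \<zeta> + ?e"]) (use e' in auto)
 have "qnorm Q (\<xi> \<oplus>\<^bsub>Q\<^esub> \<zeta>) \<le> qnorm X (x \<oplus>\<^bsub>X\<^esub> y)"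
  unfolding x'(2) y(2) Q_add[OF x'(1) y(1)] using x'(1) y(1) by (intro Q_norm_le) auto
 also have "\<dots> \<le> K * (qnorm X x + qnorm X y)" by (rule K(1)[OF x'(1) y(1)])
 also have "\<dots> \<le> K * ((qnorm Q \<xi> + ?e) + (qnorm Q \<zeta> + ?e))" using x'(3) y(3) K(2) by (intro mult_left_mono) auto
 also have "\<dots> = K * (qnorm Q \<xi> + qnorm Q \<zeta>) + e" using K(2) by (simp add: field_simps)
 finally show "qnorm Q (\<xi> \<oplus>\<^bsub>Q\<^esub> \<zeta>) \<le> K * (qnorm Q \<xi> + qnorm Q \<zeta>) + e" .
qed

lemma Q_scale: assumes "\<xi> \<in> carrier Q" shows "qnorm Q (c \<odot>\<^bsub>Q\<^esub> \<xi>) = \<bar>c\<bar> * qnorm Q \<xi>"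
proof -
 interpret Q: real_space Q by (rule real_space.intro[OF real_vs_Q])
 have le: "qnorm Q (c \<odot>\<^bsub>Q\<^esub> \<xi>) \<le> \<bar>c\<bar> * qnorm Q \<xi>" if xi: "\<xi> \<in> carrier Q" for c \<xi>
 proof (rule field_le_epsilon)
  fix e :: real assume e: "0 < e"
  let ?e = "e / (\<bar>c\<bar> + 1)"
  have e': "0 < ?e" using e by simp
  obtain x where x: "x \<in> carrier X" "\<xi> = cl x" "qnorm X x < qnorm Q \<xi> + ?e"
   by (rule Q_norm_lift[OF xi, of "qnorm Q \<xi> + ?e"]) (use e' in auto)
  have "qnorm Q (c \<odot>\<^bsub>Q\<^esub> \<xi>) \<le> qnorm X (c \<odot>\<^bsub>X\<^esub> x)"
   unfolding x(2) Q_smult[OF x(1)] by (rule Q_norm_le[OF X.v_smult[OF x(1)]])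
  also have "\<dots> = \<bar>c\<bar> * qnorm X x" by (rule homogeneousD(4)[OF hX x(1)])
  also have "\<dots> \<le> \<bar>c\<bar> * (qnorm Q \<xi> + ?e)" using x(3) by (intro mult_left_mono) auto
  also have "\<dots> \<le> \<bar>c\<bar> * qnorm Q \<xi> + e" using e by (simp add: field_simps)
  finally show "qnorm Q (c \<odot>\<^bsub>Q\<^esub> \<xi>) \<le> \<bar>c\<bar> * qnorm Q \<xi> + e" .
 qed
 show ?thesis
 proof (cases "c = 0")
  case True
  then show ?thesis using le[OF assms, of c] Q_norm_nonneg[OF Q.v_smult[OF assms, of c]] by simp
 next
  case False
  have "(1 / c) \<odot>\<^bsub>Q\<^esub> (c \<odot>\<^bsub>Q\<^esub> \<xi>) = \<xi>" using False assms by (simp flip: Q.v_compat)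
  then have "qnorm Q \<xi> \<le> \<bar>1 / c\<bar> * qnorm Q (c \<odot>\<^bsub>Q\<^esub> \<xi>)" using le[OF Q.v_smult[OF assms, of c], of "1 / c"] by simp
  then have "\<bar>c\<bar> * qnorm Q \<xi> \<le> qnorm Q (c \<odot>\<^bsub>Q\<^esub> \<xi>)" using False by (simp add: field_simps)
  with le[OF assms, of c] show ?thesis by simp
 qed
qed

lemma quasi_normed_Q: "quasi_normed_space Q"
 unfolding quasi_normed_space_def
proof (intro conjI ballI allI real_vs_Q Q_norm_nonneg Q_scale)
 fix \<xi> assume xi: "\<xi> \<in> carrier Q"
 then obtain x where x: "x \<in> carrier X" "\<xi> = cl x" by (rule Q_cases)
 show "qnorm Q \<xi> = 0 \<longleftrightarrow> \<xi> = \<zero>\<^bsub>Q\<^esub>"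
 proof
  assume "qnorm Q \<xi> = 0"
  then have "x \<in> M" using Q_norm_zero x by simp
  then have "cl (x \<oplus>\<^bsub>X\<^esub> \<zero>\<^bsub>X\<^esub>) = cl \<zero>\<^bsub>X\<^esub>" by (rule cl_eqI) simp
  then show "\<xi> = \<zero>\<^bsub>Q\<^esub>" using x by (simp add: Q_zero)
 next
  assume "\<xi> = \<zero>\<^bsub>Q\<^esub>"
  then show "qnorm Q \<xi> = 0"
  by (smt (verit) Q_norm_le[of "\<zero>\<^bsub>X\<^esub>"] homogeneous_zero[OF hX] Q_norm_nonneg[OF xi] Q_zero)
 qed
next
 obtain K where "1 \<le> K" "\<forall>x\<in>carrier X. \<forall>y\<in>carrier X. qnorm X (x \<oplus>\<^bsub>X\<^esub> y) \<le> K * (qnorm X x + qnorm X y)"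
  using quasi_triangle[OF X] by blast
 then show "\<exists>K. \<forall>x\<in>carrier Q. \<forall>y\<in>carrier Q. qnorm Q (x \<oplus>\<^bsub>Q\<^esub> y) \<le> K * (qnorm Q x + qnorm Q y)"
  by (intro exI[of _ K] ballI Q_triangle) auto
qed auto

text \<open>The dual of the quotient is the annihilator of \<open>M\<close>: a functional that vanishes on \<open>M\<close> may be evaluated
 at any representative.\<close>
definition induced :: "('a \<Rightarrow> real) \<Rightarrow> 'a set \<Rightarrow> real" where
 "induced f \<xi> = f (SOME x. x \<in> \<xi>)"

lemma induced_cl:
 assumes f: "lfun X f" "\<And>m. m \<in> M \<Longrightarrow> f m = 0" and x: "x \<in> carrier X"
 shows "induced f (cl x) = f x"
proof -
 obtain h where h: "h \<in> M" "(SOME y. y \<in> cl x) = h \<oplus>\<^bsub>X\<^esub> x"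
  by (metis self_cl[OF x] someI mem_cl)
 show ?thesis
  using h(1) M_facts(1) f x by (fastforce simp: induced_def h(2) lfunD)
qed

lemma lfun_induced: assumes f: "lfun X f" "\<And>m. m \<in> M \<Longrightarrow> f m = 0" shows "lfun Q (induced f)"
 unfolding lfun_def
proof (intro conjI ballI allI)
 fix \<xi> \<zeta> assume "\<xi> \<in> carrier Q" "\<zeta> \<in> carrier Q"
 then obtain x y where "x \<in> carrier X" "\<xi> = cl x" "y \<in> carrier X" "\<zeta> = cl y" by (auto elim!: Q_cases)
 then show "induced f (\<xi> \<oplus>\<^bsub>Q\<^esub> \<zeta>) = induced f \<xi> + induced f \<zeta>" by (simp add: Q_add induced_cl[OF f] lfunD(1)[OF f(1)])
next
 fix c \<xi> assume "\<xi> \<in> carrier Q"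
 then obtain x where "x \<in> carrier X" "\<xi> = cl x" by (auto elim!: Q_cases)
 then show "induced f (c \<odot>\<^bsub>Q\<^esub> \<xi>) = c * induced f \<xi>" by (simp add: Q_smult induced_cl[OF f] lfunD(2)[OF f(1)])
qed

lemma lfun_cl: "lfun Q g \<Longrightarrow> lfun X (\<lambda>x. g (cl x))"
 unfolding lfun_def by (auto simp: Q_add[symmetric] Q_smult[symmetric] cl_in)

end

lemma closed_common_kernel:
 assumes X: "quasi_normed_space X" and f: "\<And>i. i < n \<Longrightarrow> lfun X (f i)"
  and b: "\<And>i. i < n \<Longrightarrow> \<exists>K. \<forall>x\<in>carrier X. \<bar>f i x\<bar> \<le> K * qnorm X x"
 shows "closed_subspace {x \<in> carrier X. \<forall>i<n. f i x = 0} X"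
proof -
 let ?M = "{x \<in> carrier X. \<forall>i<n. f i x = 0}"
 have vs: "real_vs X" by (rule homogeneousD(1)[OF quasi_normed_homogeneous[OF X]])
 interpret X: real_space X by (rule real_space.intro[OF vs])
 have md: "module (class_ring :: real ring) X" by (rule X.module_axioms)
 have "LinearCombinations.submodule (class_ring :: real ring) ?M X"
  by (rule LinearCombinations.submodule.intro[OF md]) (auto simp: lfunD[OF f] X.lfun_zero[OF f])
 then have sub: "VectorSpace.subspace (class_ring :: real ring) ?M X" using vs by (simp add: VectorSpace.subspace_def)
 show ?thesis
  unfolding closed_subspace_def
 proof (intro conjI sub allI impI)
  fix s x assume a: "(\<forall>k. s k \<in> ?M) \<and> x \<in> carrier X \<and> q_tendsto X s x"
  have "f i x = 0" if i: "i < n" for i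
  proof -
   obtain K where K: "\<And>x. x \<in> carrier X \<Longrightarrow> \<bar>f i x\<bar> \<le> K * qnorm X x" using b[OF i] by blast
   have "\<bar>f i x\<bar> \<le> K * qnorm X (s k \<ominus>\<^bsub>X\<^esub> x)" for k
   using a i X.lfun_diff[OF f[OF i], of "s k" x] K[of "s k \<ominus>\<^bsub>X\<^esub> x"] by simp
   moreover have "(\<lambda>k. K * qnorm X (s k \<ominus>\<^bsub>X\<^esub> x)) \<longlonglongrightarrow> K * 0" using a unfolding q_tendsto_def by (intro tendsto_intros) auto
   ultimately have "\<bar>f i x\<bar> \<le> K * 0" by (intro LIMSEQ_le_const) auto
   then show ?thesis by simp
  qed
  then show "x \<in> ?M" using a by simp
 qed
qed

section \<open>Gelfand numbers and weak cotype\<close>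

text \<open>Maps from the Hilbert spaces of the definition become coordinate maps, and \<open>u\<close> becomes the seminorm
 \<open>a \<mapsto> \<parallel>u (a\<^sub>0 e\<^sub>1 + \<dots> + a\<^sub>n\<^sub>-\<^sub>1 e\<^sub>n)\<parallel>\<close>; the indices shift by one.\<close>

definition euclidean_structure :: "'a qspace \<Rightarrow> nat \<Rightarrow> (nat \<Rightarrow> 'a \<Rightarrow> real) \<Rightarrow> 'a qspace" where
 "euclidean_structure V n \<phi> = V\<lparr>qnorm := \<lambda>x. nrm n (\<lambda>i. \<phi> i x)\<rparr>"

lemma euclidean_structure_simps [simp]:
 "carrier (euclidean_structure V n \<phi>) = carrier V" "\<zero>\<^bsub>euclidean_structure V n \<phi>\<^esub> = \<zero>\<^bsub>V\<^esub>"
 "x \<oplus>\<^bsub>euclidean_structure V n \<phi>\<^esub> y = x \<oplus>\<^bsub>V\<^esub> y" "c \<odot>\<^bsub>euclidean_structure V n \<phi>\<^esub> x = c \<odot>\<^bsub>V\<^esub> x"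
 "qnorm (euclidean_structure V n \<phi>) x = nrm n (\<lambda>i. \<phi> i x)"
 by (simp_all add: euclidean_structure_def)

text \<open>Completeness follows from that of the real line, one coordinate at a time.\<close>
lemma hilbert_of_coords:
 assumes V: "real_vs V" and c: "coords V n b \<phi>"
 shows "hilbert_space (euclidean_structure V n \<phi>) (\<lambda>x y. ip n (\<lambda>i. \<phi> i x) (\<lambda>i. \<phi> i y))"
  and "orthonormal_basis (euclidean_structure V n \<phi>) (\<lambda>x y. ip n (\<lambda>i. \<phi> i x) (\<lambda>i. \<phi> i y)) n (\<lambda>i. b (i - 1))"
  and "coords (euclidean_structure V n \<phi>) n b \<phi>"
proof -
 let ?H = "euclidean_structure V n \<phi>"
 interpret V: real_space V by (rule real_space.intro[OF V])
 have vsH: "real_vs ?H"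
 proof (rule real_vsI)
  show "\<And>x. x \<in> carrier ?H \<Longrightarrow> x \<oplus>\<^bsub>?H\<^esub> (- 1) \<odot>\<^bsub>?H\<^esub> x = \<zero>\<^bsub>?H\<^esub>"
   by (simp add: V.v_uminus[symmetric] V.M.r_neg)
  show "\<And>x y. x \<in> carrier ?H \<Longrightarrow> y \<in> carrier ?H \<Longrightarrow> x \<oplus>\<^bsub>?H\<^esub> y = y \<oplus>\<^bsub>?H\<^esub> x" by (simp add: V.M.a_comm)
  show "\<And>x y z. x \<in> carrier ?H \<Longrightarrow> y \<in> carrier ?H \<Longrightarrow> z \<in> carrier ?H \<Longrightarrow>
   (x \<oplus>\<^bsub>?H\<^esub> y) \<oplus>\<^bsub>?H\<^esub> z = x \<oplus>\<^bsub>?H\<^esub> (y \<oplus>\<^bsub>?H\<^esub> z)" by (simp add: V.M.a_assoc)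
 qed (simp_all add: V.v_compat V.v_ladd V.v_radd)
 show cH: "coords ?H n b \<phi>" using c by (simp add: coords_def lfun_def)
 interpret H: real_space ?H by (rule real_space.intro[OF vsH])
 have lf: "lfun ?H (\<phi> i)" if "i < n" for i by (rule H.coordsD(2)[OF cH that])
 have add: "ip n (\<lambda>i. \<phi> i (x \<oplus>\<^bsub>?H\<^esub> y)) z = ip n (\<lambda>i. \<phi> i x) z + ip n (\<lambda>i. \<phi> i y) z"
  if "x \<in> carrier ?H" "y \<in> carrier ?H" for x y z
 proof -
  have "ip n (\<lambda>i. \<phi> i (x \<oplus>\<^bsub>?H\<^esub> y)) z = ip n (\<lambda>i. \<phi> i x + \<phi> i y) z"
   by (rule ip_cong) (simp_all only: lfunD(1)[OF lf that])
  then show ?thesis by (simp only: ip_add_left)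
 qed
 have smult: "ip n (\<lambda>i. \<phi> i (a \<odot>\<^bsub>?H\<^esub> x)) z = a * ip n (\<lambda>i. \<phi> i x) z" if "x \<in> carrier ?H" for x a z
 proof -
  show ?thesis
  by (smt (verit) ip_cong lfunD(2)[OF lf that] ip_scale_left)
 qed
 have diff: "qnorm ?H (x \<ominus>\<^bsub>?H\<^esub> y) = nrm n (\<lambda>i. \<phi> i x - \<phi> i y)" if "x \<in> carrier ?H" "y \<in> carrier ?H" for x y
  unfolding euclidean_structure_simps by (rule nrm_cong) (rule H.lfun_diff[OF lf that])
 have complete: "q_complete ?H"
  unfolding q_complete_def
 proof (intro allI impI)
  fix s assume a: "(\<forall>k. s k \<in> carrier ?H) \<and> q_Cauchy ?H s"
  then have s: "s k \<in> carrier ?H" for k by blast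
  have "convergent (\<lambda>k. \<phi> i (s k))" if i: "i < n" for i
   unfolding Cauchy_convergent_iff[symmetric] Cauchy_def
  proof (intro allI impI)
   fix e :: real assume "0 < e"
   then obtain N where N: "\<forall>m\<ge>N. \<forall>k\<ge>N. qnorm ?H (s m \<ominus>\<^bsub>?H\<^esub> s k) < e" using a unfolding q_Cauchy_def by blast
   have "dist (\<phi> i (s m)) (\<phi> i (s k)) < e" if "m \<ge> N" "k \<ge> N" for m k
    using N[rule_format, OF that] coord_le_nrm[OF i, of "\<lambda>i. \<phi> i (s m) - \<phi> i (s k)"]
    unfolding diff[OF s s] dist_real_def by linarith
   then show "\<exists>N. \<forall>m\<ge>N. \<forall>k\<ge>N. dist (\<phi> i (s m)) (\<phi> i (s k)) < e" by blast
  qed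
  then obtain t where t: "\<And>i. i < n \<Longrightarrow> (\<lambda>k. \<phi> i (s k)) \<longlonglongrightarrow> t i" unfolding convergent_def by metis
  let ?x = "lc ?H n b t"
  have x: "?x \<in> carrier ?H" by (rule H.lc_closed) (rule H.coordsD(1)[OF cH])
  have "qnorm ?H (s k \<ominus>\<^bsub>?H\<^esub> ?x) = sqrt (\<Sum>i<n. (\<phi> i (s k) - t i)\<^sup>2)" for k
  proof -
   have "nrm n (\<lambda>i. \<phi> i (s k) - \<phi> i ?x) = nrm n (\<lambda>i. \<phi> i (s k) - t i)"
    by (rule nrm_cong) (simp only: H.coords_lc[OF cH])
   then show ?thesis unfolding diff[OF s x] by (simp only: nrm_def ip_def power2_eq_square)
  qed
  moreover have "(\<lambda>k. sqrt (\<Sum>i<n. (\<phi> i (s k) - t i)\<^sup>2)) \<longlonglongrightarrow> sqrt (\<Sum>i<n. (t i - t i)\<^sup>2)"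
   by (intro tendsto_intros t) auto
  ultimately have "q_tendsto ?H s ?x" unfolding q_tendsto_def by simp
  with x show "\<exists>x\<in>carrier ?H. q_tendsto ?H s x" by blast
 qed
 show "hilbert_space ?H (\<lambda>x y. ip n (\<lambda>i. \<phi> i x) (\<lambda>i. \<phi> i y))"
  unfolding hilbert_space_def
 proof (intro conjI ballI allI vsH complete)
  fix x assume x: "x \<in> carrier ?H"
  show "ip n (\<lambda>i. \<phi> i x) (\<lambda>i. \<phi> i x) = 0 \<longleftrightarrow> x = \<zero>\<^bsub>?H\<^esub>"
  proof
   assume "ip n (\<lambda>i. \<phi> i x) (\<lambda>i. \<phi> i x) = 0"
   then have "nrm n (\<lambda>i. \<phi> i x) = 0" by (simp add: nrm_def)
   then show "x = \<zero>\<^bsub>?H\<^esub>" unfolding nrm_eq_0_iff by (intro H.coordsD(4)[OF cH x]) blast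
  next
   assume "x = \<zero>\<^bsub>?H\<^esub>"
   then have "(\<Sum>i<n. \<phi> i x * \<phi> i x) = 0" using H.lfun_zero[OF lf] by (intro sum.neutral) simp
   then show "ip n (\<lambda>i. \<phi> i x) (\<lambda>i. \<phi> i x) = 0" by (simp only: ip_def)
  qed
  show "qnorm ?H x = sqrt (ip n (\<lambda>i. \<phi> i x) (\<lambda>i. \<phi> i x))" by (simp add: nrm_def)
 next
  fix x y assume x: "x \<in> carrier ?H" and y: "y \<in> carrier ?H"
  show "ip n (\<lambda>i. \<phi> i x) (\<lambda>i. \<phi> i y) = ip n (\<lambda>i. \<phi> i y) (\<lambda>i. \<phi> i x)" by (rule ip_commute)
  show "ip n (\<lambda>i. \<phi> i (c \<odot>\<^bsub>?H\<^esub> x)) (\<lambda>i. \<phi> i y) = c * ip n (\<lambda>i. \<phi> i x) (\<lambda>i. \<phi> i y)" for c by (rule smult[OF x])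
  show "ip n (\<lambda>i. \<phi> i (x \<oplus>\<^bsub>?H\<^esub> y)) (\<lambda>i. \<phi> i z) = ip n (\<lambda>i. \<phi> i x) (\<lambda>i. \<phi> i z) + ip n (\<lambda>i. \<phi> i y) (\<lambda>i. \<phi> i z)"
   for z by (rule add[OF x y])
 qed simp
 show "orthonormal_basis ?H (\<lambda>x y. ip n (\<lambda>i. \<phi> i x) (\<lambda>i. \<phi> i y)) n (\<lambda>i. b (i - 1))"
  unfolding orthonormal_basis_def
 proof (intro conjI ballI)
  have "(\<lambda>i. b (i - 1)) ` {1..n} = b ` (\<lambda>i. i - 1) ` {1..n}" by (simp add: image_image)
  also have "(\<lambda>i. i - 1) ` {1..n} = {..<n}"
   by (force simp: image_iff intro!: bexI[of _ "Suc _"])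
  finally show "vectorspace.basis class_ring ?H ((\<lambda>i. b (i - 1)) ` {1..n})" using H.coords_basis(1)[OF cH] by simp
  fix i j assume ij: "i \<in> {1..n}" "j \<in> {1..n}"
  have "ip n (\<lambda>l. \<phi> l (b (i - 1))) (\<lambda>l. \<phi> l (b (j - 1))) = (\<Sum>l<n. if l = i - 1 then (if i = j then 1 else 0) else 0)"
   unfolding ip_def using ij by (intro sum.cong) (auto simp: V.coordsD(3)[OF c])
  also have "\<dots> = (if i = j then 1 else 0)" using ij by (subst sum.delta) auto
  finally show "ip n (\<lambda>l. \<phi> l (b (i - 1))) (\<lambda>l. \<phi> l (b (j - 1))) = (if i = j then 1 else 0)" .
 qed
qed

text \<open>Weak cotype 2 is tested on Hilbert spaces whose elements are functions on the naturals, with orthonormal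
 bases numbered from \<open>1\<close>. The norm is a placeholder, to be replaced by means of \<open>euclidean_structure\<close>.\<close>
definition coordinate_space :: "nat \<Rightarrow> (nat \<Rightarrow> real) qspace" where
 "coordinate_space n = \<lparr> carrier = {x. \<forall>i. i \<notin> {1..n} \<longrightarrow> x i = 0}, mult = (\<lambda>x y. x), one = (\<lambda>i. 0), zero = (\<lambda>i. 0),
  add = (\<lambda>x y i. x i + y i), smult = (\<lambda>c x i. c * x i), qnorm = (\<lambda>x. 0) \<rparr>"

lemma coordinate_space: "real_vs (coordinate_space n)"
 "coords (coordinate_space n) n (\<lambda>j i. if i = Suc j then 1 else 0) (\<lambda>j x. x (Suc j))"
proof -
 show "real_vs (coordinate_space n)" by (rule real_vsI) (auto simp: coordinate_space_def algebra_simps)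
 have "x = (\<lambda>i. 0)" if "\<forall>i. i = 0 \<or> \<not> i \<le> n \<longrightarrow> x i = 0" "\<forall>i<n. x (Suc i) = (0::real)" for x
 proof
  fix i show "x i = 0"
  proof (cases "i = 0 \<or> \<not> i \<le> n")
   case False
   then have "i - 1 < n" "Suc (i - 1) = i" by linarith+
   then show ?thesis using that(2)[rule_format, of "i - 1"] by simp
  qed (use that(1) in blast)
 qed
 then show "coords (coordinate_space n) n (\<lambda>j i. if i = Suc j then 1 else 0) (\<lambda>j x. x (Suc j))"
  by (auto simp: coords_def lfun_def coordinate_space_def not_less_eq_eq)
qed

lemma ell_norm_eq_ell:
 assumes Z: "real_vs Z" and ue: "\<And>i. i \<in> {1..n} \<Longrightarrow> u (e i) \<in> carrier Z"
  and p: "seminorm n (\<lambda>g. qnorm Z (lc Z n (\<lambda>i. u (e (Suc i))) g))"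
 shows "ell_norm n e Z u = ell n (\<lambda>g. qnorm Z (lc Z n (\<lambda>i. u (e (Suc i))) g))"
proof -
 let ?p = "\<lambda>g. qnorm Z (lc Z n (\<lambda>i. u (e (Suc i))) g)"
 let ?P = "Pi\<^sub>M {1..n} (\<lambda>_. std_normal_distribution)"
 interpret Z: real_space Z by (rule real_space.intro[OF Z])
 have d: "distr ?P (gauss n) (\<lambda>\<omega>. \<lambda>i\<in>{..<n}. \<omega> (Suc i)) = gauss n"
  unfolding gauss_def by (rule distr_PiM_reindex) (auto intro: prob_space_gauss1 simp: inj_on_def)
 have m: "(\<lambda>\<omega>. \<lambda>i\<in>{..<n}. \<omega> (Suc i)) \<in> measurable ?P (gauss n)"
  unfolding gauss_def by (rule measurable_restrict) (auto intro: measurable_component_singleton)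
 have "(\<integral>g. (?p g)\<^sup>2 \<partial>gauss n) = (\<integral>\<omega>. (?p (\<lambda>i\<in>{..<n}. \<omega> (Suc i)))\<^sup>2 \<partial>?P)"
  by (subst d[symmetric], rule integral_distr[OF m]) (use measurable_gauss_seminorm[OF p] in measurable)
 also have "\<dots> = (\<integral>\<omega>. (qnorm Z (\<Oplus>\<^bsub>Z\<^esub>k\<in>{1..n}. \<omega> k \<odot>\<^bsub>Z\<^esub> u (e k)))\<^sup>2 \<partial>?P)"
 proof -
  have "lc Z n (\<lambda>i. u (e (Suc i))) (\<lambda>i\<in>{..<n}. \<omega> (Suc i)) = (\<Oplus>\<^bsub>Z\<^esub>k\<in>{1..n}. \<omega> k \<odot>\<^bsub>Z\<^esub> u (e k))" for \<omega>
  proof -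
   have "(\<Oplus>\<^bsub>Z\<^esub>k\<in>{1..n}. \<omega> k \<odot>\<^bsub>Z\<^esub> u (e k)) = lc Z n (\<lambda>i. u (e (Suc i))) (\<lambda>i. \<omega> (Suc i))"
    by (rule Z.finsum_eq_lc) (rule ue)
   then show ?thesis by (simp cong: lc_cong)
  qed
  then show ?thesis by (simp only:)
 qed
 finally show ?thesis unfolding ell_norm_def ell_def by (simp only:)
qed

text \<open>This is how tuples of functionals enter the finite-dimensional theory.\<close>
lemma seminorm_dual:
 assumes X: "homogeneous_space X" and z: "\<And>i. i < n \<Longrightarrow> z i \<in> carrier (dual X)"
 shows "seminorm n (\<lambda>a. qnorm (dual X) (lc (dual X) n z a))"
proof -
 interpret D: real_space "dual X" by (rule real_space.intro[OF real_vs_dual[OF X]])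
 have cl: "lc (dual X) n z a \<in> carrier (dual X)" for a by (rule D.lc_closed) (rule z)
 show ?thesis
  unfolding seminorm_def
 proof (intro conjI allI impI)
  fix x y :: "nat \<Rightarrow> real" assume "\<forall>i<n. x i = y i"
  then show "qnorm (dual X) (lc (dual X) n z x) = qnorm (dual X) (lc (dual X) n z y)"
  by (metis lc_cong)
 next
  fix x y
  show "qnorm (dual X) (lc (dual X) n z (\<lambda>i. x i + y i)) \<le> qnorm (dual X) (lc (dual X) n z x) + qnorm (dual X) (lc (dual X) n z y)"
  proof (rule dual_norm_le[OF X])
   fix t assume t: "t \<in> carrier X" "qnorm X t \<le> 1"
   have b: "\<bar>lc (dual X) n z a t\<bar> \<le> qnorm (dual X) (lc (dual X) n z a)" for a
   by (smt (verit) dual_bound[OF X cl t(1)] mult_left_mono[OF t(2) dual_nonneg[OF X cl]])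
   show "\<bar>lc (dual X) n z (\<lambda>i. x i + y i) t\<bar> \<le> qnorm (dual X) (lc (dual X) n z x) + qnorm (dual X) (lc (dual X) n z y)"
  using b[of x] b[of y] by (simp add: lc_dual[OF X z t(1)] sum.distrib distrib_right)
  qed
 next
  fix c x
  show "qnorm (dual X) (lc (dual X) n z (\<lambda>i. c * x i)) = \<bar>c\<bar> * qnorm (dual X) (lc (dual X) n z x)"
  by (simp add: D.lc_scale z homogeneousD(4)[OF homogeneous_dual[OF X] cl])
 qed
qed

lemma lc_carrier_update: "lc (W\<lparr>carrier := A\<rparr>) n b a = lc W n b a"
 by (induction n) auto

lemma real_vs_image:
 assumes V: "real_vs V" and W: "real_vs W" and v: "v \<in> lin_maps V W"
 shows "real_vs (W\<lparr>carrier := v ` carrier V\<rparr>)"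
proof -
 interpret V: real_space V by (rule real_space.intro[OF V])
 interpret W: real_space W by (rule real_space.intro[OF W])
 note vD = lin_mapsD[OF v]
 have z: "v \<zero>\<^bsub>V\<^esub> = \<zero>\<^bsub>W\<^esub>" by (rule lin_map_zero[OF V W v])
 have c: "x \<in> carrier W" if "x \<in> v ` carrier V" for x using that vD(1) by blast
 show ?thesis
 proof (rule real_vsI)
  show "\<zero>\<^bsub>W\<lparr>carrier := v ` carrier V\<rparr>\<^esub> \<in> carrier (W\<lparr>carrier := v ` carrier V\<rparr>)"
   using imageI[OF V.M.zero_closed, of v] by (simp add: z)
  fix x y assume "x \<in> carrier (W\<lparr>carrier := v ` carrier V\<rparr>)" "y \<in> carrier (W\<lparr>carrier := v ` carrier V\<rparr>)"
  then obtain x' y' where xy: "x' \<in> carrier V" "x = v x'" "y' \<in> carrier V" "y = v y'" by auto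
  show "x \<oplus>\<^bsub>W\<lparr>carrier := v ` carrier V\<rparr>\<^esub> y \<in> carrier (W\<lparr>carrier := v ` carrier V\<rparr>)"
   using imageI[OF V.M.a_closed[OF xy(1,3)], of v] by (simp add: vD(2) xy)
  show "x \<oplus>\<^bsub>W\<lparr>carrier := v ` carrier V\<rparr>\<^esub> y = y \<oplus>\<^bsub>W\<lparr>carrier := v ` carrier V\<rparr>\<^esub> x"
   using W.M.a_comm[OF vD(1)[OF xy(1)] vD(1)[OF xy(3)]] by (simp add: xy)
  show "a \<odot>\<^bsub>W\<lparr>carrier := v ` carrier V\<rparr>\<^esub> (x \<oplus>\<^bsub>W\<lparr>carrier := v ` carrier V\<rparr>\<^esub> y) =
    a \<odot>\<^bsub>W\<lparr>carrier := v ` carrier V\<rparr>\<^esub> x \<oplus>\<^bsub>W\<lparr>carrier := v ` carrier V\<rparr>\<^esub> a \<odot>\<^bsub>W\<lparr>carrier := v ` carrier V\<rparr>\<^esub> y" for a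
   using W.v_radd[OF vD(1)[OF xy(1)] vD(1)[OF xy(3)]] by (simp add: xy)
 next
  fix a x assume "x \<in> carrier (W\<lparr>carrier := v ` carrier V\<rparr>)"
  then obtain x' where x: "x' \<in> carrier V" "x = v x'" by auto
  show "a \<odot>\<^bsub>W\<lparr>carrier := v ` carrier V\<rparr>\<^esub> x \<in> carrier (W\<lparr>carrier := v ` carrier V\<rparr>)"
   using imageI[OF V.v_smult[OF x(1)], of v] by (simp add: vD(3) x)
 next
  fix x assume "x \<in> carrier (W\<lparr>carrier := v ` carrier V\<rparr>)"
  then have x: "x \<in> carrier W" using c by simp
  show "x \<oplus>\<^bsub>W\<lparr>carrier := v ` carrier V\<rparr>\<^esub> \<zero>\<^bsub>W\<lparr>carrier := v ` carrier V\<rparr>\<^esub> = x"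
   "x \<oplus>\<^bsub>W\<lparr>carrier := v ` carrier V\<rparr>\<^esub> (- 1) \<odot>\<^bsub>W\<lparr>carrier := v ` carrier V\<rparr>\<^esub> x = \<zero>\<^bsub>W\<lparr>carrier := v ` carrier V\<rparr>\<^esub>"
   "1 \<odot>\<^bsub>W\<lparr>carrier := v ` carrier V\<rparr>\<^esub> x = x"
   using x W.M.r_neg[OF x] by (simp_all add: W.v_uminus)
  show "(a * d) \<odot>\<^bsub>W\<lparr>carrier := v ` carrier V\<rparr>\<^esub> x = a \<odot>\<^bsub>W\<lparr>carrier := v ` carrier V\<rparr>\<^esub> (d \<odot>\<^bsub>W\<lparr>carrier := v ` carrier V\<rparr>\<^esub> x)"
   "(a + d) \<odot>\<^bsub>W\<lparr>carrier := v ` carrier V\<rparr>\<^esub> x =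
    a \<odot>\<^bsub>W\<lparr>carrier := v ` carrier V\<rparr>\<^esub> x \<oplus>\<^bsub>W\<lparr>carrier := v ` carrier V\<rparr>\<^esub> d \<odot>\<^bsub>W\<lparr>carrier := v ` carrier V\<rparr>\<^esub> x" for a d
   using x by (simp_all add: W.v_compat W.v_ladd)
 next
  fix x y z assume "x \<in> carrier (W\<lparr>carrier := v ` carrier V\<rparr>)" "y \<in> carrier (W\<lparr>carrier := v ` carrier V\<rparr>)"
   "z \<in> carrier (W\<lparr>carrier := v ` carrier V\<rparr>)"
  then have "x \<in> carrier W" "y \<in> carrier W" "z \<in> carrier W" using c by simp_all
  from W.M.a_assoc[OF this] show "(x \<oplus>\<^bsub>W\<lparr>carrier := v ` carrier V\<rparr>\<^esub> y) \<oplus>\<^bsub>W\<lparr>carrier := v ` carrier V\<rparr>\<^esub> z =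
    x \<oplus>\<^bsub>W\<lparr>carrier := v ` carrier V\<rparr>\<^esub> (y \<oplus>\<^bsub>W\<lparr>carrier := v ` carrier V\<rparr>\<^esub> z)" by simp
 qed
qed

lemma lin_rank_le:
 assumes V: "real_vs V" and W: "real_vs W" and v: "v \<in> lin_maps V W"
  and w: "\<And>i. i < j \<Longrightarrow> w i \<in> v ` carrier V" and g: "\<And>x. x \<in> carrier V \<Longrightarrow> \<exists>a. v x = lc W j w a"
 shows "fin_dim (W\<lparr>carrier := v ` carrier V\<rparr>)" "lin_rank V W v \<le> j"
proof -
 interpret I: real_space "W\<lparr>carrier := v ` carrier V\<rparr>" by (rule real_space.intro[OF real_vs_image[OF V W v]])
 have w': "\<And>i. i < j \<Longrightarrow> w i \<in> carrier (W\<lparr>carrier := v ` carrier V\<rparr>)" using w by simp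
 have g': "\<exists>a. x = lc (W\<lparr>carrier := v ` carrier V\<rparr>) j w a" if "x \<in> carrier (W\<lparr>carrier := v ` carrier V\<rparr>)" for x
  using that g unfolding lc_carrier_update by auto
 show "fin_dim (W\<lparr>carrier := v ` carrier V\<rparr>)" by (rule I.dim_le_of_spanning(1)[OF w' g'])
 show "lin_rank V W v \<le> j" unfolding lin_rank_def by (rule I.dim_le_of_spanning(2)[OF w' g'])
qed

lemma lin_maps_diff:
 assumes V: "real_vs V" and W: "real_vs W" and u: "u \<in> lin_maps V W" and v: "v \<in> lin_maps V W"
 shows "(\<lambda>x. u x \<ominus>\<^bsub>W\<^esub> v x) \<in> lin_maps V W"
proof -
 interpret V: real_space V by (rule real_space.intro[OF V])
 interpret W: real_space W by (rule real_space.intro[OF W])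
 note uD = lin_mapsD[OF u] and vD = lin_mapsD[OF v]
 have "u (x \<oplus>\<^bsub>V\<^esub> y) \<ominus>\<^bsub>W\<^esub> v (x \<oplus>\<^bsub>V\<^esub> y) = (u x \<ominus>\<^bsub>W\<^esub> v x) \<oplus>\<^bsub>W\<^esub> (u y \<ominus>\<^bsub>W\<^esub> v y)"
  if xy: "x \<in> carrier V" "y \<in> carrier V" for x y
 proof -
  note c = uD(1)[OF xy(1)] uD(1)[OF xy(2)] vD(1)[OF xy(1)] vD(1)[OF xy(2)]
  show ?thesis unfolding uD(2)[OF xy] vD(2)[OF xy] using c by (simp add: a_minus_def W.M.minus_add W.M.a_ac)
 qed
 moreover have "u (c \<odot>\<^bsub>V\<^esub> x) \<ominus>\<^bsub>W\<^esub> v (c \<odot>\<^bsub>V\<^esub> x) = c \<odot>\<^bsub>W\<^esub> (u x \<ominus>\<^bsub>W\<^esub> v x)" if x: "x \<in> carrier V" for c x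
 proof -
  note c = uD(1)[OF x] vD(1)[OF x]
  have "(- 1) \<odot>\<^bsub>W\<^esub> (c \<odot>\<^bsub>W\<^esub> v x) = c \<odot>\<^bsub>W\<^esub> ((- 1) \<odot>\<^bsub>W\<^esub> v x)"
   using c(2) by (simp flip: W.v_compat)
  then show ?thesis unfolding uD(3)[OF x] vD(3)[OF x] using c by (simp add: W.v_minus W.v_radd)
 qed
 moreover have "u x \<ominus>\<^bsub>W\<^esub> v x \<in> carrier W" if "x \<in> carrier V" for x
  using uD(1)[OF that] vD(1)[OF that] by simp
 ultimately show ?thesis unfolding module_hom_def by auto
qed

lemma bounded_into_dual:
 assumes X: "homogeneous_space X" and H: "real_vs H" and c: "coords H m b \<phi>"
  and q: "\<And>x. x \<in> carrier H \<Longrightarrow> qnorm H x = nrm m (\<lambda>i. \<phi> i x)" and w: "w \<in> lin_maps H (dual X)"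
 shows "\<exists>B\<ge>0. \<forall>x\<in>carrier H. qnorm (dual X) (w x) \<le> B * qnorm H x"
proof -
 interpret H: real_space H by (rule real_space.intro[OF H])
 let ?p = "\<lambda>a. qnorm (dual X) (lc (dual X) m (\<lambda>i. w (b i)) a)"
 obtain B where B: "0 \<le> B" "\<And>a. ?p a \<le> B * nrm m a"
  by (metis seminorm_bounded seminorm_dual[OF X] lin_mapsD(1)[OF w H.coordsD(1)[OF c]])
 have "qnorm (dual X) (w x) \<le> B * qnorm H x" if x: "x \<in> carrier H" for x
 by (metis H.coords_expansion[OF c x] B(2)[of "\<lambda>i. \<phi> i x"] q[OF x] hom_lc[OF H real_vs_dual[OF X] w] H.coordsD(1)[OF c])
 with B(1) show ?thesis by blast
qed

lemma powr_minus_half: "0 < k \<Longrightarrow> real k powr (-1/2) = 1 / sqrt (real k)"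
 using powr_minus_divide[of "real k" "1/2"] powr_half_sqrt[of "real k"] by simp

text \<open>A map of rank less than \<open>k\<close> vanishes where \<open>k - 1\<close> functionals do, so approximation numbers bound
 Gelfand numbers.\<close>
lemma gelfand_bounded_of_weak_cotype2:
 assumes X: "homogeneous_space X" and z: "\<And>i. i < n \<Longrightarrow> z i \<in> carrier (dual X)"
  and C: "\<forall>(H :: (nat \<Rightarrow> real) qspace) h n e u.
    hilbert_space H h \<and> orthonormal_basis H h n e \<and> u \<in> lin_maps H (dual X) \<longrightarrow>
    (\<forall>k\<in>{1..n}. approx_number k H (dual X) u \<le> C * real k powr (-1/2) * ell_norm n e (dual X) u)"
 shows "gelfand_bounded C (\<lambda>a. qnorm (dual X) (lc (dual X) n z a))"
 unfolding gelfand_bounded_def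
proof (intro allI impI, elim conjE)
 let ?Z = "dual X"
 fix m U c and k :: nat
 assume k: "1 \<le> k" "k \<le> m" and c: "C / sqrt (real k) * ell m (\<lambda>x. qnorm ?Z (lc ?Z n z (lin m U x))) < c"
 let ?b = "\<lambda>j i. if i = Suc j then 1 else (0::real)" and ?\<phi> = "\<lambda>j x. x (Suc j) :: real"
 let ?V = "coordinate_space m"
 let ?H = "euclidean_structure ?V m ?\<phi>"
 let ?h = "\<lambda>x y. ip m (\<lambda>i. ?\<phi> i x) (\<lambda>i. ?\<phi> i y)"
 note hb = hilbert_of_coords[OF coordinate_space]
 have H: "real_vs ?H" using hb(1) by (simp add: hilbert_space_def)
 interpret H: real_space ?H by (rule real_space.intro[OF H])
 have Zvs: "real_vs ?Z" by (rule real_vs_dual[OF X])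
 interpret Z: real_space ?Z by (rule real_space.intro[OF Zvs])
 have ZH: "homogeneous_space ?Z" by (rule homogeneous_dual[OF X])
 have HH: "homogeneous_space ?H" by (rule hilbert_homogeneous[OF hb(1)])
 define u where "u x = lc ?Z n z (lin m U (\<lambda>i. x (Suc i)))" for x
 have uc: "u x \<in> carrier ?Z" for x unfolding u_def by (rule Z.lc_closed) (rule z)
 have u: "u \<in> lin_maps ?H ?Z"
 using uc by (simp add: u_def lin_add Z.lc_add z lin_scale Z.lc_scale module_hom_def coordinate_space_def)
 have bc: "?b i \<in> carrier ?H" if "i < m" for i by (rule H.coordsD(1)[OF hb(3) that])
 have expand: "u (lc ?H m ?b a) = lc ?Z n z (lin m U a)" for a
 by (smt (verit) lin_cong H.coords_lc[OF hb(3)] u_def)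
 have sem: "seminorm m (\<lambda>g. qnorm ?Z (lc ?Z m (\<lambda>i. u (?b i)) g))"
  by (rule seminorm_dual[OF X]) (rule uc)
 have ell: "ell_norm m (\<lambda>i. ?b (i - 1)) ?Z u = ell m (\<lambda>x. qnorm ?Z (lc ?Z n z (lin m U x)))"
  using ell_norm_eq_ell[OF Zvs, of m u "\<lambda>i. ?b (i - 1)"] uc sem by (simp add: expand[symmetric] hom_lc[OF H Zvs u bc, symmetric])
 have "approx_number k ?H ?Z u \<le> C * real k powr (-1/2) * ell_norm m (\<lambda>i. ?b (i - 1)) ?Z u"
  using C[rule_format, OF conjI[OF hb(1) conjI[OF hb(2) u]], of k] k by simp
 also have "\<dots> < c" unfolding ell using c k(1) powr_minus_half[of k] by simp
 finally have less: "approx_number k ?H ?Z u < c" .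
 let ?S = "{op_norm ?H ?Z (\<lambda>x. u x \<ominus>\<^bsub>?Z\<^esub> v x) | v. v \<in> lin_maps ?H ?Z \<and> lin_rank ?H ?Z v < k}"
 have "?S \<noteq> {}"
 proof -
  have l: "(\<lambda>x. \<zero>\<^bsub>?Z\<^esub>) \<in> lin_maps ?H ?Z" by (auto simp: module_hom_def)
  have "lin_rank ?H ?Z (\<lambda>x. \<zero>\<^bsub>?Z\<^esub>) \<le> 0" by (rule lin_rank_le(2)[OF H Zvs l]) auto
  then have "lin_rank ?H ?Z (\<lambda>x. \<zero>\<^bsub>?Z\<^esub>) < k" using k by simp
  with l show ?thesis by blast
 qed
 from cInf_lessD[OF this less[unfolded approx_number_def]] obtain v where v: "v \<in> lin_maps ?H ?Z"
  and rank: "lin_rank ?H ?Z v < k" and op: "op_norm ?H ?Z (\<lambda>x. u x \<ominus>\<^bsub>?Z\<^esub> v x) < c" by blast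
 let ?I = "?Z\<lparr>carrier := v ` carrier ?H\<rparr>"
 interpret I: real_space ?I by (rule real_space.intro[OF real_vs_image[OF H Zvs v]])
 have vlc: "v (lc ?H m ?b a) = lc ?Z m (\<lambda>i. v (?b i)) a" for a by (rule hom_lc[OF H Zvs v bc])
 have "fin_dim ?I"
 proof (rule lin_rank_le(1)[OF H Zvs v, where w="\<lambda>i. v (?b i)" and j=m])
  show "v (?b i) \<in> v ` carrier ?H" if "i < m" for i using bc[OF that] by (rule imageI)
  show "\<exists>a. v x = lc ?Z m (\<lambda>i. v (?b i)) a" if "x \<in> carrier ?H" for x
   using H.coords_expansion[OF hb(3) that] vlc by metis
 qed
 then obtain w \<psi> where I: "coords ?I (vdim ?I) w \<psi>" using I.coords_of_fin_dim by blast
 \<comment> \<open>the coordinates on the range of \<open>v\<close>, composed with \<open>v\<close>, are the functionals that cut out the subspace\<close>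
 define r where "r l i = (if l < vdim ?I then \<psi> l (v (?b i)) else 0)" for l i
 show "gel m (\<lambda>x. qnorm ?Z (lc ?Z n z (lin m U x))) (k - 1) c"
  unfolding gel_def
 proof (intro exI allI impI)
  fix x assume x: "\<forall>l<k - 1. ip m (r l) x = 0"
  let ?x = "lc ?H m ?b x"
  have xc: "?x \<in> carrier ?H" by (rule H.lc_closed) (rule bc)
  have vb: "v (?b i) \<in> carrier ?I" if "i < m" for i using bc[OF that] by simp
  have "v ?x = \<zero>\<^bsub>?I\<^esub>"
  proof (rule I.coordsD(4)[OF I])
   show "v ?x \<in> carrier ?I" using xc by simp
   fix l assume l: "l < vdim ?I"
   have "\<psi> l (v ?x) = \<psi> l (lc ?I m (\<lambda>i. v (?b i)) x)" by (simp only: vlc lc_carrier_update)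
   also have "\<dots> = (\<Sum>i<m. x i * \<psi> l (v (?b i)))" by (rule I.lfun_lc[OF I.coordsD(2)[OF I l] vb])
   also have "\<dots> = ip m (r l) x" using l by (simp add: r_def ip_def mult.commute)
   also have "\<dots> = 0"
  using rank x l by (simp add: lin_rank_def)
   finally show "\<psi> l (v ?x) = 0" .
  qed
  then have vx: "v ?x = \<zero>\<^bsub>?Z\<^esub>" by simp
  let ?w = "\<lambda>x. u x \<ominus>\<^bsub>?Z\<^esub> v x"
  have wl: "?w \<in> lin_maps ?H ?Z" by (rule lin_maps_diff[OF H Zvs u v])
  have "bounded_lin ?H ?Z ?w"
   unfolding bounded_lin_def using bounded_into_dual[OF X H hb(3) _ wl] wl by auto
  from op_norm_bound[OF HH ZH this xc]
  have "qnorm ?Z (u ?x \<ominus>\<^bsub>?Z\<^esub> v ?x) \<le> op_norm ?H ?Z ?w * qnorm ?H ?x" .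
  also have "\<dots> \<le> c * qnorm ?H ?x" using op homogeneousD(2)[OF HH xc] by (intro mult_right_mono) auto
  also have "u ?x \<ominus>\<^bsub>?Z\<^esub> v ?x = u ?x" unfolding vx using uc by (simp add: a_minus_def)
  also have "qnorm ?H ?x = nrm m x"
   unfolding euclidean_structure_simps by (rule nrm_cong) (rule H.coords_lc[OF hb(3)])
  finally show "qnorm ?Z (lc ?Z n z (lin m U x)) \<le> c * nrm m x" by (simp only: expand)
 qed
qed

section \<open>Euclidean quotients of finite-dimensional quotients\<close>

text \<open>Iterating the quasi-triangle inequality makes the constant exponential in \<open>n\<close>; it serves for
 qualitative statements about a fixed finite-dimensional space.\<close>
lemma qnorm_lc_le:
 assumes V: "homogeneous_space V" and K: "\<And>x y. x \<in> carrier V \<Longrightarrow> y \<in> carrier V \<Longrightarrow> qnorm V (x \<oplus>\<^bsub>V\<^esub> y) \<le> K * (qnorm V x + qnorm V y)" "1 \<le> K"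
 shows "(\<And>i. i < n \<Longrightarrow> b i \<in> carrier V) \<Longrightarrow> qnorm V (lc V n b a) \<le> K ^ n * (\<Sum>i<n. \<bar>a i\<bar> * qnorm V (b i))"
proof (induction n)
 case 0
 then show ?case using homogeneous_zero[OF V] by simp
next
 case (Suc n)
 interpret V: real_space V by (rule real_space.intro[OF homogeneousD(1)[OF V]])
 have b: "b i \<in> carrier V" if "i < n" for i by (rule Suc.prems[OF less_SucI[OF that]])
 have bn: "b n \<in> carrier V" by (rule Suc.prems[OF lessI])
 have q: "0 \<le> \<bar>a i\<bar> * qnorm V (b i)" if "i < Suc n" for i using homogeneousD(2)[OF V Suc.prems[OF that]] by simp
 have "qnorm V (lc V (Suc n) b a) \<le> K * (qnorm V (lc V n b a) + qnorm V (a n \<odot>\<^bsub>V\<^esub> b n))"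
  unfolding lc.simps by (rule K(1)[OF V.lc_closed[OF b] V.v_smult[OF bn]])
 also have "\<dots> \<le> K * (K ^ n * (\<Sum>i<n. \<bar>a i\<bar> * qnorm V (b i)) + K ^ n * (\<bar>a n\<bar> * qnorm V (b n)))"
 proof (intro mult_left_mono add_mono)
  have "1 * (\<bar>a n\<bar> * qnorm V (b n)) \<le> K ^ n * (\<bar>a n\<bar> * qnorm V (b n))"
   using K(2) q[of n] by (intro mult_right_mono one_le_power) auto
  then show "qnorm V (a n \<odot>\<^bsub>V\<^esub> b n) \<le> K ^ n * (\<bar>a n\<bar> * qnorm V (b n))" by (simp add: homogeneousD(4)[OF V bn])
 qed (use Suc.IH[OF b] K(2) in auto)
 also have "\<dots> = K ^ Suc n * (\<Sum>i<Suc n. \<bar>a i\<bar> * qnorm V (b i))" by (simp add: algebra_simps)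
 finally show ?case .
qed

text \<open>In finite dimension the quasi-norm dominates a multiple of any Euclidean norm, by compactness of
 the unit sphere.\<close>
lemma coordinates_bounded:
 assumes V: "homogeneous_space V" and K: "\<And>x y. x \<in> carrier V \<Longrightarrow> y \<in> carrier V \<Longrightarrow> qnorm V (x \<oplus>\<^bsub>V\<^esub> y) \<le> K * (qnorm V x + qnorm V y)" "1 \<le> K"
  and c: "coords V n b \<phi>"
 shows "\<exists>B\<ge>0. \<forall>x\<in>carrier V. nrm n (\<lambda>i. \<phi> i x) \<le> B * qnorm V x"
proof (rule ccontr)
 interpret V: real_space V by (rule real_space.intro[OF homogeneousD(1)[OF V]])
 note bc = V.coordsD(1)[OF c]
 have bcl: "lc V n b t \<in> carrier V" for t by (rule V.lc_closed) (rule bc)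
 have bq: "qnorm V (lc V n b t) \<le> K ^ n * (\<Sum>i<n. \<bar>t i\<bar> * qnorm V (b i))" for t by (rule qnorm_lc_le[OF V K], assumption, assumption, rule bc)
 assume n: "\<not> ?thesis"
 have "\<exists>a. nrm n a = 1 \<and> qnorm V (lc V n b a) < 1 / Suc k" for k
 proof -
  obtain x where x: "x \<in> carrier V" "real (Suc k) * qnorm V x < nrm n (\<lambda>i. \<phi> i x)"
  by (metis n not_le of_nat_0_le_iff)
  let ?s = "nrm n (\<lambda>i. \<phi> i x)"
  have s: "0 < ?s" using x(2) homogeneousD(2)[OF V x(1)] by (smt (verit) mult_nonneg_nonneg of_nat_0_le_iff)
  have "qnorm V (lc V n b (\<lambda>i. (1 / ?s) * \<phi> i x)) < 1 / Suc k"
  using V.lc_scale[of n b "1 / ?s" "\<lambda>i. \<phi> i x"] bc V.coords_expansion[OF c x(1)] s x(2) by (simp add: homogeneousD(4)[OF V x(1)] field_simps)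
  moreover have "nrm n (\<lambda>i. (1 / ?s) * \<phi> i x) = 1" by (rule unit_multiple[OF s])
  ultimately show ?thesis by blast
 qed
 then obtain a where a: "\<And>k. nrm n (a k) = 1" "\<And>k. qnorm V (lc V n b (a k)) < 1 / Suc k" by metis
 obtain l r where r: "strict_mono (r :: nat \<Rightarrow> nat)"
  and lim: "\<forall>e>0. eventually (\<lambda>k. \<forall>i\<in>{..<n}. dist (a (r k) i) (l i) < e) sequentially"
 proof -
  have "\<exists>l r. strict_mono (r :: nat \<Rightarrow> nat) \<and> (\<forall>e>0. eventually (\<lambda>k. \<forall>i\<in>{..<n}. dist (a (r k) i) (l i) < e) sequentially)"
  proof (rule compact_lemma_general[where proj="\<lambda>x i. x i" and unproj="\<lambda>e. e", rule_format])
   show "bounded ((\<lambda>x. x i) ` range a)" if "i \<in> {..<n}" for i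
    unfolding bounded_iff using coord_le_nrm[of i n "a _"] a(1) that by (intro exI[of _ 1]) auto
  qed auto
  then show ?thesis using that by blast
 qed
 have lim': "(\<lambda>k. a (r k) i) \<longlonglongrightarrow> l i" if "i < n" for i
  unfolding tendsto_iff using lim that by (auto elim!: eventually_mono)
 have "(\<lambda>k. nrm n (a (r k))) \<longlonglongrightarrow> nrm n l" unfolding nrm_def ip_def by (intro tendsto_intros lim') auto
 then have nl: "nrm n l = 1" using a(1) by (simp add: LIMSEQ_const_iff)
 let ?S = "\<lambda>k. K * (1 / Suc (r k) + K ^ n * (\<Sum>i<n. \<bar>l i - a (r k) i\<bar> * qnorm V (b i)))"
 have "qnorm V (lc V n b l) \<le> ?S k" for k
 proof -
  have "lc V n b (\<lambda>i. a (r k) i + (l i - a (r k) i)) = lc V n b (a (r k)) \<oplus>\<^bsub>V\<^esub> lc V n b (\<lambda>i. l i - a (r k) i)"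
   by (rule V.lc_add) (rule bc)
  then have "qnorm V (lc V n b l) \<le> K * (qnorm V (lc V n b (a (r k))) + qnorm V (lc V n b (\<lambda>i. l i - a (r k) i)))"
   using K(1)[OF bcl[of "a (r k)"] bcl[of "\<lambda>i. l i - a (r k) i"]] by simp
  also have "\<dots> \<le> ?S k"
   using a(2)[of "r k"] bq[of "\<lambda>i. l i - a (r k) i"] K(2) by (intro mult_left_mono add_mono) auto
  finally show ?thesis .
 qed
 moreover have "?S \<longlonglongrightarrow> K * (0 + K ^ n * (\<Sum>i<n. \<bar>l i - l i\<bar> * qnorm V (b i)))"
  by (intro tendsto_intros lim' LIMSEQ_subseq_LIMSEQ[OF LIMSEQ_Suc[OF lim_1_over_n] r, unfolded o_def]) auto
 ultimately have "qnorm V (lc V n b l) \<le> K * (0 + K ^ n * (\<Sum>i<n. \<bar>l i - l i\<bar> * qnorm V (b i)))"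
  by (intro LIMSEQ_le_const) auto
 then have "lc V n b l = \<zero>\<^bsub>V\<^esub>" using homogeneousD(2,3)[OF V bcl[of l]] by simp
 then have "l i = 0" if "i < n" for i using V.coords_lc[OF c that, of l] V.lfun_zero[OF V.coordsD(2)[OF c that]] by simp
 then show False
  by (smt (verit) nl nrm_eq_0_iff)
qed

lemma dual_vectors:
 assumes W: "\<And>a. \<exists>i<m. a i \<noteq> 0 \<Longrightarrow> 0 < nrm n (lin m W a)"
 shows "\<exists>v. \<forall>i<m. \<forall>j<m. ip n (W i) (v j) = (if i = j then 1 else 0)"
proof -
 have "\<exists>v. \<forall>i<m. ip n (W i) v = (if i = j then 1 else 0)" if j: "j < m" for j
 proof -
  define r where "r i = (if i < j then W i else W (Suc i))" for i
  obtain a where a: "nrm n (lin m W a) = 1" "\<forall>i<m - 1. ip n (lin m W a) (r i) = 0"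
   using unit_vector_in_kernel[of "m - 1" m n W r] W j by auto
  let ?v = "lin m W a"
  have z: "ip n (W i) ?v = 0" if i: "i < m" "i \<noteq> j" for i
  proof (cases "i < j")
   case True
   then show ?thesis using a(2)[rule_format, of i] j by (simp add: r_def ip_commute)
  next
   case False
   then have "i - 1 < m - 1" "\<not> i - 1 < j" "Suc (i - 1) = i" using i by linarith+
   then show ?thesis using a(2)[rule_format, of "i - 1"] i by (simp add: r_def ip_commute)
  qed
  have ne: "ip n (W j) ?v \<noteq> 0"
  using a(1) nrm_sq[of n ?v] j z by (fastforce simp: ip_lin_left sum.remove[of _ j] sum.neutral)
  have "(1 / ip n (W j) ?v) * ip n (W j) ?v = 1" using ne by simp
  then show ?thesis
   by (intro exI[of _ "\<lambda>i. (1 / ip n (W j) ?v) * ?v i"]) (use z in \<open>auto simp: ip_scale_right simp del: times_divide_eq_left\<close>)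
 qed
 then show ?thesis by metis
qed

text \<open>Greedy approximation: the image of the unit ball need not be convex, but some element of it is
 within a fixed angle of any given direction, so that each step shrinks the error by a factor. The
 number of steps needed for a given accuracy depends on \<open>D\<close> only; the quasi-triangle inequality loses
 a factor \<open>K\<close> at each of them.\<close>
lemma greedy_approximation:
 assumes X: "homogeneous_space X" and K: "\<And>x y. x \<in> carrier X \<Longrightarrow> y \<in> carrier X \<Longrightarrow> qnorm X (x \<oplus>\<^bsub>X\<^esub> y) \<le> K * (qnorm X x + qnorm X y)" "1 \<le> K"
  and Y: "\<And>j. j < m \<Longrightarrow> lfun X (y j)" and D: "1 \<le> D"
  and up: "\<And>x. x \<in> carrier X \<Longrightarrow> qnorm X x \<le> 1 \<Longrightarrow> nrm m (\<lambda>j. y j x) \<le> D"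
  and low: "\<And>a c. c < nrm m a \<Longrightarrow> \<exists>x\<in>carrier X. qnorm X x \<le> 1 \<and> c < ip m a (\<lambda>j. y j x)"
 shows "\<exists>x\<in>carrier X. qnorm X x \<le> real J * K ^ J * nrm m a \<and>
  nrm m (\<lambda>j. a j - y j x) \<le> (sqrt (1 - 1 / (4 * D\<^sup>2))) ^ J * nrm m a"
proof (induction J)
 case 0
 interpret X: real_space X by (rule real_space.intro[OF homogeneousD(1)[OF X]])
 have "nrm m (\<lambda>j. a j - y j \<zero>\<^bsub>X\<^esub>) = nrm m a" by (rule nrm_cong) (simp add: X.lfun_zero[OF Y])
 then show ?case using homogeneous_zero[OF X] by (intro bexI[of _ "\<zero>\<^bsub>X\<^esub>"]) auto
next
 case (Suc J)
 interpret X: real_space X by (rule real_space.intro[OF homogeneousD(1)[OF X]])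
 let ?\<theta> = "sqrt (1 - 1 / (4 * D\<^sup>2))"
 have key: "t\<^sup>2 - 2 * (t / (2 * E)) * (t / 2) + (t / (2 * E))\<^sup>2 * E = (1 - 1 / (4 * E)) * t\<^sup>2" if "0 < E" for t E :: real
  using that by (simp add: field_simps power2_eq_square)
 have D2: "1 \<le> D\<^sup>2" using D by simp
 have \<theta>: "0 \<le> 1 - 1 / (4 * D\<^sup>2)" "?\<theta> \<le> 1" "0 \<le> ?\<theta>"
 proof -
  have "1 / (4 * D\<^sup>2) \<le> 1" "0 \<le> 1 / (4 * D\<^sup>2)" using D2 by (subst divide_le_eq_1_pos) auto
  then show "0 \<le> 1 - 1 / (4 * D\<^sup>2)" "?\<theta> \<le> 1" "0 \<le> ?\<theta>" by auto
 qed
 obtain x where x: "x \<in> carrier X" "qnorm X x \<le> real J * K ^ J * nrm m a"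
  "nrm m (\<lambda>j. a j - y j x) \<le> ?\<theta> ^ J * nrm m a" using Suc by blast
 define d where "d j = a j - y j x" for j
 have "\<exists>z\<in>carrier X. qnorm X z \<le> nrm m d \<and> nrm m (\<lambda>j. d j - y j z) \<le> ?\<theta> * nrm m d"
 proof (cases "nrm m d = 0")
  case True
  have "nrm m (\<lambda>j. d j - y j \<zero>\<^bsub>X\<^esub>) = nrm m d" by (rule nrm_cong) (simp add: X.lfun_zero[OF Y])
  then show ?thesis using True homogeneous_zero[OF X] by (intro bexI[of _ "\<zero>\<^bsub>X\<^esub>"]) auto
 next
  case False
  then have d0: "0 < nrm m d" using nrm_nonneg[of m d] by linarith
  obtain z where z: "z \<in> carrier X" "qnorm X z \<le> 1" "nrm m d / 2 < ip m d (\<lambda>j. y j z)"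
   using low[of "nrm m d / 2" d] d0 by auto
  \<comment> \<open>minimises the bound \<open>\<parallel>d\<parallel>\<^sup>2 - s \<parallel>d\<parallel> + s\<^sup>2 D\<^sup>2\<close> for the squared new error\<close>
  define s where "s = nrm m d / (2 * D\<^sup>2)"
  have s: "0 \<le> s" "s \<le> nrm m d"
  proof -
   have p: "0 < 2 * D\<^sup>2" "1 \<le> 2 * D\<^sup>2" using D2 by auto
   show "0 \<le> s" unfolding s_def using d0 p by (intro divide_nonneg_pos) auto
   show "s \<le> nrm m d" unfolding s_def pos_divide_le_eq[OF p(1)] using mult_left_mono[OF p(2), of "nrm m d"] by simp
  qed
  show ?thesis
  proof (intro bexI conjI)
   show "s \<odot>\<^bsub>X\<^esub> z \<in> carrier X" by (rule X.v_smult[OF z(1)])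
   have "qnorm X (s \<odot>\<^bsub>X\<^esub> z) = s * qnorm X z" using s by (simp add: homogeneousD(4)[OF X z(1)])
   also have "\<dots> \<le> nrm m d * 1" using s z(2) homogeneousD(2)[OF X z(1)] by (intro mult_mono) auto
   finally show "qnorm X (s \<odot>\<^bsub>X\<^esub> z) \<le> nrm m d" by simp
   let ?y = "\<lambda>j. y j z"
   have "(nrm m (\<lambda>j. d j - y j (s \<odot>\<^bsub>X\<^esub> z)))\<^sup>2 = (nrm m (\<lambda>j. d j - s * ?y j))\<^sup>2"
    by (rule arg_cong[of _ _ "\<lambda>t. t\<^sup>2"], rule nrm_cong) (simp add: lfunD(2)[OF Y z(1)])
   also have "\<dots> = (nrm m d)\<^sup>2 - 2 * s * ip m d ?y + s\<^sup>2 * (nrm m ?y)\<^sup>2"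
    unfolding nrm_sq ip_diff_left ip_diff_right ip_scale_left ip_scale_right ip_commute[of m ?y d] by (simp add: power2_eq_square algebra_simps)
   also have "\<dots> \<le> (nrm m d)\<^sup>2 - 2 * s * (nrm m d / 2) + s\<^sup>2 * D\<^sup>2"
   proof -
    have "s\<^sup>2 * (nrm m ?y)\<^sup>2 \<le> s\<^sup>2 * D\<^sup>2"
  by (simp add: power_mono[OF up[OF z(1,2)] nrm_nonneg] mult_left_mono)
    moreover have "2 * s * (nrm m d / 2) \<le> 2 * s * ip m d ?y" using z(3) s(1) by (intro mult_left_mono) auto
    ultimately show ?thesis by linarith
   qed
   also have "\<dots> = (1 - 1 / (4 * D\<^sup>2)) * (nrm m d)\<^sup>2"
    unfolding s_def by (rule key) (use D2 in linarith)
   also have "\<dots> = (?\<theta> * nrm m d)\<^sup>2" using \<theta>(1) by (simp add: power_mult_distrib)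
   finally have "(nrm m (\<lambda>j. d j - y j (s \<odot>\<^bsub>X\<^esub> z)))\<^sup>2 \<le> (?\<theta> * nrm m d)\<^sup>2" .
   from power2_le_imp_le[OF this mult_nonneg_nonneg[OF \<theta>(3) nrm_nonneg]]
   show "nrm m (\<lambda>j. d j - y j (s \<odot>\<^bsub>X\<^esub> z)) \<le> ?\<theta> * nrm m d" .
  qed
 qed
 then obtain z where z: "z \<in> carrier X" "qnorm X z \<le> nrm m d" "nrm m (\<lambda>j. d j - y j z) \<le> ?\<theta> * nrm m d" by blast
 have da: "nrm m d \<le> ?\<theta> ^ J * nrm m a" using x(3) by (simp add: d_def[abs_def])
 show ?case
 proof (intro bexI conjI)
  show "x \<oplus>\<^bsub>X\<^esub> z \<in> carrier X" using x(1) z(1) by simp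
  have "qnorm X (x \<oplus>\<^bsub>X\<^esub> z) \<le> K * (qnorm X x + qnorm X z)" by (rule K(1)[OF x(1) z(1)])
  also have "\<dots> \<le> K * (real J * K ^ J * nrm m a + K ^ J * nrm m a)"
  proof (intro mult_left_mono add_mono x(2))
   have "1 * nrm m a \<le> K ^ J * nrm m a" using K(2) by (intro mult_right_mono one_le_power) auto
   then show "qnorm X z \<le> K ^ J * nrm m a"
  by (smt (verit) z(2) order.trans[OF da mult_right_mono[OF power_le_one[OF \<theta>(3,2)] nrm_nonneg]])
  qed (use K(2) in auto)
  also have "\<dots> = real (Suc J) * K ^ Suc J * nrm m a" by (simp add: algebra_simps)
  finally show "qnorm X (x \<oplus>\<^bsub>X\<^esub> z) \<le> real (Suc J) * K ^ Suc J * nrm m a" .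
  have "nrm m (\<lambda>j. a j - y j (x \<oplus>\<^bsub>X\<^esub> z)) = nrm m (\<lambda>j. d j - y j z)"
   by (rule nrm_cong) (simp add: lfunD(1)[OF Y x(1) z(1)] d_def)
  also have "\<dots> \<le> ?\<theta> * (?\<theta> ^ J * nrm m a)" using z(3) mult_left_mono[OF da \<theta>(3)] by linarith
  finally show "nrm m (\<lambda>j. a j - y j (x \<oplus>\<^bsub>X\<^esub> z)) \<le> ?\<theta> ^ Suc J * nrm m a" by (simp add: mult.assoc)
 qed
qed

text \<open>The identity factors through \<open>E\<close> with the Euclidean norm of its coordinates.\<close>
lemma euclidean_distance_le:
 assumes E: "homogeneous_space E" and c: "coords E m \<epsilon> \<eta>"
  and up: "\<And>x. x \<in> carrier E \<Longrightarrow> nrm m (\<lambda>j. \<eta> j x) \<le> D * qnorm E x" "0 \<le> D"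
  and low: "\<And>x. x \<in> carrier E \<Longrightarrow> qnorm E x \<le> B * nrm m (\<lambda>j. \<eta> j x)" "0 \<le> B"
 shows "euclidean_distance E \<le> ereal (B * D)"
proof -
 let ?H = "euclidean_structure E m \<eta>" and ?h = "\<lambda>x y. ip m (\<lambda>i. \<eta> i x) (\<lambda>i. \<eta> i y)"
 note hb = hilbert_of_coords[OF homogeneousD(1)[OF E] c]
 have H: "homogeneous_space ?H" by (rule hilbert_homogeneous[OF hb(1)])
 have b: "bounded_lin E ?H (\<lambda>x. x)" "bounded_lin ?H E (\<lambda>x. x)"
  unfolding bounded_lin_def using up(1) low(1) by (auto simp: module_hom_def)
 have o1: "op_norm E ?H (\<lambda>x. x) \<le> D"
 proof (rule op_norm_le[OF E])
  fix x assume x: "x \<in> carrier E" "qnorm E x \<le> 1"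
  show "qnorm ?H x \<le> D" using up(1)[OF x(1)] mult_left_mono[OF x(2) up(2)] by simp
 qed
 have o2: "op_norm ?H E (\<lambda>x. x) \<le> B"
 proof (rule op_norm_le[OF H])
  fix x assume x: "x \<in> carrier ?H" "qnorm ?H x \<le> 1"
  show "qnorm E x \<le> B" using low(1)[of x] mult_left_mono[OF x(2) low(2)] x(1) by simp
 qed
 have "euclidean_distance E \<le> ereal (op_norm ?H E (\<lambda>x. x) * op_norm E ?H (\<lambda>x. x))"
  unfolding euclidean_distance_def by (rule Inf_lower) (use hb(1) b in blast)
 also have "\<dots> \<le> ereal (B * D)"
  using b(1) up(1) o1 o2 low(2) by (simp add: op_norm_nonneg[OF E H, of _ D] bounded_lin_def mult_mono)
 finally show ?thesis .
qed

text \<open>Lifting the Euclidean section of the space of functionals to a quotient of \<open>F\<close>. The section bounds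
 the Euclidean norm of the coordinates by the quotient norm; the reverse estimate comes from greedy
 approximation, whose remainder is absorbed because a reverse estimate with some constant is
 automatic in finite dimension.\<close>
lemma euclidean_quotient:
 fixes X :: "'a qspace"
 assumes X: "quasi_normed_space X" and M: "closed_subspace M X" and fin: "fin_dim (quotient_space X M)"
  and C: "\<forall>(H :: (nat \<Rightarrow> real) qspace) h n e u.
    hilbert_space H h \<and> orthonormal_basis H h n e \<and> u \<in> lin_maps H (dual X) \<longrightarrow>
    (\<forall>k\<in>{1..n}. approx_number k H (dual X) u \<le> C * real k powr (-1/2) * ell_norm n e (dual X) u)" "0 \<le> C"
  and \<eta>: "0 < \<eta>" "\<eta> < 1"
  and K: "\<And>x y. x \<in> carrier X \<Longrightarrow> y \<in> carrier X \<Longrightarrow> qnorm X (x \<oplus>\<^bsub>X\<^esub> y) \<le> K * (qnorm X x + qnorm X y)" "1 \<le> K"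
  and D: "D = exp (12 * (41 + 40 * C) / \<eta>)"
  and J: "(sqrt (1 - 1 / (4 * D\<^sup>2))) ^ J \<le> 1 / (2 * K)"
 shows "\<exists>E. is_quotient_of E (quotient_space X M) \<and> (1 - \<eta>) * real (vdim (quotient_space X M)) \<le> real (vdim E) \<and>
  euclidean_distance E \<le> ereal (2 * K * (real J * K ^ J) * D)"
proof -
 let ?F = "quotient_space X M" and ?Z = "dual X"
 interpret q: closed_quotient X M by (rule closed_quotient.intro[OF X M])
 note hX = q.hX
 have F: "quasi_normed_space ?F" by (rule q.quasi_normed_Q)
 have hF: "homogeneous_space ?F" by (rule quasi_normed_homogeneous[OF F])
 interpret F: real_space ?F by (rule real_space.intro[OF homogeneousD(1)[OF hF]])
 have KF: "qnorm ?F (x \<oplus>\<^bsub>?F\<^esub> y) \<le> K * (qnorm ?F x + qnorm ?F y)" if "x \<in> carrier ?F" "y \<in> carrier ?F" for x y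
  by (rule q.Q_triangle[OF K(1) K(2) that])
 define n where "n = vdim ?F"
 obtain b \<phi> where F_coords: "coords ?F n b \<phi>" using F.coords_of_fin_dim[OF fin] unfolding n_def by blast
 obtain B where B: "0 \<le> B" "\<And>x. x \<in> carrier ?F \<Longrightarrow> nrm n (\<lambda>i. \<phi> i x) \<le> B * qnorm ?F x"
  using coordinates_bounded[OF hF KF K(2) F_coords] by blast
 have \<phi>B: "\<bar>\<phi> i x\<bar> \<le> B * qnorm ?F x" if "i < n" "x \<in> carrier ?F" for i x
  using coord_le_nrm[OF that(1), of "\<lambda>i. \<phi> i x"] B(2)[OF that(2)] by linarith
 define f where "f i x = \<phi> i (q.cl x)" for i x
 have fl: "lfun X (f i)" if "i < n" for i
  unfolding f_def[abs_def] by (rule q.lfun_cl[OF F.coordsD(2)[OF F_coords that]])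
 have fB: "\<bar>f i x\<bar> \<le> B * qnorm X x" if "i < n" "x \<in> carrier X" for i x
  using \<phi>B[OF that(1) q.cl_in[OF that(2)]] mult_left_mono[OF q.Q_norm_le[OF that(2)] B(1)] unfolding f_def by linarith
 define z where "z i = restrict (f i) (carrier X)" for i
 have z: "z i \<in> carrier ?Z" if "i < n" for i
  unfolding dual_carrier_iff[OF hX] z_def using fl[OF that] fB[OF that] by (auto simp: lfun_def)
 have zlc: "lc ?Z n z a x = (\<Sum>i<n. a i * f i x)" if "x \<in> carrier X" for a x
 proof -
  have "lc ?Z n z a x = (\<Sum>i<n. a i * z i x)" by (rule lc_dual[OF hX]) (rule z, assumption, rule that)
  then show ?thesis using that by (simp add: z_def)
 qed
 let ?N = "\<lambda>a. qnorm ?Z (lc ?Z n z a)"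
 interpret Z: real_space ?Z by (rule real_space.intro[OF real_vs_dual[OF hX]])
 have zc: "lc ?Z n z a \<in> carrier ?Z" for a by (rule Z.lc_closed) (rule z)
 have N_upper: "\<bar>\<Sum>i<n. a i * f i x\<bar> \<le> ?N a * qnorm X x" if "x \<in> carrier X" for a x
  using dual_bound[OF hX zc that, of a] unfolding zlc[OF that] .
 have sem: "seminorm n ?N" by (rule seminorm_dual[OF hX z])
 have gel: "gelfand_bounded C ?N" by (rule gelfand_bounded_of_weak_cotype2[OF hX z C(1)])
 have "\<exists>x. x \<in> carrier X \<and> q.cl x = b i" if i: "i < n" for i
  by (rule q.Q_cases[OF F.coordsD(1)[OF F_coords i]]) blast
 then obtain p where p: "\<And>i. i < n \<Longrightarrow> p i \<in> carrier X" "\<And>i. i < n \<Longrightarrow> q.cl (p i) = b i" by metis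
 define s where "s = 1 + (\<Sum>i<n. qnorm X (p i))"
 have s: "0 < s" unfolding s_def using homogeneousD(2)[OF hX p(1)] by (intro add_pos_nonneg sum_nonneg) auto
 \<comment> \<open>lifting the basis of \<open>F\<close> to \<open>X\<close> shows that the coefficients are controlled by the dual norm\<close>
 have lower: "1 / s * nrm n a \<le> ?N a" for a
 proof -
  have "nrm n a \<le> (\<Sum>i<n. \<bar>a i\<bar>)" unfolding nrm_L2_set by (rule L2_set_le_sum_abs)
  also have "\<dots> \<le> (\<Sum>i<n. ?N a * qnorm X (p i))"
  proof (rule sum_mono)
   fix i assume "i \<in> {..<n}"
   then have i: "i < n" by simp
   have "(\<Sum>l<n. a l * f l (p i)) = (\<Sum>l<n. if l = i then a i else 0)"
    using i by (intro sum.cong) (auto simp: f_def p(2) F.coordsD(3)[OF F_coords])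
   also have "\<dots> = a i" using i by simp
   finally show "\<bar>a i\<bar> \<le> ?N a * qnorm X (p i)" using N_upper[OF p(1)[OF i], of a] by simp
  qed
  also have "\<dots> \<le> ?N a * s" unfolding s_def sum_distrib_left[symmetric]
   using dual_nonneg[OF hX zc] by (intro mult_left_mono) auto
  finally show ?thesis using s by (simp add: pos_divide_le_eq)
 qed
 obtain m W where m: "(1 - \<eta>) * n \<le> real m" and W: "\<And>a. nrm m a \<le> ?N (lin m W a)" "\<And>a. ?N (lin m W a) \<le> D * nrm m a"
  using euclidean_sections[OF gel C(2) \<eta> sem _ lower] s unfolding D by auto
 have D1: "1 \<le> D" unfolding D using C(2) \<eta> by simp
 define y where "y j \<xi> = (\<Sum>i<n. W j i * \<phi> i \<xi>)" for j \<xi>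
 have yl: "lfun ?F (y j)" for j unfolding y_def[abs_def] by (rule lfun_sum) (rule F.coordsD(2)[OF F_coords])
 define y' where "y' j x = y j (q.cl x)" for j x
 have y'l: "lfun X (y' j)" for j unfolding y'_def[abs_def] by (rule q.lfun_cl[OF yl])
 have pair: "ip m a (\<lambda>j. y' j x) = (\<Sum>i<n. lin m W a i * f i x)" for a x
  unfolding ip_def y'_def y_def lin_def f_def by (simp add: sum_distrib_left sum_distrib_right mult.assoc sum.swap[of _ "{..<n}"])
 have up: "nrm m (\<lambda>j. y' j x) \<le> D * qnorm X x" if x: "x \<in> carrier X" for x
 proof (cases "nrm m (\<lambda>j. y' j x) = 0")
  case True
  then show ?thesis using D1 homogeneousD(2)[OF hX x] by simp
 next
  case False
  let ?t = "\<lambda>j. y' j x"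
  have "nrm m ?t * nrm m ?t = ip m ?t ?t" using nrm_sq[of m ?t] by (simp add: power2_eq_square)
  also have "\<dots> \<le> ?N (lin m W ?t) * qnorm X x" unfolding pair using N_upper[OF x, of "lin m W ?t"] by linarith
  also have "\<dots> \<le> (D * nrm m ?t) * qnorm X x" by (rule mult_right_mono[OF W(2) homogeneousD(2)[OF hX x]])
  finally have "nrm m ?t * nrm m ?t \<le> nrm m ?t * (D * qnorm X x)" by (simp only: mult_ac)
  moreover have "0 < nrm m ?t" using False nrm_nonneg[of m ?t] by linarith
  ultimately show ?thesis by (rule mult_left_le_imp_le)
 qed
 \<comment> \<open>the dual norm is attained up to any error on the unit ball of \<open>X\<close>, which is symmetric\<close>
 have low: "\<exists>x\<in>carrier X. qnorm X x \<le> 1 \<and> c < ip m a (\<lambda>j. y' j x)" if c: "c < nrm m a" for a c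
 proof (rule ccontr)
  assume n: "\<not> ?thesis"
  have "?N (lin m W a) \<le> c"
  proof (rule dual_norm_le[OF hX])
   fix x assume x: "x \<in> carrier X" "qnorm X x \<le> 1"
   let ?x = "(- 1) \<odot>\<^bsub>X\<^esub> x"
   have x': "?x \<in> carrier X" "qnorm X ?x \<le> 1" using x q.X.v_smult[OF x(1), of "- 1"] by (simp_all add: homogeneousD(4)[OF hX x(1)])
   have "ip m a (\<lambda>j. y' j ?x) = - ip m a (\<lambda>j. y' j x)"
   proof -
    have "ip m a (\<lambda>j. y' j ?x) = ip m a (\<lambda>j. (- 1) * y' j x)" by (rule ip_cong) (simp_all only: lfunD(2)[OF y'l x(1)])
    then show ?thesis unfolding ip_scale_right by simp
   qed
   moreover have "ip m a (\<lambda>j. y' j x) \<le> c" "ip m a (\<lambda>j. y' j ?x) \<le> c" using n x x' by (meson not_le)+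
   ultimately show "\<bar>lc ?Z n z (lin m W a) x\<bar> \<le> c" unfolding zlc[OF x(1)] pair[symmetric] by linarith
  qed
  with W(1)[of a] c show False by linarith
 qed
 \<comment> \<open>\<open>E\<close> is the quotient by the common kernel of the functionals in the Euclidean section\<close>
 let ?ker = "{\<xi> \<in> carrier ?F. \<forall>j<m. y j \<xi> = 0}"
 have yB: "\<exists>K. \<forall>x\<in>carrier ?F. \<bar>y j x\<bar> \<le> K * qnorm ?F x" for j
 proof (intro exI ballI)
  fix x assume x: "x \<in> carrier ?F"
  have "\<bar>y j x\<bar> \<le> (\<Sum>i<n. \<bar>W j i\<bar> * \<bar>\<phi> i x\<bar>)" unfolding y_def abs_mult[symmetric] by (rule sum_abs)
  also have "\<dots> \<le> (\<Sum>i<n. \<bar>W j i\<bar> * (B * qnorm ?F x))" by (intro sum_mono mult_left_mono \<phi>B x) auto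
  finally show "\<bar>y j x\<bar> \<le> (\<Sum>i<n. \<bar>W j i\<bar> * B) * qnorm ?F x" by (simp add: sum_distrib_right mult.assoc)
 qed
 have N0: "closed_subspace ?ker ?F" by (rule closed_common_kernel[OF F yl yB])
 let ?E = "quotient_space ?F ?ker"
 interpret e: closed_quotient ?F ?ker by (rule closed_quotient.intro[OF F N0])
 have hE: "homogeneous_space ?E" by (rule quasi_normed_homogeneous[OF e.quasi_normed_Q])
 interpret E: real_space ?E by (rule real_space.intro[OF homogeneousD(1)[OF hE]])
 have KE: "qnorm ?E (x \<oplus>\<^bsub>?E\<^esub> y) \<le> K * (qnorm ?E x + qnorm ?E y)" if "x \<in> carrier ?E" "y \<in> carrier ?E" for x y
  by (rule e.Q_triangle[OF KF K(2) that])
 define h where "h j = e.induced (y j)" for j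
 have hcl: "h j (e.cl \<xi>) = y j \<xi>" if "\<xi> \<in> carrier ?F" "j < m" for j \<xi>
  unfolding h_def by (rule e.induced_cl[OF yl _ that(1)]) (use that(2) in simp)
 have hl: "lfun ?E (h j)" if "j < m" for j
  unfolding h_def by (rule e.lfun_induced[OF yl]) (use that in simp)
 have inj: "0 < nrm n (lin m W a)" if a: "\<exists>i<m. a i \<noteq> 0" for a
 proof (rule ccontr)
  assume "\<not> 0 < nrm n (lin m W a)"
  then have z: "nrm n (lin m W a) = 0" using nrm_nonneg[of n "lin m W a"] by linarith
  have "?N (lin m W a) = ?N (\<lambda>_. 0)" by (rule seminorm_cong[OF sem]) (use z in \<open>simp add: nrm_eq_0_iff\<close>)
  then show False
  by (smt (verit) W(1)[of a] seminorm_zero[OF sem] a nrm_pos[of _ m a])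
 qed
 obtain v where v: "\<And>i j. i < m \<Longrightarrow> j < m \<Longrightarrow> ip n (W i) (v j) = (if i = j then 1 else 0)"
  using dual_vectors[of m n W, OF inj] by blast
 have bF: "b i \<in> carrier ?F" if "i < n" for i by (rule F.coordsD(1)[OF F_coords that])
 have lcF: "lc ?F n b a \<in> carrier ?F" for a by (rule F.lc_closed[OF bF])
 define \<epsilon> where "\<epsilon> j = e.cl (lc ?F n b (v j))" for j
 have E_coords: "coords ?E m \<epsilon> h"
  unfolding coords_def
 proof (intro conjI allI impI ballI)
  show "\<epsilon> i \<in> carrier ?E" for i unfolding \<epsilon>_def by (rule e.cl_in[OF lcF])
  show "lfun ?E (h i)" if "i < m" for i by (rule hl[OF that])
  show "h i (\<epsilon> j) = (if i = j then 1 else 0)" if "i < m" "j < m" for i j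
  proof -
   have "h i (\<epsilon> j) = y i (lc ?F n b (v j))" unfolding \<epsilon>_def by (rule hcl[OF lcF that(1)])
   also have "\<dots> = (\<Sum>l<n. W i l * \<phi> l (lc ?F n b (v j)))" by (simp only: y_def)
   also have "\<dots> = ip n (W i) (v j)" unfolding ip_def by (rule sum.cong) (simp_all add: F.coords_lc[OF F_coords])
   finally show ?thesis using v[OF that] by simp
  qed
  show "\<xi> = \<zero>\<^bsub>?E\<^esub>" if \<xi>: "\<xi> \<in> carrier ?E" "\<forall>j<m. h j \<xi> = 0" for \<xi>
  proof -
   obtain \<zeta> where \<zeta>: "\<zeta> \<in> carrier ?F" "\<xi> = e.cl \<zeta>" by (rule e.Q_cases[OF \<xi>(1)])
   have "\<zeta> \<in> ?ker" using \<zeta> \<xi>(2) hcl by auto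
   then have "e.cl (\<zeta> \<oplus>\<^bsub>?F\<^esub> \<zero>\<^bsub>?F\<^esub>) = e.cl \<zero>\<^bsub>?F\<^esub>" by (rule e.cl_eqI) (rule F.M.zero_closed)
   then show ?thesis using \<zeta> by (simp add: e.Q_zero)
  qed
 qed
 have upE: "nrm m (\<lambda>j. h j \<xi>) \<le> D * qnorm ?E \<xi>" if \<xi>: "\<xi> \<in> carrier ?E" for \<xi>
 proof -
  have "nrm m (\<lambda>j. h j \<xi>) / D \<le> c" if c: "qnorm ?E \<xi> < c" for c
  proof -
   obtain \<zeta> where \<zeta>: "\<zeta> \<in> carrier ?F" "\<xi> = e.cl \<zeta>" "qnorm ?F \<zeta> < c" by (rule e.Q_norm_lift[OF \<xi> c])
   obtain x where x: "x \<in> carrier X" "\<zeta> = q.cl x" "qnorm X x < c" by (rule q.Q_norm_lift[OF \<zeta>(1,3)])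
   have "nrm m (\<lambda>j. h j \<xi>) = nrm m (\<lambda>j. y' j x)"
   proof (rule nrm_cong)
    fix j assume "j < m"
    from hcl[OF \<zeta>(1) this] show "h j \<xi> = y' j x" unfolding \<zeta>(2) y'_def x(2)[symmetric] .
   qed
   also have "\<dots> \<le> D * qnorm X x" by (rule up[OF x(1)])
   also have "\<dots> \<le> D * c" using x(3) D1 by (intro mult_left_mono) auto
   finally show ?thesis using D1 by (simp add: field_simps)
  qed
  then have "nrm m (\<lambda>j. h j \<xi>) / D \<le> qnorm ?E \<xi>" by (rule dense_ge)
  then show ?thesis using D1 by (simp add: field_simps)
 qed
 define A where "A = real J * K ^ J"
 have A0: "0 \<le> A" using K(2) by (simp add: A_def)
 \<comment> \<open>one round of greedy approximation turns a valid constant \<open>B\<close> into \<open>K A + B / 2\<close>, and the iteration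
  of this map tends to \<open>2 K A\<close> from any start\<close>
 define valid where "valid B \<longleftrightarrow> (\<forall>\<xi>\<in>carrier ?E. qnorm ?E \<xi> \<le> B * nrm m (\<lambda>j. h j \<xi>))" for B
 have greedy: "\<exists>x\<in>carrier X. qnorm X x \<le> real J * K ^ J * nrm m a \<and>
  nrm m (\<lambda>j. a j - y' j x) \<le> (sqrt (1 - 1 / (4 * D\<^sup>2))) ^ J * nrm m a" for a
 proof (rule greedy_approximation[OF hX K(1) K(2) y'l D1])
  fix x assume x: "x \<in> carrier X" "qnorm X x \<le> 1"
  have "D * qnorm X x \<le> D * 1" using x(2) D1 by (intro mult_left_mono) auto
  then show "nrm m (\<lambda>j. y' j x) \<le> D" using up[OF x(1)] by linarith
 qed (use low in auto)
 have step: "valid (K * A + B / 2)" if B: "valid B" "0 \<le> B" for B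
  unfolding valid_def
 proof
  fix \<xi> assume \<xi>: "\<xi> \<in> carrier ?E"
  let ?a = "\<lambda>j. h j \<xi>"
  obtain x where x: "x \<in> carrier X" "qnorm X x \<le> A * nrm m ?a"
   "nrm m (\<lambda>j. ?a j - y' j x) \<le> (sqrt (1 - 1 / (4 * D\<^sup>2))) ^ J * nrm m ?a"
   unfolding A_def using greedy[of ?a] by blast
  let ?\<zeta> = "e.cl (q.cl x)"
  have cx: "q.cl x \<in> carrier ?F" by (rule q.cl_in[OF x(1)])
  have \<zeta>: "?\<zeta> \<in> carrier ?E" by (rule e.cl_in[OF cx])
  have d: "\<xi> \<ominus>\<^bsub>?E\<^esub> ?\<zeta> \<in> carrier ?E" by (rule E.M.minus_closed[OF \<xi> \<zeta>])
  have "qnorm ?E \<xi> \<le> K * (qnorm ?E ?\<zeta> + qnorm ?E (\<xi> \<ominus>\<^bsub>?E\<^esub> ?\<zeta>))"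
  using \<xi> \<zeta> KE[OF \<zeta> d] by (simp add: a_minus_def E.M.a_lcomm E.M.r_neg)
  also have "\<dots> \<le> K * (A * nrm m ?a + B * (1 / (2 * K) * nrm m ?a))"
  proof (intro mult_left_mono add_mono)
   show "qnorm ?E ?\<zeta> \<le> A * nrm m ?a" using e.Q_norm_le[OF cx] q.Q_norm_le[OF x(1)] x(2) by linarith
   show "qnorm ?E (\<xi> \<ominus>\<^bsub>?E\<^esub> ?\<zeta>) \<le> B * (1 / (2 * K) * nrm m ?a)"
  by (smt (verit) B(1) d valid_def nrm_cong E.lfun_diff[OF hl \<xi> \<zeta>] hcl[OF cx] y'_def mult_left_mono[OF order.trans[OF x(3) mult_right_mono[OF J nrm_nonneg]] B(2)])
  qed (use K(2) in auto)
  also have "\<dots> = (K * A + B / 2) * nrm m ?a" using K(2) by (simp add: field_simps)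
  finally show "qnorm ?E \<xi> \<le> (K * A + B / 2) * nrm m ?a" .
 qed
 define B0 where "B0 = K ^ m * (\<Sum>j<m. qnorm ?E (\<epsilon> j))"
 have \<epsilon>E: "\<epsilon> j \<in> carrier ?E" if "j < m" for j by (rule E.coordsD(1)[OF E_coords that])
 have B0: "0 \<le> B0" unfolding B0_def using K(2) homogeneousD(2)[OF hE \<epsilon>E] by (intro mult_nonneg_nonneg sum_nonneg) auto
 have valid0: "valid B0"
  unfolding valid_def
 proof
  fix \<xi> assume \<xi>: "\<xi> \<in> carrier ?E"
  have "qnorm ?E \<xi> = qnorm ?E (lc ?E m \<epsilon> (\<lambda>j. h j \<xi>))" using E.coords_expansion[OF E_coords \<xi>] by simp
  also have "\<dots> \<le> K ^ m * (\<Sum>j<m. \<bar>h j \<xi>\<bar> * qnorm ?E (\<epsilon> j))" by (rule qnorm_lc_le[OF hE KE K(2) \<epsilon>E])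
  also have "\<dots> \<le> K ^ m * (\<Sum>j<m. nrm m (\<lambda>j. h j \<xi>) * qnorm ?E (\<epsilon> j))"
   using K(2) homogeneousD(2)[OF hE \<epsilon>E] coord_le_nrm[of _ m "\<lambda>j. h j \<xi>"] by (intro mult_left_mono sum_mono mult_right_mono) auto
  also have "\<dots> = B0 * nrm m (\<lambda>j. h j \<xi>)" by (simp add: B0_def sum_distrib_left sum_distrib_right mult_ac)
  finally show "qnorm ?E \<xi> \<le> B0 * nrm m (\<lambda>j. h j \<xi>)" .
 qed
 have validi: "valid (2 * K * A + B0 / 2 ^ i)" for i
 proof (induction i)
  case 0
  have "B0 * nrm m a \<le> (2 * K * A + B0 / 2 ^ 0) * nrm m a" for a using K(2) A0 by (intro mult_right_mono) auto
  then show ?case using valid0 unfolding valid_def by (meson order.trans)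
 next
  case (Suc i)
  have "0 \<le> 2 * K * A + B0 / 2 ^ i" using K(2) A0 B0 by (intro add_nonneg_nonneg mult_nonneg_nonneg) auto
  have "K * A + (2 * K * A + B0 / 2 ^ i) / 2 = 2 * K * A + B0 / 2 ^ Suc i" by (simp add: add_divide_distrib)
  with step[OF Suc \<open>0 \<le> 2 * K * A + B0 / 2 ^ i\<close>] show ?case by (simp only:)
 qed
 have lowE: "qnorm ?E \<xi> \<le> 2 * K * A * nrm m (\<lambda>j. h j \<xi>)" if \<xi>: "\<xi> \<in> carrier ?E" for \<xi>
 proof (rule LIMSEQ_le_const)
  have "(\<lambda>i. (2 * K * A + B0 * (1 / 2) ^ i) * nrm m (\<lambda>j. h j \<xi>)) \<longlonglongrightarrow> (2 * K * A + B0 * 0) * nrm m (\<lambda>j. h j \<xi>)"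
   by (intro tendsto_intros LIMSEQ_realpow_zero) auto
  then show "(\<lambda>i. (2 * K * A + B0 * (1 / 2) ^ i) * nrm m (\<lambda>j. h j \<xi>)) \<longlonglongrightarrow> 2 * K * A * nrm m (\<lambda>j. h j \<xi>)" by simp
  have "qnorm ?E \<xi> \<le> (2 * K * A + B0 * (1 / 2) ^ i) * nrm m (\<lambda>j. h j \<xi>)" for i
  using bspec[OF validi[of i, unfolded valid_def] \<xi>] by (simp add: power_divide)
  then show "\<exists>N. \<forall>i\<ge>N. qnorm ?E \<xi> \<le> (2 * K * A + B0 * (1 / 2) ^ i) * nrm m (\<lambda>j. h j \<xi>)" by blast
 qed
 have nonneg: "0 \<le> D" "0 \<le> 2 * K * A" using D1 K(2) A0 by simp_all
 show ?thesis
 by (smt (verit) m is_quotient_of_def exI conjI N0 refl E.coords_basis(3)[OF E_coords] n_def euclidean_distance_le[OF hE E_coords upE nonneg(1) lowE nonneg(2)] A_def)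
qed

theorem euclidean_quotients_of_weak_cotype2:
 assumes X: "quasi_normed_space X" and wc: "weak_cotype2 (dual X)" and \<alpha>: "0 < \<alpha>" "\<alpha> < 1"
 shows "\<exists>C :: real. \<forall>F. is_quotient_of F X \<and> fin_dim F \<longrightarrow>
   (\<exists>E. is_quotient_of E F \<and> real (vdim E) \<ge> \<alpha> * real (vdim F) \<and> euclidean_distance E \<le> ereal C)"
proof -
 obtain C0 where C0: "\<forall>(H :: (nat \<Rightarrow> real) qspace) h n e u.
    hilbert_space H h \<and> orthonormal_basis H h n e \<and> u \<in> lin_maps H (dual X) \<longrightarrow>
    (\<forall>k\<in>{1..n}. approx_number k H (dual X) u \<le> C0 * real k powr (-1/2) * ell_norm n e (dual X) u)"
  using wc unfolding weak_cotype2_def by blast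
 define C where "C = \<bar>C0\<bar>"
 have C: "\<forall>(H :: (nat \<Rightarrow> real) qspace) h n e u.
    hilbert_space H h \<and> orthonormal_basis H h n e \<and> u \<in> lin_maps H (dual X) \<longrightarrow>
    (\<forall>k\<in>{1..n}. approx_number k H (dual X) u \<le> C * real k powr (-1/2) * ell_norm n e (dual X) u)"
 proof (intro allI impI ballI)
  fix H :: "(nat \<Rightarrow> real) qspace" and h n e u k
  assume a: "hilbert_space H h \<and> orthonormal_basis H h n e \<and> u \<in> lin_maps H (dual X)" and k: "k \<in> {1..n}"
  have "approx_number k H (dual X) u \<le> C0 * real k powr (-1/2) * ell_norm n e (dual X) u" using C0[rule_format, OF a k] .
  also have "\<dots> \<le> C * real k powr (-1/2) * ell_norm n e (dual X) u"
   unfolding C_def ell_norm_def by (intro mult_right_mono) auto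
  finally show "approx_number k H (dual X) u \<le> C * real k powr (-1/2) * ell_norm n e (dual X) u" .
 qed
 obtain K where K: "1 \<le> K" "\<And>x y. x \<in> carrier X \<Longrightarrow> y \<in> carrier X \<Longrightarrow> qnorm X (x \<oplus>\<^bsub>X\<^esub> y) \<le> K * (qnorm X x + qnorm X y)"
  using quasi_triangle[OF X] by blast
 let ?\<eta> = "1 - \<alpha>"
 define D where "D = exp (12 * (41 + 40 * C) / ?\<eta>)"
 have D: "1 \<le> D" unfolding D_def using \<alpha> by (simp add: C_def)
 \<comment> \<open>enough greedy steps to halve the remainder even after multiplication by \<open>K\<close>; their number does not
  depend on the quotient\<close>
 obtain J where J: "(sqrt (1 - 1 / (4 * D\<^sup>2))) ^ J < 1 / (2 * K)"
  using D real_arch_pow_inv[of "1 / (2 * K)" "sqrt (1 - 1 / (4 * D\<^sup>2))"] K(1) by (fastforce)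
 show ?thesis
 proof (rule exI[of _ "2 * K * (real J * K ^ J) * D"], intro allI impI)
  fix F assume "is_quotient_of F X \<and> fin_dim F"
  then obtain M where M: "closed_subspace M X" "F = quotient_space X M" "fin_dim F" unfolding is_quotient_of_def by blast
  have C': "0 \<le> C" by (simp add: C_def)
  have \<eta>: "0 < ?\<eta>" "?\<eta> < 1" "1 - ?\<eta> = \<alpha>" using \<alpha> by simp_all
  from euclidean_quotient[OF X M(1) M(3)[unfolded M(2)] C C' \<eta>(1,2) K(2) K(1) D_def less_imp_le[OF J]]
  show "\<exists>E. is_quotient_of E F \<and> real (vdim E) \<ge> \<alpha> * real (vdim F) \<and>
    euclidean_distance E \<le> ereal (2 * K * (real J * K ^ J) * D)" unfolding M(2) \<eta>(3) .
 qed
qed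

section \<open>Hilbertian subspaces of the dual\<close>

lemma (in real_space) lc_lin:
 assumes b: "\<And>i. i < n \<Longrightarrow> b i \<in> carrier V"
 shows "lc V m (\<lambda>j. lc V n b (G j)) c = lc V n b (lin m G c)"
proof (induction m)
 case 0
 show ?case
  by (simp add: lc_zero[OF b] lin_def)
next
 case (Suc m)
 have "lc V n b (lin (Suc m) G c) = lc V n b (\<lambda>i. lin m G c i + c m * G m i)" by (rule lc_cong) (simp_all add: lin_def)
 also have "\<dots> = lc V n b (lin m G c) \<oplus>\<^bsub>V\<^esub> lc V n b (\<lambda>i. c m * G m i)" by (rule lc_add[OF b])
 also have "lc V n b (\<lambda>i. c m * G m i) = c m \<odot>\<^bsub>V\<^esub> lc V n b (G m)" by (rule lc_scale[OF b])
 finally show ?case using Suc by simp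
qed

text \<open>Linearly independent functionals admit a dual family of vectors: one step of elimination per
 functional.\<close>
lemma (in real_space) dual_elements:
 fixes k :: nat
 shows "(\<And>i. i < k \<Longrightarrow> lfun V (w i)) \<Longrightarrow> (\<And>a. \<exists>i<k. a i \<noteq> 0 \<Longrightarrow> \<exists>x\<in>carrier V. (\<Sum>i<k. a i * w i x) \<noteq> 0) \<Longrightarrow>
  \<exists>x. \<forall>i<k. x i \<in> carrier V \<and> (\<forall>j<k. w j (x i) = (if i = j then 1 else 0))"
proof (induction k)
 case 0
 then show ?case by simp
next
 case (Suc k)
 have l: "lfun V (w i)" if "i < k" for i by (rule Suc.prems(1)[OF less_SucI[OF that]])
 have lk: "lfun V (w k)" by (rule Suc.prems(1)[OF lessI])
 have "\<exists>x\<in>carrier V. (\<Sum>i<k. a i * w i x) \<noteq> 0" if "\<exists>i<k. a i \<noteq> 0" for a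
 proof -
  from that have "\<exists>i<Suc k. (if i = k then 0 else a i) \<noteq> 0" by (auto intro: less_SucI)
  from Suc.prems(2)[OF this] show ?thesis by simp
 qed
 from Suc.IH[OF l this] obtain x where x: "\<And>i. i < k \<Longrightarrow> x i \<in> carrier V"
  "\<And>i j. i < k \<Longrightarrow> j < k \<Longrightarrow> w j (x i) = (if i = j then 1 else 0)" by blast
 have "\<exists>i<Suc k. (if i = k then 1 else - w k (x i)) \<noteq> 0" by (intro exI[of _ k]) simp
 from Suc.prems(2)[OF this] obtain t where t: "t \<in> carrier V" "(\<Sum>i<k. - w k (x i) * w i t) + w k t \<noteq> 0" by auto
 define y where "y = t \<ominus>\<^bsub>V\<^esub> lc V k x (\<lambda>i. w i t)"
 have lcx: "lc V k x a \<in> carrier V" for a by (rule lc_closed) (rule x(1))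
 have y: "y \<in> carrier V" unfolding y_def using t(1) lcx by simp
 have wy: "w j y = 0" if j: "j < k" for j
 proof -
  have "w j (lc V k x (\<lambda>i. w i t)) = (\<Sum>i<k. w i t * w j (x i))" by (rule lfun_lc[OF l[OF j] x(1)])
  also have "\<dots> = (\<Sum>i<k. if i = j then w j t else 0)" using j by (intro sum.cong) (auto simp: x(2))
  finally show ?thesis using j by (simp add: y_def lfun_diff[OF l[OF j] t(1) lcx])
 qed
 have wk: "w k y \<noteq> 0"
  using t(2) by (simp add: lfun_lc[OF lk x(1)] y_def lfun_diff[OF lk t(1) lcx] sum_negf mult.commute)
 define e where "e = (1 / w k y) \<odot>\<^bsub>V\<^esub> y"
 have e: "e \<in> carrier V" "w k e = 1" using y wk by (simp_all add: e_def lfunD(2)[OF lk y])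
 have ej: "w j e = 0" if "j < k" for j using wy[OF that] by (simp add: e_def lfunD(2)[OF l[OF that] y])
 define x' where "x' i = (if i = k then e else x i \<ominus>\<^bsub>V\<^esub> w k (x i) \<odot>\<^bsub>V\<^esub> e)" for i
 have "x' i \<in> carrier V" if "i < Suc k" for i using that e x(1) by (auto simp: x'_def less_Suc_eq)
 moreover have "w j (x' i) = (if i = j then 1 else 0)" if "i < Suc k" "j < Suc k" for i j
 proof (cases "i = k")
  case True
  then show ?thesis using that e ej by (auto simp: x'_def less_Suc_eq)
 next
  case False
  then have i: "i < k" using that by simp
  have lj: "lfun V (w j)" by (rule Suc.prems(1)[OF that(2)])
  show ?thesis
  using False that(2) i e(2) ej x(2)[OF i] by (fastforce simp: x'_def lfun_diff[OF lj x(1)[OF i] v_smult[OF e(1)]] lfunD(2)[OF lj e(1)] less_Suc_eq)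
 qed
 ultimately show ?case by blast
qed

text \<open>Instead of projecting, a vector orthogonal to those already found is obtained by counting unknowns.\<close>
lemma (in real_space) gram_schmidt:
 assumes c: "coords V m b \<phi>"
  and G: "\<And>y. y \<in> carrier V \<Longrightarrow> lfun V (\<lambda>x. G x y)" "\<And>x y. x \<in> carrier V \<Longrightarrow> y \<in> carrier V \<Longrightarrow> G x y = G y x"
   "\<And>x. x \<in> carrier V \<Longrightarrow> x \<noteq> \<zero>\<^bsub>V\<^esub> \<Longrightarrow> 0 < G x x"
 shows "s \<le> m \<Longrightarrow> \<exists>f. (\<forall>i<s. f i \<in> carrier V) \<and> (\<forall>i<s. \<forall>j<s. G (f i) (f j) = (if i = j then 1 else (0::real)))"
proof (induction s)
 case 0
 then show ?case by simp
next
 case (Suc s)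
 then obtain f where f: "\<And>i. i < s \<Longrightarrow> f i \<in> carrier V" "\<And>i j. i < s \<Longrightarrow> j < s \<Longrightarrow> G (f i) (f j) = (if i = j then 1 else 0)"
  by auto
 obtain a where a: "\<exists>i<m. a i \<noteq> 0" "\<And>j. j < s \<Longrightarrow> ip m a (\<lambda>l. G (b l) (f j)) = 0"
  using homogeneous_system[of s m "\<lambda>j l. G (b l) (f j)"] Suc.prems by auto
 note bc = coordsD(1)[OF c]
 let ?x = "lc V m b a"
 have x: "?x \<in> carrier V" by (rule lc_closed[OF bc])
 have "?x \<noteq> \<zero>\<^bsub>V\<^esub>"
 proof
  assume z: "?x = \<zero>\<^bsub>V\<^esub>"
  from a(1) obtain i where i: "i < m" "a i \<noteq> 0" by blast
  then show False using coords_lc[OF c i(1), of a] lfun_zero[OF coordsD(2)[OF c i(1)]] z by simp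
 qed
 then have p: "0 < G ?x ?x" by (rule G(3)[OF x])
 have xf: "G ?x (f j) = 0" if j: "j < s" for j
 using a(2)[OF j] by (simp add: lfun_lc[OF G(1)[OF f(1)[OF j]] bc] ip_def)
 define e where "e = (1 / sqrt (G ?x ?x)) \<odot>\<^bsub>V\<^esub> ?x"
 have e: "e \<in> carrier V" unfolding e_def by (rule v_smult[OF x])
 have Ge: "G e y = (1 / sqrt (G ?x ?x)) * G ?x y" if "y \<in> carrier V" for y
  unfolding e_def by (rule lfunD(2)[OF G(1)[OF that] x])
 have ef: "G e (f j) = 0" if "j < s" for j using Ge[OF f(1)[OF that]] xf[OF that] by simp
 have ee: "G e e = 1"
  using Ge[OF e] G(2)[OF x e] Ge[OF x] p by simp
 show ?case
 proof (intro exI[of _ "\<lambda>i. if i = s then e else f i"] conjI allI impI)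
  fix i j assume "i < Suc s" "j < Suc s"
  then show "G (if i = s then e else f i) (if j = s then e else f j) = (if i = j then 1 else 0)"
   using ee ef f(2) G(2)[OF f(1) e] by (auto simp: less_Suc_eq)
 qed (use e f(1) in \<open>auto simp: less_Suc_eq\<close>)
qed

text \<open>Points of the unit ball of \<open>X\<close>, up to sign, act on the span of the \<open>z i\<close> as functionals dominated by the
 dual norm, and the dual norm is the supremum of their values.\<close>
lemma norming_functionals:
 assumes X: "homogeneous_space X" and z: "\<And>i. i < n \<Longrightarrow> z i \<in> carrier (dual X)" and e: "0 < e"
 shows "\<exists>r. (\<forall>y. ip n r y \<le> qnorm (dual X) (lc (dual X) n z y)) \<and> qnorm (dual X) (lc (dual X) n z a) - e \<le> ip n r a"
proof -
 let ?N = "\<lambda>a. qnorm (dual X) (lc (dual X) n z a)"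
 interpret Z: real_space "dual X" by (rule real_space.intro[OF real_vs_dual[OF X]])
 have zc: "lc (dual X) n z a \<in> carrier (dual X)" for a by (rule Z.lc_closed) (rule z)
 have "\<exists>t\<in>carrier X. qnorm X t \<le> 1 \<and> ?N a - e < \<bar>lc (dual X) n z a t\<bar>"
 by (smt (verit) e dual_norm_le[OF X] ccontr)
 then obtain t where t: "t \<in> carrier X" "qnorm X t \<le> 1" "?N a - e < \<bar>lc (dual X) n z a t\<bar>" by blast
 define \<sigma> where "\<sigma> = (if 0 \<le> lc (dual X) n z a t then 1 else - 1 :: real)"
 have ip: "ip n (\<lambda>i. \<sigma> * z i t) y = \<sigma> * lc (dual X) n z y t" for y
 by (simp add: lc_dual[OF X] z t ip_def sum_distrib_left mult_ac)
 have "\<sigma> * lc (dual X) n z y t \<le> ?N y" for y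
 proof -
  have "\<sigma> * lc (dual X) n z y t \<le> \<bar>lc (dual X) n z y t\<bar>" by (auto simp: \<sigma>_def)
  also have "\<dots> \<le> ?N y * qnorm X t" by (rule dual_bound[OF X zc t(1)])
  also have "\<dots> \<le> ?N y * 1" by (rule mult_left_mono[OF t(2) dual_nonneg[OF X zc]])
  finally show ?thesis by simp
 qed
 moreover have "\<sigma> * lc (dual X) n z a t = \<bar>lc (dual X) n z a t\<bar>" by (simp add: \<sigma>_def)
 ultimately show ?thesis using t(3) by (intro exI[of _ "\<lambda>i. \<sigma> * z i t"]) (simp add: ip)
qed

text \<open>Independent functionals \<open>w\<close> span the dual of the quotient of \<open>X\<close> by their common kernel. A Euclidean
 quotient \<open>E\<close> of that quotient embeds the dual of \<open>E\<close>, which is Euclidean, into their span.\<close>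
lemma hilbertian_subspaces_of_euclidean_quotients:
 fixes X :: "'a qspace"
 assumes X: "quasi_normed_space X" and z: "\<And>i. i < n \<Longrightarrow> z i \<in> carrier (dual X)"
  and C: "\<And>F. is_quotient_of F X \<Longrightarrow> fin_dim F \<Longrightarrow>
   \<exists>E. is_quotient_of E F \<and> real (vdim E) \<ge> \<alpha> * real (vdim F) \<and> euclidean_distance E \<le> ereal C"
  and C1: "C < C1"
 shows "hilbertian_subspaces \<alpha> C1 (\<lambda>a. qnorm (dual X) (lc (dual X) n z a))"
 unfolding hilbertian_subspaces_def
proof (intro allI impI)
 fix k :: nat and U :: "nat \<Rightarrow> nat \<Rightarrow> real"
 let ?Z = "dual X" and ?N = "\<lambda>a. qnorm (dual X) (lc (dual X) n z a)"
 assume inj: "\<forall>a. (\<exists>i<k. a i \<noteq> 0) \<longrightarrow> 0 < ?N (lin k U a)"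
 have hX: "homogeneous_space X" by (rule quasi_normed_homogeneous[OF X])
 interpret X: real_space X by (rule real_space.intro[OF homogeneousD(1)[OF hX]])
 interpret Z: real_space ?Z by (rule real_space.intro[OF real_vs_dual[OF hX]])
 have zc: "lc ?Z n z a \<in> carrier ?Z" for a by (rule Z.lc_closed) (rule z)
 have zlc: "lc ?Z n z a x = (\<Sum>i<n. a i * z i x)" if "x \<in> carrier X" for a x
  by (rule lc_dual[OF hX]) (rule z, assumption, rule that)
 define w where "w j x = (\<Sum>i<n. U j i * z i x)" for j x
 have wl: "lfun X (w j)" for j unfolding w_def[abs_def] by (rule lfun_sum) (rule dualD(2)[OF hX z])
 have wN: "lc ?Z n z (lin k U a) x = (\<Sum>j<k. a j * w j x)" if "x \<in> carrier X" for a x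
  unfolding zlc[OF that] w_def lin_def by (simp add: sum_distrib_left sum_distrib_right mult.assoc sum.swap[of _ "{..<n}"])
 have wB: "\<exists>K. \<forall>x\<in>carrier X. \<bar>w j x\<bar> \<le> K * qnorm X x" for j
 proof (intro exI ballI)
  fix x assume x: "x \<in> carrier X"
  show "\<bar>w j x\<bar> \<le> ?N (U j) * qnorm X x" using dual_bound[OF hX zc x, of "U j"] unfolding zlc[OF x] w_def .
 qed
 have "\<exists>x\<in>carrier X. (\<Sum>j<k. a j * w j x) \<noteq> 0" if a: "\<exists>i<k. a i \<noteq> 0" for a
 proof (rule ccontr)
  assume n: "\<not> ?thesis"
  have "?N (lin k U a) \<le> 0" by (rule dual_norm_le[OF hX]) (use n in \<open>auto simp: wN\<close>)
  with inj a show False by (meson not_less)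
 qed
 from X.dual_elements[of k w, OF wl this] obtain t where t: "\<And>i. i < k \<Longrightarrow> t i \<in> carrier X"
  "\<And>i j. i < k \<Longrightarrow> j < k \<Longrightarrow> w j (t i) = (if i = j then 1 else 0)" by blast
 let ?M = "{x \<in> carrier X. \<forall>j<k. w j x = 0}"
 have M: "closed_subspace ?M X" by (rule closed_common_kernel[OF X wl wB])
 let ?F = "quotient_space X ?M"
 interpret q: closed_quotient X ?M by (rule closed_quotient.intro[OF X M])
 have F: "quasi_normed_space ?F" by (rule q.quasi_normed_Q)
 have hF: "homogeneous_space ?F" by (rule quasi_normed_homogeneous[OF F])
 interpret F: real_space ?F by (rule real_space.intro[OF homogeneousD(1)[OF hF]])
 define \<phi> where "\<phi> j = q.induced (w j)" for j
 have \<phi>: "\<phi> j (q.cl x) = w j x" if "j < k" "x \<in> carrier X" for j x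
  unfolding \<phi>_def by (rule q.induced_cl[OF wl _ that(2)]) (use that(1) in simp)
 have F_coords: "coords ?F k (\<lambda>j. q.cl (t j)) \<phi>"
  unfolding coords_def
 proof (intro conjI allI impI ballI)
  show "q.cl (t i) \<in> carrier ?F" if "i < k" for i by (rule q.cl_in[OF t(1)[OF that]])
  show "lfun ?F (\<phi> i)" if "i < k" for i unfolding \<phi>_def by (rule q.lfun_induced[OF wl]) (use that in simp)
  show "\<phi> i (q.cl (t j)) = (if i = j then 1 else 0)" if "i < k" "j < k" for i j
   unfolding \<phi>[OF that(1) t(1)[OF that(2)]] using t(2)[OF that(2,1)] by auto
  show "\<xi> = \<zero>\<^bsub>?F\<^esub>" if \<xi>: "\<xi> \<in> carrier ?F" "\<forall>j<k. \<phi> j \<xi> = 0" for \<xi>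
  proof -
   obtain x where x: "x \<in> carrier X" "\<xi> = q.cl x" by (rule q.Q_cases[OF \<xi>(1)])
   have "x \<in> ?M" using x \<xi>(2) \<phi> by auto
   then have "q.cl (x \<oplus>\<^bsub>X\<^esub> \<zero>\<^bsub>X\<^esub>) = q.cl \<zero>\<^bsub>X\<^esub>" by (rule q.cl_eqI) (rule X.M.zero_closed)
   then show ?thesis using x by (simp add: q.Q_zero)
  qed
 qed
 have dimF: "vdim ?F = k" "fin_dim ?F" using F.coords_basis[OF F_coords] by auto
 have "is_quotient_of ?F X" unfolding is_quotient_of_def by (intro exI conjI, rule M, rule refl)
 from C[OF this dimF(2)] obtain E where E: "is_quotient_of E ?F" "\<alpha> * real k \<le> real (vdim E)" "euclidean_distance E \<le> ereal C"
  unfolding dimF(1) by blast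
 then obtain N0 where N0: "closed_subspace N0 ?F" "E = quotient_space ?F N0" unfolding is_quotient_of_def by blast
 interpret e: closed_quotient ?F N0 by (rule closed_quotient.intro[OF F N0(1)])
 have hE: "homogeneous_space E" unfolding N0(2) by (rule quasi_normed_homogeneous[OF e.quasi_normed_Q])
 interpret E: real_space E by (rule real_space.intro[OF homogeneousD(1)[OF hE]])
 define cl2 where "cl2 x = e.cl (q.cl x)" for x
 have cl2: "cl2 x \<in> carrier E" if "x \<in> carrier X" for x unfolding cl2_def N0(2) by (rule e.cl_in[OF q.cl_in[OF that]])
 have cl2_norm: "qnorm E (cl2 x) \<le> qnorm X x" if "x \<in> carrier X" for x
  unfolding cl2_def N0(2) using e.Q_norm_le[OF q.cl_in[OF that]] q.Q_norm_le[OF that] by linarith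
 have lift: "\<exists>x\<in>carrier X. \<xi> = cl2 x \<and> qnorm X x < c" if \<xi>: "\<xi> \<in> carrier E" "qnorm E \<xi> < c" for \<xi> c
 proof -
  obtain \<zeta> where \<zeta>: "\<zeta> \<in> carrier ?F" "\<xi> = e.cl \<zeta>" "qnorm ?F \<zeta> < c" by (rule e.Q_norm_lift[OF \<xi>[unfolded N0(2)]])
  obtain x where x: "x \<in> carrier X" "\<zeta> = q.cl x" "qnorm X x < c" by (rule q.Q_norm_lift[OF \<zeta>(1,3)])
  show ?thesis using x \<zeta>(2) unfolding cl2_def by blast
 qed
 have l2: "lfun X (\<lambda>x. g (cl2 x))" if "lfun E g" for g
  unfolding cl2_def by (rule q.lfun_cl, rule e.lfun_cl) (use that N0(2) in simp)
 have cl2_0: "cl2 x = \<zero>\<^bsub>E\<^esub>" if x: "x \<in> ?M" for x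
 proof -
  have "q.cl (x \<oplus>\<^bsub>X\<^esub> \<zero>\<^bsub>X\<^esub>) = q.cl \<zero>\<^bsub>X\<^esub>" using x by (rule q.cl_eqI) (rule X.M.zero_closed)
  then show ?thesis using x unfolding cl2_def N0(2) e.Q_zero q.Q_zero by simp
 qed
 define m where "m = vdim E"
 have "fin_dim E"
 proof (rule E.dim_le_of_spanning(1)[where b="\<lambda>j. e.cl (q.cl (t j))" and n=k])
  show "e.cl (q.cl (t i)) \<in> carrier E" if "i < k" for i using cl2[OF t(1)[OF that]] unfolding cl2_def .
  show "\<exists>a. \<xi> = lc E k (\<lambda>j. e.cl (q.cl (t j))) a" if \<xi>: "\<xi> \<in> carrier E" for \<xi>
  proof -
   obtain \<zeta> where \<zeta>: "\<zeta> \<in> carrier ?F" "\<xi> = e.cl \<zeta>" by (rule e.Q_cases[OF \<xi>[unfolded N0(2)]])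
   have "e.cl (lc ?F k (\<lambda>j. q.cl (t j)) (\<lambda>j. \<phi> j \<zeta>)) = lc E k (\<lambda>j. e.cl (q.cl (t j))) (\<lambda>j. \<phi> j \<zeta>)"
    by (rule hom_lc[OF homogeneousD(1)[OF hF] homogeneousD(1)[OF hE] e.cl_lin_map[folded N0(2)]]) (rule q.cl_in[OF t(1)])
   then show ?thesis
  by (simp add: F.coords_expansion[OF F_coords \<zeta>(1), symmetric] \<zeta>(2)[symmetric] exI[where x="\<lambda>j. \<phi> j \<zeta>"])
  qed
 qed
 then obtain \<epsilon> \<eta> where E_coords: "coords E m \<epsilon> \<eta>" using E.coords_of_fin_dim unfolding m_def by blast
 have "euclidean_distance E < ereal C1" using E(3) C1 by (meson ereal_less_eq(3) less_ereal.simps(1) order.strict_trans1)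
 then obtain H :: "'a set set qspace" and h v u where H: "hilbert_space H h" and u: "bounded_lin E H u" and v: "bounded_lin H E v"
  and vu: "\<And>x. x \<in> carrier E \<Longrightarrow> v (u x) = x" and d: "op_norm H E v * op_norm E H u < C1"
  unfolding euclidean_distance_def Inf_less_iff by auto
 define \<nu> where "\<nu> = op_norm H E v"
 define \<mu> where "\<mu> = op_norm E H u"
 have hH: "homogeneous_space H" by (rule hilbert_homogeneous[OF H])
 interpret H: real_space H by (rule real_space.intro[OF homogeneousD(1)[OF hH]])
 have ul: "u \<in> lin_maps E H" and vl: "v \<in> lin_maps H E" using u v by (auto simp: bounded_lin_def)
 have h: "\<And>x y. x \<in> carrier H \<Longrightarrow> y \<in> carrier H \<Longrightarrow> h x y = h y x"
  "\<And>x y z. x \<in> carrier H \<Longrightarrow> y \<in> carrier H \<Longrightarrow> z \<in> carrier H \<Longrightarrow> h (x \<oplus>\<^bsub>H\<^esub> y) z = h x z + h y z"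
  "\<And>c x y. x \<in> carrier H \<Longrightarrow> y \<in> carrier H \<Longrightarrow> h (c \<odot>\<^bsub>H\<^esub> x) y = c * h x y"
  "\<And>x. x \<in> carrier H \<Longrightarrow> 0 \<le> h x x" "\<And>x. x \<in> carrier H \<Longrightarrow> h x x = 0 \<longleftrightarrow> x = \<zero>\<^bsub>H\<^esub>"
  "\<And>x. x \<in> carrier H \<Longrightarrow> qnorm H x = sqrt (h x x)"
  using H unfolding hilbert_space_def by auto
 have \<nu>0: "0 \<le> \<nu>" unfolding \<nu>_def using v by (auto simp: bounded_lin_def intro: op_norm_nonneg[OF hH hE])
 \<comment> \<open>the Euclidean structure that the factorisation through \<open>H\<close> induces on \<open>E\<close>\<close>
 define G where "G x y = h (u x) (u y)" for x y
 note uc = lin_mapsD(1)[OF ul]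
 have Gl: "lfun E (\<lambda>x. G x y)" if "y \<in> carrier E" for y
  unfolding lfun_def G_def using h(2,3) uc that by (auto simp: lin_mapsD(2,3)[OF ul])
 have Gs: "G x y = G y x" if "x \<in> carrier E" "y \<in> carrier E" for x y unfolding G_def by (rule h(1)[OF uc uc]) (rule that)+
 have Gp: "0 < G x x" if x: "x \<in> carrier E" "x \<noteq> \<zero>\<^bsub>E\<^esub>" for x
 by (metis h(4,5)[OF uc[OF x(1)]] vu[OF x(1)] lin_map_zero[OF homogeneousD(1)[OF hH] homogeneousD(1)[OF hE] vl] x(2) G_def less_le)
 have Gn: "0 \<le> G x x" if "x \<in> carrier E" for x unfolding G_def by (rule h(4)[OF uc[OF that]])
 obtain f where f: "\<And>i. i < m \<Longrightarrow> f i \<in> carrier E" "\<And>i j. i < m \<Longrightarrow> j < m \<Longrightarrow> G (f i) (f j) = (if i = j then 1 else 0)"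
  using E.gram_schmidt[OF E_coords Gl Gs Gp order_refl] by auto
 have fc: "lc E m f a \<in> carrier E" for a by (rule E.lc_closed) (rule f(1))
 define g where "g j x = G x (f j)" for j x
 have gl: "lfun E (g j)" if "j < m" for j unfolding g_def[abs_def] by (rule Gl[OF f(1)[OF that]])
 have Gf: "G (lc E m f a) y = (\<Sum>i<m. a i * G (f i) y)" if "y \<in> carrier E" for a y
  by (rule E.lfun_lc[OF Gl[OF that] f(1)])
 have gf: "g j (lc E m f a) = a j" if j: "j < m" for j a
 proof -
  have "g j (lc E m f a) = (\<Sum>i<m. if i = j then a i else 0)"
   unfolding g_def Gf[OF f(1)[OF j]] using j by (intro sum.cong) (auto simp: f(2))
  then show ?thesis using j by simp
 qed
 have GP: "G (lc E m f a) y = ip m a (\<lambda>j. g j y)" if "y \<in> carrier E" for a y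
  unfolding Gf[OF that] ip_def g_def using Gs[OF f(1) that] by (intro sum.cong) auto
 have Gff: "G (lc E m f a) (lc E m f a) = (nrm m a)\<^sup>2" for a
  unfolding GP[OF fc] nrm_sq by (rule ip_cong) (simp_all add: gf)
 have bessel_E: "nrm m (\<lambda>j. g j x) \<le> qnorm H (u x)" if x: "x \<in> carrier E" for x
 proof -
  let ?a = "\<lambda>j. g j x"
  let ?P = "lc E m f ?a"
  have d: "x \<ominus>\<^bsub>E\<^esub> ?P \<in> carrier E" by (rule E.M.minus_closed[OF x fc])
  have "(nrm m ?a)\<^sup>2 \<le> G x x"
  using Gn[OF d] Gff[of ?a] by (simp add: E.lfun_diff[OF Gl[OF d] x fc] Gs[OF x d] E.lfun_diff[OF Gl[OF x] x fc] Gs[OF fc d] E.lfun_diff[OF Gl[OF fc] x fc] Gs[OF x fc] GP[OF x] nrm_sq)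
  then show ?thesis unfolding h(6)[OF uc[OF x]] G_def by (rule real_le_rsqrt)
 qed
 \<comment> \<open>the functionals \<open>\<nu> g j\<close>, pulled back to \<open>X\<close> and expanded in the \<open>w l\<close>; the factor \<open>\<nu>\<close> normalises the
  lower estimate\<close>
 define L where "L j l = \<nu> * g j (cl2 (t l))" for j l
 have expand: "g j (cl2 x) = (\<Sum>l<k. w l x * g j (cl2 (t l)))" if j: "j < m" and x: "x \<in> carrier X" for j x
 proof -
  let ?y = "lc X k t (\<lambda>l. w l x)"
  have y: "?y \<in> carrier X" by (rule X.lc_closed) (rule t(1))
  have "w i (x \<ominus>\<^bsub>X\<^esub> ?y) = 0" if i: "i < k" for i
  proof -
   have "w i ?y = (\<Sum>l<k. w l x * w i (t l))" by (rule X.lfun_lc[OF wl t(1)])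
   also have "\<dots> = (\<Sum>l<k. if l = i then w i x else 0)" using i by (intro sum.cong) (auto simp: t(2))
   finally show ?thesis using i by (simp add: X.lfun_diff[OF wl x y])
  qed
  then have "cl2 (x \<ominus>\<^bsub>X\<^esub> ?y) = \<zero>\<^bsub>E\<^esub>" using X.M.minus_closed[OF x y] by (intro cl2_0) simp
  then have "g j (cl2 x) = g j (cl2 ?y)"
  by (smt (verit) E.lfun_zero[OF gl[OF j]] X.lfun_diff[OF l2[OF gl[OF j]] x y])
  also have "\<dots> = (\<Sum>l<k. w l x * g j (cl2 (t l)))" by (rule X.lfun_lc[OF l2[OF gl[OF j]] t(1)])
  finally show ?thesis .
 qed
 have eval: "lc ?Z n z (lin k U (lin m L a)) x = \<nu> * ip m a (\<lambda>j. g j (cl2 x))" if x: "x \<in> carrier X" for a x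
 proof -
  have "lc ?Z n z (lin k U (lin m L a)) x = (\<Sum>j<m. a j * (\<nu> * (\<Sum>l<k. w l x * g j (cl2 (t l)))))"
   unfolding wN[OF x] lin_def[of m] L_def by (simp add: sum_distrib_left sum_distrib_right sum.swap[of _ "{..<k}"] mult_ac)
  also have "\<dots> = (\<Sum>j<m. a j * (\<nu> * g j (cl2 x)))" by (intro sum.cong) (auto simp: expand[OF _ x])
  finally show ?thesis by (simp add: ip_def sum_distrib_left mult_ac)
 qed
 have upper: "?N (lin k U (lin m L a)) \<le> C1 * nrm m a" for a
 proof (rule dual_norm_le[OF hX])
  fix x assume x: "x \<in> carrier X" "qnorm X x \<le> 1"
  have "\<bar>ip m a (\<lambda>j. g j (cl2 x))\<bar> \<le> nrm m a * nrm m (\<lambda>j. g j (cl2 x))" by (rule ip_le_nrm)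
  also have "\<dots> \<le> nrm m a * (\<mu> * 1)"
  proof (rule mult_left_mono)
   have \<mu>0: "0 \<le> \<mu>" unfolding \<mu>_def using u by (auto simp: bounded_lin_def intro: op_norm_nonneg[OF hE hH])
   have "nrm m (\<lambda>j. g j (cl2 x)) \<le> \<mu> * qnorm E (cl2 x)"
    using bessel_E[OF cl2[OF x(1)]] op_norm_bound[OF hE hH u cl2[OF x(1)]] unfolding \<mu>_def by linarith
   also have "\<dots> \<le> \<mu> * 1" using cl2_norm[OF x(1)] x(2) by (intro mult_left_mono[OF _ \<mu>0]) linarith
   finally show "nrm m (\<lambda>j. g j (cl2 x)) \<le> \<mu> * 1" .
  qed simp
  finally have "\<nu> * \<bar>ip m a (\<lambda>j. g j (cl2 x))\<bar> \<le> \<nu> * (nrm m a * (\<mu> * 1))" by (rule mult_left_mono[OF _ \<nu>0])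
  also have "\<dots> = (\<nu> * \<mu>) * nrm m a" by simp
  also have "\<dots> \<le> C1 * nrm m a" using d unfolding \<nu>_def \<mu>_def by (intro mult_right_mono) auto
  finally show "\<bar>lc ?Z n z (lin k U (lin m L a)) x\<bar> \<le> C1 * nrm m a" unfolding eval[OF x(1)] abs_mult using \<nu>0 by simp
 qed
 \<comment> \<open>evaluate at a lift of the vector with coordinates \<open>a\<close>, whose norm is at most \<open>\<nu> \<parallel>a\<parallel>\<close>\<close>
 have lower: "nrm m a \<le> ?N (lin k U (lin m L a))" for a
 proof (cases "nrm m a = 0")
  case True
  then show ?thesis using dual_nonneg[OF hX zc] by simp
 next
  case False
  then have a0: "0 < nrm m a" using nrm_nonneg[of m a] by linarith
  let ?x = "lc E m f a"
  have qx: "qnorm E ?x \<le> \<nu> * nrm m a"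
  using Gff[of a] op_norm_bound[OF hH hE v uc[OF fc], of a] by (simp add: h(6)[OF uc[OF fc]] G_def vu[OF fc] \<nu>_def)
  have "?x \<noteq> \<zero>\<^bsub>E\<^esub>"
  using E.lfun_zero[OF Gl[OF E.M.zero_closed]] Gff[of a] a0 by (fastforce)
  then have np: "0 < \<nu> * nrm m a"
  by (smt (verit) homogeneousD(2,3)[OF hE fc] qx less_le)
  let ?q = "?N (lin k U (lin m L a))"
  have q0: "0 \<le> ?q" by (rule dual_nonneg[OF hX zc])
  have "(\<nu> * nrm m a) * nrm m a \<le> (\<nu> * nrm m a) * ?q"
  proof (rule field_le_epsilon)
   fix \<delta> :: real assume \<delta>: "0 < \<delta>"
   let ?c = "\<nu> * nrm m a + \<delta> / (?q + 1)"
   have "0 < \<delta> / (?q + 1)" using \<delta> q0 by simp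
   then have "qnorm E ?x < ?c" using qx by linarith
   from lift[OF fc this] obtain x where x: "x \<in> carrier X" "?x = cl2 x" "qnorm X x < ?c" by blast
   have "ip m a (\<lambda>j. g j (cl2 x)) = (nrm m a)\<^sup>2"
    unfolding x(2)[symmetric] nrm_sq by (rule ip_cong) (simp_all add: gf)
   then have "(\<nu> * nrm m a) * nrm m a = lc ?Z n z (lin k U (lin m L a)) x"
    by (simp add: eval[OF x(1)] power2_eq_square)
   also have "\<dots> \<le> ?q * qnorm X x" using dual_bound[OF hX zc x(1), of "lin k U (lin m L a)"] by linarith
   also have "\<dots> \<le> ?q * ?c" using x(3) by (intro mult_left_mono q0) auto
   also have "\<dots> = (\<nu> * nrm m a) * ?q + \<delta> * (?q / (?q + 1))" by (simp add: distrib_left)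
   also have "\<dots> \<le> (\<nu> * nrm m a) * ?q + \<delta> * 1"
    using q0 \<delta> by (intro add_left_mono mult_left_mono) (simp_all add: divide_le_eq_1)
   finally show "(\<nu> * nrm m a) * nrm m a \<le> (\<nu> * nrm m a) * ?q + \<delta>" by simp
  qed
  then show ?thesis using np by (rule mult_left_le_imp_le)
 qed
 show "\<exists>m L. \<alpha> * real k \<le> real m \<and> (\<forall>a. nrm m a \<le> ?N (lin k U (lin m L a)) \<and> ?N (lin k U (lin m L a)) \<le> C1 * nrm m a)"
  using E(2) upper lower unfolding m_def by blast
qed

section \<open>The characterisation\<close>

lemma coords_of_orthonormal_basis:
 assumes H: "hilbert_space H h" and e: "orthonormal_basis H h n e"
 shows "\<exists>\<phi>. coords H n (\<lambda>i. e (Suc i)) \<phi> \<and> (\<forall>x\<in>carrier H. qnorm H x = nrm n (\<lambda>i. \<phi> i x))"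
proof -
 have hH: "homogeneous_space H" by (rule hilbert_homogeneous[OF H])
 interpret H: real_space H by (rule real_space.intro[OF homogeneousD(1)[OF hH]])
 have h: "\<And>x y. x \<in> carrier H \<Longrightarrow> y \<in> carrier H \<Longrightarrow> h x y = h y x"
  "\<And>x y z. x \<in> carrier H \<Longrightarrow> y \<in> carrier H \<Longrightarrow> z \<in> carrier H \<Longrightarrow> h (x \<oplus>\<^bsub>H\<^esub> y) z = h x z + h y z"
  "\<And>c x y. x \<in> carrier H \<Longrightarrow> y \<in> carrier H \<Longrightarrow> h (c \<odot>\<^bsub>H\<^esub> x) y = c * h x y"
  "\<And>x. x \<in> carrier H \<Longrightarrow> qnorm H x = sqrt (h x x)"
  using H unfolding hilbert_space_def by auto
 have ee: "h (e (Suc i)) (e (Suc j)) = (if i = j then 1 else 0)" if "i < n" "j < n" for i j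
  using e that unfolding orthonormal_basis_def by auto
 have im: "(\<lambda>i. e (Suc i)) ` {..<n} = e ` {1..n}"
 proof -
  have "Suc ` {..<n} = {1..n}" by (simp add: lessThan_atLeast0 image_Suc_atLeastLessThan atLeastLessThanSuc_atLeastAtMost)
  then show ?thesis by (metis image_image)
 qed
 have B: "H.basis ((\<lambda>i. e (Suc i)) ` {..<n})" unfolding im using e by (simp add: orthonormal_basis_def)
 then have ec: "e (Suc i) \<in> carrier H" if "i < n" for i
  by (auto simp: that H.basis_def)
 have inj: "inj_on (\<lambda>i. e (Suc i)) {..<n}"
 proof (rule inj_onI)
  fix i j assume ij: "i \<in> {..<n}" "j \<in> {..<n}" "e (Suc i) = e (Suc j)"
  then show "i = j" using ee[of i i] ee[of i j] by (auto split: if_splits)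
 qed
 obtain \<phi> where c: "coords H n (\<lambda>i. e (Suc i)) \<phi>" using H.coords_of_basis[OF ec inj B] by blast
 have lh: "lfun H (\<lambda>x. h x y)" if "y \<in> carrier H" for y unfolding lfun_def using h(2,3) that by blast
 have "qnorm H x = nrm n (\<lambda>i. \<phi> i x)" if x: "x \<in> carrier H" for x
 proof -
  let ?x = "lc H n (\<lambda>i. e (Suc i)) (\<lambda>i. \<phi> i x)"
  have ex: "x = ?x" by (rule H.coords_expansion[OF c x])
  have he: "h (e (Suc i)) x = \<phi> i x" if i: "i < n" for i
  proof -
   have "h (e (Suc i)) x = h ?x (e (Suc i))" using h(1)[OF ec[OF i] x] ex by simp
   also have "\<dots> = (\<Sum>j<n. \<phi> j x * h (e (Suc j)) (e (Suc i)))" by (rule H.lfun_lc[OF lh[OF ec[OF i]] ec])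
   also have "\<dots> = (\<Sum>j<n. if j = i then \<phi> i x else 0)" using i by (intro sum.cong) (auto simp: ee)
   finally show ?thesis using i by simp
  qed
  have "h x x = h ?x x" using ex by simp
  also have "\<dots> = (\<Sum>i<n. \<phi> i x * h (e (Suc i)) x)" by (rule H.lfun_lc[OF lh[OF x] ec])
  also have "\<dots> = ip n (\<lambda>i. \<phi> i x) (\<lambda>i. \<phi> i x)" unfolding ip_def by (intro sum.cong) (auto simp: he)
  finally show ?thesis by (simp add: h(4)[OF x] nrm_def)
 qed
 with c show ?thesis by blast
qed

lemma lin_map_lc:
 assumes H: "real_vs H" and Z: "real_vs Z" and \<psi>: "\<And>j. j < m \<Longrightarrow> lfun H (\<psi> j)" and w: "\<And>j. j < m \<Longrightarrow> w j \<in> carrier Z"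
 shows "(\<lambda>x. lc Z m w (\<lambda>j. \<psi> j x)) \<in> lin_maps H Z"
proof -
 interpret Z: real_space Z by (rule real_space.intro[OF Z])
 have "lc Z m w (\<lambda>j. \<psi> j (x \<oplus>\<^bsub>H\<^esub> y)) = lc Z m w (\<lambda>j. \<psi> j x) \<oplus>\<^bsub>Z\<^esub> lc Z m w (\<lambda>j. \<psi> j y)"
  if xy: "x \<in> carrier H" "y \<in> carrier H" for x y
 proof -
  have "lc Z m w (\<lambda>j. \<psi> j (x \<oplus>\<^bsub>H\<^esub> y)) = lc Z m w (\<lambda>j. \<psi> j x + \<psi> j y)"
   by (rule lc_cong) (simp_all add: lfunD(1)[OF \<psi> xy])
  also have "\<dots> = lc Z m w (\<lambda>j. \<psi> j x) \<oplus>\<^bsub>Z\<^esub> lc Z m w (\<lambda>j. \<psi> j y)" by (rule Z.lc_add[OF w])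
  finally show ?thesis .
 qed
 moreover have "lc Z m w (\<lambda>j. \<psi> j (c \<odot>\<^bsub>H\<^esub> x)) = c \<odot>\<^bsub>Z\<^esub> lc Z m w (\<lambda>j. \<psi> j x)" if x: "x \<in> carrier H" for c x
 proof -
  have "lc Z m w (\<lambda>j. \<psi> j (c \<odot>\<^bsub>H\<^esub> x)) = lc Z m w (\<lambda>j. c * \<psi> j x)"
   by (rule lc_cong) (simp_all add: lfunD(2)[OF \<psi> x])
  also have "\<dots> = c \<odot>\<^bsub>Z\<^esub> lc Z m w (\<lambda>j. \<psi> j x)" by (rule Z.lc_scale[OF w])
  finally show ?thesis .
 qed
 moreover have "lc Z m w (\<lambda>j. \<psi> j x) \<in> carrier Z" for x by (rule Z.lc_closed[OF w])
 ultimately show ?thesis unfolding module_hom_def by auto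
qed

text \<open>The converse passage from Gelfand to approximation numbers: compose with the orthogonal projection
 onto the good subspace.\<close>
lemma approx_number_le_of_gel:
 assumes X: "homogeneous_space X" and H: "hilbert_space H h" and e: "orthonormal_basis H h n e" and u: "u \<in> lin_maps H (dual X)"
  and k: "k \<in> {1..n}" and gel: "gel n (\<lambda>a. qnorm (dual X) (lc (dual X) n (\<lambda>i. u (e (Suc i))) a)) (k - 1) c" and c: "0 \<le> c"
 shows "approx_number k H (dual X) u \<le> c"
proof -
 let ?Z = "dual X"
 have hH: "homogeneous_space H" by (rule hilbert_homogeneous[OF H])
 have hZ: "homogeneous_space ?Z" by (rule homogeneous_dual[OF X])
 note Hv = homogeneousD(1)[OF hH] and Zv = homogeneousD(1)[OF hZ]
 interpret H: real_space H by (rule real_space.intro[OF Hv])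
 interpret Z: real_space ?Z by (rule real_space.intro[OF Zv])
 obtain \<phi> where co: "coords H n (\<lambda>i. e (Suc i)) \<phi>" and q: "\<And>x. x \<in> carrier H \<Longrightarrow> qnorm H x = nrm n (\<lambda>i. \<phi> i x)"
  using coords_of_orthonormal_basis[OF H e] by blast
 let ?b = "\<lambda>i. e (Suc i)"
 note bc = H.coordsD(1)[OF co]
 define z where "z i = u (?b i)" for i
 have z: "z i \<in> carrier ?Z" if "i < n" for i unfolding z_def by (rule lin_mapsD(1)[OF u bc[OF that]])
 have ux: "u x = lc ?Z n z (\<lambda>i. \<phi> i x)" if x: "x \<in> carrier H" for x
 proof -
  have "u (lc H n ?b (\<lambda>i. \<phi> i x)) = lc ?Z n (\<lambda>i. u (?b i)) (\<lambda>i. \<phi> i x)" by (rule hom_lc[OF Hv Zv u bc])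
  then show ?thesis unfolding z_def[abs_def] H.coords_expansion[OF co x, symmetric] .
 qed
 have lcz: "lc ?Z n z a \<in> carrier ?Z" for a by (rule Z.lc_closed[OF z])
 obtain r where r: "\<And>x. (\<And>l. l < k - 1 \<Longrightarrow> ip n (r l) x = 0) \<Longrightarrow> qnorm ?Z (lc ?Z n z x) \<le> c * nrm n x"
  using gel unfolding gel_def z_def[symmetric] by blast
 \<comment> \<open>\<open>s\<close> is the dimension of the good subspace; on its complement \<open>u\<close> has rank at most \<open>k - 1\<close>\<close>
 define s where "s = n - (k - 1)"
 have s: "s + (k - 1) = n" "s \<le> n" using k by (auto simp: s_def)
 obtain f where f: "orthonormal n s f" "\<forall>i<s. \<forall>j<k - 1. ip n (f i) (r j) = 0"
  using orthonormal_in_kernel[of s "k - 1" n r] s by auto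
 obtain g where g: "orthonormal n n g" "\<forall>i<s. g i = f i" using orthonormal_extend[OF f(1) s(2) order_refl] by blast
 define G where "G j = g (s + j)" for j
 define \<psi> where "\<psi> j x = ip n (\<lambda>i. \<phi> i x) (G j)" for j x
 have \<psi>l: "lfun H (\<psi> j)" for j
 by (simp add: lfun_sum H.coordsD(2)[OF co] \<psi>_def[abs_def] ip_def mult.commute)
 define w where "w j = lc ?Z n z (G j)" for j
 define v where "v x = lc ?Z (k - 1) w (\<lambda>j. \<psi> j x)" for x
 have v: "v \<in> lin_maps H ?Z" unfolding v_def[abs_def] by (rule lin_map_lc[OF Hv Zv \<psi>l]) (simp add: w_def lcz)
 have rank: "lin_rank H ?Z v < k"
 proof -
  have "lin_rank H ?Z v \<le> k - 1"
  proof (rule lin_rank_le(2)[OF Hv Zv v])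
   show "\<exists>a. v x = lc ?Z (k - 1) w a" for x unfolding v_def by blast
   fix j assume j: "j < k - 1"
   let ?x = "lc H n ?b (G j)"
   have x: "?x \<in> carrier H" by (rule H.lc_closed[OF bc])
   have "\<psi> l ?x = (if l = j then 1 else 0)" if l: "l < k - 1" for l
   proof -
    have "\<psi> l ?x = ip n (G j) (G l)" unfolding \<psi>_def by (rule ip_cong) (simp_all add: H.coords_lc[OF co])
    also have "\<dots> = (if l = j then 1 else 0)" unfolding G_def using orthonormalD[OF g(1), of "s + j" "s + l"] j l s(1) by auto
    finally show ?thesis .
   qed
   then show "w j \<in> v ` carrier H"
  by (smt (verit) x v_def lc_cong Z.lc_unit[OF _ j] w_def lcz imageI)
  qed
  then show ?thesis using k by auto
 qed
 have split: "(\<Sum>j<s + t. y j) = (\<Sum>j<s. y j) + (\<Sum>j<t. y (s + j))" for t and y :: "nat \<Rightarrow> real"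
  by (induction t) simp_all
 have le: "op_norm H ?Z (\<lambda>x. u x \<ominus>\<^bsub>?Z\<^esub> v x) \<le> c"
 proof (rule op_norm_le[OF hH])
  fix x assume x: "x \<in> carrier H" "qnorm H x \<le> 1"
  let ?a = "\<lambda>i. \<phi> i x"
  let ?d = "\<lambda>i. ?a i - lin (k - 1) G (\<lambda>j. \<psi> j x) i"
  have d: "?d i = lin s f (\<lambda>j. ip n ?a (f j)) i" if i: "i < n" for i
  proof -
   have "?a i = (\<Sum>j<n. ip n ?a (g j) * g j i)" by (rule orthonormal_expansion[OF g(1) i])
   also have "\<dots> = (\<Sum>j<s + (k - 1). ip n ?a (g j) * g j i)" by (simp only: s(1))
   also have "\<dots> = (\<Sum>j<s. ip n ?a (g j) * g j i) + (\<Sum>j<k - 1. ip n ?a (g (s + j)) * g (s + j) i)"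
    by (rule split)
   also have "(\<Sum>j<s. ip n ?a (g j) * g j i) = lin s f (\<lambda>j. ip n ?a (f j)) i"
    unfolding lin_def using g(2) by (intro sum.cong) auto
   also have "(\<Sum>j<k - 1. ip n ?a (g (s + j)) * g (s + j) i) = lin (k - 1) G (\<lambda>j. \<psi> j x) i"
    by (simp add: lin_def G_def \<psi>_def)
   finally show ?thesis by simp
  qed
  have "ip n (r l) ?d = 0" if l: "l < k - 1" for l
  proof -
   have "ip n (r l) ?d = ip n (r l) (lin s f (\<lambda>j. ip n ?a (f j)))" by (rule ip_cong) (simp_all only: d)
   also have "\<dots> = 0" unfolding ip_lin_right using f(2) l by (intro sum.neutral) (auto simp: ip_commute[of n "r l"])
   finally show ?thesis .
  qed
  then have "qnorm ?Z (lc ?Z n z ?d) \<le> c * nrm n ?d" by (rule r)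
  also have "\<dots> \<le> c * 1"
  proof (rule mult_left_mono[OF _ c])
   have "nrm n ?d = nrm n (lin s f (\<lambda>j. ip n ?a (f j)))" by (rule nrm_cong) (rule d)
   also have "\<dots> = nrm s (\<lambda>j. ip n ?a (f j))" by (rule orthonormal_nrm_lin[OF f(1)])
   also have "\<dots> \<le> nrm n ?a" unfolding nrm_def using bessel[OF f(1), of ?a] by (simp add: ip_def[of s] power2_eq_square)
   also have "\<dots> \<le> 1" using x(2) by (simp add: q[OF x(1)])
   finally show "nrm n ?d \<le> 1" .
  qed
  also have "lc ?Z n z ?d = u x \<ominus>\<^bsub>?Z\<^esub> v x"
  by (simp add: v_def w_def[abs_def] Z.lc_lin[OF z] ux[OF x(1)] Z.lc_diff[OF z])
  finally show "qnorm ?Z (u x \<ominus>\<^bsub>?Z\<^esub> v x) \<le> c" by simp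
 qed
 have "bdd_below {op_norm H ?Z (\<lambda>x. u x \<ominus>\<^bsub>?Z\<^esub> v x) | v. v \<in> lin_maps H ?Z \<and> lin_rank H ?Z v < k}"
 proof (rule bdd_belowI[of _ 0])
  fix t assume "t \<in> {op_norm H ?Z (\<lambda>x. u x \<ominus>\<^bsub>?Z\<^esub> v x) | v. v \<in> lin_maps H ?Z \<and> lin_rank H ?Z v < k}"
  then obtain v' where v': "v' \<in> lin_maps H ?Z" "t = op_norm H ?Z (\<lambda>x. u x \<ominus>\<^bsub>?Z\<^esub> v' x)" by blast
  have l: "(\<lambda>x. u x \<ominus>\<^bsub>?Z\<^esub> v' x) \<in> lin_maps H ?Z" by (rule lin_maps_diff[OF Hv Zv u v'(1)])
  obtain B where B: "\<And>x. x \<in> carrier H \<Longrightarrow> qnorm ?Z (u x \<ominus>\<^bsub>?Z\<^esub> v' x) \<le> B * qnorm H x"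
   using bounded_into_dual[OF X Hv co q l] by blast
  show "0 \<le> t" unfolding v'(2) by (rule op_norm_nonneg[OF hH hZ l B])
 qed
 then have "approx_number k H ?Z u \<le> op_norm H ?Z (\<lambda>x. u x \<ominus>\<^bsub>?Z\<^esub> v x)"
  unfolding approx_number_def by (rule cInf_lower[rotated]) (use v rank in blast)
 with le show ?thesis by linarith
qed

theorem weak_cotype2_of_euclidean_quotients:
 fixes X :: "'a qspace"
 assumes X: "quasi_normed_space X" and \<alpha>: "0 < \<alpha>" "\<alpha> < 1"
  and C: "\<And>F. is_quotient_of F X \<Longrightarrow> fin_dim F \<Longrightarrow>
   \<exists>E. is_quotient_of E F \<and> real (vdim E) \<ge> \<alpha> * real (vdim F) \<and> euclidean_distance E \<le> ereal C"
 shows "weak_cotype2 (dual X)"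
proof -
 let ?Z = "dual X"
 have hX: "homogeneous_space X" by (rule quasi_normed_homogeneous[OF X])
 have hZ: "homogeneous_space ?Z" by (rule homogeneous_dual[OF hX])
 define C1 where "C1 = max 0 C + 1"
 have C1: "C < C1" "0 < C1" by (auto simp: C1_def)
 obtain C' where C': "\<forall>n p k c. seminorm n p \<longrightarrow>
  (\<forall>x e. 0 < e \<longrightarrow> (\<exists>r. (\<forall>y. ip n r y \<le> p y) \<and> p x - e \<le> ip n r x)) \<longrightarrow>
  hilbertian_subspaces \<alpha> C1 p \<longrightarrow> k \<in> {1..n} \<longrightarrow> C' / sqrt (real k) * ell n p < c \<longrightarrow> gel n p (k - 1) c"
  using gelfand_estimate_of_hilbertian_subspaces[of \<alpha> C1] \<alpha> C1 by auto
 show ?thesis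
  unfolding weak_cotype2_def
 proof (rule exI[of _ "\<bar>C'\<bar>"], intro allI impI ballI)
  fix H :: "(nat \<Rightarrow> real) qspace" and h n e u k
  assume a: "hilbert_space H h \<and> orthonormal_basis H h n e \<and> u \<in> lin_maps H ?Z" and k: "k \<in> {1..n}"
  then have H: "hilbert_space H h" and e: "orthonormal_basis H h n e" and u: "u \<in> lin_maps H ?Z" by auto
  obtain \<phi> where co: "coords H n (\<lambda>i. e (Suc i)) \<phi>" using coords_of_orthonormal_basis[OF H e] by blast
  interpret H: real_space H by (rule real_space.intro[OF homogeneousD(1)[OF hilbert_homogeneous[OF H]]])
  have z: "u (e (Suc i)) \<in> carrier ?Z" if "i < n" for i by (rule lin_mapsD(1)[OF u H.coordsD(1)[OF co that]])
  let ?p = "\<lambda>a. qnorm ?Z (lc ?Z n (\<lambda>i. u (e (Suc i))) a)"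
  have sem: "seminorm n ?p" by (rule seminorm_dual[OF hX z])
  have ell: "ell_norm n e ?Z u = ell n ?p"
  proof (rule ell_norm_eq_ell[where u=u and e=e, OF homogeneousD(1)[OF hZ] _ sem])
   fix i assume "i \<in> {1..n}"
   then have "i - 1 < n" "Suc (i - 1) = i" by auto
   then show "u (e i) \<in> carrier ?Z" using z[of "i - 1"] by simp
  qed
  have norming: "\<exists>r. (\<forall>y. ip n r y \<le> ?p y) \<and> ?p x - \<delta> \<le> ip n r x" if "0 < \<delta>" for x \<delta>
   by (rule norming_functionals[OF hX z that])
  have hs: "hilbertian_subspaces \<alpha> C1 ?p" by (rule hilbertian_subspaces_of_euclidean_quotients[OF X z C C1(1)])
  have "approx_number k H ?Z u \<le> c" if c: "\<bar>C'\<bar> / sqrt (real k) * ell n ?p < c" for c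
  proof -
   have "C' / sqrt (real k) * ell n ?p \<le> \<bar>C'\<bar> / sqrt (real k) * ell n ?p"
    by (intro mult_right_mono divide_right_mono ell_nonneg) auto
   with c have c': "C' / sqrt (real k) * ell n ?p < c" by linarith
   have "0 \<le> \<bar>C'\<bar> / sqrt (real k) * ell n ?p" by (intro mult_nonneg_nonneg ell_nonneg) auto
   with c have c0: "0 \<le> c" by linarith
   show ?thesis
  using C'[rule_format, OF sem norming hs k c'] by (simp add: approx_number_le_of_gel[OF hX H e u k _ c0])
  qed
  then have "approx_number k H ?Z u \<le> \<bar>C'\<bar> / sqrt (real k) * ell n ?p" by (rule dense_ge)
  then show "approx_number k H ?Z u \<le> \<bar>C'\<bar> * real k powr (-1/2) * ell_norm n e ?Z u"
   unfolding ell using k powr_minus_half[of k] by simp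
 qed
qed

theorem theorem13:
 fixes X :: "'a qspace" and \<alpha> :: real
 assumes "quasi_banach_space X" and "0 < \<alpha>" and "\<alpha> < 1"
 shows "weak_cotype2 (dual X) \<longleftrightarrow>
  (\<exists>C :: real. \<forall>F. is_quotient_of F X \<and> fin_dim F \<longrightarrow>
   (\<exists>E. is_quotient_of E F \<and> real (vdim E) \<ge> \<alpha> * real (vdim F) \<and>
      euclidean_distance E \<le> ereal C))"
proof -
 have X: "quasi_normed_space X" using assms(1) by (simp add: quasi_banach_space_def)
 show ?thesis
 by (metis euclidean_quotients_of_weak_cotype2[OF X _ assms(2,3)] weak_cotype2_of_euclidean_quotients[OF X assms(2,3)])
qed

end
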